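(* For any $L>0$ there exist positive constants $C$ and $T_0$ such that every solution $u$ of the linear plate problem (P$_0$) described in the context with $E(0)\le L$ satisfies $$E(0)\le C\int_0^T\int_\Omega \chi_\omega(x,y)\,|u_t(x,y,t)|^2\,dx\,dy\,dt\qquad\text{for all } T\ge T_0 .$$
   Context: Let $l>0$ with $l\ll\pi$, $\Omega=(0,\pi)\times(-l,l)\subset\mathbb R^2$ with boundary $\Gamma$, and let $0<\sigma<\tfrac12$. Let $\omega\subset\Omega$ be a neighbourhood of the boundary, i.e. an open subset of $\Omega$ that contains $\Omega\cap\mathcal O$ for some open neighbourhood $\mathcal O$ of $\Gamma$ in $\mathbb R^2$; $\chi_\omega$ is its characteristic function. Let $H^2_*(\Omega)=\{w\in H^2(\Omega): w=0 \text{ on } \{0,\pi\}\times(-l,l)\}$ with the inner product $(u,v)_{H^2_*}=\int_\Omega \big[u_{xx}v_{xx}+u_{yy}v_{yy}+\sigma(u_{xx}v_{yy}+u_{yy}v_{xx})+2(1-\sigma)u_{xy}v_{xy}\big]dx\,dy$, which makes it a Hilbert space with norm equivalent to the usual $H^2$ norm. The linear plate problem (P$_0$) is $$\begin{cases}u_{tt}+\Delta^2u=0 & \text{in }\Omega\times(0,\infty),\\ u(0,y,t)=u_{xx}(0,y,t)=u(\pi,y,t)=u_{xx}(\pi,y,t)=0,& (y,t)\in(-l,l)\times(0,\infty),\\ u_{yy}(x,\pm l,t)+\sigma u_{xx}(x,\pm l,t)=0,& (x,t)\in(0,\pi)\times(0,\infty),\\ u_{yyy}(x,\pm l,t)+(2-\sigma)u_{xxy}(x,\pm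 l,t)=0,& (x,t)\in(0,\pi)\times(0,\infty),\\ u(\cdot,0)=u_0,\quad u_t(\cdot,0)=u_1 & \text{in }\Omega.\end{cases}$$ For $(u_0,u_1)\in H^2_*(\Omega)\times L^2(\Omega)$ it has a unique (weak, i.e. semigroup) solution with $(u,u_t)\in C([0,\infty);H^2_*(\Omega)\times L^2(\Omega))$; equivalently, for every $v\in H^2_*(\Omega)$, $\frac{d}{dt}(u_t,v)_{L^2}+(u,v)_{H^2_*}=0$, together with the initial conditions. "Solution" means such a solution. Its energy is $E(t)=\frac12\|u_t(t)\|_{L^2}^2+\frac12\|u(t)\|_{H^2_*}^2$, which is constant in $t$. *)

theory Defs
  imports "HOL-Analysis.Analysis"
begin

section \<open>Square-integrable functions\<close>

text \<open>Elements of function spaces on a set \<open>S\<close> of the plane are represented by functions on the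
  whole plane; their values outside \<open>S\<close> and on null sets are irrelevant.\<close>

definition L2 :: "(real \<times> real) set \<Rightarrow> (real \<times> real \<Rightarrow> real) set" where
  "L2 S = {f \<in> borel_measurable (lebesgue_on S). integrable (lebesgue_on S) (\<lambda>p. (f p)\<^sup>2)}"

definition L2_inner ::
    "(real \<times> real) set \<Rightarrow> (real \<times> real \<Rightarrow> real) \<Rightarrow> (real \<times> real \<Rightarrow> real) \<Rightarrow> real" where
  "L2_inner S f g = (\<integral>p. f p * g p \<partial>lebesgue_on S)"

definition L2_norm :: "(real \<times> real) set \<Rightarrow> (real \<times> real \<Rightarrow> real) \<Rightarrow> real" where
  "L2_norm S f = sqrt (L2_inner S f f)"

section \<open>Weak derivatives and the Sobolev space of order two\<close>

definition partial_x :: "(real \<times> real \<Rightarrow> real) \<Rightarrow> real \<times> real \<Rightarrow> real" where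
  "partial_x f = (\<lambda>(x, y). deriv (\<lambda>s. f (s, y)) x)"

definition partial_y :: "(real \<times> real \<Rightarrow> real) \<Rightarrow> real \<times> real \<Rightarrow> real" where
  "partial_y f = (\<lambda>(x, y). deriv (\<lambda>s. f (x, s)) y)"

definition partials :: "nat \<Rightarrow> nat \<Rightarrow> (real \<times> real \<Rightarrow> real) \<Rightarrow> real \<times> real \<Rightarrow> real" where
  "partials i j f = (partial_x ^^ i) ((partial_y ^^ j) f)"

text \<open>Infinite differentiability: since \<open>differentiable_on\<close> is total differentiability, each of
  the listed partial derivatives is continuous, and the order of differentiation does not matter.\<close>

definition smooth :: "(real \<times> real \<Rightarrow> real) \<Rightarrow> bool" where
  "smooth f \<longleftrightarrow> (\<forall>i j. partials i j f differentiable_on UNIV)"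

definition test_functions :: "(real \<times> real) set \<Rightarrow> (real \<times> real \<Rightarrow> real) set" where
  "test_functions S =
     {\<phi>. smooth \<phi> \<and> compact (closure {p. \<phi> p \<noteq> 0}) \<and> closure {p. \<phi> p \<noteq> 0} \<subseteq> S}"

definition is_weak_deriv ::
    "(real \<times> real) set \<Rightarrow> nat \<Rightarrow> nat \<Rightarrow> (real \<times> real \<Rightarrow> real) \<Rightarrow> (real \<times> real \<Rightarrow> real) \<Rightarrow> bool" where
  "is_weak_deriv S i j w g \<longleftrightarrow>
     (\<forall>\<phi>\<in>test_functions S. L2_inner S w (partials i j \<phi>) = (- 1) ^ (i + j) * L2_inner S g \<phi>)"

definition H2 :: "(real \<times> real) set \<Rightarrow> (real \<times> real \<Rightarrow> real) set" where
  "H2 S = {w \<in> L2 S. \<forall>i j. i + j \<le> 2 \<longrightarrow> (\<exists>g\<in>L2 S. is_weak_deriv S i j w g)}"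

text \<open>On an open set the weak derivative is unique up to null sets, so that the integrals below do
  not depend on the choice.\<close>

definition weak_deriv ::
    "(real \<times> real) set \<Rightarrow> nat \<Rightarrow> nat \<Rightarrow> (real \<times> real \<Rightarrow> real) \<Rightarrow> real \<times> real \<Rightarrow> real" where
  "weak_deriv S i j w = (SOME g. g \<in> L2 S \<and> is_weak_deriv S i j w g)"

section \<open>The plate and its energy space\<close>

definition plate :: "real \<Rightarrow> (real \<times> real) set" where
  "plate l = {0<..<pi} \<times> {-l<..<l}"

text \<open>Functions in \<open>H2 (plate l)\<close> have a unique representative that is continuous up to the boundary
  (Sobolev embedding in dimension two); the boundary condition is a condition on the values of this
  representative.\<close>

definition H2_star :: "real \<Rightarrow> (real \<times> real \<Rightarrow> real) set" where
  "H2_star l = {w \<in> H2 (plate l).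
     \<exists>g. continuous_on (closure (plate l)) g \<and> (AE p in lebesgue_on (plate l). w p = g p) \<and>
         (\<forall>p \<in> {0, pi} \<times> {-l<..<l}. g p = 0)}"

definition H2_star_inner ::
    "real \<Rightarrow> real \<Rightarrow> (real \<times> real \<Rightarrow> real) \<Rightarrow> (real \<times> real \<Rightarrow> real) \<Rightarrow> real" where
  "H2_star_inner l \<sigma> u v =
     (let uxx = weak_deriv (plate l) 2 0 u; uxy = weak_deriv (plate l) 1 1 u;
          uyy = weak_deriv (plate l) 0 2 u;
          vxx = weak_deriv (plate l) 2 0 v; vxy = weak_deriv (plate l) 1 1 v;
          vyy = weak_deriv (plate l) 0 2 v
      in \<integral>p. uxx p * vxx p + uyy p * vyy p + \<sigma> * (uxx p * vyy p + uyy p * vxx p)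
             + 2 * (1 - \<sigma>) * uxy p * vxy p \<partial>lebesgue_on (plate l))"

definition H2_star_norm :: "real \<Rightarrow> real \<Rightarrow> (real \<times> real \<Rightarrow> real) \<Rightarrow> real" where
  "H2_star_norm l \<sigma> u = sqrt (H2_star_inner l \<sigma> u u)"

section \<open>The linear plate equation\<close>

text \<open>Weak solutions of \<open>u\<^sub>t\<^sub>t + \<Delta>\<^sup>2 u = 0\<close>, hinged at \<open>x = 0\<close> and \<open>x = \<pi>\<close> and free at \<open>y = \<plusminus>l\<close>, with
  initial data \<open>(u0, u1)\<close>. All boundary conditions other than \<open>u = 0\<close> are natural, i.e. contained in
  the variational equation. The function \<open>ut\<close> is the time derivative of \<open>u\<close>, as a derivative of an
  \<open>L2\<close>-valued function; derivatives and limits at time \<open>0\<close> are one-sided.\<close>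

definition plate_solution ::
    "real \<Rightarrow> real \<Rightarrow> (real \<times> real \<Rightarrow> real) \<Rightarrow> (real \<times> real \<Rightarrow> real) \<Rightarrow>
     (real \<Rightarrow> real \<times> real \<Rightarrow> real) \<Rightarrow> (real \<Rightarrow> real \<times> real \<Rightarrow> real) \<Rightarrow> bool" where
  "plate_solution l \<sigma> u0 u1 u ut \<longleftrightarrow>
     (\<forall>t\<ge>0. u t \<in> H2_star l \<and> ut t \<in> L2 (plate l)) \<and>
     (\<forall>t\<ge>0. ((\<lambda>s. H2_star_norm l \<sigma> (\<lambda>p. u s p - u t p)) \<longlongrightarrow> 0) (at t within {0..})) \<and>
     (\<forall>t\<ge>0. ((\<lambda>s. L2_norm (plate l) (\<lambda>p. ut s p - ut t p)) \<longlongrightarrow> 0) (at t within {0..})) \<and>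
     (\<forall>t\<ge>0. ((\<lambda>s. L2_norm (plate l) (\<lambda>p. (u s p - u t p) / (s - t) - ut t p)) \<longlongrightarrow> 0)
                (at t within {0..})) \<and>
     (\<forall>v\<in>H2_star l. \<forall>t\<ge>0.
        ((\<lambda>s. L2_inner (plate l) (ut s) v) has_real_derivative - H2_star_inner l \<sigma> (u t) v)
          (at t within {0..})) \<and>
     (AE p in lebesgue_on (plate l). u 0 p = u0 p) \<and>
     (AE p in lebesgue_on (plate l). ut 0 p = u1 p)"

definition plate_energy ::
    "real \<Rightarrow> real \<Rightarrow> (real \<Rightarrow> real \<times> real \<Rightarrow> real) \<Rightarrow> (real \<Rightarrow> real \<times> real \<Rightarrow> real) \<Rightarrow> real \<Rightarrow> real" where
  "plate_energy l \<sigma> u ut t =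
     1 / 2 * (L2_norm (plate l) (ut t))\<^sup>2 + 1 / 2 * (H2_star_norm l \<sigma> (u t))\<^sup>2"

definition boundary_neighbourhood :: "(real \<times> real) set \<Rightarrow> (real \<times> real) set \<Rightarrow> bool" where
  "boundary_neighbourhood S \<omega> \<longleftrightarrow>
     open \<omega> \<and> \<omega> \<subseteq> S \<and> (\<exists>U. open U \<and> frontier S \<subseteq> U \<and> S \<inter> U \<subseteq> \<omega>)"

end

theory Submission
  imports Defs
begin

text \<open>
  Write \<open>|\<cdot>|\<close> for the \<open>L2\<close> norm on the plate \<open>\<Omega>\<close>, \<open>V\<close> for the energy space, \<open>B\<close> for its inner product
  and \<open>E\<close> for the energy. The estimate is obtained with explicit local multipliers.

  Let \<open>M\<close> be a bounded operator on \<open>L2\<close> that maps \<open>V\<close> into \<open>V\<close>. Along a solution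
  the derivative of \<open>(u\<^sub>t, M u)\<close> is \<open>(u\<^sub>t, M u\<^sub>t) - B(u, M u)\<close> (\<open>pairing_identity\<close>). Hence the time integral of the
  right-hand side is at most a constant times \<open>E(0)\<close>, uniformly in \<open>T\<close>, as soon as \<open>|(z, M u)|\<close> is
  bounded by \<open>|z|\<close> times the norm of \<open>u\<close> in \<open>V\<close> (\<open>multiplier_integral_bound\<close>). Conservation of energy comes from the same calculus,
  applied to the pairing of \<open>u\<^sub>t\<close> and \<open>u\<close> at two times reflected at a common midpoint.

  The classical choice \<open>M u = q \<cdot> \<nabla>u\<close> with \<open>q(p) = p\<close> gives
  \<open>(z, M z) - B(u, M u) = - |z|\<^sup>2 - B(u, u)\<close> up to boundary terms, but \<open>M u\<close> need not belong to \<open>V\<close>. Here \<open>q\<close> is cut off in a layer along the boundary that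
  is contained in \<open>\<omega>\<close>, and the gradient is replaced by symmetric difference quotients, which preserve \<open>V\<close>.
  Their step tends to zero only after integration in time (\<open>R_limit\<close>, \<open>R_bound\<close>). The cutoff leaves errors
  that are integrals over the layer of \<open>z\<^sup>2\<close>, of the squared Hessian and of the squared gradient of \<open>u\<close>. The second
  multiplier \<open>(1 - \<chi>) u\<close>, with \<open>1 - \<chi>\<close> supported in the layer, absorbs the Hessian, and integration by
  parts interpolates the gradient between the Hessian and \<open>u\<close>. The result is \<open>multiplier_inequality\<close> and, after
  integration in time, \<open>weak_observability\<close>:
  \<open>T E(0) \<le> C E(0) + C \<integral>\<^sub>0\<^sup>T \<integral>\<^sub>\<omega> (u\<^sub>t\<^sup>2 + u\<^sup>2)\<close>.

  The term \<open>u\<^sup>2\<close> is usually removed by compactness and unique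
  continuation, which gives no control of the constants. A direct argument is available: the equation says
  \<open>u = - A\<^sup>-\<^sup>1 u\<^sub>t\<^sub>t\<close>, hence the integral of \<open>u\<close> over any time interval is bounded by a multiple of the square root of \<open>E(0)\<close>,
  independently of the length of the interval (\<open>average_bounded\<close>). So the mean of \<open>u\<close> over \<open>[t, t + \<tau>]\<close> is of
  order \<open>1 / \<tau>\<close>, whereas \<open>u(t)\<close> differs from this mean on \<open>\<omega>\<close> by at most the integral of \<open>|u\<^sub>t|\<close> over \<open>\<omega>\<close> and the interval.
  For a large fixed \<open>\<tau>\<close> the contribution of the mean is absorbed into \<open>T E(0)\<close> (\<open>absorb_low_order\<close>). All
  inequalities are homogeneous, so the constants do not depend on the size of the energy.
\<close>

section \<open>Semi-inner products on spaces of functions\<close>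

text \<open>Functions are not identified when they agree almost everywhere, so the forms are only
  semidefinite.\<close>

locale inner_form =
  fixes H :: "('p \<Rightarrow> real) set" and ip :: "('p \<Rightarrow> real) \<Rightarrow> ('p \<Rightarrow> real) \<Rightarrow> real"
  assumes add: "f \<in> H \<Longrightarrow> g \<in> H \<Longrightarrow> (\<lambda>p. f p + g p) \<in> H"
    and scale: "f \<in> H \<Longrightarrow> (\<lambda>p. c * f p) \<in> H"
    and ip_sym: "f \<in> H \<Longrightarrow> g \<in> H \<Longrightarrow> ip f g = ip g f"
    and ip_add: "f \<in> H \<Longrightarrow> g \<in> H \<Longrightarrow> h \<in> H \<Longrightarrow> ip (\<lambda>p. f p + g p) h = ip f h + ip g h"
    and ip_scale: "f \<in> H \<Longrightarrow> g \<in> H \<Longrightarrow> ip (\<lambda>p. c * f p) g = c * ip f g"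
    and ip_pos: "f \<in> H \<Longrightarrow> 0 \<le> ip f f"
begin

definition nm :: "('p \<Rightarrow> real) \<Rightarrow> real" where "nm f = sqrt (ip f f)"

lemma nm_nonneg [simp]: "f \<in> H \<Longrightarrow> 0 \<le> nm f"
  by (simp add: nm_def ip_pos)

lemma nm_sq: "f \<in> H \<Longrightarrow> (nm f)\<^sup>2 = ip f f"
  by (simp add: nm_def ip_pos)

lemma diff: "f \<in> H \<Longrightarrow> g \<in> H \<Longrightarrow> (\<lambda>p. f p - g p) \<in> H"
  using add[of f "\<lambda>p. (-1) * g p"] scale[of g "-1"] by simp

lemma divide: "f \<in> H \<Longrightarrow> (\<lambda>p. f p / c) \<in> H"
  using scale[of f "1/c"] by simp

lemma ip_diff: "f \<in> H \<Longrightarrow> g \<in> H \<Longrightarrow> h \<in> H \<Longrightarrow> ip (\<lambda>p. f p - g p) h = ip f h - ip g h"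
  using ip_add[of f "\<lambda>p. (-1) * g p" h] scale[of g "-1"] ip_scale[of g h "-1"] by simp

lemma ip_divide: "f \<in> H \<Longrightarrow> g \<in> H \<Longrightarrow> ip (\<lambda>p. f p / c) g = ip f g / c"
  using ip_scale[of f g "1/c"] by simp

lemma ip_add_right: "f \<in> H \<Longrightarrow> g \<in> H \<Longrightarrow> h \<in> H \<Longrightarrow> ip h (\<lambda>p. f p + g p) = ip h f + ip h g"
  using ip_sym[OF add[of f g], of h] ip_add[of f g h] ip_sym[of f h] ip_sym[of g h] by simp

lemma ip_diff_right: "f \<in> H \<Longrightarrow> g \<in> H \<Longrightarrow> h \<in> H \<Longrightarrow> ip h (\<lambda>p. f p - g p) = ip h f - ip h g"
  using ip_sym[OF diff[of f g], of h] ip_diff[of f g h] ip_sym[of f h] ip_sym[of g h] by simp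

lemma ip_scale_right: "f \<in> H \<Longrightarrow> g \<in> H \<Longrightarrow> ip f (\<lambda>p. c * g p) = c * ip f g"
  using ip_sym[OF scale[of g c], of f] ip_scale[of g f c] ip_sym[of g f] by simp

lemma ip_divide_right: "f \<in> H \<Longrightarrow> g \<in> H \<Longrightarrow> ip f (\<lambda>p. g p / c) = ip f g / c"
  using ip_sym[OF divide[of g c], of f] ip_divide[of g f c] ip_sym[of g f] by simp

lemma nm_scale: "f \<in> H \<Longrightarrow> nm (\<lambda>p. c * f p) = \<bar>c\<bar> * nm f"
  by (simp add: nm_def ip_scale ip_scale_right scale real_sqrt_mult flip: mult.assoc)

lemma nm_commute: "f \<in> H \<Longrightarrow> g \<in> H \<Longrightarrow> nm (\<lambda>p. f p - g p) = nm (\<lambda>p. g p - f p)"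
  using nm_scale[of "\<lambda>p. f p - g p" "-1"] diff[of f g] by simp

lemma Cauchy_Schwarz:
  assumes f: "f \<in> H" and g: "g \<in> H"
  shows "\<bar>ip f g\<bar> \<le> nm f * nm g"
proof -
  have q: "0 \<le> ip f f + 2 * c * ip f g + c * c * ip g g" for c
  proof -
    have "ip (\<lambda>p. f p + c * g p) (\<lambda>p. f p + c * g p)
        = ip f f + 2 * c * ip f g + c * c * ip g g"
      using f g by (simp add: ip_add ip_add_right scale add ip_scale ip_scale_right ip_sym[of g f])
    then show ?thesis using ip_pos[OF add[OF f scale[OF g, of c]]] by simp
  qed
  have "(ip f g)\<^sup>2 \<le> ip f f * ip g g"
  proof (cases "ip g g = 0")
    case True
    have "ip f g = 0"
    proof (rule ccontr)
      assume "ip f g \<noteq> 0"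
      then show False using q[of "- (ip f f + 1) / (2 * ip f g)"] True by (simp add: field_simps)
    qed
    then show ?thesis using True by simp
  next
    case False
    then have pos: "ip g g > 0" using ip_pos[OF g] by simp
    have "0 \<le> ip f f - (ip f g)\<^sup>2 / ip g g"
      using q[of "- ip f g / ip g g"] False by (simp add: field_simps power2_eq_square)
    then show ?thesis using pos by (simp add: field_simps)
  qed
  then have "sqrt ((ip f g)\<^sup>2) \<le> sqrt (ip f f * ip g g)" by (rule real_sqrt_le_mono)
  then show ?thesis by (simp add: nm_def real_sqrt_mult)
qed

lemma nm_triangle:
  assumes f: "f \<in> H" and g: "g \<in> H"
  shows "nm (\<lambda>p. f p + g p) \<le> nm f + nm g"
proof (rule power2_le_imp_le)
  have "(nm (\<lambda>p. f p + g p))\<^sup>2 = ip f f + 2 * ip f g + ip g g"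
    using f g by (simp add: nm_sq add ip_add ip_add_right ip_sym[of g f])
  also have "\<dots> \<le> (nm f + nm g)\<^sup>2"
    using Cauchy_Schwarz[OF f g] nm_sq[OF f] nm_sq[OF g]
    by (simp add: power2_sum)
  finally show "(nm (\<lambda>p. f p + g p))\<^sup>2 \<le> (nm f + nm g)\<^sup>2" .
qed (use f g in simp)

lemma tendsto_ip:
  assumes "\<forall>\<^sub>F x in F. f x \<in> H" "\<forall>\<^sub>F x in F. g x \<in> H" and fh: "f0 \<in> H" and gh: "g0 \<in> H"
    and lf: "((\<lambda>x. nm (\<lambda>p. f x p - f0 p)) \<longlongrightarrow> 0) F"
    and lg: "((\<lambda>x. nm (\<lambda>p. g x p - g0 p)) \<longlongrightarrow> 0) F"
  shows "((\<lambda>x. ip (f x) (g x)) \<longlongrightarrow> ip f0 g0) F"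
proof -
  let ?a = "\<lambda>x. nm (\<lambda>p. f x p - f0 p)" and ?b = "\<lambda>x. nm (\<lambda>p. g x p - g0 p)"
  have "((\<lambda>x. ?a x * ?b x + ?a x * nm g0 + nm f0 * ?b x) \<longlongrightarrow> 0 * 0 + 0 * nm g0 + nm f0 * 0) F"
    by (intro tendsto_intros lf lg)
  then have lim: "((\<lambda>x. ?a x * ?b x + ?a x * nm g0 + nm f0 * ?b x) \<longlongrightarrow> 0) F" by simp
  have "\<forall>\<^sub>F x in F. norm (ip (f x) (g x) - ip f0 g0) \<le> ?a x * ?b x + ?a x * nm g0 + nm f0 * ?b x"
    using assms(1,2)
  proof eventually_elim
    case (elim x)
    let ?d = "\<lambda>p. f x p - f0 p" and ?e = "\<lambda>p. g x p - g0 p"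
    have m: "?d \<in> H" "?e \<in> H" using elim fh gh diff by auto
    have "ip (f x) (g x) - ip f0 g0 = ip ?d ?e + ip ?d g0 + ip f0 ?e"
      using elim fh gh by (simp add: ip_diff ip_diff_right diff)
    then show ?case
      using Cauchy_Schwarz[OF m] Cauchy_Schwarz[OF m(1) gh] Cauchy_Schwarz[OF fh m(2)] by simp
  qed
  then have "((\<lambda>x. ip (f x) (g x) - ip f0 g0) \<longlongrightarrow> 0) F"
    using lim by (rule Lim_null_comparison)
  then show ?thesis by (simp add: LIM_zero_iff)
qed

lemma nm_self [simp]: "f \<in> H \<Longrightarrow> nm (\<lambda>p. f p - f p) = 0"
  using nm_scale[of f 0] by simp

lemma tendsto_ip_left:
  assumes "\<forall>\<^sub>F x in F. f x \<in> H" "f0 \<in> H" "b \<in> H"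
    and lf: "((\<lambda>x. nm (\<lambda>p. f x p - f0 p)) \<longlongrightarrow> 0) F"
  shows "((\<lambda>x. ip (f x) b) \<longlongrightarrow> ip f0 b) F"
  using assms nm_self[OF \<open>b \<in> H\<close>] by (intro tendsto_ip) simp_all

text \<open>Additivity and homogeneity are required for all functions, not only on \<open>H\<close>; this holds for the
  pointwise formulas used below and keeps side conditions away from difference quotients.\<close>

definition bounded_op :: "(('p \<Rightarrow> real) \<Rightarrow> ('p \<Rightarrow> real)) \<Rightarrow> bool" where
  "bounded_op M \<longleftrightarrow> (\<forall>f\<in>H. M f \<in> H) \<and>
     (\<forall>f g. M (\<lambda>p. f p + g p) = (\<lambda>p. M f p + M g p)) \<and>
     (\<forall>c f. M (\<lambda>p. c * f p) = (\<lambda>p. c * M f p)) \<and>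
     (\<exists>K\<ge>0. \<forall>f\<in>H. nm (M f) \<le> K * nm f)"

lemma bounded_op_scale: "bounded_op M \<Longrightarrow> M (\<lambda>p. c * f p) = (\<lambda>p. c * M f p)"
  unfolding bounded_op_def by auto

lemma bounded_op_diff: "bounded_op M \<Longrightarrow> M (\<lambda>p. f p - g p) = (\<lambda>p. M f p - M g p)"
proof -
  assume M: "bounded_op M"
  have "M (\<lambda>p. f p + (-1) * g p) = (\<lambda>p. M f p + (-1) * M g p)"
    using M unfolding bounded_op_def by metis
  then show ?thesis by simp
qed

lemma bounded_op_tendsto:
  assumes M: "bounded_op M" and "\<forall>\<^sub>F x in F. f x \<in> H" "f0 \<in> H"
    and lim: "((\<lambda>x. nm (\<lambda>p. f x p - f0 p)) \<longlongrightarrow> 0) F"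
  shows "((\<lambda>x. nm (\<lambda>p. M (f x) p - M f0 p)) \<longlongrightarrow> 0) F"
proof -
  obtain K where K: "\<And>f. f \<in> H \<Longrightarrow> nm (M f) \<le> K * nm f" using M unfolding bounded_op_def by blast
  have "((\<lambda>x. K * nm (\<lambda>p. f x p - f0 p)) \<longlongrightarrow> 0) F"
    using tendsto_mult_left[OF lim, of K] by simp
  moreover have "\<forall>\<^sub>F x in F. norm (nm (\<lambda>p. M (f x) p - M f0 p)) \<le> K * nm (\<lambda>p. f x p - f0 p)"
    using assms(2)
  proof eventually_elim
    case (elim x)
    have d: "(\<lambda>p. f x p - f0 p) \<in> H" using elim assms(3) diff by blast
    then have "M (\<lambda>p. f x p - f0 p) \<in> H" using M unfolding bounded_op_def by blast
    with d have "nm (\<lambda>p. M (f x) p - M f0 p) \<le> K * nm (\<lambda>p. f x p - f0 p)"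
      "nm (\<lambda>p. M (f x) p - M f0 p) \<ge> 0"
      using K[of "\<lambda>p. f x p - f0 p"] bounded_op_diff[OF M, of "f x" f0] nm_nonneg
      by auto
    then show ?case by simp
  qed
  ultimately show ?thesis by (rule Lim_null_comparison[rotated])
qed

end

section \<open>Abstract weak solutions\<close>

text \<open>The abstract equation \<open>u\<^sub>t\<^sub>t + A u = 0\<close> for the operator \<open>A\<close> of the form \<open>B\<close>, in the weak sense.\<close>

locale weak_wave = H: inner_form H ip + V: inner_form V B
  for H :: "('p \<Rightarrow> real) set" and ip and V :: "('p \<Rightarrow> real) set" and B +
  fixes P :: real and u ut :: "real \<Rightarrow> 'p \<Rightarrow> real"
  assumes VH: "V \<subseteq> H" and P: "0 < P" and Poincare: "v \<in> V \<Longrightarrow> ip v v \<le> P * B v v"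
    and uV: "0 \<le> t \<Longrightarrow> u t \<in> V" and utH: "0 \<le> t \<Longrightarrow> ut t \<in> H"
    and u_cont: "0 \<le> t \<Longrightarrow> ((\<lambda>s. V.nm (\<lambda>p. u s p - u t p)) \<longlongrightarrow> 0) (at t within {0..})"
    and ut_cont: "0 \<le> t \<Longrightarrow> ((\<lambda>s. H.nm (\<lambda>p. ut s p - ut t p)) \<longlongrightarrow> 0) (at t within {0..})"
    and u_deriv: "0 \<le> t \<Longrightarrow>
      ((\<lambda>s. H.nm (\<lambda>p. (u s p - u t p) / (s - t) - ut t p)) \<longlongrightarrow> 0) (at t within {0..})"
    and weak_eq: "v \<in> V \<Longrightarrow> 0 \<le> t \<Longrightarrow>
      ((\<lambda>s. ip (ut s) v) has_real_derivative - B (u t) v) (at t within {0..})"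
begin

lemma VinH: "v \<in> V \<Longrightarrow> v \<in> H" using VH by blast

lemma uH: "0 \<le> t \<Longrightarrow> u t \<in> H" using uV VinH by blast

lemma nm_Poincare: "v \<in> V \<Longrightarrow> H.nm v \<le> sqrt P * V.nm v"
  unfolding H.nm_def V.nm_def using Poincare[of v]
  by (metis real_sqrt_le_iff real_sqrt_mult)

lemma u_cont_H:
  assumes "0 \<le> t" shows "((\<lambda>s. H.nm (\<lambda>p. u s p - u t p)) \<longlongrightarrow> 0) (at t within {0..})"
proof (rule Lim_null_comparison)
  show "((\<lambda>s. sqrt P * V.nm (\<lambda>p. u s p - u t p)) \<longlongrightarrow> 0) (at t within {0..})"
    using tendsto_mult_left[OF u_cont[OF assms], of "sqrt P"] by simp
  show "\<forall>\<^sub>F s in at t within {0..}. norm (H.nm (\<lambda>p. u s p - u t p)) \<le> sqrt P * V.nm (\<lambda>p. u s p - u t p)"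
  proof -
    have "norm (H.nm (\<lambda>p. u s p - u t p)) \<le> sqrt P * V.nm (\<lambda>p. u s p - u t p)" if "s \<ge> 0" for s
      using nm_Poincare[of "\<lambda>p. u s p - u t p"] V.diff[OF uV[OF that] uV[OF assms]]
        H.nm_nonneg[OF VinH, of "\<lambda>p. u s p - u t p"] by simp
    then show ?thesis by (auto simp: eventually_at_filter)
  qed
qed

lemma ev_nonneg: "(\<And>s. 0 \<le> s \<Longrightarrow> Q s) \<Longrightarrow> \<forall>\<^sub>F s in at t within {0..}. Q (s::real)"
  by (auto simp: eventually_at_filter)

lemma continuous_ip:
  assumes "H.bounded_op M" "H.bounded_op N" "a = u \<or> a = ut" "b = u \<or> b = ut"
  shows "continuous_on {0..} (\<lambda>t. ip (M (a t)) (N (b t)))"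
  unfolding continuous_on_def
proof
  fix t :: real assume t: "t \<in> {0..}"
  have a: "s \<ge> 0 \<Longrightarrow> a s \<in> H" and b: "s \<ge> 0 \<Longrightarrow> b s \<in> H" for s
    using assms(3,4) uH utH by auto
  have M: "f \<in> H \<Longrightarrow> M f \<in> H" and N: "f \<in> H \<Longrightarrow> N f \<in> H" for f
    using assms(1,2) unfolding H.bounded_op_def by auto
  have la: "((\<lambda>s. H.nm (\<lambda>p. a s p - a t p)) \<longlongrightarrow> 0) (at t within {0..})"
    and lb: "((\<lambda>s. H.nm (\<lambda>p. b s p - b t p)) \<longlongrightarrow> 0) (at t within {0..})"
    using assms(3,4) u_cont_H[of t] ut_cont[of t] t by auto
  have ea: "\<forall>\<^sub>F s in at t within {0..}. a s \<in> H" and eb: "\<forall>\<^sub>F s in at t within {0..}. b s \<in> H"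
    by (rule ev_nonneg, rule a b, assumption)+
  have t0: "0 \<le> t" using t by simp
  show "((\<lambda>t. ip (M (a t)) (N (b t))) \<longlongrightarrow> ip (M (a t)) (N (b t))) (at t within {0..})"
  proof (rule H.tendsto_ip)
    show "\<forall>\<^sub>F x in at t within {0..}. M (a x) \<in> H" by (rule ev_nonneg) (rule M, rule a)
    show "\<forall>\<^sub>F x in at t within {0..}. N (b x) \<in> H" by (rule ev_nonneg) (rule N, rule b)
    show "((\<lambda>x. H.nm (\<lambda>p. M (a x) p - M (a t) p)) \<longlongrightarrow> 0) (at t within {0..})"
      by (rule H.bounded_op_tendsto[OF assms(1) ea a[OF t0] la])
    show "((\<lambda>x. H.nm (\<lambda>p. N (b x) p - N (b t) p)) \<longlongrightarrow> 0) (at t within {0..})"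
      by (rule H.bounded_op_tendsto[OF assms(2) eb b[OF t0] lb])
  qed (use t0 a b M N in auto)
qed

lemma id_bounded: "H.bounded_op (\<lambda>f. f)"
  unfolding H.bounded_op_def by (auto intro!: exI[of _ 1])

lemma continuous_B:
  assumes v: "v \<in> V" shows "continuous_on {0..} (\<lambda>t. B (u t) v)"
  unfolding continuous_on_def
proof
  fix t :: real assume "t \<in> {0..}"
  then have t: "0 \<le> t" by simp
  show "((\<lambda>t. B (u t) v) \<longlongrightarrow> B (u t) v) (at t within {0..})"
    by (rule V.tendsto_ip_left[OF ev_nonneg[OF uV] uV[OF t] v u_cont[OF t]])
qed

lemma continuous_ip_fixed:
  assumes "b \<in> H"
  shows "continuous_on {0..} (\<lambda>t. ip (u t) b)" "continuous_on {0..} (\<lambda>t. ip (ut t) b)"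
  unfolding continuous_on_def
proof (safe, goal_cases)
  case (1 t)
  show ?case by (rule H.tendsto_ip_left[OF ev_nonneg[OF uH] uH assms u_cont_H]) (use 1 in auto)
next
  case (2 t)
  show ?case by (rule H.tendsto_ip_left[OF ev_nonneg[OF utH] utH assms ut_cont]) (use 2 in auto)
qed

lemma continuous_B_self: "continuous_on {0..} (\<lambda>t. B (u t) (u t))"
  unfolding continuous_on_def
proof
  fix t :: real assume "t \<in> {0..}"
  then have t: "0 \<le> t" by simp
  show "((\<lambda>t. B (u t) (u t)) \<longlongrightarrow> B (u t) (u t)) (at t within {0..})"
    by (rule V.tendsto_ip[OF ev_nonneg[OF uV] ev_nonneg[OF uV] uV[OF t] uV[OF t] u_cont[OF t] u_cont[OF t]])
qed

subsection \<open>Differentiating pairings\<close>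

lemma filterlim_ray:
  assumes "0 < (t::real)" "d \<noteq> 0"
  shows "filterlim (\<lambda>x. t + d * x) (at t within {0..}) (at 0)"
proof -
  have "filterlim (\<lambda>x. t + d * x) (at t) (at 0)"
    using assms by (auto simp: filterlim_at eventually_at_filter intro!: tendsto_eq_intros)
  moreover have "at t within {0..} = at t"
    using assms by (intro at_within_interior) (auto simp: interior_real_atLeast)
  ultimately show ?thesis by simp
qed

text \<open>The two factors move with separate speeds \<open>e\<close> and \<open>d\<close>, so that one computation serves the
  multiplier identity (\<open>e = d\<close>) and the recovery of the energy from a skew pairing (\<open>e = -d\<close>). The increment splits into
  that of \<open>u\<^sub>t\<close> against the fixed vector \<open>M (u r0)\<close> of \<open>V\<close>, governed by the weak equation, and that of \<open>u\<close>,
  whose quotient converges in \<open>H\<close>.\<close>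

lemma pairing_deriv:
  assumes s0: "0 < s0" and r0: "0 < r0" and e: "\<bar>e\<bar> = 1" and d: "\<bar>d\<bar> = (1::real)"
    and M: "H.bounded_op M" and MV: "\<And>v. v \<in> V \<Longrightarrow> M v \<in> V"
  shows "((\<lambda>x. ip (ut (s0 + e * x)) (M (u (r0 + d * x)))) has_real_derivative
     (d * ip (ut s0) (M (ut r0)) - e * B (u s0) (M (u r0)))) (at 0)"
proof -
  have e0: "e \<noteq> 0" and d0: "d \<noteq> 0" and dd: "d * d = 1" using e d by (auto simp: abs_if split: if_splits)
  have MH: "f \<in> H \<Longrightarrow> M f \<in> H" for f using M unfolding H.bounded_op_def by blast
  have fe: "filterlim (\<lambda>x. s0 + e * x) (at s0 within {0..}) (at 0)"
    and fd: "filterlim (\<lambda>x. r0 + d * x) (at r0 within {0..}) (at 0)"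
    using s0 r0 e0 d0 by (auto intro: filterlim_ray)
  have "((\<lambda>x. s0 + e * x) \<longlongrightarrow> s0) (at 0)" "((\<lambda>x. r0 + d * x) \<longlongrightarrow> r0) (at 0)"
    by (auto intro!: tendsto_eq_intros)
  then have ev: "\<forall>\<^sub>F x in at 0. 0 < s0 + e * x" "\<forall>\<^sub>F x in at 0. 0 < r0 + d * x"
    using s0 r0 by (auto dest: order_tendstoD(1))
  have nz: "\<forall>\<^sub>F x in at (0::real). x \<noteq> 0" by (simp add: eventually_at_filter)
  let ?q = "\<lambda>x p. (u (r0 + d * x) p - u r0 p) / x"
  have qH: "\<forall>\<^sub>F x in at 0. ?q x \<in> H"
    using ev(2) by eventually_elim (use r0 in \<open>auto intro!: H.divide H.diff uH\<close>)
  have "((\<lambda>x. H.nm (\<lambda>p. (u (r0 + d * x) p - u r0 p) / ((r0 + d * x) - r0) - ut r0 p)) \<longlongrightarrow> 0) (at 0)"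
    using filterlim_compose[OF u_deriv fd] r0 by simp
  moreover have "\<forall>\<^sub>F x in at 0.
      H.nm (\<lambda>p. (u (r0 + d * x) p - u r0 p) / ((r0 + d * x) - r0) - ut r0 p)
    = H.nm (\<lambda>p. ?q x p - d * ut r0 p)"
    using ev(2) nz
  proof eventually_elim
    case (elim x)
    have eq: "(\<lambda>p. d * ((u (r0 + d * x) p - u r0 p) / ((r0 + d * x) - r0) - ut r0 p))
        = (\<lambda>p. ?q x p - d * ut r0 p)"
      using elim d0 by (auto simp: field_simps)
    have mem: "(\<lambda>p. (u (r0 + d * x) p - u r0 p) / ((r0 + d * x) - r0) - ut r0 p) \<in> H"
      using elim r0 by (auto intro!: H.divide H.diff uH utH)
    show ?case using H.nm_scale[OF mem, of d] unfolding eq d by (simp only: mult_1)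
  qed
  ultimately have lq: "((\<lambda>x. H.nm (\<lambda>p. ?q x p - d * ut r0 p)) \<longlongrightarrow> 0) (at 0)"
    by (rule Lim_transform_eventually)
  have lu: "((\<lambda>x. H.nm (\<lambda>p. ut (s0 + e * x) p - ut s0 p)) \<longlongrightarrow> 0) (at 0)"
    using filterlim_compose[OF ut_cont fe] s0 by simp
  have utev: "\<forall>\<^sub>F x in at 0. ut (s0 + e * x) \<in> H"
    using ev(1) by eventually_elim (use utH in auto)
  have dH: "(\<lambda>p. d * ut r0 p) \<in> H" by (rule H.scale, rule utH) (use r0 in simp)
  have "((\<lambda>x. ip (ut (s0 + e * x)) (M (?q x))) \<longlongrightarrow> ip (ut s0) (M (\<lambda>p. d * ut r0 p))) (at 0)"
  proof (rule H.tendsto_ip[OF utev _ _ _ lu])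
    show "\<forall>\<^sub>F x in at 0. M (?q x) \<in> H" using qH by eventually_elim (rule MH)
    show "((\<lambda>x. H.nm (\<lambda>p. M (?q x) p - M (\<lambda>p. d * ut r0 p) p)) \<longlongrightarrow> 0) (at 0)"
      by (rule H.bounded_op_tendsto[OF M qH dH lq])
  qed (use s0 dH in \<open>auto intro: utH MH\<close>)
  moreover have "ip (ut s0) (M (\<lambda>p. d * ut r0 p)) = d * ip (ut s0) (M (ut r0))"
    using M s0 r0 MH utH unfolding H.bounded_op_def by (simp add: H.ip_scale_right)
  ultimately have 1: "((\<lambda>x. ip (ut (s0 + e * x)) (M (?q x))) \<longlongrightarrow> d * ip (ut s0) (M (ut r0))) (at 0)"
    by simp
  have Mu: "M (u r0) \<in> V" by (rule MV, rule uV) (use r0 in simp)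
  have "((\<lambda>s. (ip (ut s) (M (u r0)) - ip (ut s0) (M (u r0))) / (s - s0)) \<longlongrightarrow> - B (u s0) (M (u r0)))
      (at s0 within {0..})"
    using weak_eq[OF Mu, of s0] s0 by (simp add: has_field_derivative_iff)
  from filterlim_compose[OF this fe]
  have "((\<lambda>x. (ip (ut (s0 + e * x)) (M (u r0)) - ip (ut s0) (M (u r0))) / (e * x))
      \<longlongrightarrow> - B (u s0) (M (u r0))) (at 0)" by simp
  from tendsto_mult_left[OF this, of e]
  have "((\<lambda>x. e * ((ip (ut (s0 + e * x)) (M (u r0)) - ip (ut s0) (M (u r0))) / (e * x)))
      \<longlongrightarrow> e * (- B (u s0) (M (u r0)))) (at 0)" .
  from tendsto_add[OF 1 this]
  have "((\<lambda>x. ip (ut (s0 + e * x)) (M (?q x))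
      + e * ((ip (ut (s0 + e * x)) (M (u r0)) - ip (ut s0) (M (u r0))) / (e * x)))
      \<longlongrightarrow> d * ip (ut s0) (M (ut r0)) - e * B (u s0) (M (u r0))) (at 0)" by simp
  moreover have "\<forall>\<^sub>F x in at 0. ip (ut (s0 + e * x)) (M (?q x))
      + e * ((ip (ut (s0 + e * x)) (M (u r0)) - ip (ut s0) (M (u r0))) / (e * x))
     = (ip (ut (s0 + e * x)) (M (u (r0 + d * x))) - ip (ut s0) (M (u r0))) / (x - 0)"
    using ev nz
  proof eventually_elim
    case (elim x)
    have a: "u (r0 + d * x) \<in> H" "u r0 \<in> H" "ut (s0 + e * x) \<in> H"
      using elim r0 by (auto intro: uH utH)
    have "M (?q x) = (\<lambda>p. (M (u (r0 + d * x)) p - M (u r0) p) / x)"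
    proof -
      have "M (\<lambda>p. (1/x) * (u (r0 + d * x) p - u r0 p)) = (\<lambda>p. (1/x) * M (\<lambda>p. u (r0 + d * x) p - u r0 p) p)"
        by (rule H.bounded_op_scale[OF M])
      then show ?thesis using H.bounded_op_diff[OF M] by simp
    qed
    then have E: "ip (ut (s0 + e * x)) (M (?q x))
        = (ip (ut (s0 + e * x)) (M (u (r0 + d * x))) - ip (ut (s0 + e * x)) (M (u r0))) / x"
      using a by (simp add: H.ip_divide_right H.ip_diff_right MH H.diff)
    show ?case unfolding E using elim e0 by (simp add: diff_divide_distrib right_diff_distrib)
  qed
  ultimately show ?thesis
    unfolding has_field_derivative_iff by (simp add: Lim_transform_eventually)
qed

lemma pairing_identity:
  assumes M: "H.bounded_op M" and MV: "\<And>v. v \<in> V \<Longrightarrow> M v \<in> V" and T: "0 \<le> T"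
  shows "((\<lambda>t. ip (ut t) (M (ut t)) - B (u t) (M (u t))) has_integral
     (ip (ut T) (M (u T)) - ip (ut 0) (M (u 0)))) {0..T}"
proof (rule fundamental_theorem_of_calculus_interior[OF T])
  show "continuous_on {0..T} (\<lambda>t. ip (ut t) (M (u t)))"
    using continuous_ip[OF id_bounded M, of ut u] by (auto intro: continuous_on_subset)
  fix t assume "t \<in> {0<..<T}"
  then have t: "0 < t" by simp
  have "((\<lambda>x. ip (ut (t + 1 * x)) (M (u (t + 1 * x)))) has_real_derivative
     (1 * ip (ut t) (M (ut t)) - 1 * B (u t) (M (u t)))) (at 0)"
    by (rule pairing_deriv[OF t t _ _ M MV]) auto
  then have "((\<lambda>t. ip (ut t) (M (u t))) has_real_derivative
     (ip (ut t) (M (ut t)) - B (u t) (M (u t)))) (at t)"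
    using DERIV_shift[of "\<lambda>t. ip (ut t) (M (u t))" _ 0 t] by (simp add: add.commute)
  then show "((\<lambda>t. ip (ut t) (M (u t))) has_vector_derivative
     (ip (ut t) (M (ut t)) - B (u t) (M (u t)))) (at t)"
    by (simp add: has_real_derivative_iff_has_vector_derivative)
qed

subsection \<open>Conservation of energy\<close>

definition en :: "real \<Rightarrow> real" where "en t = ip (ut t) (ut t) + B (u t) (u t)"

lemma en_nonneg: "0 \<le> t \<Longrightarrow> 0 \<le> en t"
  unfolding en_def by (simp add: H.ip_pos V.ip_pos utH uV)

text \<open>The symmetry of \<open>B\<close> and of the inner product makes the derivative of this expression in \<open>t\<close>
  vanish: with \<open>s = t - a\<close> and \<open>r = t + a\<close> both pairings have the derivative \<open>(u\<^sub>t(s), u\<^sub>t(r)) - B(u(s), u(r))\<close>. The energy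
  itself cannot be differentiated term by term, since \<open>u\<^sub>t\<close> is differentiable only when paired with elements of \<open>V\<close>.\<close>

lemma skew_pairing_constant:
  assumes "0 < a" "a < t" "a < t'"
  shows "ip (ut (t - a)) (u (t + a)) - ip (ut (t + a)) (u (t - a))
       = ip (ut (t' - a)) (u (t' + a)) - ip (ut (t' + a)) (u (t' - a))"
proof -
  let ?G = "\<lambda>t. ip (ut (t - a)) (u (t + a)) - ip (ut (t + a)) (u (t - a))"
  have der: "(?G has_real_derivative 0) (at t)" if "t \<in> {a<..}" for t
  proof -
    have t: "0 < t - a" "0 < t + a" using that assms by auto
    have "((\<lambda>x. ip (ut (t - a + 1 * x)) (u (t + a + 1 * x)) - ip (ut (t + a + 1 * x)) (u (t - a + 1 * x)))
      has_real_derivative ((1 * ip (ut (t - a)) (ut (t + a)) - 1 * B (u (t - a)) (u (t + a)))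
       - (1 * ip (ut (t + a)) (ut (t - a)) - 1 * B (u (t + a)) (u (t - a))))) (at 0)"
      using t by (intro DERIV_diff pairing_deriv[OF _ _ _ _ id_bounded]) auto
    moreover have "ip (ut (t - a)) (ut (t + a)) = ip (ut (t + a)) (ut (t - a))"
      "B (u (t - a)) (u (t + a)) = B (u (t + a)) (u (t - a))"
      using t by (auto intro!: H.ip_sym V.ip_sym utH uV)
    ultimately have "((\<lambda>x. ?G (x + t)) has_real_derivative 0) (at 0)"
      by (simp add: algebra_simps)
    then show ?thesis using DERIV_shift[of ?G 0 0 t] by simp
  qed
  have "\<exists>c. \<forall>t\<in>{a<..}. ?G t = c"
  proof (rule has_field_derivative_zero_constant)
    fix t assume "t \<in> {a<..}"
    from der[OF this] show "(?G has_real_derivative 0) (at t within {a<..})" by (rule has_field_derivative_at_within)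
  qed (rule convex_real_interval)
  then obtain c where "\<forall>t\<in>{a<..}. ?G t = c" ..
  then show ?thesis using bspec[of "{a<..}" _ t] bspec[of "{a<..}" _ t'] assms by simp
qed

text \<open>Differentiation in \<open>a\<close> at \<open>a = 0\<close> turns the conserved pairing into the energy.\<close>

lemma skew_pairing_deriv:
  assumes "0 < t"
  shows "((\<lambda>a. (ip (ut (t - a)) (u (t + a)) - ip (ut (t + a)) (u (t - a))) / a) \<longlongrightarrow> 2 * en t) (at 0)"
proof -
  have "((\<lambda>a. ip (ut (t + (-1) * a)) (u (t + 1 * a)) - ip (ut (t + 1 * a)) (u (t + (-1) * a)))
     has_real_derivative ((1 * ip (ut t) (ut t) - (-1) * B (u t) (u t))
       - ((-1) * ip (ut t) (ut t) - 1 * B (u t) (u t)))) (at 0)"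
    using assms by (intro DERIV_diff pairing_deriv[OF _ _ _ _ id_bounded]) auto
  then show ?thesis unfolding has_field_derivative_iff by (simp add: en_def)
qed

lemma energy_conservation_pos:
  assumes "0 < t" "0 < t'" shows "en t = en t'"
proof -
  let ?G = "\<lambda>t a. (ip (ut (t - a)) (u (t + a)) - ip (ut (t + a)) (u (t - a))) / a"
  have "(?G t \<longlongrightarrow> 2 * en t) (at_right 0)"
    using skew_pairing_deriv[OF assms(1)] by (rule filterlim_at_split[THEN iffD1, THEN conjunct2])
  moreover have ev: "\<forall>\<^sub>F a in at_right 0. ?G t a = ?G t' a"
    unfolding eventually_at_right_field
  proof (intro exI[of _ "min t t'"] conjI allI impI)
    fix a assume "0 < a" "a < min t t'"
    then show "?G t a = ?G t' a" using skew_pairing_constant[of a t t'] by simp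
  qed (use assms in simp)
  ultimately have l1: "(?G t' \<longlongrightarrow> 2 * en t) (at_right 0)" by (rule Lim_transform_eventually)
  have l2: "(?G t' \<longlongrightarrow> 2 * en t') (at_right 0)"
    using skew_pairing_deriv[OF assms(2)] by (rule filterlim_at_split[THEN iffD1, THEN conjunct2])
  have "2 * en t = 2 * en t'"
    by (rule tendsto_unique[OF _ l1 l2]) (rule trivial_limit_at_right_real)
  then show ?thesis by simp
qed

lemma energy_conservation:
  assumes "0 \<le> t" shows "en t = en 0"
proof -
  have "continuous_on {0..} (\<lambda>t. ip (ut t) (ut t) + B (u t) (u t))"
    by (rule continuous_on_add[OF continuous_ip[OF id_bounded id_bounded] continuous_B_self]) simp_all
  then have "((\<lambda>t. ip (ut t) (ut t) + B (u t) (u t)) \<longlongrightarrow> ip (ut 0) (ut 0) + B (u 0) (u 0)) (at 0 within {0..})"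
    unfolding continuous_on_def by (rule bspec) simp
  then have "(en \<longlongrightarrow> en 0) (at 0 within {0..})" by (simp add: en_def[abs_def])
  then have "(en \<longlongrightarrow> en 0) (at_right 0)" by (rule tendsto_within_subset) auto
  moreover have "\<forall>\<^sub>F s in at_right 0. en s = en 1"
    unfolding eventually_at_right_field
  proof (intro exI[of _ 1] conjI allI impI)
    fix s :: real assume "0 < s" then show "en s = en 1" by (rule energy_conservation_pos) simp
  qed simp
  ultimately have l1: "((\<lambda>_. en 1) \<longlongrightarrow> en 0) (at_right (0::real))"
    by (rule Lim_transform_eventually)
  have e01: "en 1 = en 0"
    by (rule tendsto_unique[OF _ tendsto_const l1]) (rule trivial_limit_at_right_real)
  show ?thesis
  proof (cases "t = 0")
    case False
    then have "en t = en 1" by (intro energy_conservation_pos) (use assms in auto)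
    then show ?thesis unfolding e01 .
  qed simp
qed

lemma nm_ut_le:
  assumes "0 \<le> t" shows "H.nm (ut t) \<le> sqrt (en 0)"
proof -
  have "ip (ut t) (ut t) \<le> en t" using V.ip_pos[OF uV[OF assms]] by (simp add: en_def)
  then show ?thesis by (simp add: H.nm_def energy_conservation[OF assms])
qed

lemma nm_u_le:
  assumes "0 \<le> t" shows "V.nm (u t) \<le> sqrt (en 0)"
proof -
  have "B (u t) (u t) \<le> en t" using H.ip_pos[OF utH[OF assms]] by (simp add: en_def)
  then show ?thesis by (simp add: V.nm_def energy_conservation[OF assms])
qed

subsection \<open>Time averages\<close>

lemma int_cont: "0 \<le> a \<Longrightarrow> continuous_on {0..} f \<Longrightarrow> f integrable_on {a..(b::real)}" for f :: "real \<Rightarrow> real"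
  by (rule integrable_continuous_real) (auto intro: continuous_on_subset)

text \<open>The vector \<open>w\<close> stands for the integral of \<open>u\<close> over \<open>[a, b]\<close>: it is a Riemann sum whose
  error is uniform in the test vector. By bisection it is enough to find it locally, where \<open>u\<close> is nearly constant, and to
  add it up over adjacent intervals.\<close>

lemma time_average:
  assumes ab: "0 \<le> a" "a \<le> b" and e: "0 < e"
  shows "\<exists>w\<in>V. (\<forall>f\<in>H. \<bar>integral {a..b} (\<lambda>s. ip (u s) f) - ip w f\<bar> \<le> e * (b - a) * H.nm f) \<and>
     (\<forall>v\<in>V. \<bar>integral {a..b} (\<lambda>s. B (u s) v) - B w v\<bar> \<le> e * (b - a) * V.nm v)"
proof -
  let ?P = "\<lambda>a b. 0 \<le> a \<longrightarrow> (\<exists>w\<in>V.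
     (\<forall>f\<in>H. \<bar>integral {a..b} (\<lambda>s. ip (u s) f) - ip w f\<bar> \<le> e * (b - a) * H.nm f) \<and>
     (\<forall>v\<in>V. \<bar>integral {a..b} (\<lambda>s. B (u s) v) - B w v\<bar> \<le> e * (b - a) * V.nm v))"
  from \<open>a \<le> b\<close> have "?P a b"
  proof (induction rule: Bolzano)
    case (trans a b c)
    show ?case
    proof
      assume a: "0 \<le> a"
      obtain w where w: "w \<in> V" "\<forall>f\<in>H. \<bar>integral {a..b} (\<lambda>s. ip (u s) f) - ip w f\<bar> \<le> e * (b - a) * H.nm f"
        "\<forall>v\<in>V. \<bar>integral {a..b} (\<lambda>s. B (u s) v) - B w v\<bar> \<le> e * (b - a) * V.nm v"
        using trans(1) a by blast
      have b: "0 \<le> b" using a trans by simp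
      obtain z where z: "z \<in> V" "\<forall>f\<in>H. \<bar>integral {b..c} (\<lambda>s. ip (u s) f) - ip z f\<bar> \<le> e * (c - b) * H.nm f"
        "\<forall>v\<in>V. \<bar>integral {b..c} (\<lambda>s. B (u s) v) - B z v\<bar> \<le> e * (c - b) * V.nm v"
        using trans(2) b by blast
      have wz: "w \<in> H" "z \<in> H" using w z VinH by auto
      have 1: "\<bar>integral {a..c} (\<lambda>s. ip (u s) f) - ip (\<lambda>p. w p + z p) f\<bar> \<le> e * (c - a) * H.nm f" if f: "f \<in> H" for f
      proof -
        have "integral {a..c} (\<lambda>s. ip (u s) f) = integral {a..b} (\<lambda>s. ip (u s) f) + integral {b..c} (\<lambda>s. ip (u s) f)"
          using Henstock_Kurzweil_Integration.integral_combine[OF trans(3,4) int_cont[OF a continuous_ip_fixed(1)[OF f]]] by simp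
        moreover have "ip (\<lambda>p. w p + z p) f = ip w f + ip z f" by (rule H.ip_add[OF wz f])
        moreover have "e * (c - a) * H.nm f = e * (b - a) * H.nm f + e * (c - b) * H.nm f"
          by (simp add: algebra_simps)
        ultimately show ?thesis using bspec[OF w(2) f] bspec[OF z(2) f] by linarith
      qed
      have 2: "\<bar>integral {a..c} (\<lambda>s. B (u s) f) - B (\<lambda>p. w p + z p) f\<bar> \<le> e * (c - a) * V.nm f" if f: "f \<in> V" for f
      proof -
        have "integral {a..c} (\<lambda>s. B (u s) f) = integral {a..b} (\<lambda>s. B (u s) f) + integral {b..c} (\<lambda>s. B (u s) f)"
          using Henstock_Kurzweil_Integration.integral_combine[OF trans(3,4) int_cont[OF a continuous_B[OF f]]] by simp
        moreover have "B (\<lambda>p. w p + z p) f = B w f + B z f" by (rule V.ip_add[OF w(1) z(1) f])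
        moreover have "e * (c - a) * V.nm f = e * (b - a) * V.nm f + e * (c - b) * V.nm f"
          by (simp add: algebra_simps)
        ultimately show ?thesis using bspec[OF w(3) f] bspec[OF z(3) f] by linarith
      qed
      show "\<exists>w\<in>V. (\<forall>f\<in>H. \<bar>integral {a..c} (\<lambda>s. ip (u s) f) - ip w f\<bar> \<le> e * (c - a) * H.nm f) \<and>
        (\<forall>v\<in>V. \<bar>integral {a..c} (\<lambda>s. B (u s) v) - B w v\<bar> \<le> e * (c - a) * V.nm v)"
        by (rule bexI[of _ "\<lambda>p. w p + z p"]) (use 1 2 V.add[OF w(1) z(1)] in auto)
    qed
  next
    case (local x)
    have x: "0 \<le> x" using local ab by simp
    have 1: "\<forall>\<^sub>F s in at x within {0..}. V.nm (\<lambda>p. u s p - u x p) < e"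
      using u_cont[OF x] e by (rule order_tendstoD(2))
    have 2: "\<forall>\<^sub>F s in at x within {0..}. H.nm (\<lambda>p. u s p - u x p) < e"
      using u_cont_H[OF x] e by (rule order_tendstoD(2))
    obtain d where d: "d > 0" and dd: "\<And>s. s \<in> {0..} \<Longrightarrow> s \<noteq> x \<Longrightarrow> dist s x < d \<Longrightarrow>
        V.nm (\<lambda>p. u s p - u x p) < e \<and> H.nm (\<lambda>p. u s p - u x p) < e"
      using eventually_conj[OF 1 2] unfolding eventually_at by blast
    have near: "V.nm (\<lambda>p. u s p - u x p) \<le> e \<and> H.nm (\<lambda>p. u s p - u x p) \<le> e" if "0 \<le> s" "\<bar>s - x\<bar> < d" for s
    proof (cases "s = x")
      case True then show ?thesis
        using V.nm_self[OF uV[OF x]] H.nm_self[OF uH[OF x]] e by simp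
    next
      case False
      with dd[of s] that show ?thesis by (auto simp: dist_real_def)
    qed
    have "?P a b" if "a \<le> x" "x \<le> b" "b - a < d" for a b
    proof
      assume a: "0 \<le> a"
      have ab: "a \<le> b" using that by simp
      have s: "0 \<le> s \<and> \<bar>s - x\<bar> < d" if "s \<in> {a..b}" for s
        using that \<open>a \<le> x\<close> \<open>x \<le> b\<close> \<open>b - a < d\<close> a by auto
      have w: "(\<lambda>p. (b - a) * u x p) \<in> V" by (rule V.scale[OF uV[OF x]])
      have 1: "\<bar>integral {a..b} (\<lambda>s. ip (u s) f) - ip (\<lambda>p. (b - a) * u x p) f\<bar> \<le> e * (b - a) * H.nm f" if f: "f \<in> H" for f
      proof -
        have bd: "norm (ip (u s) f - ip (u x) f) \<le> e * H.nm f" if "s \<in> {a..b}" for s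
        proof -
          have "\<bar>ip (\<lambda>p. u s p - u x p) f\<bar> \<le> H.nm (\<lambda>p. u s p - u x p) * H.nm f"
            using s[OF that] x by (intro H.Cauchy_Schwarz H.diff uH f) auto
          also have "\<dots> \<le> e * H.nm f" using near[of s] s[OF that] f by (intro mult_right_mono) auto
          finally show ?thesis using s[OF that] x f by (simp add: H.ip_diff uH)
        qed
        have i: "(\<lambda>s. ip (u s) f) integrable_on {a..b}" by (rule int_cont[OF a continuous_ip_fixed(1)[OF f]])
        have "norm (integral {a..b} (\<lambda>s. ip (u s) f - ip (u x) f)) \<le> integral {a..b} (\<lambda>s. e * H.nm f)"
          using bd by (intro integral_norm_bound_integral integrable_diff i integrable_const_ivl) auto
        moreover have "integral {a..b} (\<lambda>s. ip (u s) f - ip (u x) f)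
            = integral {a..b} (\<lambda>s. ip (u s) f) - (b - a) * ip (u x) f"
          using ab by (simp add: Henstock_Kurzweil_Integration.integral_diff[OF i integrable_const_ivl])
        ultimately show ?thesis using ab x f by (simp add: H.ip_scale uH mult_ac)
      qed
      have 2: "\<bar>integral {a..b} (\<lambda>s. B (u s) f) - B (\<lambda>p. (b - a) * u x p) f\<bar> \<le> e * (b - a) * V.nm f" if f: "f \<in> V" for f
      proof -
        have bd: "norm (B (u s) f - B (u x) f) \<le> e * V.nm f" if "s \<in> {a..b}" for s
        proof -
          have "\<bar>B (\<lambda>p. u s p - u x p) f\<bar> \<le> V.nm (\<lambda>p. u s p - u x p) * V.nm f"
            using s[OF that] x by (intro V.Cauchy_Schwarz V.diff uV f) auto
          also have "\<dots> \<le> e * V.nm f" using near[of s] s[OF that] f by (intro mult_right_mono) auto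
          finally show ?thesis using s[OF that] x f by (simp add: V.ip_diff uV)
        qed
        have i: "(\<lambda>s. B (u s) f) integrable_on {a..b}" by (rule int_cont[OF a continuous_B[OF f]])
        have "norm (integral {a..b} (\<lambda>s. B (u s) f - B (u x) f)) \<le> integral {a..b} (\<lambda>s. e * V.nm f)"
          using bd by (intro integral_norm_bound_integral integrable_diff i integrable_const_ivl) auto
        moreover have "integral {a..b} (\<lambda>s. B (u s) f - B (u x) f)
            = integral {a..b} (\<lambda>s. B (u s) f) - (b - a) * B (u x) f"
          using ab by (simp add: Henstock_Kurzweil_Integration.integral_diff[OF i integrable_const_ivl])
        ultimately show ?thesis using ab x f by (simp add: V.ip_scale uV mult_ac)
      qed
      show "\<exists>w\<in>V. (\<forall>f\<in>H. \<bar>integral {a..b} (\<lambda>s. ip (u s) f) - ip w f\<bar> \<le> e * (b - a) * H.nm f) \<and>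
        (\<forall>v\<in>V. \<bar>integral {a..b} (\<lambda>s. B (u s) v) - B w v\<bar> \<le> e * (b - a) * V.nm v)"
        by (rule bexI[OF _ w]) (use 1 2 in auto)
    qed
    then show ?case using d by blast
  qed
  then show ?thesis using ab by blast
qed

text \<open>Testing the weak equation with \<open>w\<close>, the approximate integral of \<open>u\<close>, and integrating in time
  gives \<open>B(w, w) \<approx> (u\<^sub>t(a) - u\<^sub>t(b), w)\<close>. With the Poincare inequality this bounds \<open>w\<close> by the energy,
  independently of \<open>b - a\<close>. It replaces the inverse of the elliptic operator.\<close>

lemma average_bounded:
  assumes ab: "0 \<le> a" "a \<le> b" and f: "f \<in> H"
  shows "\<bar>integral {a..b} (\<lambda>s. ip (u s) f)\<bar> \<le> 2 * P * sqrt (en 0) * H.nm f"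
proof (rule field_le_epsilon)
  fix \<epsilon> :: real assume eps: "0 < \<epsilon>"
  define K where "K = ((b - a) + sqrt P * (b - a)) * H.nm f + 1"
  have sP: "0 \<le> sqrt P" "sqrt P * sqrt P = P" using P by auto
  have K: "0 < K" using ab f sP H.nm_nonneg[OF f] unfolding K_def
    by (intro add_nonneg_pos mult_nonneg_nonneg) auto
  define e where "e = \<epsilon> / K"
  have e: "0 < e" using eps K by (simp add: e_def)
  obtain w where w: "w \<in> V"
    and w1: "\<bar>integral {a..b} (\<lambda>s. ip (u s) f) - ip w f\<bar> \<le> e * (b - a) * H.nm f"
    and w2: "\<bar>integral {a..b} (\<lambda>s. B (u s) w) - B w w\<bar> \<le> e * (b - a) * V.nm w"
    using time_average[OF ab e] f by blast
  have wH: "w \<in> H" using w VinH by blast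
  have b0: "0 \<le> b" using ab by simp
  have "((\<lambda>s. - B (u s) w) has_integral (ip (ut b) w - ip (ut a) w)) {a..b}"
  proof (rule fundamental_theorem_of_calculus[OF ab(2)])
    fix s assume "s \<in> {a..b}"
    then have "((\<lambda>s. ip (ut s) w) has_real_derivative - B (u s) w) (at s within {0..})"
      using ab by (intro weak_eq[OF w]) auto
    then have "((\<lambda>s. ip (ut s) w) has_real_derivative - B (u s) w) (at s within {a..b})"
      by (rule DERIV_subset) (use ab in auto)
    then show "((\<lambda>s. ip (ut s) w) has_vector_derivative - B (u s) w) (at s within {a..b})"
      by (simp add: has_real_derivative_iff_has_vector_derivative)
  qed
  then have "integral {a..b} (\<lambda>s. B (u s) w) = ip (ut a) w - ip (ut b) w"
    using integral_unique[OF has_integral_neg, of "\<lambda>s. - B (u s) w" "ip (ut b) w - ip (ut a) w" "{a..b}"]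
    by (simp only: minus_minus minus_diff_eq)
  moreover have "\<bar>ip (ut t) w\<bar> \<le> sqrt (en 0) * (sqrt P * V.nm w)" if "0 \<le> t" for t
  proof -
    have "\<bar>ip (ut t) w\<bar> \<le> H.nm (ut t) * H.nm w" by (rule H.Cauchy_Schwarz[OF utH[OF that] wH])
    also have "\<dots> \<le> sqrt (en 0) * (sqrt P * V.nm w)"
      by (intro mult_mono nm_ut_le nm_Poincare that w) (use en_nonneg[of 0] wH in auto)
    finally show ?thesis .
  qed
  from this[OF ab(1)] this[OF b0] have "\<bar>ip (ut a) w - ip (ut b) w\<bar> \<le> 2 * (sqrt (en 0) * (sqrt P * V.nm w))" by linarith
  ultimately have "V.nm w * V.nm w \<le> (2 * sqrt (en 0) * sqrt P + e * (b - a)) * V.nm w"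
    using w2 V.nm_sq[OF w] by (simp add: power2_eq_square algebra_simps)
  then have nw: "V.nm w \<le> 2 * sqrt (en 0) * sqrt P + e * (b - a)"
  proof (cases "V.nm w = 0")
    case True
    have "0 \<le> 2 * sqrt (en 0) * sqrt P + e * (b - a)"
      using sP en_nonneg[of 0] e ab by (intro add_nonneg_nonneg mult_nonneg_nonneg) auto
    then show ?thesis using True by simp
  next
    case False
    then have "0 < V.nm w" using V.nm_nonneg[OF w] by linarith
    then show ?thesis using \<open>V.nm w * V.nm w \<le> _\<close> by (simp add: mult_le_cancel_right)
  qed
  have "\<bar>ip w f\<bar> \<le> H.nm w * H.nm f" by (rule H.Cauchy_Schwarz[OF wH f])
  also have "\<dots> \<le> (sqrt P * (2 * sqrt (en 0) * sqrt P + e * (b - a))) * H.nm f"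
    using nm_Poincare[OF w] mult_left_mono[OF nw sP(1)] f by (intro mult_right_mono) auto
  finally have "\<bar>integral {a..b} (\<lambda>s. ip (u s) f)\<bar>
      \<le> (sqrt P * (2 * sqrt (en 0) * sqrt P + e * (b - a))) * H.nm f + e * (b - a) * H.nm f"
    using w1 by linarith
  also have "\<dots> = 2 * (sqrt P * sqrt P) * sqrt (en 0) * H.nm f + e * (((b - a) + sqrt P * (b - a)) * H.nm f)"
    by (simp add: algebra_simps)
  also have "\<dots> \<le> 2 * (sqrt P * sqrt P) * sqrt (en 0) * H.nm f + e * K"
    using e by (intro add_left_mono mult_left_mono) (auto simp: K_def)
  also have "e * K = \<epsilon>" using K by (simp add: e_def)
  finally show "\<bar>integral {a..b} (\<lambda>s. ip (u s) f)\<bar> \<le> 2 * P * sqrt (en 0) * H.nm f + \<epsilon>"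
    using sP(2) by simp
qed

subsection \<open>Localised lower-order terms\<close>

lemma ip_u_deriv:
  assumes t: "0 \<le> t" and b: "b \<in> H"
  shows "((\<lambda>s. ip (u s) b) has_real_derivative ip (ut t) b) (at t within {0..})"
proof -
  have ev: "\<forall>\<^sub>F s in at t within {0..}. (\<lambda>p. (u s p - u t p) / (s - t)) \<in> H"
    by (rule ev_nonneg) (rule H.divide, rule H.diff, rule uH, assumption, rule uH, rule t)
  have "((\<lambda>s. ip (\<lambda>p. (u s p - u t p) / (s - t)) b) \<longlongrightarrow> ip (ut t) b) (at t within {0..})"
    by (rule H.tendsto_ip_left[OF ev utH[OF t] b u_deriv[OF t]])
  moreover have "\<forall>\<^sub>F s in at t within {0..}. ip (\<lambda>p. (u s p - u t p) / (s - t)) b = (ip (u s) b - ip (u t) b) / (s - t)"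
    by (rule ev_nonneg) (simp add: H.ip_divide H.ip_diff H.diff uH t b)
  ultimately show ?thesis unfolding has_field_derivative_iff by (rule Lim_transform_eventually)
qed

context
  fixes J :: "('p \<Rightarrow> real) \<Rightarrow> ('p \<Rightarrow> real)"
  assumes J: "H.bounded_op J"
    and J_sym: "\<And>f g. f \<in> H \<Longrightarrow> g \<in> H \<Longrightarrow> ip (J f) g = ip f (J g)"
    and J_idem: "\<And>f. J (J f) = J f"
begin

lemma JH: "f \<in> H \<Longrightarrow> J f \<in> H" using J unfolding H.bounded_op_def by auto

lemma continuous_Jut: "continuous_on {0..} (\<lambda>t. ip (J (ut t)) (J (ut t)))"
  by (rule continuous_ip[OF J J]) auto

lemma continuous_Ju: "continuous_on {0..} (\<lambda>t. ip (J (u t)) (J (u t)))"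
  by (rule continuous_ip[OF J J]) auto

text \<open>Pair \<open>u(s)\<close>, for \<open>s\<close> in \<open>[t, t + \<tau>]\<close>, with \<open>b = J (u t)\<close>. Its time mean is small by
  \<open>average_bounded\<close>, and since \<open>J b = b\<close> its variation sees only \<open>J u\<^sub>t\<close>.\<close>

lemma local_low_order:
  assumes t: "0 \<le> t" and tau: "0 < \<tau>"
  shows "ip (J (u t)) (J (u t)) \<le>
    2 * \<tau> * integral {t..t+\<tau>} (\<lambda>s. ip (J (ut s)) (J (ut s))) + 8 * P\<^sup>2 * en 0 / \<tau>\<^sup>2"
proof -
  define b where "b = J (u t)"
  define m where "m = ip b b"
  define g where "g = (\<lambda>s. ip (J (ut s)) (J (ut s)))"
  define G where "G = integral {t..t+\<tau>} g"
  have b: "b \<in> H" unfolding b_def by (rule JH, rule uH, rule t)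
  have Jb: "J b = b" by (simp add: b_def J_idem)
  have m0: "0 \<le> m" unfolding m_def by (rule H.ip_pos[OF b])
  have nb: "H.nm b = sqrt m" by (simp add: H.nm_def m_def)
  have g0: "0 \<le> g s" if "0 \<le> s" for s unfolding g_def by (rule H.ip_pos, rule JH, rule utH, rule that)
  have gi: "g integrable_on {t..s}" for s unfolding g_def by (rule int_cont[OF t continuous_Jut])
  have pt: "\<bar>ip (ut r) b\<bar> \<le> \<tau> * g r + m / (4 * \<tau>)" if r: "0 \<le> r" for r
  proof -
    have "ip (ut r) b = ip (J (ut r)) b" using J_sym[OF utH[OF r] b] Jb by simp
    then have "\<bar>ip (ut r) b\<bar> \<le> H.nm (J (ut r)) * H.nm b"
      using H.Cauchy_Schwarz[OF JH[OF utH[OF r]] b] by simp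
    also have "\<dots> = sqrt (g r) * sqrt m" unfolding nb by (simp add: H.nm_def g_def)
    also have "\<dots> \<le> \<tau> * g r + m / (4 * \<tau>)"
    proof -
      have "0 \<le> (2 * \<tau> * sqrt (g r) - sqrt m)\<^sup>2" by simp
      also have "\<dots> = 4 * \<tau>\<^sup>2 * g r + m - 4 * \<tau> * (sqrt (g r) * sqrt m)"
        using g0[OF r] m0 by (simp add: power2_diff power_mult_distrib)
      finally have "4 * \<tau> * (sqrt (g r) * sqrt m) \<le> 4 * \<tau>\<^sup>2 * g r + m" by simp
      then have "sqrt (g r) * sqrt m \<le> (4 * \<tau>\<^sup>2 * g r + m) / (4 * \<tau>)"
        using tau by (simp add: pos_le_divide_eq mult.commute)
      then show ?thesis using tau by (simp add: add_divide_distrib power2_eq_square)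
    qed
    finally show ?thesis .
  qed
  have low: "m - ip (u s) b \<le> \<tau> * G + m / 4" if s: "s \<in> {t..t+\<tau>}" for s
  proof -
    have ts: "t \<le> s" using s by simp
    have "((\<lambda>r. ip (ut r) b) has_integral (ip (u s) b - ip (u t) b)) {t..s}"
    proof (rule fundamental_theorem_of_calculus[OF ts])
      fix r assume "r \<in> {t..s}"
      then have "((\<lambda>s. ip (u s) b) has_real_derivative ip (ut r) b) (at r within {0..})"
        using t by (intro ip_u_deriv b) auto
      then have "((\<lambda>s. ip (u s) b) has_real_derivative ip (ut r) b) (at r within {t..s})"
        by (rule DERIV_subset) (use t in auto)
      then show "((\<lambda>s. ip (u s) b) has_vector_derivative ip (ut r) b) (at r within {t..s})"
        by (simp add: has_real_derivative_iff_has_vector_derivative)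
    qed
    then have hi: "(\<lambda>r. ip (ut r) b) integrable_on {t..s}"
      and ie: "integral {t..s} (\<lambda>r. ip (ut r) b) = ip (u s) b - ip (u t) b"
      by (auto simp: integrable_on_def integral_unique)
    have bi: "(\<lambda>r. \<tau> * g r + m / (4 * \<tau>)) integrable_on {t..s}"
      using integrable_add[OF integrable_on_cmult_left[OF gi, of \<tau>] integrable_const_ivl] by simp
    have "norm (integral {t..s} (\<lambda>r. ip (ut r) b)) \<le> integral {t..s} (\<lambda>r. \<tau> * g r + m / (4 * \<tau>))"
      using pt t by (intro integral_norm_bound_integral hi bi) auto
    also have "\<dots> = \<tau> * integral {t..s} g + (s - t) * (m / (4 * \<tau>))"
      using Henstock_Kurzweil_Integration.integral_add[OF integrable_on_cmult_left[OF gi, of \<tau>] integrable_const_ivl] ts by simp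
    also have "\<dots> \<le> \<tau> * G + \<tau> * (m / (4 * \<tau>))"
    proof (intro add_mono mult_left_mono mult_right_mono)
      show "integral {t..s} g \<le> G" unfolding G_def
        using s t g0 by (intro integral_subset_le gi) auto
    qed (use s tau m0 in auto)
    also have "\<tau> * (m / (4 * \<tau>)) = m / 4" using tau by simp
    finally have "\<bar>ip (u s) b - ip (u t) b\<bar> \<le> \<tau> * G + m / 4" using ie by simp
    moreover have "ip (u t) b = m"
      using J_sym[OF uH[OF t] b] Jb by (simp add: m_def flip: b_def)
    ultimately show ?thesis by linarith
  qed
  have ui: "(\<lambda>s. ip (u s) b) integrable_on {t..t+\<tau>}" by (rule int_cont[OF t continuous_ip_fixed(1)[OF b]])
  have "integral {t..t+\<tau>} (\<lambda>s. m - ip (u s) b) \<le> integral {t..t+\<tau>} (\<lambda>s. \<tau> * G + m / 4)"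
    by (intro integral_le integrable_diff ui integrable_const_ivl low)
  then have "\<tau> * m - integral {t..t+\<tau>} (\<lambda>s. ip (u s) b) \<le> \<tau> * (\<tau> * G + m / 4)"
    using tau by (simp add: Henstock_Kurzweil_Integration.integral_diff[OF integrable_const_ivl ui])
  moreover have "\<bar>integral {t..t+\<tau>} (\<lambda>s. ip (u s) b)\<bar> \<le> 2 * P * sqrt (en 0) * sqrt m"
    using average_bounded[OF t _ b, of "t+\<tau>"] tau nb by simp
  moreover have "2 * P * sqrt (en 0) * sqrt m \<le> \<tau> * m / 4 + 4 * P\<^sup>2 * en 0 / \<tau>"
  proof -
    have "0 \<le> (\<tau> * sqrt m - 4 * P * sqrt (en 0))\<^sup>2" by simp
    also have "\<dots> = \<tau>\<^sup>2 * m + 16 * P\<^sup>2 * en 0 - 4 * \<tau> * (2 * P * sqrt (en 0) * sqrt m)"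
      using en_nonneg[of 0] m0 by (simp add: power2_diff power_mult_distrib)
    finally have "2 * P * sqrt (en 0) * sqrt m \<le> (\<tau>\<^sup>2 * m + 16 * P\<^sup>2 * en 0) / (4 * \<tau>)"
      using tau by (simp add: pos_le_divide_eq mult_ac)
    then show ?thesis using tau by (simp add: add_divide_distrib power2_eq_square)
  qed
  ultimately have "\<tau> * m \<le> \<tau> * (\<tau> * G + m / 4) + \<tau> * m / 4 + 4 * P\<^sup>2 * en 0 / \<tau>" by linarith
  then have "\<tau> * m / 2 \<le> \<tau>\<^sup>2 * G + 4 * P\<^sup>2 * en 0 / \<tau>"
    by (simp add: distrib_left power2_eq_square)
  then have "m \<le> (\<tau>\<^sup>2 * G + 4 * P\<^sup>2 * en 0 / \<tau>) * 2 / \<tau>"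
    using tau by (simp add: pos_le_divide_eq mult_ac)
  also have "\<dots> = 2 * \<tau> * G + 8 * P\<^sup>2 * en 0 / \<tau>\<^sup>2"
    using tau by (simp add: field_simps power2_eq_square)
  finally show ?thesis by (simp add: m_def b_def G_def g_def)
qed

text \<open>Integrate \<open>local_low_order\<close> over \<open>[0, T - \<tau>]\<close>. The sliding windows contribute at most \<open>\<tau>\<close> times
  the whole integral, and the choice of \<open>\<tau>\<close> lets half of \<open>c (T - \<tau>) E\<close> absorb the rest.\<close>

lemma absorb_low_order:
  assumes c: "0 < c" and C1: "0 \<le> C1" and C2: "0 \<le> C2" and tau: "0 < \<tau>"
    and tau_large: "16 * C2 * P\<^sup>2 \<le> c * \<tau>\<^sup>2"
    and main: "\<And>T. 0 \<le> T \<Longrightarrow> c * T * en 0 \<le> C1 * en 0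
      + C2 * integral {0..T} (\<lambda>t. ip (J (ut t)) (J (ut t)) + ip (J (u t)) (J (u t)))"
    and T: "\<tau> + 2 * (C1 + 1) / c \<le> T"
  shows "en 0 \<le> C2 * (1 + 2 * \<tau>\<^sup>2) * integral {0..T} (\<lambda>t. ip (J (ut t)) (J (ut t)))"
proof -
  define g where "g = (\<lambda>s. ip (J (ut s)) (J (ut s)))"
  define m where "m = (\<lambda>s. ip (J (u s)) (J (u s)))"
  define S where "S = T - \<tau>"
  define G where "G = (\<lambda>t. integral {0..t} g)"
  have SC: "2 * (C1 + 1) / c \<le> S" using T by (simp add: S_def)
  moreover have "0 \<le> 2 * (C1 + 1) / c" using c C1 by simp
  ultimately have S0: "0 \<le> S" and ST: "S \<le> T" "\<tau> \<le> T" "0 \<le> T" using tau by (auto simp: S_def)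
  have g0: "0 \<le> g s" if "0 \<le> s" for s unfolding g_def by (rule H.ip_pos, rule JH, rule utH, rule that)
  have gi: "0 \<le> a \<Longrightarrow> g integrable_on {a..b}" for a b unfolding g_def by (rule int_cont[OF _ continuous_Jut])
  have mi: "m integrable_on {0..S}" unfolding m_def by (rule int_cont[OF _ continuous_Ju]) simp
  have Gc: "continuous_on {0..T} G" unfolding G_def by (rule indefinite_integral_continuous_1[OF gi]) simp
  have Gi: "G integrable_on {a..b}" if "0 \<le> a" "b \<le> T" for a b
    using that by (intro integrable_continuous_real continuous_on_subset[OF Gc]) auto
  have Gmono: "G a \<le> G b" if "0 \<le> a" "a \<le> b" for a b
    unfolding G_def using that g0 by (intro integral_subset_le gi) auto
  have G0: "0 \<le> G a" if "0 \<le> a" for a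
    using Gmono[of 0 a] that by (simp add: G_def)
  have Gsi: "(\<lambda>t. G (t + \<tau>)) integrable_on {0..S}"
    by (intro integrable_continuous_real continuous_on_compose2[OF Gc] continuous_intros) (use tau in \<open>auto simp: S_def\<close>)
  have window: "integral {t..t+\<tau>} g = G (t + \<tau>) - G t" if "0 \<le> t" for t
    using Henstock_Kurzweil_Integration.integral_combine[of 0 t "t+\<tau>" g] gi[of 0] that tau by (simp add: G_def)
  have sh: "integral {0..S} (\<lambda>t. G (t + \<tau>)) = integral {\<tau>..T} G"
    using integral_shift[of 0 \<tau> S G] continuous_on_subset[OF Gc, of "{\<tau>..T}"] tau by (simp add: S_def o_def)
  have "integral {0..S} (\<lambda>t. G (t + \<tau>) - G t) = integral {\<tau>..T} G - integral {0..S} G"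
    using sh by (simp add: Henstock_Kurzweil_Integration.integral_diff[OF Gsi Gi[OF _ ST(1)]])
  also have "\<dots> = integral {S..T} G - integral {0..\<tau>} G"
    using Henstock_Kurzweil_Integration.integral_combine[of 0 S T G] Henstock_Kurzweil_Integration.integral_combine[of 0 \<tau> T G] Gi[of 0 T] S0 ST tau by simp
  also have "\<dots> \<le> integral {S..T} G"
    using Henstock_Kurzweil_Integration.integral_nonneg[OF Gi[of 0 \<tau>]] G0 ST by simp
  also have "\<dots> \<le> integral {S..T} (\<lambda>_. G T)"
    using S0 by (intro integral_le Gi integrable_const_ivl Gmono) auto
  also have "\<dots> = \<tau> * G T" using tau by (simp add: S_def)
  finally have GT: "integral {0..S} (\<lambda>t. G (t + \<tau>) - G t) \<le> \<tau> * G T" .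
  define K where "K = 8 * P\<^sup>2 * en 0 / \<tau>\<^sup>2"
  have mb: "m t \<le> 2 * \<tau> * (G (t + \<tau>) - G t) + K" if "t \<in> {0..S}" for t
    using local_low_order[OF _ tau, of t] window[of t] that unfolding K_def m_def g_def[symmetric] by simp
  have i1: "(\<lambda>t. 2 * \<tau> * (G (t + \<tau>) - G t)) integrable_on {0..S}"
    using integrable_on_cmult_left[OF integrable_diff[OF Gsi Gi[OF order_refl ST(1)]], of "2 * \<tau>"] by simp
  have "integral {0..S} m \<le> integral {0..S} (\<lambda>t. 2 * \<tau> * (G (t + \<tau>) - G t) + K)"
    using mb by (intro integral_le mi integrable_add i1 integrable_const_ivl) auto
  also have "\<dots> = 2 * \<tau> * integral {0..S} (\<lambda>t. G (t + \<tau>) - G t) + S * K"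
    using Henstock_Kurzweil_Integration.integral_add[OF i1 integrable_const_ivl] S0 by simp
  also have "\<dots> \<le> 2 * \<tau> * (\<tau> * G T) + S * K" using GT tau by simp
  finally have mS: "integral {0..S} m \<le> 2 * \<tau>\<^sup>2 * G T + S * K" by (simp add: power2_eq_square)
  have gS: "integral {0..S} g \<le> G T" using Gmono[OF S0 ST(1)] by (simp add: G_def)
  have "c * S * en 0 \<le> C1 * en 0 + C2 * (integral {0..S} g + integral {0..S} m)"
    using main[OF S0] Henstock_Kurzweil_Integration.integral_add[OF gi[of 0 S] mi] unfolding g_def m_def by simp
  also have "\<dots> \<le> C1 * en 0 + C2 * (G T + (2 * \<tau>\<^sup>2 * G T + S * K))"
    using mS gS C2 by (intro add_left_mono mult_left_mono) auto
  also have "\<dots> = C1 * en 0 + C2 * (1 + 2 * \<tau>\<^sup>2) * G T + S * (C2 * K)" by (simp add: algebra_simps)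
  also have "C2 * K \<le> c / 2 * en 0"
  proof -
    have "C2 * K = (16 * C2 * P\<^sup>2) * en 0 / (2 * \<tau>\<^sup>2)" by (simp add: K_def)
    also have "\<dots> \<le> (c * \<tau>\<^sup>2) * en 0 / (2 * \<tau>\<^sup>2)"
      using tau_large en_nonneg[of 0] by (intro divide_right_mono mult_right_mono) auto
    also have "\<dots> = c / 2 * en 0" using tau by simp
    finally show ?thesis .
  qed
  finally have "c * S * en 0 \<le> C1 * en 0 + C2 * (1 + 2 * \<tau>\<^sup>2) * G T + S * (c / 2 * en 0)"
    using S0 by (simp add: mult_left_mono)
  then have "(c * S / 2 - C1) * en 0 \<le> C2 * (1 + 2 * \<tau>\<^sup>2) * G T" by (simp add: algebra_simps)
  moreover have "1 \<le> c * S / 2 - C1" using SC c by (simp add: pos_divide_le_eq mult.commute)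
  then have "1 * en 0 \<le> (c * S / 2 - C1) * en 0" using en_nonneg[of 0] by (intro mult_right_mono) auto
  ultimately show ?thesis by (simp add: G_def g_def)
qed

end

end


section \<open>Square-integrable functions\<close>

lemma L2_integrable_mult:
  assumes "f \<in> L2 S" "g \<in> L2 S"
  shows "integrable (lebesgue_on S) (\<lambda>p. f p * g p)"
proof (rule Bochner_Integration.integrable_bound)
  show "integrable (lebesgue_on S) (\<lambda>p. (f p)\<^sup>2 + (g p)\<^sup>2)"
    using assms by (auto simp: L2_def)
  show "(\<lambda>p. f p * g p) \<in> borel_measurable (lebesgue_on S)"
    using assms by (auto simp: L2_def)
  have "\<bar>a * b\<bar> \<le> a\<^sup>2 + b\<^sup>2" for a b :: real
  proof -
    have "0 \<le> (\<bar>a\<bar> - \<bar>b\<bar>)\<^sup>2" by simp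
    then have "2 * \<bar>a * b\<bar> \<le> a\<^sup>2 + b\<^sup>2" by (simp add: power2_diff abs_mult)
    then show ?thesis by (smt (verit) zero_le_power2)
  qed
  then show "AE p in lebesgue_on S. norm (f p * g p) \<le> norm ((f p)\<^sup>2 + (g p)\<^sup>2)"
    by (intro AE_I2) (simp add: abs_of_nonneg)
qed

lemma L2_add: "f \<in> L2 S \<Longrightarrow> g \<in> L2 S \<Longrightarrow> (\<lambda>p. f p + g p) \<in> L2 S"
  using L2_integrable_mult[of f S g]
  by (auto simp: L2_def power2_sum mult.assoc)

lemma L2_scale: "f \<in> L2 S \<Longrightarrow> (\<lambda>p. c * f p) \<in> L2 S"
  by (auto simp: L2_def power_mult_distrib)

interpretation L2: inner_form "L2 S" "L2_inner S" for S
proof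
  fix f g h :: "real \<times> real \<Rightarrow> real" and c :: real
  show "f \<in> L2 S \<Longrightarrow> g \<in> L2 S \<Longrightarrow> (\<lambda>p. f p + g p) \<in> L2 S" by (rule L2_add)
  show "f \<in> L2 S \<Longrightarrow> (\<lambda>p. c * f p) \<in> L2 S" by (rule L2_scale)
  show "L2_inner S f g = L2_inner S g f" by (simp add: L2_inner_def mult.commute)
  show "f \<in> L2 S \<Longrightarrow> g \<in> L2 S \<Longrightarrow> h \<in> L2 S \<Longrightarrow>
      L2_inner S (\<lambda>p. f p + g p) h = L2_inner S f h + L2_inner S g h"
    by (simp add: L2_inner_def distrib_right L2_integrable_mult)
  show "L2_inner S (\<lambda>p. c * f p) g = c * L2_inner S f g"
    by (simp add: L2_inner_def mult.assoc)
  show "0 \<le> L2_inner S f f" by (simp add: L2_inner_def)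
qed

lemma L2_measurable: "f \<in> L2 S \<Longrightarrow> f \<in> borel_measurable (lebesgue_on S)"
  by (simp add: L2_def)

lemma L2_dominated:
  assumes "f \<in> borel_measurable (lebesgue_on S)" "g \<in> L2 S" "\<And>p. p \<in> S \<Longrightarrow> \<bar>f p\<bar> \<le> K * \<bar>g p\<bar>"
  shows "f \<in> L2 S"
proof -
  have "integrable (lebesgue_on S) (\<lambda>p. (f p)\<^sup>2)"
  proof (rule Bochner_Integration.integrable_bound)
    show "integrable (lebesgue_on S) (\<lambda>p. K\<^sup>2 * (g p)\<^sup>2)" using assms(2) by (simp add: L2_def)
    show "(\<lambda>p. (f p)\<^sup>2) \<in> borel_measurable (lebesgue_on S)" using assms(1) by simp
    show "AE p in lebesgue_on S. norm ((f p)\<^sup>2) \<le> norm (K\<^sup>2 * (g p)\<^sup>2)"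
    proof (rule AE_I2)
      fix p assume "p \<in> space (lebesgue_on S)"
      then have "\<bar>f p\<bar> \<le> K * \<bar>g p\<bar>" using assms(3) by simp
      then have "\<bar>f p\<bar>\<^sup>2 \<le> (K * \<bar>g p\<bar>)\<^sup>2" by (intro power_mono) auto
      then show "norm ((f p)\<^sup>2) \<le> norm (K\<^sup>2 * (g p)\<^sup>2)" by (simp add: power_mult_distrib)
    qed
  qed
  with assms(1) show ?thesis by (simp add: L2_def)
qed

lemma L2_mult_bounded:
  assumes "c \<in> borel_measurable (lebesgue_on S)" "f \<in> L2 S" "\<And>p. p \<in> S \<Longrightarrow> \<bar>c p\<bar> \<le> K"
  shows "(\<lambda>p. c p * f p) \<in> L2 S"
  by (rule L2_dominated[OF _ assms(2), of _ K])
     (use assms in \<open>auto simp: L2_def abs_mult intro!: mult_right_mono\<close>)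

lemma L2_inner_mono:
  assumes "f \<in> L2 S" "g \<in> L2 S" "\<And>p. p \<in> S \<Longrightarrow> \<bar>f p\<bar> \<le> K * \<bar>g p\<bar>"
  shows "L2_inner S f f \<le> K\<^sup>2 * L2_inner S g g"
proof -
  have "(\<integral>p. f p * f p \<partial>lebesgue_on S) \<le> (\<integral>p. K\<^sup>2 * (g p * g p) \<partial>lebesgue_on S)"
  proof (rule integral_mono)
    fix p assume "p \<in> space (lebesgue_on S)"
    then have "\<bar>f p\<bar> \<le> K * \<bar>g p\<bar>" using assms(3) by simp
    then have "\<bar>f p\<bar>\<^sup>2 \<le> (K * \<bar>g p\<bar>)\<^sup>2" by (intro power_mono) auto
    then show "f p * f p \<le> K\<^sup>2 * (g p * g p)"
      by (simp add: power_mult_distrib flip: power2_eq_square)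
  qed (use assms L2_integrable_mult in auto)
  then show ?thesis by (simp add: L2_inner_def)
qed

lemma L2_inner_cong:
  "(\<And>p. p \<in> S \<Longrightarrow> f p * g p = f' p * g' p) \<Longrightarrow> L2_inner S f g = L2_inner S f' g'"
  unfolding L2_inner_def by (intro Bochner_Integration.integral_cong) auto

text \<open>Functions vanishing off \<open>S\<close> have the same integrals over \<open>S\<close> and over the plane.\<close>

lemma L2_UNIV_iff:
  assumes S: "S \<in> sets lebesgue" and z: "\<And>p. p \<notin> S \<Longrightarrow> f p = 0"
  shows "f \<in> L2 UNIV \<longleftrightarrow> f \<in> L2 S"
proof -
  have "(\<lambda>p. indicator S p *\<^sub>R f p) = f" "(\<lambda>p. indicator S p *\<^sub>R (f p)\<^sup>2) = (\<lambda>p. (f p)\<^sup>2)"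
    using z by (fastforce simp: indicator_def split: if_splits)+
  then show ?thesis
    using S borel_measurable_restrict_space_iff[of S lebesgue f] integrable_restrict_space[of S lebesgue "\<lambda>p. (f p)\<^sup>2"]
    by (simp add: L2_def lebesgue_on_UNIV_eq)
qed

lemma L2_inner_UNIV:
  assumes S: "S \<in> sets lebesgue" and z: "\<And>p. p \<notin> S \<Longrightarrow> f p * g p = 0"
  shows "L2_inner UNIV f g = L2_inner S f g"
proof -
  have "(\<lambda>p. indicator S p *\<^sub>R (f p * g p)) = (\<lambda>p. f p * g p)"
    using z by (fastforce simp: indicator_def split: if_splits)
  then show ?thesis
    using S integral_restrict_space[of S lebesgue "\<lambda>p. f p * g p"]
    by (simp add: L2_inner_def lebesgue_on_UNIV_eq)
qed

lemma L2_UNIV_restrict: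
  assumes S: "S \<in> sets lebesgue" and f: "f \<in> L2 UNIV" shows "f \<in> L2 S"
proof -
  have f': "f \<in> borel_measurable lebesgue" "integrable lebesgue (\<lambda>p. (f p)\<^sup>2)"
    using f by (auto simp: L2_def lebesgue_on_UNIV_eq)
  have "integrable lebesgue (\<lambda>p. indicator S p *\<^sub>R (f p)\<^sup>2)"
    using integrable_mult_indicator[OF _ f'(2), of S] S by simp
  then show ?thesis
    using S f' by (simp add: L2_def integrable_restrict_space measurable_restrict_space1)
qed

lemma L2_ext0:
  assumes S: "S \<in> sets lebesgue" and f: "f \<in> L2 S"
    and c: "continuous_on UNIV c" and K: "\<And>p. \<bar>c p\<bar> \<le> K" and z: "\<And>p. p \<notin> S \<Longrightarrow> c p = 0"
  shows "(\<lambda>p. c p * f p) \<in> L2 UNIV"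
proof -
  have "(\<lambda>p. c p * f p) \<in> L2 S"
    by (rule L2_mult_bounded[OF _ f, of _ K])
       (use c S K in \<open>auto intro!: continuous_imp_measurable_on_sets_lebesgue intro: continuous_on_subset\<close>)
  then show ?thesis using L2_UNIV_iff[OF S, of "\<lambda>p. c p * f p"] z by simp
qed

section \<open>Smooth functions of one variable\<close>

text \<open>\<open>Cn n f\<close>: \<open>f\<close> is \<open>n\<close> times differentiable on the line.\<close>

primrec Cn :: "nat \<Rightarrow> (real \<Rightarrow> real) \<Rightarrow> bool" where
  "Cn 0 f \<longleftrightarrow> True"
| "Cn (Suc n) f \<longleftrightarrow> (\<forall>x. f differentiable at x) \<and> Cn n (deriv f)"

definition smooth1 :: "(real \<Rightarrow> real) \<Rightarrow> bool" where
  "smooth1 f \<longleftrightarrow> (\<forall>n. Cn n f)"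

lemma deriv_real: "f differentiable at x \<Longrightarrow> (f has_real_derivative deriv f x) (at x)" for f :: "real \<Rightarrow> real"
  by (simp add: DERIV_deriv_iff_real_differentiable)

lemma smooth1_DERIV: "smooth1 f \<Longrightarrow> (f has_real_derivative deriv f x) (at x)"
  unfolding smooth1_def by (metis Cn.simps(2) deriv_real)

lemma smooth1_deriv: "smooth1 f \<Longrightarrow> smooth1 (deriv f)"
  unfolding smooth1_def by (metis Cn.simps(2))

lemma smooth1_cont: "smooth1 f \<Longrightarrow> continuous_on A f"
  by (meson DERIV_isCont continuous_at_imp_continuous_on smooth1_DERIV)

lemma Cn_Suc: "Cn (Suc n) f \<Longrightarrow> Cn n f"
  by (induction n arbitrary: f) auto

lemma Cn_SucI:
  assumes "\<And>x. (f has_real_derivative g x) (at x)" "Cn n g"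
  shows "Cn (Suc n) f"
proof -
  have "deriv f = g" using assms(1) by (intro ext DERIV_imp_deriv)
  then show ?thesis using assms by (auto simp: real_differentiable_def)
qed

lemma Cn_const: "Cn n (\<lambda>x. c)"
proof (induction n arbitrary: c)
  case (Suc n)
  show ?case by (rule Cn_SucI[OF _ Suc[of 0]]) auto
qed simp

lemma Cn_add: "Cn n f \<Longrightarrow> Cn n g \<Longrightarrow> Cn n (\<lambda>x. f x + g x)"
proof (induction n arbitrary: f g)
  case (Suc n)
  show ?case
    by (rule Cn_SucI[of _ "\<lambda>x. deriv f x + deriv g x"])
       (use Suc in \<open>auto intro!: DERIV_add deriv_real\<close>)
qed simp

lemma Cn_mult: "Cn n f \<Longrightarrow> Cn n g \<Longrightarrow> Cn n (\<lambda>x. f x * g x)"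
proof (induction n arbitrary: f g)
  case (Suc n)
  have "Cn n (\<lambda>x. f x * deriv g x)" "Cn n (\<lambda>x. deriv f x * g x)"
    using Suc.prems by (auto intro!: Suc.IH dest: Cn_Suc simp: Cn_Suc)
  then show ?case
    by (intro Cn_SucI[of _ "\<lambda>x. f x * deriv g x + deriv f x * g x"] Cn_add)
       (use Suc.prems in \<open>auto intro!: DERIV_mult' deriv_real\<close>)
qed simp

lemma Cn_inverse: "Cn n f \<Longrightarrow> (\<And>x. f x \<noteq> 0) \<Longrightarrow> Cn n (\<lambda>x. inverse (f x))"
proof (induction n)
  case (Suc n)
  have 1: "Cn n (\<lambda>x. inverse (f x))" using Suc Cn_Suc by blast
  have "Cn n (\<lambda>x. (-1) * (inverse (f x) * deriv f x * inverse (f x)))"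
    using Suc.prems 1 by (intro Cn_mult Cn_const) auto
  moreover have "((\<lambda>x. inverse (f x)) has_real_derivative (-1) * (inverse (f x) * deriv f x * inverse (f x))) (at x)" for x
    using DERIV_inverse'[OF deriv_real, of f x] Suc.prems by simp
  ultimately show ?case by (rule Cn_SucI[rotated])
qed simp

lemma Cn_affine: "Cn n f \<Longrightarrow> Cn n (\<lambda>x. f (a * x + b))"
proof (induction n arbitrary: f)
  case (Suc n)
  have "Cn n (\<lambda>x. deriv f (a * x + b) * a)"
    using Suc by (intro Cn_mult Cn_const) auto
  moreover have "((\<lambda>x. f (a * x + b)) has_real_derivative deriv f (a * x + b) * a) (at x)" for x
    by (rule DERIV_chain'[of "\<lambda>x. a * x + b" a x UNIV f "deriv f (a * x + b)"])
       (use Suc.prems in \<open>auto intro!: derivative_eq_intros deriv_real\<close>)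
  ultimately show ?case by (rule Cn_SucI[rotated])
qed simp

lemma smooth1_const: "smooth1 (\<lambda>x. c)" by (simp add: smooth1_def Cn_const)
lemma smooth1_mult: "smooth1 f \<Longrightarrow> smooth1 g \<Longrightarrow> smooth1 (\<lambda>x. f x * g x)" by (simp add: smooth1_def Cn_mult)
lemma smooth1_affine: "smooth1 f \<Longrightarrow> smooth1 (\<lambda>x. f (a * x + b))" by (simp add: smooth1_def Cn_affine)
lemma smooth1_id: "smooth1 (\<lambda>x. x)"
  unfolding smooth1_def
proof
  fix n show "Cn n (\<lambda>x. x)"
    by (cases n) (auto intro!: Cn_SucI[of _ "\<lambda>x. 1"] Cn_const simp del: Cn.simps(2))
qed

text \<open>The functions \<open>x\<^sup>-\<^sup>k exp (- 1 / x)\<close>, continued by \<open>0\<close>, span a space that is closed under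
  differentiation; this is the source of all smooth functions with compact support.\<close>

definition flat :: "nat \<Rightarrow> real \<Rightarrow> real" where
  "flat k x = (if x \<le> 0 then 0 else inverse x ^ k * exp (- inverse x))"

lemma flat_lim: "(flat k \<longlongrightarrow> 0) (at_right 0)"
proof -
  have "((\<lambda>y::real. y ^ k / exp y) \<longlongrightarrow> 0) at_top" by (rule tendsto_power_div_exp_0)
  then have "((\<lambda>x::real. inverse x ^ k / exp (inverse x)) \<longlongrightarrow> 0) (at_right 0)"
    by (rule filterlim_compose[OF _ filterlim_inverse_at_top_right])
  then show ?thesis
    by (rule Lim_transform_eventually)
       (auto simp: flat_def exp_minus field_simps eventually_at_right_field intro!: exI[of _ 1])
qed

lemma flat_deriv: "(flat k has_real_derivative - real k * flat (Suc k) x + flat (Suc (Suc k)) x) (at x)"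
proof (cases "x = 0")
  case True
  have "((\<lambda>h. (flat k h - flat k 0) / (h - 0)) \<longlongrightarrow> 0) (at_right 0)"
    by (rule Lim_transform_eventually[OF flat_lim[of "Suc k"]])
       (auto simp: flat_def field_simps eventually_at_right_field intro!: exI[of _ 1])
  moreover have "((\<lambda>h. (flat k h - flat k 0) / (h - 0)) \<longlongrightarrow> 0) (at_left 0)"
    by (rule Lim_transform_eventually[OF tendsto_const])
       (auto simp: flat_def eventually_at_left_field intro!: exI[of _ "-1"])
  ultimately have "((\<lambda>h. (flat k h - flat k 0) / (h - 0)) \<longlongrightarrow> 0) (at 0)"
    by (simp add: filterlim_at_split)
  then show ?thesis using True by (simp add: has_field_derivative_iff flat_def)
next
  case False
  show ?thesis
  proof (cases "x < 0")
    case True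
    have "((\<lambda>x. 0) has_real_derivative 0) (at x)" by simp
    then have "(flat k has_real_derivative 0) (at x)"
      by (rule has_field_derivative_transform_within_open[of _ _ _ "{..<0}"]) (use True in \<open>auto simp: flat_def\<close>)
    then show ?thesis using True by (simp add: flat_def)
  next
    case False
    with \<open>x \<noteq> 0\<close> have x: "0 < x" by simp
    have inv: "((\<lambda>x. inverse x) has_real_derivative - (inverse x)\<^sup>2) (at x)"
      using DERIV_inverse[of x] x by (simp add: power2_eq_square)
    have pow: "((\<lambda>x. inverse x ^ k) has_real_derivative - real k * inverse x ^ Suc k) (at x)"
    proof (cases k)
      case (Suc n)
      show ?thesis using DERIV_power_Suc[OF inv, of n] unfolding Suc
        by (simp add: power2_eq_square algebra_simps)
    qed simp
    have "((\<lambda>x. inverse x ^ k * exp (- inverse x)) has_real_derivative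
        inverse x ^ k * (exp (- inverse x) * - (- (inverse x)\<^sup>2)) + (- real k * inverse x ^ Suc k) * exp (- inverse x)) (at x)"
      by (intro DERIV_mult' pow DERIV_fun_exp DERIV_minus inv)
    then have "((\<lambda>x. inverse x ^ k * exp (- inverse x)) has_real_derivative
        - real k * flat (Suc k) x + flat (Suc (Suc k)) x) (at x)"
      using x by (simp add: flat_def power2_eq_square mult_ac)
    then show ?thesis
      by (rule has_field_derivative_transform_within_open[of _ _ _ "{0<..}"]) (use x in \<open>auto simp: flat_def\<close>)
  qed
qed

lemma Cn_flat: "Cn n (flat k)"
proof (induction n arbitrary: k)
  case (Suc n)
  show ?case
    by (rule Cn_SucI[OF flat_deriv]) (intro Cn_add Cn_mult Cn_const Suc)
qed simp

text \<open>A smooth transition from \<open>0\<close> on the negative half-line to \<open>1\<close> beyond \<open>1\<close>.\<close>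

definition step :: "real \<Rightarrow> real" where
  "step x = flat 0 x * inverse (flat 0 x + flat 0 ((-1) * x + 1))"

lemma flat0_pos: "0 < x \<Longrightarrow> 0 < flat 0 x" "0 \<le> flat 0 x"
  by (auto simp: flat_def)

lemma step_den: "flat 0 x + flat 0 ((-1) * x + 1) > 0"
  using flat0_pos[of x] flat0_pos[of "1 - x"] by (cases "0 < x") (auto intro: add_pos_nonneg add_nonneg_pos)

lemma smooth1_step: "smooth1 step"
  unfolding smooth1_def step_def[abs_def]
  by (intro allI Cn_mult Cn_inverse Cn_add Cn_flat Cn_affine) (use step_den in \<open>metis less_irrefl\<close>)

lemma step_0: "x \<le> 0 \<Longrightarrow> step x = 0" by (simp add: step_def flat_def)
lemma step_1: "1 \<le> x \<Longrightarrow> step x = 1" using flat0_pos(1)[of x] by (simp add: step_def flat_def)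
lemma step_range: "0 \<le> step x" "step x \<le> 1"
  using step_den[of x] flat0_pos(2)[of x] flat0_pos(2)[of "(-1) * x + 1"]
  by (auto simp: step_def field_simps)

subsection \<open>Compactly supported smooth functions and cutoffs\<close>

definition Dfun :: "real set \<Rightarrow> (real \<Rightarrow> real) set" where
  "Dfun I = {a. smooth1 a \<and> (\<exists>lo hi. {lo..hi} \<subseteq> I \<and> (\<forall>x. x \<notin> {lo..hi} \<longrightarrow> a x = 0))}"

lemma deriv_outside:
  assumes "\<And>x. x \<notin> {lo..hi} \<Longrightarrow> a x = 0" "x \<notin> {lo..hi::real}"
  shows "deriv a x = (0::real)"
proof -
  have "((\<lambda>x. 0) has_real_derivative 0) (at x)" by simp
  then have "(a has_real_derivative 0) (at x)"
    by (rule has_field_derivative_transform_within_open[of _ _ _ "- {lo..hi}"]) (use assms in auto)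
  then show ?thesis by (rule DERIV_imp_deriv)
qed

lemma Dfun_deriv: assumes "a \<in> Dfun I" shows "deriv a \<in> Dfun I"
proof -
  obtain lo hi where z: "{lo..hi} \<subseteq> I" "\<And>x. x \<notin> {lo..hi} \<Longrightarrow> a x = 0" and s: "smooth1 a"
    using assms by (auto simp: Dfun_def)
  have "\<forall>x. x \<notin> {lo..hi} \<longrightarrow> deriv a x = 0" using deriv_outside[of lo hi a, OF z(2)] by blast
  then show ?thesis using z(1) smooth1_deriv[OF s] unfolding Dfun_def by blast
qed

lemma Dfun_smooth: "a \<in> Dfun I \<Longrightarrow> smooth1 a" by (simp add: Dfun_def)

lemma Dfun_mult: "smooth1 g \<Longrightarrow> a \<in> Dfun I \<Longrightarrow> (\<lambda>x. g x * a x) \<in> Dfun I"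
  unfolding Dfun_def by (auto intro: smooth1_mult)

lemma Dfun_scale: "a \<in> Dfun I \<Longrightarrow> (\<lambda>x. c * a x) \<in> Dfun I"
  using Dfun_mult[OF smooth1_const] .

lemma Dfun_bounded: assumes "a \<in> Dfun I" obtains K where "0 \<le> K" "\<And>x. \<bar>a x\<bar> \<le> K"
proof -
  obtain lo hi where z: "\<And>x. x \<notin> {lo..hi} \<Longrightarrow> a x = 0" and s: "smooth1 a"
    using assms by (auto simp: Dfun_def)
  have "bounded (a ` {lo..hi})"
    by (intro compact_imp_bounded compact_continuous_image smooth1_cont s) simp
  then obtain K where "\<forall>y\<in>a ` {lo..hi}. norm y \<le> K" unfolding bounded_iff by blast
  then have K: "\<And>x. x \<in> {lo..hi} \<Longrightarrow> \<bar>a x\<bar> \<le> K" by simp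
  have "\<bar>a x\<bar> \<le> max K 0" for x using K[of x] z[of x] by (cases "x \<in> {lo..hi}") auto
  then show ?thesis using that[of "max K 0"] by simp
qed

text \<open>The value is \<open>1\<close> on \<open>[c + \<kappa>, d - \<kappa>]\<close> and \<open>0\<close> off \<open>(c, d)\<close>.\<close>

definition cutoff :: "real \<Rightarrow> real \<Rightarrow> real \<Rightarrow> real \<Rightarrow> real" where
  "cutoff \<kappa> c d x = step ((x - c) / \<kappa>) * step ((d - x) / \<kappa>)"

lemma cutoff_Dfun:
  assumes "0 < \<kappa>" "{c..d} \<subseteq> I" shows "cutoff \<kappa> c d \<in> Dfun I"
proof -
  have "smooth1 (\<lambda>x. step ((1/\<kappa>) * x + (- c / \<kappa>)) * step ((-1/\<kappa>) * x + d / \<kappa>))"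
    by (intro smooth1_mult smooth1_affine smooth1_step)
  moreover have "(\<lambda>x. step ((1/\<kappa>) * x + (- c / \<kappa>)) * step ((-1/\<kappa>) * x + d / \<kappa>)) = cutoff \<kappa> c d"
    by (auto simp: cutoff_def diff_divide_distrib)
  ultimately have "smooth1 (cutoff \<kappa> c d)" by simp
  moreover have "cutoff \<kappa> c d x = 0" if "x \<notin> {c..d}" for x
    using that assms(1) step_0[of "(x - c) / \<kappa>"] step_0[of "(d - x) / \<kappa>"]
    by (auto simp: cutoff_def divide_le_0_iff)
  ultimately show ?thesis using assms(2) unfolding Dfun_def by blast
qed

lemma cutoff_1: "0 < \<kappa> \<Longrightarrow> c + \<kappa> \<le> x \<Longrightarrow> x \<le> d - \<kappa> \<Longrightarrow> cutoff \<kappa> c d x = 1"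
  by (simp add: cutoff_def step_1)

lemma cutoff_0: "0 < \<kappa> \<Longrightarrow> x \<le> c \<or> d \<le> x \<Longrightarrow> cutoff \<kappa> c d x = 0"
  by (auto simp: cutoff_def step_0 divide_le_0_iff)

lemma cutoff_range: "0 \<le> cutoff \<kappa> c d x" "cutoff \<kappa> c d x \<le> 1"
  unfolding cutoff_def using step_range by (auto intro: mult_le_one)

section \<open>Tensor test functions\<close>

text \<open>Sums of products of functions of one variable with compact support in the open intervals \<open>I\<close> and \<open>J\<close>. Their partial derivatives are
  of the same kind and commute, and they are dense in \<open>L2\<close> of an open box, so weak identities can be
  tested on them alone.\<close>

inductive_set TS :: "real set \<Rightarrow> real set \<Rightarrow> (real \<times> real \<Rightarrow> real) set" for I J where
  tensor: "a \<in> Dfun I \<Longrightarrow> b \<in> Dfun J \<Longrightarrow> (\<lambda>p. a (fst p) * b (snd p)) \<in> TS I J"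
| plus: "\<phi> \<in> TS I J \<Longrightarrow> \<psi> \<in> TS I J \<Longrightarrow> (\<lambda>p. \<phi> p + \<psi> p) \<in> TS I J"

lemma TS_scale: "\<phi> \<in> TS I J \<Longrightarrow> (\<lambda>p. c * \<phi> p) \<in> TS I J"
proof (induction rule: TS.induct)
  case (tensor a b)
  then show ?case using TS.tensor[OF Dfun_scale[of a I c] tensor(2)] by (simp add: mult.assoc)
next
  case (plus \<phi> \<psi>)
  then show ?case using TS.plus[OF plus(3,4)] by (simp add: distrib_left)
qed

lemma TS_differentiable: "\<phi> \<in> TS I J \<Longrightarrow> \<phi> differentiable_on UNIV"
proof (induction rule: TS.induct)
  case (tensor a b)
  have d: "a differentiable (at x)" "b differentiable (at x)" for x
    using smooth1_DERIV[OF Dfun_smooth[OF tensor(1)]] smooth1_DERIV[OF Dfun_smooth[OF tensor(2)]]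
    unfolding real_differentiable_def by blast+
  have "(\<lambda>p::real \<times> real. a (fst p)) differentiable (at p)" "(\<lambda>p::real \<times> real. b (snd p)) differentiable (at p)" for p
    using differentiable_chain_at[OF bounded_linear_imp_differentiable[OF bounded_linear_fst] d(1), of p]
      differentiable_chain_at[OF bounded_linear_imp_differentiable[OF bounded_linear_snd] d(2), of p]
    by (simp_all only: o_def)
  then show ?case by (auto simp: differentiable_on_def)
qed (intro differentiable_on_add)

lemma partial_x_DERIV:
  assumes "f differentiable_on UNIV"
  shows "((\<lambda>s. f (s, y)) has_real_derivative partial_x f (x, y)) (at x)"
proof -
  have "f differentiable at (x, y)" using assms by (simp add: differentiable_on_def)
  then have "(\<lambda>s. f (s, y)) differentiable at x"
    using differentiable_chain_at[of "\<lambda>s. (s, y)" x f] by (simp add: o_def)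
  then show ?thesis by (simp add: partial_x_def deriv_real)
qed

lemma partial_y_DERIV:
  assumes "f differentiable_on UNIV"
  shows "((\<lambda>s. f (x, s)) has_real_derivative partial_y f (x, y)) (at y)"
proof -
  have "f differentiable at (x, y)" using assms by (simp add: differentiable_on_def)
  then have "(\<lambda>s. f (x, s)) differentiable at y"
    using differentiable_chain_at[of "\<lambda>s. (x, s)" y f] by (simp add: o_def)
  then show ?thesis by (simp add: partial_y_def deriv_real)
qed

lemma partial_x_eqI: "(\<And>x y. ((\<lambda>s. f (s, y)) has_real_derivative g (x, y)) (at x)) \<Longrightarrow> partial_x f = g"
  by (auto simp: partial_x_def fun_eq_iff intro!: DERIV_imp_deriv)

lemma partial_y_eqI: "(\<And>x y. ((\<lambda>s. f (x, s)) has_real_derivative g (x, y)) (at y)) \<Longrightarrow> partial_y f = g"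
  by (auto simp: partial_y_def fun_eq_iff intro!: DERIV_imp_deriv)

lemma partial_x_add: "f differentiable_on UNIV \<Longrightarrow> g differentiable_on UNIV \<Longrightarrow>
    partial_x (\<lambda>p. f p + g p) = (\<lambda>p. partial_x f p + partial_x g p)"
  by (intro partial_x_eqI DERIV_add partial_x_DERIV)

lemma partial_y_add: "f differentiable_on UNIV \<Longrightarrow> g differentiable_on UNIV \<Longrightarrow>
    partial_y (\<lambda>p. f p + g p) = (\<lambda>p. partial_y f p + partial_y g p)"
  by (intro partial_y_eqI DERIV_add partial_y_DERIV)

lemma partial_x_mult: "f differentiable_on UNIV \<Longrightarrow> g differentiable_on UNIV \<Longrightarrow>
    partial_x (\<lambda>p. f p * g p) = (\<lambda>p. f p * partial_x g p + partial_x f p * g p)"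
  by (intro partial_x_eqI DERIV_mult' partial_x_DERIV)

lemma partial_y_mult: "f differentiable_on UNIV \<Longrightarrow> g differentiable_on UNIV \<Longrightarrow>
    partial_y (\<lambda>p. f p * g p) = (\<lambda>p. f p * partial_y g p + partial_y f p * g p)"
  by (intro partial_y_eqI DERIV_mult' partial_y_DERIV)

lemma partial_x_tensor: "smooth1 a \<Longrightarrow> partial_x (\<lambda>p. a (fst p) * b (snd p)) = (\<lambda>p. deriv a (fst p) * b (snd p))"
  by (intro partial_x_eqI) (auto intro!: DERIV_cmult_right smooth1_DERIV)

lemma partial_y_tensor: "smooth1 b \<Longrightarrow> partial_y (\<lambda>p. a (fst p) * b (snd p)) = (\<lambda>p. a (fst p) * deriv b (snd p))"
  by (intro partial_y_eqI) (auto intro!: DERIV_cmult smooth1_DERIV)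

lemma TS_partial_x: "\<phi> \<in> TS I J \<Longrightarrow> partial_x \<phi> \<in> TS I J"
proof (induction rule: TS.induct)
  case (tensor a b)
  show ?case unfolding partial_x_tensor[OF Dfun_smooth[OF tensor(1)], of b]
    by (rule TS.tensor[OF Dfun_deriv[OF tensor(1)] tensor(2)])
next
  case (plus \<phi> \<psi>)
  show ?case unfolding partial_x_add[OF TS_differentiable[OF plus(1)] TS_differentiable[OF plus(2)]]
    by (rule TS.plus[OF plus(3,4)])
qed

lemma TS_partial_y: "\<phi> \<in> TS I J \<Longrightarrow> partial_y \<phi> \<in> TS I J"
proof (induction rule: TS.induct)
  case (tensor a b)
  show ?case unfolding partial_y_tensor[OF Dfun_smooth[OF tensor(2)], of a]
    by (rule TS.tensor[OF tensor(1) Dfun_deriv[OF tensor(2)]])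
next
  case (plus \<phi> \<psi>)
  show ?case unfolding partial_y_add[OF TS_differentiable[OF plus(1)] TS_differentiable[OF plus(2)]]
    by (rule TS.plus[OF plus(3,4)])
qed

lemma TS_partial_commute: "\<phi> \<in> TS I J \<Longrightarrow> partial_y (partial_x \<phi>) = partial_x (partial_y \<phi>)"
proof (induction rule: TS.induct)
  case (tensor a b)
  have sa: "smooth1 a" and sb: "smooth1 b" using tensor by (auto intro: Dfun_smooth)
  show ?case
    by (simp only: partial_x_tensor[OF sa, of b] partial_y_tensor[OF sb, of a]
      partial_y_tensor[OF sb, of "deriv a"] partial_x_tensor[OF sa, of "deriv b"])
next
  case (plus \<phi> \<psi>)
  have d: "\<phi> differentiable_on UNIV" "\<psi> differentiable_on UNIV"
    "partial_x \<phi> differentiable_on UNIV" "partial_x \<psi> differentiable_on UNIV"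
    "partial_y \<phi> differentiable_on UNIV" "partial_y \<psi> differentiable_on UNIV"
    using plus by (blast intro: TS_differentiable TS_partial_x TS_partial_y)+
  show ?case
    by (simp only: partial_x_add[OF d(1,2)] partial_y_add[OF d(1,2)] partial_y_add[OF d(3,4)] partial_x_add[OF d(5,6)] plus)
qed

lemma TS_cont: "\<phi> \<in> TS I J \<Longrightarrow> continuous_on A \<phi>"
  using differentiable_imp_continuous_on[OF TS_differentiable] continuous_on_subset by blast

lemma TS_support: "\<phi> \<in> TS I J \<Longrightarrow> \<exists>K. compact K \<and> K \<subseteq> I \<times> J \<and> (\<forall>p. p \<notin> K \<longrightarrow> \<phi> p = 0)"
proof (induction rule: TS.induct)
  case (tensor a b)
  obtain lo hi where a: "{lo..hi} \<subseteq> I" "\<forall>x. x \<notin> {lo..hi} \<longrightarrow> a x = 0" using tensor by (auto simp: Dfun_def)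
  obtain lo' hi' where b: "{lo'..hi'} \<subseteq> J" "\<forall>x. x \<notin> {lo'..hi'} \<longrightarrow> b x = 0" using tensor by (auto simp: Dfun_def)
  show ?case
    by (intro exI[of _ "{lo..hi} \<times> {lo'..hi'}"]) (use a b in \<open>auto intro!: compact_Times\<close>)
next
  case (plus \<phi> \<psi>)
  then obtain K K' where "compact K \<and> K \<subseteq> I \<times> J \<and> (\<forall>p. p \<notin> K \<longrightarrow> \<phi> p = 0)"
    "compact K' \<and> K' \<subseteq> I \<times> J \<and> (\<forall>p. p \<notin> K' \<longrightarrow> \<psi> p = 0)" by blast
  then show ?case by (intro exI[of _ "K \<union> K'"]) auto
qed

lemma TS_zero: "\<phi> \<in> TS I J \<Longrightarrow> p \<notin> I \<times> J \<Longrightarrow> \<phi> p = 0"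
  using TS_support by blast

lemma TS_bounded: assumes "\<phi> \<in> TS I J" obtains K where "0 \<le> K" "\<And>p. \<bar>\<phi> p\<bar> \<le> K"
proof -
  have "\<exists>K\<ge>0. \<forall>p. \<bar>\<phi> p\<bar> \<le> K" using assms
  proof (induction rule: TS.induct)
    case (tensor a b)
    obtain K where K: "0 \<le> K" "\<And>x. \<bar>a x\<bar> \<le> K" using Dfun_bounded tensor by blast
    obtain K' where K': "0 \<le> K'" "\<And>x. \<bar>b x\<bar> \<le> K'" using Dfun_bounded tensor by blast
    show ?case
      by (intro exI[of _ "K * K'"]) (use K K' in \<open>auto simp: abs_mult intro!: mult_mono\<close>)
  next
    case (plus \<phi> \<psi>)
    then obtain K K' where "0 \<le> K" "0 \<le> K'" "\<forall>p. \<bar>\<phi> p\<bar> \<le> K" "\<forall>p. \<bar>\<psi> p\<bar> \<le> K'" by blast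
    then show ?case by (intro exI[of _ "K + K'"] conjI allI) (auto intro!: order_trans[OF abs_triangle_ineq] add_mono)
  qed
  then show ?thesis using that by blast
qed

text \<open>The two coordinate directions are treated together: \<open>pd True\<close> is \<open>\<partial>\<^sub>x\<close>, \<open>pd False\<close> is
  \<open>\<partial>\<^sub>y\<close>, and \<open>dir k\<close> is the corresponding unit vector.\<close>

definition pd :: "bool \<Rightarrow> (real \<times> real \<Rightarrow> real) \<Rightarrow> real \<times> real \<Rightarrow> real" where
  "pd k = (if k then partial_x else partial_y)"

definition dir :: "bool \<Rightarrow> real \<times> real" where "dir k = (if k then (1, 0) else (0, 1))"

lemma TS_pd: "\<phi> \<in> TS I J \<Longrightarrow> pd k \<phi> \<in> TS I J"
  by (simp add: pd_def TS_partial_x TS_partial_y)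

lemma TS_pd_commute: "\<phi> \<in> TS I J \<Longrightarrow> pd j (pd k \<phi>) = pd k (pd j \<phi>)"
  by (simp add: pd_def TS_partial_commute)

lemma pd_mult: "f differentiable_on UNIV \<Longrightarrow> g differentiable_on UNIV \<Longrightarrow>
    pd k (\<lambda>p. f p * g p) = (\<lambda>p. f p * pd k g p + pd k f p * g p)"
  by (simp add: pd_def partial_x_mult partial_y_mult)

lemma pd_line_DERIV:
  assumes "f differentiable_on UNIV"
  shows "((\<lambda>s. f (p + s *\<^sub>R dir k)) has_real_derivative pd k f (p + s *\<^sub>R dir k)) (at s)"
proof (cases k)
  case True
  have "((\<lambda>s. f (fst p + s, snd p)) has_real_derivative partial_x f (fst p + s, snd p)) (at s)"
    using DERIV_shift[of "\<lambda>x. f (x, snd p)" "partial_x f (fst p + s, snd p)" s "fst p"]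
      partial_x_DERIV[OF assms, of "snd p" "fst p + s"] by (simp add: add.commute)
  then show ?thesis using True by (cases p) (simp add: dir_def pd_def)
next
  case False
  have "((\<lambda>s. f (fst p, snd p + s)) has_real_derivative partial_y f (fst p, snd p + s)) (at s)"
    using DERIV_shift[of "\<lambda>y. f (fst p, y)" "partial_y f (fst p, snd p + s)" s "snd p"]
      partial_y_DERIV[OF assms, of "fst p" "snd p + s"] by (simp add: add.commute)
  then show ?thesis using False by (cases p) (simp add: dir_def pd_def)
qed

lemma TS_Lipschitz:
  assumes phi: "\<phi> \<in> TS I J" obtains K where "0 \<le> K" "\<And>p s. \<bar>\<phi> (p + s *\<^sub>R dir k) - \<phi> p\<bar> \<le> K * \<bar>s\<bar>"
proof -
  obtain K where K: "0 \<le> K" "\<And>p. \<bar>pd k \<phi> p\<bar> \<le> K" using TS_bounded[OF TS_pd[OF phi]] by metis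
  have "\<bar>\<phi> (p + s *\<^sub>R dir k) - \<phi> p\<bar> \<le> K * \<bar>s\<bar>" for p s
  proof -
    have "norm (\<phi> (p + s *\<^sub>R dir k) - \<phi> (p + 0 *\<^sub>R dir k)) \<le> K * norm (s - 0)"
      by (rule field_differentiable_bound[where S=UNIV and f="\<lambda>s. \<phi> (p + s *\<^sub>R dir k)" and f'="\<lambda>s. pd k \<phi> (p + s *\<^sub>R dir k)"])
         (use pd_line_DERIV[OF TS_differentiable[OF phi]] K in auto)
    then show ?thesis by simp
  qed
  with K show ?thesis using that by blast
qed

lemma TS_Taylor:
  assumes phi: "\<phi> \<in> TS I J"
  obtains K where "0 \<le> K" "\<And>p s. \<bar>\<phi> (p + s *\<^sub>R dir k) - \<phi> p - s * pd k \<phi> p\<bar> \<le> K * s\<^sup>2"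
proof -
  obtain K where K: "0 \<le> K" "\<And>p s. \<bar>pd k \<phi> (p + s *\<^sub>R dir k) - pd k \<phi> p\<bar> \<le> K * \<bar>s\<bar>"
    using TS_Lipschitz[OF TS_pd[OF phi]] by metis
  have "\<bar>\<phi> (p + s *\<^sub>R dir k) - \<phi> p - s * pd k \<phi> p\<bar> \<le> K * s\<^sup>2" for p s
  proof -
    let ?f = "\<lambda>r. \<phi> (p + r *\<^sub>R dir k) - r * pd k \<phi> p"
    have "norm (?f s - ?f 0) \<le> (K * \<bar>s\<bar>) * norm (s - 0)"
    proof (rule field_differentiable_bound[where S="cball 0 \<bar>s\<bar>" and f="?f" and f'="\<lambda>r. pd k \<phi> (p + r *\<^sub>R dir k) - 1 * pd k \<phi> p"])
      fix r :: real assume r: "r \<in> cball 0 \<bar>s\<bar>"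
      show "(?f has_field_derivative pd k \<phi> (p + r *\<^sub>R dir k) - 1 * pd k \<phi> p) (at r within cball 0 \<bar>s\<bar>)"
        by (intro DERIV_diff DERIV_cmult_right DERIV_ident has_field_derivative_at_within[OF pd_line_DERIV[OF TS_differentiable[OF phi]]])
      have "\<bar>pd k \<phi> (p + r *\<^sub>R dir k) - pd k \<phi> p\<bar> \<le> K * \<bar>s\<bar>"
        using K(2)[of p r] mult_left_mono[OF _ K(1), of "\<bar>r\<bar>" "\<bar>s\<bar>"] r by simp
      then show "norm (pd k \<phi> (p + r *\<^sub>R dir k) - 1 * pd k \<phi> p) \<le> K * \<bar>s\<bar>" by simp
    qed auto
    then show ?thesis by (simp add: power2_eq_square mult.assoc)
  qed
  with K show ?thesis using that by blast
qed


section \<open>Products and translates of test functions\<close>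

text \<open>\<open>SX n h\<close> and \<open>SY n h\<close> unfold \<open>smooth\<close> one derivative at a time, the derivatives in \<open>y\<close> being
  taken first as in \<open>partials\<close>; this makes the product rule accessible to induction on \<open>n\<close>.\<close>

primrec SX :: "nat \<Rightarrow> (real \<times> real \<Rightarrow> real) \<Rightarrow> bool" where
  "SX 0 h \<longleftrightarrow> h differentiable_on UNIV"
| "SX (Suc n) h \<longleftrightarrow> h differentiable_on UNIV \<and> SX n (partial_x h)"

primrec SY :: "nat \<Rightarrow> (real \<times> real \<Rightarrow> real) \<Rightarrow> bool" where
  "SY 0 h \<longleftrightarrow> (\<forall>m. SX m h)"
| "SY (Suc n) h \<longleftrightarrow> (\<forall>m. SX m h) \<and> SY n (partial_y h)"

lemma SX_iff: "SX n h \<longleftrightarrow> (\<forall>i\<le>n. (partial_x ^^ i) h differentiable_on UNIV)"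
proof (induction n arbitrary: h)
  case (Suc n)
  have "(\<forall>i\<le>Suc n. (partial_x ^^ i) h differentiable_on UNIV) \<longleftrightarrow>
     h differentiable_on UNIV \<and> (\<forall>i\<le>n. (partial_x ^^ Suc i) h differentiable_on UNIV)"
    by (metis (no_types) funpow_0 not0_implies_Suc Suc_le_mono le0)
  then show ?case using Suc by (simp add: funpow_swap1 del: funpow.simps)
     (simp add: funpow_swap1)
qed simp

lemma SY_iff: "SY n h \<longleftrightarrow> (\<forall>j\<le>n. \<forall>m. SX m ((partial_y ^^ j) h))"
proof (induction n arbitrary: h)
  case (Suc n)
  have "(\<forall>j\<le>Suc n. \<forall>m. SX m ((partial_y ^^ j) h)) \<longleftrightarrow>
     (\<forall>m. SX m h) \<and> (\<forall>j\<le>n. \<forall>m. SX m ((partial_y ^^ Suc j) h))"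
    by (metis (no_types) funpow_0 not0_implies_Suc Suc_le_mono le0)
  then show ?case using Suc by (simp add: funpow_swap1)
qed simp

lemma smooth_iff: "smooth f \<longleftrightarrow> (\<forall>n. SY n f)"
  unfolding smooth_def partials_def SY_iff SX_iff by blast

lemma SX_diff: "SX n h \<Longrightarrow> h differentiable_on UNIV" by (cases n) auto

lemma SX_Suc: "SX (Suc n) h \<Longrightarrow> SX n h"
  by (induction n arbitrary: h) auto

lemma SX_add: "SX n f \<Longrightarrow> SX n g \<Longrightarrow> SX n (\<lambda>p. f p + g p)"
proof (induction n arbitrary: f g)
  case (Suc n)
  then show ?case by (auto simp: partial_x_add intro: differentiable_on_add)
qed (auto intro: differentiable_on_add)

lemma SX_mult: "\<phi> \<in> TS I J \<Longrightarrow> SX n f \<Longrightarrow> SX n (\<lambda>p. \<phi> p * f p)"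
proof (induction n arbitrary: \<phi> f)
  case 0
  then show ?case by (auto intro: differentiable_on_mult TS_differentiable)
next
  case (Suc n)
  have f: "f differentiable_on UNIV" "SX n (partial_x f)" "SX n f"
    using Suc.prems SX_Suc by auto
  have "SX n (\<lambda>p. \<phi> p * partial_x f p + partial_x \<phi> p * f p)"
    by (intro SX_add Suc.IH[OF Suc.prems(1) f(2)] Suc.IH[OF TS_partial_x[OF Suc.prems(1)] f(3)])
  then show ?case using f
    by (auto simp: partial_x_mult[OF TS_differentiable[OF Suc.prems(1)] f(1)]
      intro: differentiable_on_mult TS_differentiable[OF Suc.prems(1)])
qed

lemma SY_SX: "SY n h \<Longrightarrow> SX m h" by (cases n) auto

lemma SY_Suc: "SY (Suc n) h \<Longrightarrow> SY n h"
  by (induction n arbitrary: h) auto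

lemma SY_add: "SY n f \<Longrightarrow> SY n g \<Longrightarrow> SY n (\<lambda>p. f p + g p)"
proof (induction n arbitrary: f g)
  case (Suc n)
  have d: "f differentiable_on UNIV" "g differentiable_on UNIV"
    using SX_diff[OF SY_SX[OF Suc.prems(1), of 0]] SX_diff[OF SY_SX[OF Suc.prems(2), of 0]] by auto
  show ?case using Suc by (auto simp: partial_y_add[OF d] intro: SX_add)
qed (auto intro: SX_add)

lemma SY_mult: "\<phi> \<in> TS I J \<Longrightarrow> SY n f \<Longrightarrow> SY n (\<lambda>p. \<phi> p * f p)"
proof (induction n arbitrary: \<phi> f)
  case 0
  then show ?case by (auto intro: SX_mult)
next
  case (Suc n)
  have f: "f differentiable_on UNIV" "SY n (partial_y f)" "SY n f" "\<And>m. SX m f"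
    using Suc.prems SY_Suc SX_diff[OF SY_SX[OF Suc.prems(2), of 0]] by auto
  have "SY n (\<lambda>p. \<phi> p * partial_y f p + partial_y \<phi> p * f p)"
    by (intro SY_add Suc.IH[OF Suc.prems(1) f(2)] Suc.IH[OF TS_partial_y[OF Suc.prems(1)] f(3)])
  then show ?case using f
    by (auto simp: partial_y_mult[OF TS_differentiable[OF Suc.prems(1)] f(1)]
      intro: SX_mult[OF Suc.prems(1)])
qed

lemma TS_SX: "\<phi> \<in> TS I J \<Longrightarrow> SX n \<phi>"
  by (induction n arbitrary: \<phi>) (auto intro: TS_differentiable TS_partial_x)

lemma TS_smooth: "\<phi> \<in> TS I J \<Longrightarrow> smooth \<phi>"
proof -
  have "\<phi> \<in> TS I J \<Longrightarrow> SY n \<phi>" for n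
    by (induction n arbitrary: \<phi>) (auto intro: TS_SX TS_partial_y)
  then show "\<phi> \<in> TS I J \<Longrightarrow> smooth \<phi>" by (simp add: smooth_iff)
qed

lemma smooth_mult: "\<phi> \<in> TS I J \<Longrightarrow> smooth f \<Longrightarrow> smooth (\<lambda>p. \<phi> p * f p)"
  unfolding smooth_iff by (auto intro: SY_mult)

lemma smooth_partials: "smooth f \<Longrightarrow> partials i j f differentiable_on UNIV"
  by (simp add: smooth_def)

lemma test_functionsI:
  assumes "smooth f" "compact K" "K \<subseteq> S" "\<And>p. p \<notin> K \<Longrightarrow> f p = 0"
  shows "f \<in> test_functions S"
proof -
  have "closure {p. f p \<noteq> 0} \<subseteq> K"
    using assms by (intro closure_minimal compact_imp_closed) auto
  moreover from this have "compact (closure {p. f p \<noteq> 0})"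
    using assms(2) by (metis closed_closure compact_Int_closed inf.absorb_iff2 inf.commute)
  ultimately show ?thesis using assms by (auto simp: test_functions_def)
qed

lemma TS_test: "\<phi> \<in> TS I J \<Longrightarrow> \<phi> \<in> test_functions (I \<times> J)"
  using TS_support[of \<phi> I J] TS_smooth[of \<phi> I J] by (auto intro: test_functionsI)

lemma TS_mult_test:
  assumes "\<phi> \<in> TS I J" "\<psi> \<in> test_functions UNIV"
  shows "(\<lambda>p. \<phi> p * \<psi> p) \<in> test_functions (I \<times> J)"
proof -
  obtain K where K: "compact K" "K \<subseteq> I \<times> J" "\<forall>p. p \<notin> K \<longrightarrow> \<phi> p = 0" using TS_support[OF assms(1)] by blast
  show ?thesis
    by (rule test_functionsI[OF _ K(1,2)]) (use K assms in \<open>auto intro: smooth_mult simp: test_functions_def\<close>)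
qed

lemma test_functions_mono: "S \<subseteq> T \<Longrightarrow> test_functions S \<subseteq> test_functions T"
  by (auto simp: test_functions_def)

lemma deriv_shift: "deriv (\<lambda>s. g (s + a)) x = deriv g (x + a)" for g :: "real \<Rightarrow> real"
  unfolding deriv_def by (simp add: DERIV_shift)

lemma partial_x_shift: "partial_x (\<lambda>p. f (p + v)) = (\<lambda>p. partial_x f (p + v))"
  by (cases v) (auto simp: partial_x_def fun_eq_iff deriv_shift[where g="\<lambda>s. f (s, _)"])

lemma partial_y_shift: "partial_y (\<lambda>p. f (p + v)) = (\<lambda>p. partial_y f (p + v))"
  by (cases v) (auto simp: partial_y_def fun_eq_iff deriv_shift[where g="\<lambda>s. f (_, s)"])

lemma pd_shift: "pd k (\<lambda>p. f (p + v)) = (\<lambda>p. pd k f (p + v))"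
  by (simp add: pd_def partial_x_shift partial_y_shift)

lemma partials_shift: "partials i j (\<lambda>p. f (p + v)) = (\<lambda>p. partials i j f (p + v))"
proof -
  have y: "(partial_y ^^ j) (\<lambda>p. f (p + v)) = (\<lambda>p. (partial_y ^^ j) f (p + v))" for f
    by (induction j) (auto simp: partial_y_shift)
  have x: "(partial_x ^^ i) (\<lambda>p. f (p + v)) = (\<lambda>p. (partial_x ^^ i) f (p + v))" for f
    by (induction i) (auto simp: partial_x_shift)
  show ?thesis by (simp only: partials_def y x)
qed

lemma test_functions_shift:
  assumes "\<psi> \<in> test_functions UNIV" shows "(\<lambda>p. \<psi> (p + v)) \<in> test_functions UNIV"
proof -
  let ?K = "closure {p. \<psi> p \<noteq> 0}"
  have K: "smooth \<psi>" "compact ?K" using assms by (auto simp: test_functions_def)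
  have sh: "(\<lambda>p. p + v) differentiable_on UNIV" by (auto simp: differentiable_on_def)
  have "smooth (\<lambda>p. \<psi> (p + v))"
    unfolding smooth_def partials_shift
  proof (intro allI)
    fix i j
    have "partials i j \<psi> differentiable_on (\<lambda>p. p + v) ` UNIV"
      using K(1) by (auto simp: smooth_def intro: differentiable_on_subset)
    then show "(\<lambda>p. partials i j \<psi> (p + v)) differentiable_on UNIV"
      using differentiable_on_compose[OF sh] by simp
  qed
  moreover have "compact ((\<lambda>p. - v + p) ` ?K)" by (rule compact_translation[OF K(2)])
  moreover have "\<psi> (p + v) = 0" if "p \<notin> (\<lambda>p. - v + p) ` ?K" for p
  proof (rule ccontr)
    assume "\<psi> (p + v) \<noteq> 0"
    then have "p + v \<in> ?K" by (intro subsetD[OF closure_subset]) simp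
    then have "- v + (p + v) \<in> (\<lambda>p. - v + p) ` ?K" by (rule imageI)
    moreover have "- v + (p + v) = p" by simp
    ultimately show False using that by (simp only:)
  qed
  ultimately show ?thesis by (rule test_functionsI[OF _ _ subset_UNIV])
qed

lemma compact_support_L2:
  assumes "continuous_on UNIV h" "compact K" "\<And>p. p \<notin> K \<Longrightarrow> h p = (0::real)"
  shows "h \<in> L2 UNIV"
proof -
  have K: "K \<in> sets lebesgue" using assms(2) by (simp add: borel_compact)
  have c: "continuous_on K h" using assms(1) continuous_on_subset by blast
  have hm: "h \<in> borel_measurable (lebesgue_on K)" by (rule continuous_imp_measurable_on_sets_lebesgue[OF c K])
  have "bounded (h ` K)" by (rule compact_imp_bounded[OF compact_continuous_image[OF c assms(2)]])
  then obtain B where B: "\<forall>y\<in>h ` K. norm y \<le> B" unfolding bounded_iff by blast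
  interpret finite_measure "lebesgue_on K" by (rule finite_measure_lebesgue_on[OF lmeasurable_compact[OF assms(2)]])
  have "integrable (lebesgue_on K) (\<lambda>p. (h p)\<^sup>2)"
  proof (rule integrable_const_bound)
    show "AE p in lebesgue_on K. norm ((h p)\<^sup>2) \<le> B\<^sup>2"
    proof (rule AE_I2)
      fix p assume "p \<in> space (lebesgue_on K)"
      then have "\<bar>h p\<bar> \<le> B" using B by simp
      then have "\<bar>h p\<bar>\<^sup>2 \<le> B\<^sup>2" by (intro power_mono) auto
      then show "norm ((h p)\<^sup>2) \<le> B\<^sup>2" by simp
    qed
  qed (use hm in simp)
  with hm have "h \<in> L2 K" by (simp add: L2_def)
  then show ?thesis using L2_UNIV_iff[OF K, of h] assms(3) by simp
qed

section \<open>Weak derivatives up to second order\<close>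

text \<open>\<open>w1 k\<close> and \<open>w2 j k\<close> are the first and second weak derivatives of \<open>w\<close> in the coordinate
  directions. The condition \<open>j \<or> \<not> k\<close> selects the order of differentiation of \<open>partials\<close>, in which the
  derivative in \<open>y\<close> is taken first.\<close>

definition weak2 :: "(real \<times> real) set \<Rightarrow> (real \<times> real \<Rightarrow> real) \<Rightarrow> (bool \<Rightarrow> real \<times> real \<Rightarrow> real) \<Rightarrow>
    (bool \<Rightarrow> bool \<Rightarrow> real \<times> real \<Rightarrow> real) \<Rightarrow> bool" where
  "weak2 S w w1 w2 \<longleftrightarrow> w \<in> L2 S \<and> (\<forall>k. w1 k \<in> L2 S) \<and> (\<forall>j k. w2 j k \<in> L2 S) \<and>
     (\<forall>j k. w2 j k = w2 k j) \<and>
     (\<forall>\<psi>\<in>test_functions S. \<forall>k. L2_inner S w (pd k \<psi>) = - L2_inner S (w1 k) \<psi>) \<and>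
     (\<forall>\<psi>\<in>test_functions S. \<forall>j k. j \<or> \<not> k \<longrightarrow> L2_inner S w (pd j (pd k \<psi>)) = L2_inner S (w2 j k) \<psi>)"

definition hess :: "real \<Rightarrow> (real \<times> real \<Rightarrow> real) \<Rightarrow> bool \<Rightarrow> bool \<Rightarrow> real \<times> real \<Rightarrow> real" where
  "hess l w j k = (if j \<and> k then weak_deriv (plate l) 2 0 w
     else if \<not> j \<and> \<not> k then weak_deriv (plate l) 0 2 w else weak_deriv (plate l) 1 1 w)"

definition grad :: "real \<Rightarrow> (real \<times> real \<Rightarrow> real) \<Rightarrow> bool \<Rightarrow> real \<times> real \<Rightarrow> real" where
  "grad l w k = (if k then weak_deriv (plate l) 1 0 w else weak_deriv (plate l) 0 1 w)"

lemma partials_simps: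
  "partials 0 0 \<psi> = \<psi>" "partials (Suc 0) 0 \<psi> = pd True \<psi>" "partials 0 (Suc 0) \<psi> = pd False \<psi>"
  "partials 2 0 \<psi> = pd True (pd True \<psi>)" "partials (Suc 0) (Suc 0) \<psi> = pd True (pd False \<psi>)"
  "partials 0 2 \<psi> = pd False (pd False \<psi>)"
  by (auto simp: partials_def pd_def numeral_2_eq_2)

lemma weak_deriv_props:
  assumes "w \<in> H2 S" "i + j \<le> 2"
  shows "weak_deriv S i j w \<in> L2 S" "is_weak_deriv S i j w (weak_deriv S i j w)"
proof -
  have "\<exists>g. g \<in> L2 S \<and> is_weak_deriv S i j w g" using assms unfolding H2_def by blast
  from someI_ex[OF this] show "weak_deriv S i j w \<in> L2 S" "is_weak_deriv S i j w (weak_deriv S i j w)"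
    by (auto simp: weak_deriv_def)
qed

lemma H2_weak2: assumes "w \<in> H2 (plate l)" shows "weak2 (plate l) w (grad l w) (hess l w)"
  using assms weak_deriv_props[OF assms, of 1 0] weak_deriv_props[OF assms, of 0 1]
    weak_deriv_props[OF assms, of 2 0] weak_deriv_props[OF assms, of 0 2] weak_deriv_props[OF assms, of 1 1]
  by (auto simp: weak2_def H2_def grad_def hess_def is_weak_deriv_def partials_simps split: bool.splits)

lemma weak2_is_weak_deriv:
  assumes "weak2 S w w1 w2"
  shows "is_weak_deriv S 0 0 w w" "is_weak_deriv S 1 0 w (w1 True)" "is_weak_deriv S 0 1 w (w1 False)"
    "is_weak_deriv S 2 0 w (w2 True True)" "is_weak_deriv S 1 1 w (w2 True False)" "is_weak_deriv S 0 2 w (w2 False False)"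
proof -
  have 1: "L2_inner S w (pd k \<psi>) = - L2_inner S (w1 k) \<psi>" if "\<psi> \<in> test_functions S" for k \<psi>
    using assms that by (simp add: weak2_def)
  have 2: "L2_inner S w (pd j (pd k \<psi>)) = L2_inner S (w2 j k) \<psi>" if "\<psi> \<in> test_functions S" "j \<or> \<not> k" for j k \<psi>
    using assms that unfolding weak2_def by blast
  show "is_weak_deriv S 0 0 w w" "is_weak_deriv S 1 0 w (w1 True)" "is_weak_deriv S 0 1 w (w1 False)"
    by (simp_all add: is_weak_deriv_def partials_simps 1)
  show "is_weak_deriv S 2 0 w (w2 True True)" "is_weak_deriv S 1 1 w (w2 True False)" "is_weak_deriv S 0 2 w (w2 False False)"
    by (simp_all add: is_weak_deriv_def partials_simps 2)
qed

lemma weak2_H2: assumes w: "weak2 S w w1 w2" shows "w \<in> H2 S"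
proof -
  have L: "w \<in> L2 S" "w1 k \<in> L2 S" "w2 j k \<in> L2 S" for j k using w by (auto simp: weak2_def)
  have "\<exists>g\<in>L2 S. is_weak_deriv S i j w g" if "i + j \<le> 2" for i j
  proof -
    have "(i, j) \<in> {(0,0), (1,0), (0,1), (2,0), (1,1), (0,2)}" using that by auto
    then show ?thesis using L weak2_is_weak_deriv[OF w] by auto
  qed
  then show ?thesis using L by (auto simp: H2_def)
qed

lemma pd_support:
  assumes d: "f differentiable_on UNIV" and K: "closed K" "\<And>p. p \<notin> K \<Longrightarrow> f p = 0" and p: "p \<notin> K"
  shows "pd k f p = 0"
proof -
  have "((\<lambda>s. p + s *\<^sub>R dir k) \<longlongrightarrow> p + 0 *\<^sub>R dir k) (at (0::real))" by (intro tendsto_intros)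
  then have "\<forall>\<^sub>F s in at (0::real). p + s *\<^sub>R dir k \<in> - K"
    using K(1) p by (intro topological_tendstoD) auto
  then have "\<forall>\<^sub>F s in nhds (0::real). f (p + s *\<^sub>R dir k) = 0"
    unfolding eventually_at_filter
  proof (rule eventually_mono)
    fix s :: real assume h: "s \<noteq> 0 \<longrightarrow> s \<in> UNIV \<longrightarrow> p + s *\<^sub>R dir k \<in> - K"
    show "f (p + s *\<^sub>R dir k) = 0"
    proof (cases "s = 0")
      case True then show ?thesis using K(2)[OF p] by simp
    next
      case False then show ?thesis using h by (intro K(2)) simp
    qed
  qed
  then have "((\<lambda>s. f (p + s *\<^sub>R dir k)) has_real_derivative 0) (at 0)"
    using DERIV_cong_ev[of 0 0 "\<lambda>s. f (p + s *\<^sub>R dir k)" "\<lambda>s. 0" 0 0] by simp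
  then show ?thesis using DERIV_unique[OF pd_line_DERIV[OF d, of p k 0]] by simp
qed

lemma smooth_pd:
  assumes "smooth \<psi>"
  shows "\<psi> differentiable_on UNIV" "pd k \<psi> differentiable_on UNIV"
    "j \<or> \<not> k \<Longrightarrow> pd j (pd k \<psi>) differentiable_on UNIV"
proof -
  have d: "partials m n \<psi> differentiable_on UNIV" for m n using assms by (rule smooth_partials)
  show "\<psi> differentiable_on UNIV" "pd k \<psi> differentiable_on UNIV"
    using d[of 0 0] d[of 1 0] d[of 0 1] by (cases k; simp add: partials_simps)+
  show "j \<or> \<not> k \<Longrightarrow> pd j (pd k \<psi>) differentiable_on UNIV"
    using d[of 2 0] d[of 1 1] d[of 0 2] by (cases j; cases k; simp add: partials_simps)
qed

lemma test_L2_UNIV: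
  assumes "\<psi> \<in> test_functions S"
  shows "\<psi> \<in> L2 UNIV" "pd k \<psi> \<in> L2 UNIV" "j \<or> \<not> k \<Longrightarrow> pd j (pd k \<psi>) \<in> L2 UNIV"
proof -
  let ?K = "closure {p. \<psi> p \<noteq> 0}"
  have s: "smooth \<psi>" and K: "compact ?K" using assms by (auto simp: test_functions_def)
  have z: "\<psi> p = 0" if "p \<notin> ?K" for p
    using that closure_subset[of "{p. \<psi> p \<noteq> 0}"] by auto
  have zk: "pd k \<psi> p = 0" if "p \<notin> ?K" for p k
    by (rule pd_support[OF smooth_pd(1)[OF s] _ z that]) simp
  have zjk: "pd j (pd k \<psi>) p = 0" if "p \<notin> ?K" for p j k
    by (rule pd_support[OF smooth_pd(2)[OF s] _ zk that]) simp
  show "\<psi> \<in> L2 UNIV"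
    by (rule compact_support_L2[OF differentiable_imp_continuous_on[OF smooth_pd(1)[OF s]] K z])
  show "pd k \<psi> \<in> L2 UNIV"
    by (rule compact_support_L2[OF differentiable_imp_continuous_on[OF smooth_pd(2)[OF s]] K zk])
  show "pd j (pd k \<psi>) \<in> L2 UNIV" if "j \<or> \<not> k"
    by (rule compact_support_L2[OF differentiable_imp_continuous_on[OF smooth_pd(3)[OF s that]] K zjk])
qed

lemma test_L2:
  assumes S: "S \<in> sets lebesgue" and psi: "\<psi> \<in> test_functions S"
  shows "\<psi> \<in> L2 S" "pd k \<psi> \<in> L2 S" "j \<or> \<not> k \<Longrightarrow> pd j (pd k \<psi>) \<in> L2 S"
  by (intro L2_UNIV_restrict[OF S] test_L2_UNIV[OF psi]; assumption)+

lemma weak2D: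
  assumes "weak2 S w w1 w2"
  shows "w \<in> L2 S" "w1 k \<in> L2 S" "w2 j k \<in> L2 S" "w2 j k = w2 k j"
    "\<psi> \<in> test_functions S \<Longrightarrow> L2_inner S w (pd k \<psi>) = - L2_inner S (w1 k) \<psi>"
    "\<psi> \<in> test_functions S \<Longrightarrow> j \<or> \<not> k \<Longrightarrow> L2_inner S w (pd j (pd k \<psi>)) = L2_inner S (w2 j k) \<psi>"
  using assms unfolding weak2_def by blast+

lemma weak2_add:
  assumes "weak2 S w w1 w2" "weak2 S z z1 z2" and S: "S \<in> sets lebesgue"
  shows "weak2 S (\<lambda>p. w p + z p) (\<lambda>k p. w1 k p + z1 k p) (\<lambda>j k p. w2 j k p + z2 j k p)"
  unfolding weak2_def
proof (intro conjI allI ballI impI)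
  note w = weak2D[OF assms(1)] and z = weak2D[OF assms(2)] and t = test_L2[OF S]
  show "(\<lambda>p. w p + z p) \<in> L2 S" by (rule L2.add[OF w(1) z(1)])
  show "(\<lambda>p. w1 k p + z1 k p) \<in> L2 S" for k by (rule L2.add[OF w(2) z(2)])
  show "(\<lambda>p. w2 j k p + z2 j k p) \<in> L2 S" for j k by (rule L2.add[OF w(3) z(3)])
  show "(\<lambda>p. w2 j k p + z2 j k p) = (\<lambda>p. w2 k j p + z2 k j p)" for j k
    using w(4)[of j k] z(4)[of j k] by simp
  fix \<psi> j k assume p: "\<psi> \<in> test_functions S"
  show "L2_inner S (\<lambda>p. w p + z p) (pd k \<psi>) = - L2_inner S (\<lambda>p. w1 k p + z1 k p) \<psi>"
    by (simp add: L2.ip_add w(1,2) z(1,2) t[OF p] w(5)[OF p] z(5)[OF p])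
  assume jk: "j \<or> \<not> k"
  show "L2_inner S (\<lambda>p. w p + z p) (pd j (pd k \<psi>)) = L2_inner S (\<lambda>p. w2 j k p + z2 j k p) \<psi>"
    by (simp add: L2.ip_add w(1,3) z(1,3) t(1)[OF p] t(3)[OF p jk] w(6)[OF p jk] z(6)[OF p jk])
qed

lemma weak2_scale:
  assumes "weak2 S w w1 w2" and S: "S \<in> sets lebesgue"
  shows "weak2 S (\<lambda>p. c * w p) (\<lambda>k p. c * w1 k p) (\<lambda>j k p. c * w2 j k p)"
  unfolding weak2_def
proof (intro conjI allI ballI impI)
  note w = weak2D[OF assms(1)] and t = test_L2[OF S]
  show "(\<lambda>p. c * w p) \<in> L2 S" by (rule L2.scale[OF w(1)])
  show "(\<lambda>p. c * w1 k p) \<in> L2 S" for k by (rule L2.scale[OF w(2)])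
  show "(\<lambda>p. c * w2 j k p) \<in> L2 S" for j k by (rule L2.scale[OF w(3)])
  show "(\<lambda>p. c * w2 j k p) = (\<lambda>p. c * w2 k j p)" for j k using w(4)[of j k] by simp
  fix \<psi> j k assume p: "\<psi> \<in> test_functions S"
  show "L2_inner S (\<lambda>p. c * w p) (pd k \<psi>) = - L2_inner S (\<lambda>p. c * w1 k p) \<psi>"
    by (simp add: L2.ip_scale w(1,2) t[OF p] w(5)[OF p])
  assume jk: "j \<or> \<not> k"
  show "L2_inner S (\<lambda>p. c * w p) (pd j (pd k \<psi>)) = L2_inner S (\<lambda>p. c * w2 j k p) \<psi>"
    by (simp add: L2.ip_scale w(1,3) t(1)[OF p] t(3)[OF p jk] w(6)[OF p jk])
qed

subsection \<open>The product rule\<close>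

lemma TS_L2_mult:
  assumes "\<phi> \<in> TS I J" "I \<times> J \<in> sets lebesgue" "f \<in> L2 (I \<times> J)"
  shows "(\<lambda>p. \<phi> p * f p) \<in> L2 UNIV"
proof -
  obtain K where "\<And>p. \<bar>\<phi> p\<bar> \<le> K" using TS_bounded[OF assms(1)] by metis
  then show ?thesis
    by (rule L2_ext0[OF assms(2,3) TS_cont[OF assms(1)]]) (rule TS_zero[OF assms(1)])
qed

lemma TS_inner:
  assumes "\<phi> \<in> TS I J" "I \<times> J \<in> sets lebesgue"
  shows "L2_inner UNIV (\<lambda>p. \<phi> p * f p) g = L2_inner (I \<times> J) f (\<lambda>p. \<phi> p * g p)"
proof -
  have "L2_inner UNIV (\<lambda>p. \<phi> p * f p) g = L2_inner (I \<times> J) (\<lambda>p. \<phi> p * f p) g"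
    by (rule L2_inner_UNIV[OF assms(2)]) (simp add: TS_zero[OF assms(1)])
  also have "\<dots> = L2_inner (I \<times> J) f (\<lambda>p. \<phi> p * g p)"
    by (rule L2_inner_cong) (simp add: mult_ac)
  finally show ?thesis .
qed

lemma TS_mult_L2:
  assumes "\<phi> \<in> TS I J" "g differentiable_on UNIV" "S \<in> sets lebesgue"
  shows "(\<lambda>p. \<phi> p * g p) \<in> L2 S"
proof -
  obtain K where K: "compact K" "\<forall>p. p \<notin> K \<longrightarrow> \<phi> p = 0" using TS_support[OF assms(1)] by blast
  have "(\<lambda>p. \<phi> p * g p) \<in> L2 UNIV"
    by (rule compact_support_L2[OF _ K(1)])
       (use K(2) in \<open>auto intro!: continuous_on_mult TS_cont[OF assms(1)] differentiable_imp_continuous_on[OF assms(2)]\<close>)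
  then show ?thesis by (rule L2_UNIV_restrict[OF assms(3)])
qed

lemma weak_product1:
  assumes w: "weak2 (I \<times> J) w w1 w2" and phi: "\<phi> \<in> TS I J" and S: "I \<times> J \<in> sets lebesgue"
    and psi: "\<psi> \<in> test_functions UNIV"
  shows "L2_inner (I \<times> J) w (\<lambda>p. \<phi> p * pd k \<psi> p)
    = - L2_inner (I \<times> J) (w1 k) (\<lambda>p. \<phi> p * \<psi> p) - L2_inner (I \<times> J) w (\<lambda>p. pd k \<phi> p * \<psi> p)"
proof -
  note W = weak2D[OF w]
  have ps: "smooth \<psi>" using psi by (simp add: test_functions_def)
  note d = smooth_pd[OF ps]
  have "L2_inner (I \<times> J) w (pd k (\<lambda>p. \<phi> p * \<psi> p)) = - L2_inner (I \<times> J) (w1 k) (\<lambda>p. \<phi> p * \<psi> p)"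
    by (rule W(5)[OF TS_mult_test[OF phi psi]])
  moreover have "pd k (\<lambda>p. \<phi> p * \<psi> p) = (\<lambda>p. \<phi> p * pd k \<psi> p + pd k \<phi> p * \<psi> p)"
    by (rule pd_mult[OF TS_differentiable[OF phi] d(1)])
  ultimately show ?thesis
    by (simp add: L2.ip_add_right W(1) TS_mult_L2[OF phi d(2) S] TS_mult_L2[OF TS_pd[OF phi] d(1) S])
qed

lemma weak_product2:
  assumes w: "weak2 (I \<times> J) w w1 w2" and phi: "\<phi> \<in> TS I J" and S: "I \<times> J \<in> sets lebesgue"
    and psi: "\<psi> \<in> test_functions UNIV" and jk: "j \<or> \<not> k"
  shows "L2_inner (I \<times> J) w (\<lambda>p. \<phi> p * pd j (pd k \<psi>) p)
    = L2_inner (I \<times> J) (w2 j k) (\<lambda>p. \<phi> p * \<psi> p) + L2_inner (I \<times> J) (w1 k) (\<lambda>p. pd j \<phi> p * \<psi> p)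
     + L2_inner (I \<times> J) (w1 j) (\<lambda>p. pd k \<phi> p * \<psi> p) + L2_inner (I \<times> J) w (\<lambda>p. pd j (pd k \<phi>) p * \<psi> p)"
proof -
  note W = weak2D[OF w]
  have ps: "smooth \<psi>" using psi by (simp add: test_functions_def)
  note d = smooth_pd[OF ps] and t = TS_differentiable
  have e: "L2_inner (I \<times> J) w (pd j (pd k (\<lambda>p. \<phi> p * \<psi> p))) = L2_inner (I \<times> J) (w2 j k) (\<lambda>p. \<phi> p * \<psi> p)"
    by (rule W(6)[OF TS_mult_test[OF phi psi] jk])
  have "pd j (pd k (\<lambda>p. \<phi> p * \<psi> p)) = pd j (\<lambda>p. \<phi> p * pd k \<psi> p + pd k \<phi> p * \<psi> p)"
    by (simp only: pd_mult[OF t[OF phi] d(1)])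
  also have "\<dots> = (\<lambda>p. pd j (\<lambda>p. \<phi> p * pd k \<psi> p) p + pd j (\<lambda>p. pd k \<phi> p * \<psi> p) p)"
    using partial_x_add[OF differentiable_on_mult[OF t[OF phi] d(2)] differentiable_on_mult[OF t[OF TS_pd[OF phi]] d(1)], of k k]
      partial_y_add[OF differentiable_on_mult[OF t[OF phi] d(2)] differentiable_on_mult[OF t[OF TS_pd[OF phi]] d(1)], of k k]
    by (simp add: pd_def)
  also have "\<dots> = (\<lambda>p. (\<phi> p * pd j (pd k \<psi>) p + pd j \<phi> p * pd k \<psi> p) + (pd k \<phi> p * pd j \<psi> p + pd j (pd k \<phi>) p * \<psi> p))"
    by (simp only: pd_mult[OF t[OF phi] d(2)] pd_mult[OF t[OF TS_pd[OF phi]] d(1)])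
  finally have e2: "pd j (pd k (\<lambda>p. \<phi> p * \<psi> p)) = \<dots>" .
  have l: "(\<lambda>p. \<phi> p * pd j (pd k \<psi>) p) \<in> L2 (I \<times> J)" "(\<lambda>p. pd j \<phi> p * pd k \<psi> p) \<in> L2 (I \<times> J)"
    "(\<lambda>p. pd k \<phi> p * pd j \<psi> p) \<in> L2 (I \<times> J)" "(\<lambda>p. pd j (pd k \<phi>) p * \<psi> p) \<in> L2 (I \<times> J)"
    by (intro TS_mult_L2[OF _ _ S, of _ I J] TS_pd phi d jk)+
  have c: "pd k (pd j \<phi>) = pd j (pd k \<phi>)" by (rule TS_pd_commute[OF phi])
  show ?thesis using e unfolding e2
    by (simp add: L2.ip_add_right L2.add W(1) l weak_product1[OF w TS_pd[OF phi] S psi] c)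
qed

text \<open>The weak product rule. The support of \<open>\<phi>\<close> lies in the box, so the product, extended by zero, has
  weak derivatives on the whole plane, where it can be translated.\<close>

lemma weak2_mult:
  assumes w: "weak2 (I \<times> J) w w1 w2" and phi: "\<phi> \<in> TS I J" and S: "I \<times> J \<in> sets lebesgue"
  shows "weak2 UNIV (\<lambda>p. \<phi> p * w p) (\<lambda>k p. \<phi> p * w1 k p + pd k \<phi> p * w p)
    (\<lambda>j k p. \<phi> p * w2 j k p + pd j \<phi> p * w1 k p + pd k \<phi> p * w1 j p + pd j (pd k \<phi>) p * w p)"
  unfolding weak2_def
proof (intro conjI allI ballI impI)
  note W = weak2D[OF w]
  note l = TS_L2_mult[OF phi S] TS_L2_mult[OF TS_pd[OF phi] S] TS_L2_mult[OF TS_pd[OF TS_pd[OF phi]] S]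
  show "(\<lambda>p. \<phi> p * w p) \<in> L2 UNIV" by (rule l(1)[OF W(1)])
  show "(\<lambda>p. \<phi> p * w1 k p + pd k \<phi> p * w p) \<in> L2 UNIV" for k
    by (intro L2.add l W)
  show "(\<lambda>p. \<phi> p * w2 j k p + pd j \<phi> p * w1 k p + pd k \<phi> p * w1 j p + pd j (pd k \<phi>) p * w p) \<in> L2 UNIV" for j k
    by (intro L2.add l W)
  show "(\<lambda>p. \<phi> p * w2 j k p + pd j \<phi> p * w1 k p + pd k \<phi> p * w1 j p + pd j (pd k \<phi>) p * w p)
     = (\<lambda>p. \<phi> p * w2 k j p + pd k \<phi> p * w1 j p + pd j \<phi> p * w1 k p + pd k (pd j \<phi>) p * w p)" for j k
    by (simp add: W(4)[of j k] TS_pd_commute[OF phi, of j k] add_ac)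
  fix \<psi> j k assume psi: "\<psi> \<in> test_functions UNIV"
  have t: "\<psi> \<in> L2 UNIV" by (rule test_L2_UNIV(1)[OF psi])
  note i = TS_inner[OF phi S] TS_inner[OF TS_pd[OF phi] S] TS_inner[OF TS_pd[OF TS_pd[OF phi]] S]
  show "L2_inner UNIV (\<lambda>p. \<phi> p * w p) (pd k \<psi>) = - L2_inner UNIV (\<lambda>p. \<phi> p * w1 k p + pd k \<phi> p * w p) \<psi>"
    by (simp add: L2.ip_add l W(1,2) t i weak_product1[OF w phi S psi])
  assume jk: "j \<or> \<not> k"
  show "L2_inner UNIV (\<lambda>p. \<phi> p * w p) (pd j (pd k \<psi>)) =
    L2_inner UNIV (\<lambda>p. \<phi> p * w2 j k p + pd j \<phi> p * w1 k p + pd k \<phi> p * w1 j p + pd j (pd k \<phi>) p * w p) \<psi>"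
    by (simp add: L2.ip_add L2.add l W(1,2,3) t i weak_product2[OF w phi S psi jk])
qed

lemma weak2_restrict:
  assumes w: "weak2 UNIV w w1 w2" and S: "S \<in> sets lebesgue"
    and z: "\<And>p. p \<notin> S \<Longrightarrow> w p = 0" "\<And>k p. p \<notin> S \<Longrightarrow> w1 k p = 0" "\<And>j k p. p \<notin> S \<Longrightarrow> w2 j k p = 0"
  shows "weak2 S w w1 w2"
  unfolding weak2_def
proof (intro conjI allI ballI impI)
  note W = weak2D[OF w]
  show "w \<in> L2 S" "w1 k \<in> L2 S" "w2 j k \<in> L2 S" for j k
    by (intro L2_UNIV_restrict[OF S] W)+
  show "w2 j k = w2 k j" for j k by (rule W(4))
  fix \<psi> j k assume "\<psi> \<in> test_functions S"
  then have psi: "\<psi> \<in> test_functions UNIV" using test_functions_mono[of S UNIV] by auto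
  have e: "L2_inner S w g = L2_inner UNIV w g" "L2_inner S (w1 k) g = L2_inner UNIV (w1 k) g" "L2_inner S (w2 j k) g = L2_inner UNIV (w2 j k) g" for g
    using z by (intro L2_inner_UNIV[OF S, symmetric]; simp)+
  show "L2_inner S w (pd k \<psi>) = - L2_inner S (w1 k) \<psi>" unfolding e by (rule W(5)[OF psi])
  assume "j \<or> \<not> k"
  then show "L2_inner S w (pd j (pd k \<psi>)) = L2_inner S (w2 j k) \<psi>" unfolding e by (rule W(6)[OF psi])
qed

subsection \<open>Translations\<close>

lemma lebesgue_shift: "distr lebesgue lebesgue (\<lambda>p. v + p) = lebesgue"
  "(\<lambda>p. v + p) \<in> lebesgue \<rightarrow>\<^sub>M lebesgue" for v :: "real \<times> real"
proof -
  have T: "(\<lambda>x. v + (\<Sum>j\<in>Basis. (1 * (x \<bullet> j)) *\<^sub>R j)) = (\<lambda>p. v + p)"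
    by (simp add: euclidean_representation)
  show "(\<lambda>p. v + p) \<in> lebesgue \<rightarrow>\<^sub>M lebesgue"
    using lebesgue_affine_measurable[of "\<lambda>_. 1" v] unfolding T by simp
  show "distr lebesgue lebesgue (\<lambda>p. v + p) = lebesgue"
    using lebesgue_affine_euclidean[of "\<lambda>_. 1" v] unfolding T by (simp add: density_1)
qed

lemma L2_shift:
  assumes "f \<in> L2 UNIV" shows "(\<lambda>p. f (p + v)) \<in> L2 UNIV"
proof -
  have f: "f \<in> borel_measurable lebesgue" "integrable lebesgue (\<lambda>p. (f p)\<^sup>2)"
    using assms by (auto simp: L2_def lebesgue_on_UNIV_eq)
  have "integrable (distr lebesgue lebesgue (\<lambda>p. v + p)) (\<lambda>p. (f p)\<^sup>2)"
    using f(2) by (simp only: lebesgue_shift)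
  then have "integrable lebesgue (\<lambda>p. (f (v + p))\<^sup>2)"
    by (subst (asm) integrable_distr_eq[OF lebesgue_shift(2)]) (use f in simp_all)
  moreover have "(\<lambda>p. f (v + p)) \<in> borel_measurable lebesgue"
    by (rule measurable_compose[OF lebesgue_shift(2) f(1)])
  ultimately show ?thesis by (simp add: L2_def lebesgue_on_UNIV_eq add.commute)
qed

lemma L2_inner_shift:
  assumes "f \<in> L2 UNIV" "g \<in> L2 UNIV"
  shows "L2_inner UNIV (\<lambda>p. f (p + v)) g = L2_inner UNIV f (\<lambda>p. g (p - v))"
proof -
  have m: "(\<lambda>p. f p * g (p - v)) \<in> borel_measurable lebesgue"
    using assms(1) L2_shift[OF assms(2), of "- v"] by (auto simp: L2_def lebesgue_on_UNIV_eq)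
  have "(\<integral>p. f p * g (p - v) \<partial>lebesgue) = (\<integral>p. f p * g (p - v) \<partial>distr lebesgue lebesgue (\<lambda>p. v + p))"
    by (simp only: lebesgue_shift)
  also have "\<dots> = (\<integral>p. f (v + p) * g (v + p - v) \<partial>lebesgue)"
    by (rule integral_distr[OF lebesgue_shift(2) m])
  finally show ?thesis by (simp add: L2_inner_def lebesgue_on_UNIV_eq add.commute)
qed

lemma L2_nm_shift: "f \<in> L2 UNIV \<Longrightarrow> L2.nm UNIV (\<lambda>p. f (p + v)) = L2.nm UNIV f"
  unfolding L2.nm_def using L2_inner_shift[of f "\<lambda>p. f (p + v)" v] L2_shift[of f v] by simp

lemma weak2_shift:
  assumes w: "weak2 UNIV w w1 w2"
  shows "weak2 UNIV (\<lambda>p. w (p + v)) (\<lambda>k p. w1 k (p + v)) (\<lambda>j k p. w2 j k (p + v))"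
  unfolding weak2_def
proof (intro conjI allI ballI impI)
  note W = weak2D[OF w]
  show "(\<lambda>p. w (p + v)) \<in> L2 UNIV" "(\<lambda>p. w1 k (p + v)) \<in> L2 UNIV" "(\<lambda>p. w2 j k (p + v)) \<in> L2 UNIV" for j k
    by (intro L2_shift W)+
  show "(\<lambda>p. w2 j k (p + v)) = (\<lambda>p. w2 k j (p + v))" for j k using W(4)[of j k] by simp
  fix \<psi> j k assume psi: "\<psi> \<in> test_functions UNIV"
  have psi': "(\<lambda>p. \<psi> (p - v)) \<in> test_functions UNIV" using test_functions_shift[OF psi, of "- v"] by simp
  have sh: "pd k (\<lambda>p. \<psi> (p - v)) = (\<lambda>p. pd k \<psi> (p - v))" "pd j (\<lambda>p. pd k \<psi> (p - v)) = (\<lambda>p. pd j (pd k \<psi>) (p - v))"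
    using pd_shift[of k \<psi> "- v"] pd_shift[of j "pd k \<psi>" "- v"] by auto
  note t = test_L2_UNIV[OF psi]
  show "L2_inner UNIV (\<lambda>p. w (p + v)) (pd k \<psi>) = - L2_inner UNIV (\<lambda>p. w1 k (p + v)) \<psi>"
    using W(5)[OF psi', of k] by (simp add: L2_inner_shift W t sh)
  assume jk: "j \<or> \<not> k"
  show "L2_inner UNIV (\<lambda>p. w (p + v)) (pd j (pd k \<psi>)) = L2_inner UNIV (\<lambda>p. w2 j k (p + v)) \<psi>"
    using W(6)[OF psi' jk] by (simp add: L2_inner_shift[OF W(1) t(3)[OF jk]] L2_inner_shift[OF W(3) t(1)] sh)
qed


section \<open>Density of the tensor test functions\<close>

lemma Dfun_mono: "I \<subseteq> I' \<Longrightarrow> Dfun I \<subseteq> Dfun I'"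
  unfolding Dfun_def by blast

lemma TS_mono:
  assumes "\<phi> \<in> TS I J" shows "\<phi> \<in> TS UNIV UNIV"
  using assms
proof (induction rule: TS.induct)
  case (tensor a b)
  have "a \<in> Dfun UNIV" "b \<in> Dfun UNIV" using tensor Dfun_mono[OF subset_UNIV] by blast+
  then show ?case by (rule TS.tensor)
qed (rule TS.plus)

lemma TS_null: "(\<lambda>p. 0) \<in> TS I J"
proof -
  have "(\<lambda>x. 0) \<in> Dfun K" for K
  proof -
    have "{1..0::real} \<subseteq> K \<and> (\<forall>x. x \<notin> {1..0::real} \<longrightarrow> (0::real) = 0)" by simp
    then show ?thesis unfolding Dfun_def using smooth1_const[of 0] by blast
  qed
  from TS.tensor[OF this this] show ?thesis by simp
qed

locale open_box =
  fixes c d e g :: real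
begin

abbreviation "I \<equiv> {c<..<d}"
abbreviation "J \<equiv> {e<..<g}"
abbreviation "S \<equiv> I \<times> J"

lemma S_box: "S = box (c, e) (d, g)"
  by (auto simp: box_def Basis_prod_def)

lemma S_sets: "S \<in> sets lebesgue" unfolding S_box by simp

lemma S_fin: "finite_measure (lebesgue_on S)"
  by (rule finite_measure_lebesgue_on) (simp add: S_box)

lemma bounded_L2:
  assumes "f \<in> borel_measurable (lebesgue_on S)" "\<And>p. p \<in> S \<Longrightarrow> \<bar>f p\<bar> \<le> K"
  shows "f \<in> L2 S"
proof -
  have "(\<lambda>p. 1) \<in> L2 S"
    using finite_measure.integrable_const[OF S_fin, of "1::real"] by (simp add: L2_def)
  from L2_dominated[OF assms(1) this, of K] assms(2) show ?thesis by simp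
qed

lemma TS_L2: "\<phi> \<in> TS I J \<Longrightarrow> \<phi> \<in> L2 S"
  by (rule L2_UNIV_restrict[OF S_sets test_L2_UNIV(1)[OF TS_test]])

lemma L2_integrable: "f \<in> L2 S \<Longrightarrow> integrable (lebesgue_on S) f"
  using L2_integrable_mult[of f S "\<lambda>p. 1"] bounded_L2[of "\<lambda>p. 1" 1] by simp

text \<open>The closure of the tensor sums in \<open>L2\<close>, shown to be everything by passing from boxes to
  Borel sets and from simple functions to limits.\<close>

definition approx :: "(real \<times> real \<Rightarrow> real) \<Rightarrow> bool" where
  "approx F \<longleftrightarrow> F \<in> L2 S \<and> (\<forall>\<epsilon>>0. \<exists>\<phi>\<in>TS I J. L2.nm S (\<lambda>p. F p - \<phi> p) < \<epsilon>)"

lemma approx_TS: assumes p: "\<phi> \<in> TS I J" shows "approx \<phi>"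
  unfolding approx_def
proof (intro conjI allI impI)
  show "\<phi> \<in> L2 S" by (rule TS_L2[OF p])
  fix \<epsilon> :: real assume "0 < \<epsilon>"
  then show "\<exists>\<phi>'\<in>TS I J. L2.nm S (\<lambda>q. \<phi> q - \<phi>' q) < \<epsilon>"
    using L2.nm_self[OF TS_L2[OF p]] by (intro bexI[OF _ p]) (simp only:)
qed

lemma approx_add:
  assumes "approx F" "approx G" shows "approx (\<lambda>p. F p + G p)"
  unfolding approx_def
proof (intro conjI allI impI)
  have FG: "F \<in> L2 S" "G \<in> L2 S" using assms by (auto simp: approx_def)
  then show "(\<lambda>p. F p + G p) \<in> L2 S" by (rule L2.add)
  fix \<epsilon> :: real assume "0 < \<epsilon>"
  then have e: "0 < \<epsilon> / 2" by simp
  obtain \<phi> where p: "\<phi> \<in> TS I J" "L2.nm S (\<lambda>p. F p - \<phi> p) < \<epsilon> / 2"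
    using assms(1) e unfolding approx_def by blast
  obtain \<psi> where q: "\<psi> \<in> TS I J" "L2.nm S (\<lambda>p. G p - \<psi> p) < \<epsilon> / 2"
    using assms(2) e unfolding approx_def by blast
  have "L2.nm S (\<lambda>p. (F p - \<phi> p) + (G p - \<psi> p)) \<le> L2.nm S (\<lambda>p. F p - \<phi> p) + L2.nm S (\<lambda>p. G p - \<psi> p)"
    by (rule L2.nm_triangle; rule L2.diff) (use FG p q TS_L2 in auto)
  moreover have "(\<lambda>p. (F p - \<phi> p) + (G p - \<psi> p)) = (\<lambda>p. F p + G p - (\<phi> p + \<psi> p))"
    by (simp add: algebra_simps)
  ultimately show "\<exists>\<phi>\<in>TS I J. L2.nm S (\<lambda>p. F p + G p - \<phi> p) < \<epsilon>"
    using p q by (intro bexI[of _ "\<lambda>p. \<phi> p + \<psi> p"]) (auto intro: TS.plus)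
qed

lemma approx_scale:
  assumes "approx F" shows "approx (\<lambda>p. r * F p)"
  unfolding approx_def
proof (intro conjI allI impI)
  have F: "F \<in> L2 S" using assms by (auto simp: approx_def)
  then show "(\<lambda>p. r * F p) \<in> L2 S" by (rule L2.scale)
  fix \<epsilon> :: real assume "0 < \<epsilon>"
  then have e: "0 < \<epsilon> / (\<bar>r\<bar> + 1)" by (simp add: add_nonneg_pos)
  obtain \<phi> where p: "\<phi> \<in> TS I J" "L2.nm S (\<lambda>p. F p - \<phi> p) < \<epsilon> / (\<bar>r\<bar> + 1)"
    using assms e unfolding approx_def by blast
  have D: "(\<lambda>p. F p - \<phi> p) \<in> L2 S" by (rule L2.diff[OF F TS_L2[OF p(1)]])
  have "L2.nm S (\<lambda>p. r * F p - r * \<phi> p) = \<bar>r\<bar> * L2.nm S (\<lambda>p. F p - \<phi> p)"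
    using L2.nm_scale[OF D, of r] by (simp add: right_diff_distrib)
  also have "\<dots> \<le> (\<bar>r\<bar> + 1) * L2.nm S (\<lambda>p. F p - \<phi> p)"
    using D by (intro mult_right_mono) auto
  also have "\<dots> < \<epsilon>" using p(2) by (simp add: pos_less_divide_eq add_nonneg_pos mult.commute)
  finally show "\<exists>\<phi>\<in>TS I J. L2.nm S (\<lambda>p. r * F p - \<phi> p) < \<epsilon>"
    by (intro bexI[of _ "\<lambda>p. r * \<phi> p"] TS_scale p)
qed

lemma approx_lim:
  assumes G: "\<And>n. approx (G n)" and F: "F \<in> borel_measurable (lebesgue_on S)" and H: "H \<in> L2 S"
    and lim: "\<And>p. p \<in> S \<Longrightarrow> (\<lambda>n. G n p) \<longlonglongrightarrow> F p"
    and dom: "\<And>n p. p \<in> S \<Longrightarrow> \<bar>F p - G n p\<bar> \<le> \<bar>H p\<bar>"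
  shows "approx F"
  unfolding approx_def
proof (intro conjI allI impI)
  have GL: "G n \<in> L2 S" for n using G by (auto simp: approx_def)
  have Gm: "G n \<in> borel_measurable (lebesgue_on S)" for n using GL by (simp add: L2_def)
  have "(\<lambda>p. F p - G 0 p) \<in> L2 S"
    by (rule L2_dominated[OF _ H, of _ 1]) (use F Gm dom in auto)
  from L2.add[OF this GL[of 0]] show FL: "F \<in> L2 S" by simp
  have "(\<lambda>n. \<integral>p. (F p - G n p) * (F p - G n p) \<partial>lebesgue_on S) \<longlonglongrightarrow> (\<integral>p. 0 \<partial>lebesgue_on S)"
  proof (rule integral_dominated_convergence[where w="\<lambda>p. H p * H p"])
    show "integrable (lebesgue_on S) (\<lambda>p. H p * H p)" by (rule L2_integrable_mult[OF H H])
    show "AE p in lebesgue_on S. (\<lambda>n. (F p - G n p) * (F p - G n p)) \<longlonglongrightarrow> 0"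
    proof (rule AE_I2)
      fix p assume "p \<in> space (lebesgue_on S)"
      then have "(\<lambda>n. G n p) \<longlonglongrightarrow> F p" using lim by simp
      then have "(\<lambda>n. (F p - G n p) * (F p - G n p)) \<longlonglongrightarrow> (F p - F p) * (F p - F p)" by (intro tendsto_intros)
      then show "(\<lambda>n. (F p - G n p) * (F p - G n p)) \<longlonglongrightarrow> 0" by simp
    qed
    show "AE p in lebesgue_on S. norm ((F p - G n p) * (F p - G n p)) \<le> H p * H p" for n
    proof (rule AE_I2)
      fix p assume "p \<in> space (lebesgue_on S)"
      then have "\<bar>F p - G n p\<bar> \<le> \<bar>H p\<bar>" using dom by simp
      then have "\<bar>F p - G n p\<bar> * \<bar>F p - G n p\<bar> \<le> \<bar>H p\<bar> * \<bar>H p\<bar>" by (intro mult_mono) auto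
      then show "norm ((F p - G n p) * (F p - G n p)) \<le> H p * H p" by (simp add: abs_mult)
    qed
  qed (use F Gm in auto)
  then have "(\<lambda>n. sqrt (L2_inner S (\<lambda>p. F p - G n p) (\<lambda>p. F p - G n p))) \<longlonglongrightarrow> sqrt 0"
    unfolding L2_inner_def by (intro tendsto_intros) simp
  then have nl: "(\<lambda>n. L2.nm S (\<lambda>p. F p - G n p)) \<longlonglongrightarrow> 0" by (simp add: L2.nm_def)
  fix \<epsilon> :: real assume "0 < \<epsilon>"
  then have e: "0 < \<epsilon> / 2" by simp
  from order_tendstoD(2)[OF nl e] obtain n where n: "L2.nm S (\<lambda>p. F p - G n p) < \<epsilon> / 2"
    by (auto simp: eventually_sequentially)
  obtain \<phi> where p: "\<phi> \<in> TS I J" "L2.nm S (\<lambda>p. G n p - \<phi> p) < \<epsilon> / 2"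
    using G[of n] e unfolding approx_def by blast
  have "L2.nm S (\<lambda>p. (F p - G n p) + (G n p - \<phi> p)) \<le> L2.nm S (\<lambda>p. F p - G n p) + L2.nm S (\<lambda>p. G n p - \<phi> p)"
    by (rule L2.nm_triangle; rule L2.diff) (use FL GL p TS_L2 in auto)
  then show "\<exists>\<phi>\<in>TS I J. L2.nm S (\<lambda>p. F p - \<phi> p) < \<epsilon>"
    using p n by (intro bexI[of _ \<phi>]) auto
qed

lemma approx_cong:
  assumes "approx F" "G \<in> L2 S" "AE p in lebesgue_on S. F p = G p"
  shows "approx G"
proof -
  have "L2.nm S (\<lambda>p. F p - \<phi> p) = L2.nm S (\<lambda>p. G p - \<phi> p)" if "\<phi> \<in> TS I J" for \<phi>
    unfolding L2.nm_def L2_inner_def using assms that TS_L2[OF that]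
    by (intro arg_cong[where f=sqrt] integral_cong_AE) (auto simp: approx_def L2_def)
  then show ?thesis using assms by (auto simp: approx_def)
qed

lemma borel_ind: "A \<in> sets borel \<Longrightarrow> (indicator A :: real \<times> real \<Rightarrow> real) \<in> borel_measurable (lebesgue_on S)"
proof -
  assume "A \<in> sets borel"
  then have "(indicator A :: real \<times> real \<Rightarrow> real) \<in> borel_measurable lebesgue"
    by (intro borel_measurable_indicator) simp
  then show ?thesis by (rule measurable_restrict_space1)
qed

lemma cutoff_lim:
  "(\<lambda>n. cutoff (1 / real (Suc n)) (a + 1 / real (Suc n)) (b - 1 / real (Suc n)) x) \<longlonglongrightarrow> (if a < x \<and> x < b then 1 else 0)"
proof (cases "a < x \<and> x < b")
  case True
  define m where "m = min (x - a) (b - x) / 2"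
  have m: "0 < m" using True by (simp add: m_def)
  have "(\<lambda>n. 1 / real (Suc n)) \<longlonglongrightarrow> 0" by (rule LIMSEQ_Suc[OF lim_1_over_n])
  from order_tendstoD(2)[OF this m]
  have "\<forall>\<^sub>F n in sequentially. cutoff (1 / real (Suc n)) (a + 1 / real (Suc n)) (b - 1 / real (Suc n)) x = 1"
  proof eventually_elim
    case (elim n)
    define k where "k = 1 / real (Suc n)"
    have "0 < k" by (simp add: k_def)
    moreover have "k < m" using elim by (simp add: k_def)
    then have "a + k + k \<le> x" "x \<le> b - k - k" by (auto simp: m_def)
    ultimately show ?case unfolding k_def[symmetric] by (rule cutoff_1)
  qed
  then show ?thesis using True by (simp add: tendsto_eventually)
next
  case False
  have "cutoff (1 / real (Suc n)) (a + 1 / real (Suc n)) (b - 1 / real (Suc n)) x = 0" for n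
  proof -
    have k: "0 < 1 / real (Suc n)" by simp
    then have "x \<le> a + 1 / real (Suc n) \<or> b - 1 / real (Suc n) \<le> x" using False by linarith
    then show ?thesis by (rule cutoff_0[OF k])
  qed
  moreover have "(if a < x \<and> x < b then 1 else 0) = (0::real)" using False by (rule if_not_P)
  ultimately show ?thesis by (simp only: tendsto_const)
qed

text \<open>Cutoffs whose transition regions shrink to the boundary of the box converge to its indicator.\<close>

lemma approx_box: "approx (indicator (box a b))"
proof -
  obtain a1 a2 b1 b2 where ab: "a = (a1, a2)" "b = (b1, b2)" by (cases a, cases b)
  define X where "X n = cutoff (1 / real (Suc n)) (max a1 c + 1 / real (Suc n)) (min b1 d - 1 / real (Suc n))" for n
  define Y where "Y n = cutoff (1 / real (Suc n)) (max a2 e + 1 / real (Suc n)) (min b2 g - 1 / real (Suc n))" for n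
  show ?thesis
  proof (rule approx_lim[of "\<lambda>n p. X n (fst p) * Y n (snd p)" _ "\<lambda>p. 1"])
    fix n
    have k: "0 < 1 / real (Suc n)" by simp
    have "{x + 1 / real (Suc n)..y - 1 / real (Suc n)} \<subseteq> {x'<..<y'}" if "x' \<le> x" "y \<le> y'" for x y x' y' :: real
    proof
      fix z assume "z \<in> {x + 1 / real (Suc n)..y - 1 / real (Suc n)}"
      then have "x + 1 / real (Suc n) \<le> z" "z \<le> y - 1 / real (Suc n)" by simp_all
      then have "x' < z" "z < y'" using that k by linarith+
      then show "z \<in> {x'<..<y'}" by simp
    qed
    then have "X n \<in> Dfun I" "Y n \<in> Dfun J"
      unfolding X_def Y_def by (intro cutoff_Dfun k; simp)+
    then show "approx (\<lambda>p. X n (fst p) * Y n (snd p))" by (intro approx_TS TS.tensor)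
    fix p :: "real \<times> real"
    have "0 \<le> X n (fst p)" "X n (fst p) \<le> 1" "0 \<le> Y n (snd p)" "Y n (snd p) \<le> 1"
      unfolding X_def Y_def by (rule cutoff_range)+
    then have "0 \<le> X n (fst p) * Y n (snd p)" "X n (fst p) * Y n (snd p) \<le> 1" by (auto intro: mult_le_one)
    then show "\<bar>indicator (box a b) p - X n (fst p) * Y n (snd p)\<bar> \<le> \<bar>1\<bar>"
      by (auto simp: indicator_def)
  next
    fix p assume p: "p \<in> S"
    have "(\<lambda>n. X n (fst p) * Y n (snd p)) \<longlonglongrightarrow>
       (if max a1 c < fst p \<and> fst p < min b1 d then 1 else 0) * (if max a2 e < snd p \<and> snd p < min b2 g then 1 else 0)"
      unfolding X_def Y_def by (intro tendsto_mult cutoff_lim)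
    moreover have "(if max a1 c < fst p \<and> fst p < min b1 d then 1 else 0) * (if max a2 e < snd p \<and> snd p < min b2 g then 1 else 0)
       = (indicator (box a b) p :: real)"
      using p by (auto simp: indicator_def ab box_def Basis_prod_def)
    ultimately show "(\<lambda>n. X n (fst p) * Y n (snd p)) \<longlonglongrightarrow> indicator (box a b) p" by simp
  next
    show "(indicator (box a b) :: _ \<Rightarrow> real) \<in> borel_measurable (lebesgue_on S)" by (rule borel_ind) simp
    show "(\<lambda>p. 1) \<in> L2 S" by (rule bounded_L2[of _ 1]) auto
  qed
qed

text \<open>Boxes are stable under intersection and generate the Borel sets, and the approximable sets are
  closed under complements and countable disjoint unions.\<close>

lemma approx_borel: assumes "A \<in> sets borel" shows "approx (indicator A)"
proof -
  define GG where "GG = range (\<lambda>(a, b). box a b :: (real \<times> real) set)"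
  have sb: "sets borel = sigma_sets UNIV GG"
    unfolding GG_def borel_eq_box by simp
  have "Int_stable GG"
    unfolding GG_def Int_stable_def by (auto simp: box_Int_box)
  moreover have "GG \<subseteq> Pow UNIV" by simp
  moreover have "A \<in> sigma_sets UNIV GG" using assms by (simp add: sb)
  ultimately show ?thesis
  proof (induction rule: sigma_sets_induct_disjoint)
    case (basic A)
    then show ?case using approx_box by (auto simp: GG_def)
  next
    case empty
    show ?case using approx_TS[OF TS_null] by (simp add: indicator_def[abs_def])
  next
    case (compl A)
    have A: "A \<in> sets borel" using compl by (simp add: sb)
    have "approx (\<lambda>p. indicator (box (c, e) (d, g)) p + (-1) * indicator A p)"
      by (rule approx_add[OF approx_box approx_scale[OF compl(2)]])
    moreover have "indicator (UNIV - A) \<in> L2 S"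
      by (rule bounded_L2[OF borel_ind, of _ 1]) (use A in \<open>auto simp: indicator_def\<close>)
    ultimately show ?case
      by (rule approx_cong) (auto simp: S_box indicator_def intro!: AE_I2)
  next
    case (union A)
    have Ab: "A i \<in> sets borel" for i using union by (auto simp: sb)
    have fin: "approx (\<lambda>p. \<Sum>i<n. indicator (A i) p)" for n
    proof (induction n)
      case 0 show ?case using approx_TS[OF TS_null] by simp
    next
      case (Suc n) show ?case using approx_add[OF Suc union(3)[of n]] by simp
    qed
    have dis: "(\<Sum>i<n. indicator (A i) p) = (indicator (\<Union>i<n. A i) p :: real)" for n p
      using union(1) by (intro indicator_UN_disjoint[symmetric]) (auto simp: disjoint_family_on_def)
    show ?case
    proof (rule approx_lim[OF fin, of _ "\<lambda>p. 1"])
      show "(\<lambda>n. \<Sum>i<n. indicator (A i) p) \<longlonglongrightarrow> (indicator (\<Union> (range A)) p :: real)" for p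
        unfolding dis by (rule LIMSEQ_indicator_UN)
      show "\<bar>indicator (\<Union> (range A)) p - (\<Sum>i<n. indicator (A i) p)\<bar> \<le> \<bar>1 :: real\<bar>" for n p
        unfolding dis by (auto simp: indicator_def)
      show "(indicator (\<Union> (range A)) :: _ \<Rightarrow> real) \<in> borel_measurable (lebesgue_on S)"
        by (rule borel_ind) (use Ab in auto)
      show "(\<lambda>p. 1) \<in> L2 S" by (rule bounded_L2[of _ 1]) auto
    qed
  qed
qed

lemma approx_L2: assumes F: "F \<in> L2 S" shows "approx F"
proof -
  define F0 where "F0 p = (if p \<in> S then F p else 0)" for p
  have "F0 \<in> L2 S" using F L2_dominated[of F0 S F 1] measurable_cong[of "lebesgue_on S" F0 F borel]
    by (auto simp: F0_def L2_def)
  then have "F0 \<in> L2 UNIV" using L2_UNIV_iff[OF S_sets, of F0] by (auto simp: F0_def)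
  then have "F0 \<in> borel_measurable lebesgue" by (simp add: L2_def lebesgue_on_UNIV_eq)
  then obtain f where f: "f \<in> borel_measurable lborel" "AE p in lborel. F0 p = f p"
    using completion_ex_borel_measurable_real by blast
  have ae: "AE p in lebesgue_on S. f p = F p"
  proof -
    have "AE p in lebesgue. F0 p = f p" using f(2) by (rule AE_completion)
    then have "AE p in lebesgue_on S. F0 p = f p"
      using S_sets by (auto simp: AE_restrict_space_iff)
    moreover have "AE p in lebesgue_on S. F0 p = F p" by (rule AE_I2) (simp add: F0_def)
    ultimately show ?thesis by eventually_elim simp
  qed
  have fm: "f \<in> borel_measurable (lebesgue_on S)"
    using f(1) by (intro measurable_restrict_space1 measurable_completion) 
  have fL: "f \<in> L2 S"
  proof -
    have "integrable (lebesgue_on S) (\<lambda>p. (f p)\<^sup>2) \<longleftrightarrow> integrable (lebesgue_on S) (\<lambda>p. (F p)\<^sup>2)"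
      using ae F fm by (intro integrable_cong_AE) (auto simp: L2_def)
    then show ?thesis using F fm by (simp add: L2_def)
  qed
  have fb: "f \<in> borel_measurable borel" using f(1) by simp
  obtain G where G: "\<And>i. simple_function borel (G i)" "\<And>p. (\<lambda>i. G i p) \<longlonglongrightarrow> f p"
    "\<And>i p. dist (G i p) 0 \<le> 2 * dist (f p) 0"
    using borel_measurable_implies_sequence_metric[OF fb, of 0] by auto
  have "approx (G i)" for i
  proof -
    have fin: "finite (range (G i))" using G(1)[of i] by (simp add: simple_function_def)
    have m: "G i -` {y} \<in> sets borel" for y
      using simple_functionD(2)[OF G(1)[of i], of "{y}"] by simp
    have "approx (\<lambda>p. \<Sum>y\<in>Y. y * indicator (G i -` {y}) p)" if "finite Y" for Y
      using that
    proof (induction Y rule: finite_induct)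
      case empty show ?case using approx_TS[OF TS_null] by simp
    next
      case (insert y Y)
      show ?case unfolding sum.insert[OF insert(1,2)]
        by (rule approx_add[OF approx_scale[OF approx_borel[OF m]] insert(3)])
    qed
    from this[OF fin] have "approx (\<lambda>p. \<Sum>y\<in>range (G i). y * indicator (G i -` {y}) p)" .
    moreover have "(\<Sum>y\<in>range (G i). y * indicator (G i -` {y}) p) = G i p" for p
    proof -
      have "(\<Sum>y\<in>range (G i). y * indicator (G i -` {y}) p) = (\<Sum>y\<in>range (G i). if y = G i p then y else 0)"
        by (intro sum.cong) (auto simp: indicator_def)
      then show ?thesis using fin by (simp add: sum.delta)
    qed
    ultimately show ?thesis by simp
  qed
  then have "approx f"
  proof (rule approx_lim[OF _ fm L2.scale[OF fL, of 3]])
    fix n p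
    have "\<bar>G n p\<bar> \<le> 2 * \<bar>f p\<bar>" using G(3)[of n p] by (simp add: dist_real_def)
    then show "\<bar>f p - G n p\<bar> \<le> \<bar>3 * f p\<bar>" by (simp add: abs_mult)
  qed (rule G(2))
  then show ?thesis using F ae by (rule approx_cong)
qed

lemma density:
  assumes "F \<in> L2 S" "0 < \<epsilon>" obtains \<phi> where "\<phi> \<in> TS I J" "L2.nm S (\<lambda>p. F p - \<phi> p) < \<epsilon>"
  using approx_L2[OF assms(1)] assms(2) unfolding approx_def by blast

lemma L2_zero_AE: assumes "f \<in> L2 S" "L2_inner S f f = 0" shows "AE p in lebesgue_on S. f p = 0"
proof -
  have "AE p in lebesgue_on S. f p * f p = 0"
    using assms(2) integral_nonneg_eq_0_iff_AE[OF L2_integrable_mult[OF assms(1,1)]]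
    by (simp add: L2_inner_def)
  then show ?thesis by simp
qed

lemma fundamental_lemma:
  assumes f: "f \<in> L2 S" and z: "\<And>\<phi>. \<phi> \<in> TS I J \<Longrightarrow> L2_inner S f \<phi> = 0"
  shows "AE p in lebesgue_on S. f p = 0"
proof (rule L2_zero_AE[OF f])
  have "L2.nm S f * L2.nm S f \<le> L2.nm S f * \<epsilon>" if e: "0 < \<epsilon>" for \<epsilon>
  proof -
    obtain \<phi> where p: "\<phi> \<in> TS I J" "L2.nm S (\<lambda>p. f p - \<phi> p) < \<epsilon>" using density[OF f e] by blast
    have "L2.nm S f * L2.nm S f = L2_inner S f f" using L2.nm_sq[OF f] by (simp add: power2_eq_square)
    also have "\<dots> = L2_inner S f (\<lambda>p. f p - \<phi> p)"
      using z[OF p(1)] by (simp add: L2.ip_diff_right f TS_L2[OF p(1)])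
    also have "\<dots> \<le> L2.nm S f * L2.nm S (\<lambda>p. f p - \<phi> p)"
      using L2.Cauchy_Schwarz[OF f L2.diff[OF f TS_L2[OF p(1)]]] by simp
    also have "\<dots> \<le> L2.nm S f * \<epsilon>" using p(2) f by (intro mult_left_mono) auto
    finally show ?thesis .
  qed
  then have "L2.nm S f \<le> \<epsilon>" if "0 < \<epsilon>" for \<epsilon>
    using that L2.nm_nonneg[OF f] by (cases "L2.nm S f = 0") auto
  then have "L2.nm S f \<le> 0" using dense_ge by blast
  then have "L2.nm S f = 0" using L2.nm_nonneg[OF f] by simp
  then show "L2_inner S f f = 0" using L2.nm_sq[OF f] by simp
qed

text \<open>Needed because \<open>weak_deriv\<close> is an arbitrary choice: a derivative that is computed by hand has to agree
  with the chosen one.\<close>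

lemma weak2_unique:
  assumes w: "weak2 S w w1 w2" and z: "weak2 S w z1 z2"
  shows "AE p in lebesgue_on S. w2 j k p = z2 j k p"
proof -
  note W = weak2D[OF w] and Z = weak2D[OF z]
  have 2: "AE p in lebesgue_on S. w2 j k p = z2 j k p" if jk: "j \<or> \<not> k" for j k
  proof -
    have "AE p in lebesgue_on S. w2 j k p - z2 j k p = 0"
    proof (rule fundamental_lemma[OF L2.diff[OF W(3) Z(3)]])
      fix \<phi> assume p: "\<phi> \<in> TS I J"
      show "L2_inner S (\<lambda>p. w2 j k p - z2 j k p) \<phi> = 0"
        using W(6)[OF TS_test[OF p] jk] Z(6)[OF TS_test[OF p] jk]
        by (simp add: L2.ip_diff W(3) Z(3) TS_L2[OF p])
    qed
    then show ?thesis by simp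
  qed
  show "AE p in lebesgue_on S. w2 j k p = z2 j k p"
    using 2[of j k] 2[of k j] W(4)[of j k] Z(4)[of j k] by (cases "j \<or> \<not> k") auto
qed

subsection \<open>Difference quotients\<close>

lemma nm_UNIV: "(\<And>p. p \<notin> S \<Longrightarrow> f p = 0) \<Longrightarrow> L2.nm UNIV f = L2.nm S f"
  unfolding L2.nm_def by (subst L2_inner_UNIV[OF S_sets]) auto

lemma density_UNIV:
  assumes F: "F \<in> L2 UNIV" "\<And>p. p \<notin> S \<Longrightarrow> F p = 0" and e: "0 < \<epsilon>"
  obtains \<phi> where "\<phi> \<in> TS I J" "L2.nm UNIV (\<lambda>p. F p - \<phi> p) < \<epsilon>"
proof -
  obtain \<phi> where p: "\<phi> \<in> TS I J" "L2.nm S (\<lambda>p. F p - \<phi> p) < \<epsilon>"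
    using density[OF L2_UNIV_restrict[OF S_sets F(1)] e] by blast
  moreover have "L2.nm UNIV (\<lambda>p. F p - \<phi> p) = L2.nm S (\<lambda>p. F p - \<phi> p)"
    by (rule nm_UNIV) (simp add: F(2) TS_zero[OF p(1)])
  ultimately show ?thesis using that by simp
qed

lemma L1_bound:
  assumes f: "f \<in> L2 UNIV" "\<And>p. p \<notin> S \<Longrightarrow> f p = 0"
  obtains N where "0 \<le> N" "\<And>r K. r \<in> L2 UNIV \<Longrightarrow> (\<And>p. \<bar>r p\<bar> \<le> K) \<Longrightarrow> \<bar>L2_inner UNIV f r\<bar> \<le> K * N"
proof
  have fS: "f \<in> L2 S" by (rule L2_UNIV_restrict[OF S_sets f(1)])
  show "0 \<le> (\<integral>p. \<bar>f p\<bar> \<partial>lebesgue_on S)" by simp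
  fix r :: "real \<times> real \<Rightarrow> real" and K assume r: "r \<in> L2 UNIV" "\<And>p. \<bar>r p\<bar> \<le> K"
  have rS: "r \<in> L2 S" by (rule L2_UNIV_restrict[OF S_sets r(1)])
  have "\<bar>L2_inner UNIV f r\<bar> = \<bar>\<integral>p. f p * r p \<partial>lebesgue_on S\<bar>"
    by (subst L2_inner_UNIV[OF S_sets]) (use f(2) in \<open>auto simp: L2_inner_def\<close>)
  also have "\<dots> \<le> (\<integral>p. \<bar>f p * r p\<bar> \<partial>lebesgue_on S)" by (rule integral_abs_bound)
  also have "\<dots> \<le> (\<integral>p. K * \<bar>f p\<bar> \<partial>lebesgue_on S)"
  proof (rule integral_mono)
    show "integrable (lebesgue_on S) (\<lambda>p. \<bar>f p * r p\<bar>)" by (rule integrable_abs[OF L2_integrable_mult[OF fS rS]])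
    show "integrable (lebesgue_on S) (\<lambda>p. K * \<bar>f p\<bar>)" using L2_integrable[OF fS] by simp
    show "\<bar>f p * r p\<bar> \<le> K * \<bar>f p\<bar>" for p
      using mult_right_mono[OF r(2)[of p], of "\<bar>f p\<bar>"] by (simp add: abs_mult mult.commute)
  qed
  finally show "\<bar>L2_inner UNIV f r\<bar> \<le> K * (\<integral>p. \<bar>f p\<bar> \<partial>lebesgue_on S)" by simp
qed

end

lemma Dfun_shift: "a \<in> Dfun UNIV \<Longrightarrow> (\<lambda>x. a (x + h)) \<in> Dfun UNIV"
proof -
  assume "a \<in> Dfun UNIV"
  then obtain lo hi where a: "smooth1 a" "\<And>x. x \<notin> {lo..hi} \<Longrightarrow> a x = 0" by (auto simp: Dfun_def)
  have "smooth1 (\<lambda>x. a (x + h))" using smooth1_affine[OF a(1), of 1 h] by simp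
  moreover have "\<forall>x. x \<notin> {lo - h..hi - h} \<longrightarrow> a (x + h) = 0" using a(2) by auto
  ultimately show ?thesis unfolding Dfun_def by blast
qed

lemma TS_shift: "\<phi> \<in> TS UNIV UNIV \<Longrightarrow> (\<lambda>p. \<phi> (p + v)) \<in> TS UNIV UNIV"
proof (induction rule: TS.induct)
  case (tensor a b)
  show ?case using TS.tensor[OF Dfun_shift[OF tensor(1), of "fst v"] Dfun_shift[OF tensor(2), of "snd v"]] by simp
qed (rule TS.plus)

lemma TS_UNIV_L2: "\<phi> \<in> TS I J \<Longrightarrow> \<phi> \<in> L2 UNIV"
  by (rule test_L2_UNIV(1)[OF TS_test])

text \<open>The symmetric quotient is skew-adjoint on \<open>L2\<close> of the plane. At \<open>h = 0\<close> it is \<open>0\<close>, so bounds that are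
  uniform in \<open>h\<close> include this value.\<close>

definition dq :: "bool \<Rightarrow> real \<Rightarrow> (real \<times> real \<Rightarrow> real) \<Rightarrow> real \<times> real \<Rightarrow> real" where
  "dq k h f = (\<lambda>p. (f (p + h *\<^sub>R dir k) - f (p + (- h) *\<^sub>R dir k)) / (2 * h))"

lemma dq_L2: "f \<in> L2 UNIV \<Longrightarrow> dq k h f \<in> L2 UNIV"
  unfolding dq_def by (intro L2.divide L2.diff L2_shift)

lemma dq_inner:
  assumes "f \<in> L2 UNIV" "g \<in> L2 UNIV"
  shows "L2_inner UNIV g (dq k h f) = (L2_inner UNIV g (\<lambda>p. f (p + h *\<^sub>R dir k)) - L2_inner UNIV g (\<lambda>p. f (p + (- h) *\<^sub>R dir k))) / (2 * h)"
  unfolding dq_def by (simp add: L2.ip_divide_right L2.ip_diff_right L2.diff L2_shift assms del: scaleR_minus_left)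

lemma dq_skew:
  assumes "f \<in> L2 UNIV" "g \<in> L2 UNIV"
  shows "L2_inner UNIV g (dq k h f) = - L2_inner UNIV (dq k h g) f"
proof -
  have "L2_inner UNIV g (\<lambda>p. f (p + v)) = L2_inner UNIV (\<lambda>p. g (p - v)) f" for v
    using L2_inner_shift[OF assms, of v] L2.ip_sym L2_shift[OF assms(1), of v] L2_shift[OF assms(2), of "- v"] assms by simp
  from this[of "h *\<^sub>R dir k"] this[of "(- h) *\<^sub>R dir k"] show ?thesis
    using dq_inner[OF assms, of k h] dq_inner[OF assms(2,1), of k h] L2.ip_sym[OF assms(1) dq_L2[OF assms(2)], of k h]
      L2.ip_sym[OF assms(1) L2_shift[OF assms(2), of "h *\<^sub>R dir k"]] L2.ip_sym[OF assms(1) L2_shift[OF assms(2), of "(- h) *\<^sub>R dir k"]]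
    by (simp add: minus_divide_left)
qed

context open_box
begin

text \<open>Shift the translation to the test function and use its Taylor expansion with uniform error.\<close>

lemma translation_deriv:
  assumes f: "f \<in> L2 UNIV" "\<And>p. p \<notin> S \<Longrightarrow> f p = 0"
    and phi: "\<phi> \<in> TS UNIV UNIV"
  shows "((\<lambda>s. L2_inner UNIV (\<lambda>p. f (p + s *\<^sub>R dir k)) \<phi>) has_real_derivative
     - L2_inner UNIV f (pd k (\<lambda>p. \<phi> (p + (- s) *\<^sub>R dir k)))) (at s)"
proof -
  define \<psi> where "\<psi> = (\<lambda>p. \<phi> (p + (- s) *\<^sub>R dir k))"
  have psi: "\<psi> \<in> TS UNIV UNIV" unfolding \<psi>_def by (rule TS_shift[OF phi])
  obtain K where K: "0 \<le> K" "\<And>p r. \<bar>\<psi> (p + r *\<^sub>R dir k) - \<psi> p - r * pd k \<psi> p\<bar> \<le> K * r\<^sup>2"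
    using TS_Taylor[OF psi] by metis
  obtain N where N: "0 \<le> N" "\<And>r K. r \<in> L2 UNIV \<Longrightarrow> (\<And>p. \<bar>r p\<bar> \<le> K) \<Longrightarrow> \<bar>L2_inner UNIV f r\<bar> \<le> K * N"
    using L1_bound[OF f] by metis
  let ?k = "\<lambda>s. L2_inner UNIV (\<lambda>p. f (p + s *\<^sub>R dir k)) \<phi>"
  have L: "\<psi> \<in> L2 UNIV" "pd k \<psi> \<in> L2 UNIV" "(\<lambda>p. \<psi> (p + v)) \<in> L2 UNIV" for v
    by (rule TS_UNIV_L2[OF psi] TS_UNIV_L2[OF TS_pd[OF psi]] L2_shift[OF TS_UNIV_L2[OF psi]])+
  have keq: "?k (s + r) = L2_inner UNIV f (\<lambda>p. \<psi> (p + (- r) *\<^sub>R dir k))" for r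
    unfolding L2_inner_shift[OF f(1) TS_UNIV_L2[OF phi]] by (simp add: \<psi>_def algebra_simps)
  have bd: "\<bar>?k (s + r) - ?k s - r * (- L2_inner UNIV f (pd k \<psi>))\<bar> \<le> K * r\<^sup>2 * N" for r
  proof -
    have mem: "(\<lambda>p. \<psi> (p + (- r) *\<^sub>R dir k) - \<psi> p - (- r) * pd k \<psi> p) \<in> L2 UNIV"
      by (intro L2.diff L L2.scale)
    have "\<bar>L2_inner UNIV f (\<lambda>p. \<psi> (p + (- r) *\<^sub>R dir k) - \<psi> p - (- r) * pd k \<psi> p)\<bar> \<le> (K * r\<^sup>2) * N"
      using K(2)[of _ "- r"] by (intro N(2)[OF mem]) simp
    moreover have "L2_inner UNIV f (\<lambda>p. \<psi> (p + (- r) *\<^sub>R dir k) - \<psi> p - (- r) * pd k \<psi> p)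
      = L2_inner UNIV f (\<lambda>p. \<psi> (p + (- r) *\<^sub>R dir k)) - L2_inner UNIV f \<psi> - (- r) * L2_inner UNIV f (pd k \<psi>)"
      using L f by (simp only: L2.ip_diff_right L2.diff L2.scale L2.ip_scale_right)
    moreover have "?k s = L2_inner UNIV f \<psi>" using keq[of 0] by simp
    ultimately show ?thesis using keq[of r] by simp
  qed
  have "((\<lambda>r. (?k (s + r) - ?k s) / r - (- L2_inner UNIV f (pd k \<psi>))) \<longlongrightarrow> 0) (at 0)"
  proof (rule Lim_null_comparison)
    have "((\<lambda>r::real. K * N * \<bar>r\<bar>) \<longlongrightarrow> K * N * \<bar>0\<bar>) (at 0)" by (intro tendsto_intros)
    then show "((\<lambda>r::real. K * N * \<bar>r\<bar>) \<longlongrightarrow> 0) (at 0)" by simp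
    show "\<forall>\<^sub>F r in at 0. norm ((?k (s + r) - ?k s) / r - (- L2_inner UNIV f (pd k \<psi>))) \<le> K * N * \<bar>r\<bar>"
    proof (rule eventually_at_filter[THEN iffD2], rule always_eventually, safe)
      fix r :: real assume r: "r \<noteq> 0"
      have "(?k (s + r) - ?k s) / r - (- L2_inner UNIV f (pd k \<psi>))
         = (?k (s + r) - ?k s - r * (- L2_inner UNIV f (pd k \<psi>))) / r"
        using r by (simp add: diff_divide_distrib add_divide_distrib)
      moreover have "\<bar>?k (s + r) - ?k s - r * (- L2_inner UNIV f (pd k \<psi>))\<bar> / \<bar>r\<bar> \<le> K * N * \<bar>r\<bar>"
      proof -
        have "\<bar>?k (s + r) - ?k s - r * (- L2_inner UNIV f (pd k \<psi>))\<bar> \<le> K * N * \<bar>r\<bar> * \<bar>r\<bar>"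
          using bd[of r] by (simp add: power2_eq_square mult_ac flip: abs_mult)
        then show ?thesis using r by (simp add: pos_divide_le_eq)
      qed
      ultimately show "norm ((?k (s + r) - ?k s) / r - (- L2_inner UNIV f (pd k \<psi>))) \<le> K * N * \<bar>r\<bar>"
        by (simp only: real_norm_def abs_divide)
    qed
  qed
  then have "((\<lambda>r. (?k (s + r) - ?k s) / r) \<longlongrightarrow> - L2_inner UNIV f (pd k \<psi>)) (at 0)"
    by (rule LIM_zero_cancel)
  then show ?thesis unfolding DERIV_def \<psi>_def .
qed

context
  fixes f f' :: "real \<times> real \<Rightarrow> real" and k :: bool
  assumes f: "f \<in> L2 UNIV" "\<And>p. p \<notin> S \<Longrightarrow> f p = 0" and f': "f' \<in> L2 UNIV"
    and weak: "\<And>\<phi>. \<phi> \<in> TS UNIV UNIV \<Longrightarrow> L2_inner UNIV f (pd k \<phi>) = - L2_inner UNIV f' \<phi>"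
begin

lemma translation_weak_deriv:
  assumes phi: "\<phi> \<in> TS UNIV UNIV"
  shows "((\<lambda>s. L2_inner UNIV (\<lambda>p. f (p + s *\<^sub>R dir k)) \<phi>) has_real_derivative
     L2_inner UNIV f' (\<lambda>p. \<phi> (p + (- s) *\<^sub>R dir k))) (at s)"
  using translation_deriv[OF f phi, of k s] unfolding weak[OF TS_shift[OF phi]] minus_minus .

text \<open>The pairing with the translated function is differentiable in the shift, with derivative at most
  the product of the norms; the mean value theorem gives the bound and the derivative at \<open>0\<close> the limit.\<close>

lemma dq_TS:
  assumes phi: "\<phi> \<in> TS UNIV UNIV"
  shows "\<bar>L2_inner UNIV \<phi> (dq k h f)\<bar> \<le> L2.nm UNIV \<phi> * L2.nm UNIV f'"
    "((\<lambda>h. L2_inner UNIV \<phi> (dq k h f)) \<longlongrightarrow> L2_inner UNIV \<phi> f') (at 0)"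
proof -
  let ?k = "\<lambda>s. L2_inner UNIV (\<lambda>p. f (p + s *\<^sub>R dir k)) \<phi>"
  let ?C = "L2.nm UNIV \<phi> * L2.nm UNIV f'"
  have p: "\<phi> \<in> L2 UNIV" by (rule TS_UNIV_L2[OF phi])
  have C: "0 \<le> ?C" using p f' by simp
  have e: "L2_inner UNIV \<phi> (dq k h f) = (?k h - ?k (- h)) / (2 * h)" for h
    unfolding dq_inner[OF f(1) p] by (simp only: L2.ip_sym[OF p L2_shift[OF f(1)]])
  show "\<bar>L2_inner UNIV \<phi> (dq k h f)\<bar> \<le> ?C"
  proof (cases "h = 0")
    case False
    have "norm (?k h - ?k (- h)) \<le> ?C * norm (h - (- h))"
    proof (rule field_differentiable_bound[where S=UNIV and f="?k" and f'="\<lambda>s. L2_inner UNIV f' (\<lambda>p. \<phi> (p + (- s) *\<^sub>R dir k))"])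
      fix s
      show "(?k has_field_derivative L2_inner UNIV f' (\<lambda>p. \<phi> (p + (- s) *\<^sub>R dir k))) (at s within UNIV)"
        by (rule translation_weak_deriv[OF phi])
      show "norm (L2_inner UNIV f' (\<lambda>p. \<phi> (p + (- s) *\<^sub>R dir k))) \<le> ?C"
        using L2.Cauchy_Schwarz[OF f' L2_shift[OF p, of "(- s) *\<^sub>R dir k"]] L2_nm_shift[OF p, of "(- s) *\<^sub>R dir k"]
        by (simp add: mult.commute)
    qed auto
    then have "\<bar>?k h - ?k (- h)\<bar> \<le> ?C * \<bar>2 * h\<bar>" by simp
    then show ?thesis unfolding e using False by (simp add: pos_divide_le_eq)
  qed (use e[of 0] C in simp)
  have D: "(?k has_real_derivative L2_inner UNIV f' \<phi>) (at 0)" using translation_weak_deriv[OF phi, of 0] by simp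
  then have 1: "((\<lambda>h. (?k h - ?k 0) / h) \<longlongrightarrow> L2_inner UNIV f' \<phi>) (at 0)" by (simp add: has_field_derivative_iff)
  have "filterlim (\<lambda>h::real. - h) (at 0) (at 0)"
    by (auto simp: filterlim_at eventually_at_filter intro!: tendsto_eq_intros)
  from filterlim_compose[OF 1 this] have 2: "((\<lambda>h. (?k (- h) - ?k 0) / (- h)) \<longlongrightarrow> L2_inner UNIV f' \<phi>) (at 0)" .
  have "((\<lambda>h. ((?k h - ?k 0) / h + (?k (- h) - ?k 0) / (- h)) / 2) \<longlongrightarrow> (L2_inner UNIV f' \<phi> + L2_inner UNIV f' \<phi>) / 2) (at 0)"
    by (intro tendsto_divide tendsto_add 1 2 tendsto_const) simp
  moreover have "((?k h - ?k 0) / h + (?k (- h) - ?k 0) / (- h)) / 2 = L2_inner UNIV \<phi> (dq k h f)" for h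
    unfolding e by (cases "h = 0") (simp_all add: field_simps)
  ultimately show "((\<lambda>h. L2_inner UNIV \<phi> (dq k h f)) \<longlongrightarrow> L2_inner UNIV \<phi> f') (at 0)"
    by (simp add: L2.ip_sym[OF f' p])
qed

text \<open>By density the bound and the limit pass from test functions to all of \<open>L2\<close>.\<close>

lemma dq_weak_limit:
  assumes F: "F \<in> L2 UNIV" "\<And>p. p \<notin> S \<Longrightarrow> F p = 0"
  shows "\<bar>L2_inner UNIV F (dq k h f)\<bar> \<le> L2.nm UNIV F * L2.nm UNIV f'"
    "((\<lambda>h. L2_inner UNIV F (dq k h f)) \<longlongrightarrow> L2_inner UNIV F f') (at 0)"
proof -
  have bd: "\<bar>L2_inner UNIV F (dq k h f)\<bar> \<le> L2.nm UNIV F * L2.nm UNIV f'" if F: "F \<in> L2 UNIV" "\<And>p. p \<notin> S \<Longrightarrow> F p = 0" for F h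
  proof (rule field_le_epsilon)
    fix \<epsilon> :: real assume "0 < \<epsilon>"
    define M where "M = L2.nm UNIV (dq k h f) + L2.nm UNIV f' + 1"
    have M: "0 < M" using dq_L2[OF f(1), of k h] f' by (simp add: M_def add_nonneg_pos)
    with \<open>0 < \<epsilon>\<close> have "0 < \<epsilon> / M" by simp
    then obtain \<phi> where phi: "\<phi> \<in> TS I J" and n: "L2.nm UNIV (\<lambda>p. F p - \<phi> p) < \<epsilon> / M"
      using density_UNIV[OF F] by blast
    have p: "\<phi> \<in> L2 UNIV" by (rule TS_UNIV_L2[OF phi])
    have D: "(\<lambda>p. F p - \<phi> p) \<in> L2 UNIV" by (rule L2.diff[OF F(1) p])
    have D': "(\<lambda>p. \<phi> p - F p) \<in> L2 UNIV" by (rule L2.diff[OF p F(1)])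
    have "L2_inner UNIV F (dq k h f) = L2_inner UNIV (\<lambda>p. F p - \<phi> p) (dq k h f) + L2_inner UNIV \<phi> (dq k h f)"
      by (simp add: L2.ip_diff F p dq_L2 f)
    moreover have "\<bar>L2_inner UNIV (\<lambda>p. F p - \<phi> p) (dq k h f)\<bar> \<le> L2.nm UNIV (\<lambda>p. F p - \<phi> p) * L2.nm UNIV (dq k h f)"
      by (rule L2.Cauchy_Schwarz[OF D dq_L2[OF f(1)]])
    moreover have "\<bar>L2_inner UNIV \<phi> (dq k h f)\<bar> \<le> L2.nm UNIV \<phi> * L2.nm UNIV f'"
      by (rule dq_TS(1)[OF TS_mono[OF phi]])
    moreover have "L2.nm UNIV \<phi> \<le> L2.nm UNIV (\<lambda>p. F p - \<phi> p) + L2.nm UNIV F"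
      using L2.nm_triangle[OF D' F(1)] L2.nm_commute[OF F(1) p] by simp
    then have "L2.nm UNIV \<phi> * L2.nm UNIV f' \<le> (L2.nm UNIV (\<lambda>p. F p - \<phi> p) + L2.nm UNIV F) * L2.nm UNIV f'"
      using f' by (intro mult_right_mono) auto
    ultimately have "\<bar>L2_inner UNIV F (dq k h f)\<bar> \<le> L2.nm UNIV F * L2.nm UNIV f' + L2.nm UNIV (\<lambda>p. F p - \<phi> p) * (L2.nm UNIV (dq k h f) + L2.nm UNIV f')"
      by (simp add: algebra_simps)
    also have "L2.nm UNIV (\<lambda>p. F p - \<phi> p) * (L2.nm UNIV (dq k h f) + L2.nm UNIV f') \<le> \<epsilon> / M * M"
      using n D dq_L2[OF f(1), of k h] f' \<open>0 < \<epsilon> / M\<close> by (intro mult_mono) (auto simp: M_def)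
    also have "\<epsilon> / M * M = \<epsilon>" using M by simp
    finally show "\<bar>L2_inner UNIV F (dq k h f)\<bar> \<le> L2.nm UNIV F * L2.nm UNIV f' + \<epsilon>" by simp
  qed
  then show "\<bar>L2_inner UNIV F (dq k h f)\<bar> \<le> L2.nm UNIV F * L2.nm UNIV f'" using F by blast
  show "((\<lambda>h. L2_inner UNIV F (dq k h f)) \<longlongrightarrow> L2_inner UNIV F f') (at 0)"
  proof (rule tendstoI)
    fix \<epsilon> :: real assume "0 < \<epsilon>"
    define M where "M = 2 * L2.nm UNIV f' + 1"
    have M: "0 < M" using f' by (simp add: M_def add_nonneg_pos)
    have "0 < \<epsilon> / 2 / M" using \<open>0 < \<epsilon>\<close> M by simp
    then obtain \<phi> where phi: "\<phi> \<in> TS I J" and n: "L2.nm UNIV (\<lambda>p. F p - \<phi> p) < \<epsilon> / 2 / M"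
      using density_UNIV[OF F] by blast
    have p: "\<phi> \<in> L2 UNIV" by (rule TS_UNIV_L2[OF phi])
    have D: "(\<lambda>p. F p - \<phi> p) \<in> L2 UNIV" by (rule L2.diff[OF F(1) p])
    have z: "p \<notin> S \<Longrightarrow> F p - \<phi> p = 0" for p using F(2) TS_zero[OF phi] by simp
    have small: "2 * (L2.nm UNIV (\<lambda>p. F p - \<phi> p) * L2.nm UNIV f') \<le> \<epsilon> / 2"
    proof -
      have "L2.nm UNIV (\<lambda>p. F p - \<phi> p) * (2 * L2.nm UNIV f') \<le> \<epsilon> / 2 / M * M"
        using n D f' \<open>0 < \<epsilon> / 2 / M\<close> by (intro mult_mono) (auto simp: M_def)
      then show ?thesis using M by (simp add: mult_ac)
    qed
    have "\<forall>\<^sub>F h in at 0. dist (L2_inner UNIV \<phi> (dq k h f)) (L2_inner UNIV \<phi> f') < \<epsilon> / 2"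
      using dq_TS(2)[OF TS_mono[OF phi]] \<open>0 < \<epsilon>\<close> by (intro tendstoD) auto
    then show "\<forall>\<^sub>F h in at 0. dist (L2_inner UNIV F (dq k h f)) (L2_inner UNIV F f') < \<epsilon>"
    proof eventually_elim
      case (elim h)
      have "L2_inner UNIV F (dq k h f) = L2_inner UNIV (\<lambda>p. F p - \<phi> p) (dq k h f) + L2_inner UNIV \<phi> (dq k h f)"
        "L2_inner UNIV F f' = L2_inner UNIV (\<lambda>p. F p - \<phi> p) f' + L2_inner UNIV \<phi> f'"
        by (simp_all add: L2.ip_diff F p dq_L2 f f')
      moreover have "\<bar>L2_inner UNIV (\<lambda>p. F p - \<phi> p) (dq k h f)\<bar> \<le> L2.nm UNIV (\<lambda>p. F p - \<phi> p) * L2.nm UNIV f'"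
        by (rule bd[OF D z])
      moreover have "\<bar>L2_inner UNIV (\<lambda>p. F p - \<phi> p) f'\<bar> \<le> L2.nm UNIV (\<lambda>p. F p - \<phi> p) * L2.nm UNIV f'"
        by (rule L2.Cauchy_Schwarz[OF D f'])
      ultimately show ?case using elim small unfolding dist_real_def by linarith
    qed
  qed
qed

end

text \<open>Let the step tend to zero in the skew-adjointness of the symmetric difference quotient.\<close>

lemma integration_by_parts:
  assumes f: "f \<in> L2 UNIV" "\<And>p. p \<notin> S \<Longrightarrow> f p = 0" and f': "f' \<in> L2 UNIV"
    and wf: "\<And>\<phi>. \<phi> \<in> TS UNIV UNIV \<Longrightarrow> L2_inner UNIV f (pd k \<phi>) = - L2_inner UNIV f' \<phi>"
    and h: "h \<in> L2 UNIV" "\<And>p. p \<notin> S \<Longrightarrow> h p = 0" and h': "h' \<in> L2 UNIV"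
    and wh: "\<And>\<phi>. \<phi> \<in> TS UNIV UNIV \<Longrightarrow> L2_inner UNIV h (pd k \<phi>) = - L2_inner UNIV h' \<phi>"
  shows "L2_inner UNIV f h' = - L2_inner UNIV f' h"
proof -
  have 1: "((\<lambda>s. L2_inner UNIV f (dq k s h)) \<longlongrightarrow> L2_inner UNIV f h') (at 0)"
    by (rule dq_weak_limit(2)[OF h h' wh f])
  have "((\<lambda>s. L2_inner UNIV h (dq k s f)) \<longlongrightarrow> L2_inner UNIV h f') (at 0)"
    by (rule dq_weak_limit(2)[OF f f' wf h])
  moreover have "L2_inner UNIV h (dq k s f) = - L2_inner UNIV f (dq k s h)" for s
    using dq_skew[OF f(1) h(1), of k s] L2.ip_sym[OF f(1) dq_L2[OF h(1)], of k s] by simp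
  ultimately have "((\<lambda>s. - L2_inner UNIV f (dq k s h)) \<longlongrightarrow> L2_inner UNIV h f') (at 0)" by simp
  from tendsto_minus[OF this] have 2: "((\<lambda>s. L2_inner UNIV f (dq k s h)) \<longlongrightarrow> - L2_inner UNIV h f') (at 0)" by simp
  show ?thesis using LIM_unique[OF 1 2] L2.ip_sym[OF h(1) f'] by simp
qed

text \<open>By density it is enough to test against tensor sums, where the pairing is even differentiable in
  the shift; the norm of a translate does not depend on the shift.\<close>

lemma translation_continuous:
  assumes f: "f \<in> L2 UNIV" "\<And>p. p \<notin> S \<Longrightarrow> f p = 0"
    and F: "F \<in> L2 UNIV" "\<And>p. p \<notin> S \<Longrightarrow> F p = 0"
  shows "((\<lambda>s. L2_inner UNIV F (\<lambda>p. f (p + s *\<^sub>R dir k))) \<longlongrightarrow> L2_inner UNIV F f) (at 0)"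
proof (rule tendstoI)
  fix \<epsilon> :: real assume "0 < \<epsilon>"
  define M where "M = 2 * L2.nm UNIV f + 1"
  have M: "0 < M" using f by (simp add: M_def add_nonneg_pos)
  have "0 < \<epsilon> / 2 / M" using \<open>0 < \<epsilon>\<close> M by simp
  then obtain \<phi> where phi: "\<phi> \<in> TS I J" and n: "L2.nm UNIV (\<lambda>p. F p - \<phi> p) < \<epsilon> / 2 / M"
    using density_UNIV[OF F] by blast
  have p: "\<phi> \<in> L2 UNIV" by (rule TS_UNIV_L2[OF phi])
  have D: "(\<lambda>p. F p - \<phi> p) \<in> L2 UNIV" by (rule L2.diff[OF F(1) p])
  have small: "2 * (L2.nm UNIV (\<lambda>p. F p - \<phi> p) * L2.nm UNIV f) \<le> \<epsilon> / 2"
  proof -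
    have "L2.nm UNIV (\<lambda>p. F p - \<phi> p) * (2 * L2.nm UNIV f) \<le> \<epsilon> / 2 / M * M"
      using n D f \<open>0 < \<epsilon> / 2 / M\<close> by (intro mult_mono) (auto simp: M_def)
    then show ?thesis using M by (simp add: mult_ac)
  qed
  have "isCont (\<lambda>s. L2_inner UNIV (\<lambda>p. f (p + s *\<^sub>R dir k)) \<phi>) 0"
    by (rule DERIV_isCont[OF translation_deriv[OF f TS_mono[OF phi]]])
  then have "((\<lambda>s. L2_inner UNIV \<phi> (\<lambda>p. f (p + s *\<^sub>R dir k))) \<longlongrightarrow> L2_inner UNIV \<phi> f) (at 0)"
    unfolding isCont_def by (simp only: L2.ip_sym[OF L2_shift[OF f(1)] p] L2.ip_sym[OF f(1) p] scaleR_zero_left add_0_right)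
  then have "\<forall>\<^sub>F s in at 0. dist (L2_inner UNIV \<phi> (\<lambda>p. f (p + s *\<^sub>R dir k))) (L2_inner UNIV \<phi> f) < \<epsilon> / 2"
    using \<open>0 < \<epsilon>\<close> by (intro tendstoD) auto
  then show "\<forall>\<^sub>F s in at 0. dist (L2_inner UNIV F (\<lambda>p. f (p + s *\<^sub>R dir k))) (L2_inner UNIV F f) < \<epsilon>"
  proof eventually_elim
    case (elim s)
    have fs: "(\<lambda>p. f (p + s *\<^sub>R dir k)) \<in> L2 UNIV" by (rule L2_shift[OF f(1)])
    have "L2_inner UNIV F (\<lambda>p. f (p + s *\<^sub>R dir k)) = L2_inner UNIV (\<lambda>p. F p - \<phi> p) (\<lambda>p. f (p + s *\<^sub>R dir k)) + L2_inner UNIV \<phi> (\<lambda>p. f (p + s *\<^sub>R dir k))"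
      "L2_inner UNIV F f = L2_inner UNIV (\<lambda>p. F p - \<phi> p) f + L2_inner UNIV \<phi> f"
      by (simp_all add: L2.ip_diff F p fs f)
    moreover have "\<bar>L2_inner UNIV (\<lambda>p. F p - \<phi> p) (\<lambda>p. f (p + s *\<^sub>R dir k))\<bar> \<le> L2.nm UNIV (\<lambda>p. F p - \<phi> p) * L2.nm UNIV f"
      using L2.Cauchy_Schwarz[OF D fs] by (simp add: L2_nm_shift[OF f(1)])
    moreover have "\<bar>L2_inner UNIV (\<lambda>p. F p - \<phi> p) f\<bar> \<le> L2.nm UNIV (\<lambda>p. F p - \<phi> p) * L2.nm UNIV f"
      by (rule L2.Cauchy_Schwarz[OF D f(1)])
    ultimately show ?case using elim small unfolding dist_real_def by linarith
  qed
qed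

text \<open>Discrete form of \<open>\<integral> q f \<partial>f = - \<onehalf> \<integral> \<partial>q f\<^sup>2\<close>: the difference falls on the
  smooth function \<open>q\<close> alone, so nothing has to be known about derivatives of \<open>f\<close>.\<close>

lemma dq_square:
  assumes f: "f \<in> L2 UNIV" and q: "q \<in> TS I J"
  shows "L2_inner UNIV (\<lambda>p. q p * f p) (dq k h f)
    = - (1 / 2) * L2_inner UNIV (\<lambda>p. (q (p + h *\<^sub>R dir k) - q p) / h * f p) (\<lambda>p. f (p + h *\<^sub>R dir k))"
proof -
  let ?v = "h *\<^sub>R dir k"
  obtain K where K: "\<And>p. \<bar>q p\<bar> \<le> K" using TS_bounded[OF q] by metis
  have qm: "(\<lambda>p. q (p + v)) \<in> borel_measurable lebesgue" for v
    using L2_shift[OF TS_UNIV_L2[OF q], of v] by (simp add: L2_def lebesgue_on_UNIV_eq)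
  have L: "(\<lambda>p. q p * f p) \<in> L2 UNIV" "(\<lambda>p. q (p + v) * f p) \<in> L2 UNIV" for v
    by (rule L2_mult_bounded[OF _ f, of _ K]; use qm[of 0] qm[of v] in \<open>simp add: lebesgue_on_UNIV_eq K\<close>)+
  have fs: "(\<lambda>p. f (p + v)) \<in> L2 UNIV" for v by (rule L2_shift[OF f])
  have "L2_inner UNIV (\<lambda>p. q p * f p) (\<lambda>p. f (p + (- h) *\<^sub>R dir k)) = L2_inner UNIV (\<lambda>p. q (p + ?v) * f (p + ?v)) f"
    using L2_inner_shift[OF L(1) f, of ?v] by simp
  also have "\<dots> = L2_inner UNIV (\<lambda>p. q (p + ?v) * f p) (\<lambda>p. f (p + ?v))"
    by (rule L2_inner_cong) simp
  finally have e: "L2_inner UNIV (\<lambda>p. q p * f p) (\<lambda>p. f (p + (- h) *\<^sub>R dir k)) = \<dots>" .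
  have "(\<lambda>p. (q (p + ?v) - q p) / h * f p) = (\<lambda>p. (q (p + ?v) * f p - q p * f p) / h)"
    by (simp add: diff_divide_distrib left_diff_distrib)
  then show ?thesis
    unfolding dq_inner[OF f L(1)] e
    by (simp add: L2.ip_divide L2.ip_diff L2.diff L fs del: scaleR_minus_left)
      (simp add: diff_divide_distrib)
qed

lemma dq_square_limit:
  assumes f: "f \<in> L2 UNIV" "\<And>p. p \<notin> S \<Longrightarrow> f p = 0" and q: "q \<in> TS I J"
  shows "\<exists>C\<ge>0. \<forall>f\<in>L2 UNIV. \<forall>h. \<bar>L2_inner UNIV (\<lambda>p. q p * f p) (dq k h f)\<bar> \<le> C * L2_inner UNIV f f" (is ?bd)
    "((\<lambda>h. L2_inner UNIV (\<lambda>p. q p * f p) (dq k h f)) \<longlongrightarrow> - (1 / 2) * L2_inner UNIV (\<lambda>p. pd k q p * f p) f) (at 0)"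
proof -
  obtain K where K: "0 \<le> K" "\<And>p s. \<bar>q (p + s *\<^sub>R dir k) - q p\<bar> \<le> K * \<bar>s\<bar>" using TS_Lipschitz[OF q] by metis
  obtain K2 where K2: "0 \<le> K2" "\<And>p s. \<bar>q (p + s *\<^sub>R dir k) - q p - s * pd k q p\<bar> \<le> K2 * s\<^sup>2" using TS_Taylor[OF q] by metis
  have qm: "(\<lambda>p. q (p + v)) \<in> borel_measurable lebesgue" for v
    using L2_shift[OF TS_UNIV_L2[OF q], of v] by (simp add: L2_def lebesgue_on_UNIV_eq)
  have pm: "pd k q \<in> borel_measurable lebesgue"
    using TS_UNIV_L2[OF TS_pd[OF q]] by (simp add: L2_def lebesgue_on_UNIV_eq)
  have qd: "\<bar>(q (p + h *\<^sub>R dir k) - q p) / h\<bar> \<le> K" for p h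
    using K(2)[of p h] K(1) by (cases "h = 0") (auto simp: abs_divide pos_divide_le_eq)
  have Lq: "(\<lambda>p. (q (p + h *\<^sub>R dir k) - q p) / h * f p) \<in> L2 UNIV" if "f \<in> L2 UNIV" for f h
    using qm[of 0] qm[of "h *\<^sub>R dir k"] qd by (intro L2_mult_bounded[OF _ that, of _ K]) (auto simp: lebesgue_on_UNIV_eq)
  show ?bd
  proof (intro exI[of _ "K / 2"] conjI ballI allI)
    show "0 \<le> K / 2" using K by simp
    fix f :: "real \<times> real \<Rightarrow> real" and h assume f: "f \<in> L2 UNIV"
    have "L2_inner UNIV (\<lambda>p. (q (p + h *\<^sub>R dir k) - q p) / h * f p) (\<lambda>p. (q (p + h *\<^sub>R dir k) - q p) / h * f p)
       \<le> K\<^sup>2 * L2_inner UNIV f f"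
      by (rule L2_inner_mono[OF Lq[OF f] f]) (unfold abs_mult, intro mult_right_mono qd, simp)
    from real_sqrt_le_mono[OF this]
    have "L2.nm UNIV (\<lambda>p. (q (p + h *\<^sub>R dir k) - q p) / h * f p) \<le> K * L2.nm UNIV f"
      using K(1) by (simp add: L2.nm_def real_sqrt_mult)
    then have "\<bar>L2_inner UNIV (\<lambda>p. (q (p + h *\<^sub>R dir k) - q p) / h * f p) (\<lambda>p. f (p + h *\<^sub>R dir k))\<bar> \<le> (K * L2.nm UNIV f) * L2.nm UNIV f"
      using L2.Cauchy_Schwarz[OF Lq[OF f] L2_shift[OF f], of h "h *\<^sub>R dir k"] f
      unfolding L2_nm_shift[OF f] by (meson L2.nm_nonneg mult_right_mono order_trans)
    also have "\<dots> = K * L2_inner UNIV f f" using L2.nm_sq[OF f] by (simp add: power2_eq_square)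
    finally show "\<bar>L2_inner UNIV (\<lambda>p. q p * f p) (dq k h f)\<bar> \<le> K / 2 * L2_inner UNIV f f"
      unfolding dq_square[OF f q] by (simp add: abs_mult)
  qed
  let ?F = "\<lambda>p. pd k q p * f p"
  obtain K3 where K3: "\<And>p. \<bar>pd k q p\<bar> \<le> K3" using TS_bounded[OF TS_pd[OF q]] by metis
  have F: "?F \<in> L2 UNIV" by (rule L2_mult_bounded[OF _ f(1), of _ K3]) (use pm K3 in \<open>auto simp: lebesgue_on_UNIV_eq\<close>)
  have 1: "((\<lambda>h. L2_inner UNIV ?F (\<lambda>p. f (p + h *\<^sub>R dir k))) \<longlongrightarrow> L2_inner UNIV ?F f) (at 0)"
  proof (rule translation_continuous[OF f F])
    fix p assume "p \<notin> S"
    then have "f p = 0" by (rule f(2))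
    then show "?F p = 0" by (simp only: mult_zero_right)
  qed
  have 2: "((\<lambda>h. L2_inner UNIV (\<lambda>p. (q (p + h *\<^sub>R dir k) - q p) / h * f p - ?F p) (\<lambda>p. f (p + h *\<^sub>R dir k))) \<longlongrightarrow> 0) (at 0)"
  proof (rule Lim_null_comparison)
    have "((\<lambda>h::real. K2 * \<bar>h\<bar> * L2_inner UNIV f f) \<longlongrightarrow> K2 * \<bar>0\<bar> * L2_inner UNIV f f) (at 0)" by (intro tendsto_intros)
    then show "((\<lambda>h::real. K2 * \<bar>h\<bar> * L2_inner UNIV f f) \<longlongrightarrow> 0) (at 0)" by simp
    show "\<forall>\<^sub>F h in at 0. norm (L2_inner UNIV (\<lambda>p. (q (p + h *\<^sub>R dir k) - q p) / h * f p - ?F p) (\<lambda>p. f (p + h *\<^sub>R dir k))) \<le> K2 * \<bar>h\<bar> * L2_inner UNIV f f"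
    proof (rule eventually_at_filter[THEN iffD2], rule always_eventually, safe)
      fix h :: real assume h: "h \<noteq> 0"
      let ?G = "\<lambda>p. (q (p + h *\<^sub>R dir k) - q p) / h * f p - ?F p"
      have G: "?G \<in> L2 UNIV" by (rule L2.diff[OF Lq[OF f(1)] F])
      have "\<bar>?G p\<bar> \<le> (K2 * \<bar>h\<bar>) * \<bar>f p\<bar>" for p
      proof -
        have "?G p = (q (p + h *\<^sub>R dir k) - q p - h * pd k q p) / h * f p"
          using h by (simp add: diff_divide_distrib left_diff_distrib)
        moreover have "\<bar>(q (p + h *\<^sub>R dir k) - q p - h * pd k q p) / h\<bar> \<le> K2 * \<bar>h\<bar>"
          using K2(2)[of p h] h by (simp add: abs_divide pos_divide_le_eq power2_eq_square mult.assoc flip: abs_mult)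
        ultimately show ?thesis by (simp only: abs_mult) (intro mult_right_mono; simp)
      qed
      then have "L2_inner UNIV ?G ?G \<le> (K2 * \<bar>h\<bar>)\<^sup>2 * L2_inner UNIV f f" by (intro L2_inner_mono[OF G f(1)])
      from real_sqrt_le_mono[OF this] have "L2.nm UNIV ?G \<le> (K2 * \<bar>h\<bar>) * L2.nm UNIV f"
        using K2(1) by (simp add: L2.nm_def real_sqrt_mult)
      then have "\<bar>L2_inner UNIV ?G (\<lambda>p. f (p + h *\<^sub>R dir k))\<bar> \<le> ((K2 * \<bar>h\<bar>) * L2.nm UNIV f) * L2.nm UNIV f"
        using L2.Cauchy_Schwarz[OF G L2_shift[OF f(1)], of "h *\<^sub>R dir k"] f(1)
        unfolding L2_nm_shift[OF f(1)] by (meson L2.nm_nonneg mult_right_mono order_trans)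
      also have "\<dots> = K2 * \<bar>h\<bar> * L2_inner UNIV f f" using L2.nm_sq[OF f(1)] by (simp add: power2_eq_square)
      finally show "norm (L2_inner UNIV ?G (\<lambda>p. f (p + h *\<^sub>R dir k))) \<le> K2 * \<bar>h\<bar> * L2_inner UNIV f f" by simp
    qed
  qed
  have "((\<lambda>h. - (1 / 2) * (L2_inner UNIV (\<lambda>p. (q (p + h *\<^sub>R dir k) - q p) / h * f p - ?F p) (\<lambda>p. f (p + h *\<^sub>R dir k))
      + L2_inner UNIV ?F (\<lambda>p. f (p + h *\<^sub>R dir k)))) \<longlongrightarrow> - (1 / 2) * (0 + L2_inner UNIV ?F f)) (at 0)"
    by (intro tendsto_mult tendsto_const tendsto_add 1 2)
  moreover have "- (1 / 2) * (L2_inner UNIV (\<lambda>p. (q (p + h *\<^sub>R dir k) - q p) / h * f p - ?F p) (\<lambda>p. f (p + h *\<^sub>R dir k))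
      + L2_inner UNIV ?F (\<lambda>p. f (p + h *\<^sub>R dir k))) = L2_inner UNIV (\<lambda>p. q p * f p) (dq k h f)" for h
    unfolding dq_square[OF f(1) q] L2.ip_diff[OF Lq[OF f(1)] F L2_shift[OF f(1)]] by simp
  ultimately show "((\<lambda>h. L2_inner UNIV (\<lambda>p. q p * f p) (dq k h f)) \<longlongrightarrow> - (1 / 2) * L2_inner UNIV ?F f) (at 0)"
    by simp
qed

end


section \<open>The energy space\<close>

abbreviation Om :: "real \<Rightarrow> (real \<times> real) set" where
  "Om l \<equiv> {0<..<pi} \<times> {-l<..<l}"

interpretation Om: open_box 0 pi "-l" l for l .

text \<open>The density of \<open>H2_star_inner\<close>, written as \<open>(1 - \<sigma>)\<close> times the product of the Hessians plus
  \<open>\<sigma>\<close> times the product of the Laplacians, from which its positivity is apparent.\<close>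

definition Qf :: "real \<Rightarrow> (bool \<Rightarrow> bool \<Rightarrow> real \<times> real \<Rightarrow> real) \<Rightarrow> (bool \<Rightarrow> bool \<Rightarrow> real \<times> real \<Rightarrow> real) \<Rightarrow> real \<times> real \<Rightarrow> real" where
  "Qf \<sigma> a b p = (1 - \<sigma>) * (a True True p * b True True p + 2 * (a True False p * b True False p) + a False False p * b False False p)
     + \<sigma> * ((a True True p + a False False p) * (b True True p + b False False p))"

definition hsq :: "(bool \<Rightarrow> bool \<Rightarrow> real \<times> real \<Rightarrow> real) \<Rightarrow> real \<times> real \<Rightarrow> real" where
  "hsq a p = (a True True p)\<^sup>2 + 2 * (a True False p)\<^sup>2 + (a False False p)\<^sup>2"

lemma H2_weak2': "w \<in> H2 (Om l) \<Longrightarrow> weak2 (Om l) w (grad l w) (hess l w)"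
  using H2_weak2[of w l] by (simp add: plate_def)

lemma H2_star_inner_Qf: "H2_star_inner l \<sigma> u v = (\<integral>p. Qf \<sigma> (hess l u) (hess l v) p \<partial>lebesgue_on (Om l))"
  unfolding H2_star_inner_def Let_def Qf_def hess_def plate_def
  by (intro Bochner_Integration.integral_cong) (auto simp: algebra_simps)

lemma Qf_integrable:
  assumes "\<And>j k. a j k \<in> L2 S" "\<And>j k. b j k \<in> L2 S"
  shows "integrable (lebesgue_on S) (Qf \<sigma> a b)"
  unfolding Qf_def[abs_def]
  by (intro Bochner_Integration.integrable_add integrable_mult_right L2_integrable_mult L2.add assms)

lemma integral_Qf:
  assumes a: "\<And>j k. a j k \<in> L2 S" and b: "\<And>j k. b j k \<in> L2 S"
  shows "(\<integral>p. Qf \<sigma> a b p \<partial>lebesgue_on S) =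
     (1 - \<sigma>) * (L2_inner S (a True True) (b True True) + 2 * L2_inner S (a True False) (b True False) + L2_inner S (a False False) (b False False))
     + \<sigma> * L2_inner S (\<lambda>p. a True True p + a False False p) (\<lambda>p. b True True p + b False False p)"
proof -
  note i = L2_integrable_mult[OF a b]
  have t: "integrable (lebesgue_on S) (\<lambda>p. (a True True p + a False False p) * (b True True p + b False False p))"
    by (intro L2_integrable_mult L2.add a b)
  have "(\<integral>p. Qf \<sigma> a b p \<partial>lebesgue_on S) = (\<integral>p. (1 - \<sigma>) * (a True True p * b True True p + 2 * (a True False p * b True False p) + a False False p * b False False p) \<partial>lebesgue_on S)
     + (\<integral>p. \<sigma> * ((a True True p + a False False p) * (b True True p + b False False p)) \<partial>lebesgue_on S)"
    unfolding Qf_def by (rule Bochner_Integration.integral_add) (use i t in \<open>auto intro!: Bochner_Integration.integrable_add integrable_mult_right\<close>)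
  then show ?thesis using i t by (simp add: L2_inner_def)
qed

lemma Qf_self_ge: "0 \<le> \<sigma> \<Longrightarrow> (1 - \<sigma>) * hsq a p \<le> Qf \<sigma> a a p"
  by (simp add: Qf_def hsq_def power2_eq_square)

lemma Qf_self_le:
  assumes "0 \<le> \<sigma>" "\<sigma> \<le> 1" shows "Qf \<sigma> a a p \<le> 2 * hsq a p"
proof -
  have "(a True True p + a False False p)\<^sup>2 \<le> 2 * (a True True p)\<^sup>2 + 2 * (a False False p)\<^sup>2"
    using zero_le_power2[of "a True True p - a False False p"] by (simp add: power2_sum power2_diff)
  also have "2 * (a True True p)\<^sup>2 + 2 * (a False False p)\<^sup>2 \<le> 2 * hsq a p" by (simp add: hsq_def)
  finally have "(a True True p + a False False p)\<^sup>2 \<le> 2 * hsq a p" .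
  then have "\<sigma> * (a True True p + a False False p)\<^sup>2 \<le> \<sigma> * (2 * hsq a p)" by (rule mult_left_mono[OF _ assms(1)])
  moreover have "Qf \<sigma> a a p = (1 - \<sigma>) * hsq a p + \<sigma> * (a True True p + a False False p)\<^sup>2"
    by (simp add: Qf_def hsq_def power2_eq_square)
  moreover have "\<sigma> * hsq a p \<le> 1 * hsq a p" using assms by (intro mult_right_mono) (auto simp: hsq_def)
  ultimately show ?thesis by (simp add: algebra_simps)
qed

lemma hsq_nonneg [simp]: "0 \<le> hsq a p" by (simp add: hsq_def)

lemma Qf_young:
  assumes s: "0 \<le> \<sigma>" "\<sigma> \<le> 1" and e: "0 < \<epsilon>"
  shows "\<bar>Qf \<sigma> a b p\<bar> \<le> \<epsilon> * hsq a p + hsq b p / \<epsilon>"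
proof -
  define c where "c r = (\<lambda>j k p. \<epsilon> * a j k p + r * b j k p)" for r
  have "0 \<le> Qf \<sigma> (c r) (c r) p" for r
  proof -
    have "0 \<le> (1 - \<sigma>) * hsq (c r) p" using s by simp
    then show ?thesis using Qf_self_ge[OF s(1), of "c r" p] by linarith
  qed
  moreover have "Qf \<sigma> (c r) (c r) p = \<epsilon>\<^sup>2 * Qf \<sigma> a a p + 2 * \<epsilon> * r * Qf \<sigma> a b p + r\<^sup>2 * Qf \<sigma> b b p" for r
    by (simp add: Qf_def c_def power2_eq_square algebra_simps)
  ultimately have q: "0 \<le> \<epsilon>\<^sup>2 * Qf \<sigma> a a p + 2 * \<epsilon> * r * Qf \<sigma> a b p + r\<^sup>2 * Qf \<sigma> b b p" for r by simp
  have "2 * \<epsilon> * \<bar>Qf \<sigma> a b p\<bar> \<le> \<epsilon>\<^sup>2 * Qf \<sigma> a a p + Qf \<sigma> b b p"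
    using q[of 1] q[of "-1"] e by (cases "0 \<le> Qf \<sigma> a b p") auto
  also have "\<dots> \<le> \<epsilon>\<^sup>2 * (2 * hsq a p) + 2 * hsq b p"
    by (intro add_mono mult_left_mono Qf_self_le s) simp
  finally have "2 * \<epsilon> * \<bar>Qf \<sigma> a b p\<bar> \<le> 2 * \<epsilon> * (\<epsilon> * hsq a p + hsq b p / \<epsilon>)"
    using e by (simp add: power2_eq_square distrib_left mult_ac)
  then show ?thesis using e by simp
qed

locale plate_setting =
  fixes l \<sigma> :: real
  assumes l: "0 < l" and sigma: "0 < \<sigma>" "\<sigma> < 1 / 2"
begin

abbreviation "\<Omega> \<equiv> Om l"
abbreviation "TSO \<equiv> TS {0<..<pi} {-l<..<l}"
abbreviation "B \<equiv> H2_star_inner l \<sigma>"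
abbreviation "V \<equiv> H2_star l"

lemmas Om_sets = Om.S_sets[of l]

lemma V_weak2: "v \<in> V \<Longrightarrow> weak2 \<Omega> v (grad l v) (hess l v)"
  unfolding H2_star_def by (auto simp: plate_def intro: H2_weak2')

lemmas VD = weak2D[OF V_weak2]

lemma B_weak2:
  assumes u: "weak2 \<Omega> u u1 u2" and v: "weak2 \<Omega> v v1 v2"
  shows "B u v = (\<integral>p. Qf \<sigma> u2 v2 p \<partial>lebesgue_on \<Omega>)"
proof -
  have u': "weak2 \<Omega> u (grad l u) (hess l u)" by (rule H2_weak2'[OF weak2_H2[OF u]])
  have v': "weak2 \<Omega> v (grad l v) (hess l v)" by (rule H2_weak2'[OF weak2_H2[OF v]])
  note L = weak2D(3)[OF u] weak2D(3)[OF v] weak2D(3)[OF u'] weak2D(3)[OF v']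
  note M = L[THEN L2_measurable]
  note U = Om.weak2_unique[OF u' u] and W = Om.weak2_unique[OF v' v]
  show ?thesis unfolding H2_star_inner_Qf
  proof (rule integral_cong_AE)
    show "Qf \<sigma> (hess l u) (hess l v) \<in> borel_measurable (lebesgue_on \<Omega>)" "Qf \<sigma> u2 v2 \<in> borel_measurable (lebesgue_on \<Omega>)"
      by (intro borel_measurable_integrable Qf_integrable L)+
    show "AE p in lebesgue_on \<Omega>. Qf \<sigma> (hess l u) (hess l v) p = Qf \<sigma> u2 v2 p"
      using U[of True True] U[of True False] U[of False False] W[of True True] W[of True False] W[of False False]
      by eventually_elim (simp add: Qf_def)
  qed
qed

lemma V_I:
  assumes w: "weak2 \<Omega> v v1 v2" and g: "continuous_on (closure \<Omega>) g"
    and ae: "AE p in lebesgue_on \<Omega>. v p = g p" and z: "\<And>p. p \<in> {0, pi} \<times> {-l<..<l} \<Longrightarrow> g p = 0"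
  shows "v \<in> V"
  using weak2_H2[OF w] g ae z unfolding H2_star_def plate_def by blast

lemma V_rep:
  assumes "v \<in> V"
  obtains g where "continuous_on (closure \<Omega>) g" "AE p in lebesgue_on \<Omega>. v p = g p" "\<And>p. p \<in> {0, pi} \<times> {-l<..<l} \<Longrightarrow> g p = 0"
  using assms unfolding H2_star_def plate_def by blast

lemma V_add:
  assumes "u \<in> V" "v \<in> V" shows "(\<lambda>p. u p + v p) \<in> V"
proof -
  obtain g where g: "continuous_on (closure \<Omega>) g" "AE p in lebesgue_on \<Omega>. u p = g p" "\<And>p. p \<in> {0, pi} \<times> {-l<..<l} \<Longrightarrow> g p = 0"
    using V_rep[OF assms(1)] by blast
  obtain h where h: "continuous_on (closure \<Omega>) h" "AE p in lebesgue_on \<Omega>. v p = h p" "\<And>p. p \<in> {0, pi} \<times> {-l<..<l} \<Longrightarrow> h p = 0"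
    using V_rep[OF assms(2)] by blast
  show ?thesis
  proof (rule V_I[OF weak2_add[OF V_weak2[OF assms(1)] V_weak2[OF assms(2)] Om_sets] continuous_on_add[OF g(1) h(1)]])
    show "AE p in lebesgue_on \<Omega>. u p + v p = g p + h p" using g(2) h(2) by eventually_elim simp
    show "g p + h p = 0" if "p \<in> {0, pi} \<times> {-l<..<l}" for p using g(3)[OF that] h(3)[OF that] by simp
  qed
qed

lemma V_scale:
  assumes "u \<in> V" shows "(\<lambda>p. c * u p) \<in> V"
proof -
  obtain g where g: "continuous_on (closure \<Omega>) g" "AE p in lebesgue_on \<Omega>. u p = g p" "\<And>p. p \<in> {0, pi} \<times> {-l<..<l} \<Longrightarrow> g p = 0"
    using V_rep[OF assms(1)] by blast
  show ?thesis
  proof (rule V_I[OF weak2_scale[OF V_weak2[OF assms(1)] Om_sets]])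
    show "continuous_on (closure \<Omega>) (\<lambda>p. c * g p)" by (rule continuous_on_mult_left[OF g(1)])
    show "AE p in lebesgue_on \<Omega>. c * u p = c * g p" using g(2) by eventually_elim simp
    show "c * g p = 0" if "p \<in> {0, pi} \<times> {-l<..<l}" for p using g(3)[OF that] by simp
  qed
qed

sublocale V: inner_form V B
proof
  fix f g h :: "real \<times> real \<Rightarrow> real" and c :: real
  show "f \<in> V \<Longrightarrow> g \<in> V \<Longrightarrow> (\<lambda>p. f p + g p) \<in> V" by (rule V_add)
  show "f \<in> V \<Longrightarrow> (\<lambda>p. c * f p) \<in> V" by (rule V_scale)
  show "B f g = B g f" unfolding H2_star_inner_Qf Qf_def by (simp add: mult.commute)
  show "B (\<lambda>p. f p + g p) h = B f h + B g h" if "f \<in> V" "g \<in> V" "h \<in> V"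
  proof -
    have "B (\<lambda>p. f p + g p) h = (\<integral>p. Qf \<sigma> (\<lambda>j k p. hess l f j k p + hess l g j k p) (hess l h) p \<partial>lebesgue_on \<Omega>)"
      by (rule B_weak2[OF weak2_add[OF V_weak2[OF that(1)] V_weak2[OF that(2)] Om_sets] V_weak2[OF that(3)]])
    also have "\<dots> = (\<integral>p. Qf \<sigma> (hess l f) (hess l h) p + Qf \<sigma> (hess l g) (hess l h) p \<partial>lebesgue_on \<Omega>)"
      by (intro Bochner_Integration.integral_cong) (auto simp: Qf_def algebra_simps)
    also have "\<dots> = B f h + B g h"
      unfolding H2_star_inner_Qf by (rule Bochner_Integration.integral_add; rule Qf_integrable; rule VD(3); rule that)
    finally show ?thesis .
  qed
  show "B (\<lambda>p. c * f p) g = c * B f g" if "f \<in> V" "g \<in> V"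
  proof -
    have "B (\<lambda>p. c * f p) g = (\<integral>p. Qf \<sigma> (\<lambda>j k p. c * hess l f j k p) (hess l g) p \<partial>lebesgue_on \<Omega>)"
      by (rule B_weak2[OF weak2_scale[OF V_weak2[OF that(1)] Om_sets] V_weak2[OF that(2)]])
    also have "\<dots> = (\<integral>p. c * Qf \<sigma> (hess l f) (hess l g) p \<partial>lebesgue_on \<Omega>)"
      by (intro Bochner_Integration.integral_cong) (auto simp: Qf_def algebra_simps)
    finally show ?thesis by (simp add: H2_star_inner_Qf)
  qed
  show "0 \<le> B f f"
  proof -
    have "0 \<le> (1 - \<sigma>) * hsq a p" for a p using sigma by simp
    then have "0 \<le> Qf \<sigma> a a p" for a p using Qf_self_ge[of \<sigma> a p] sigma by (meson less_imp_le order_trans)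
    then show ?thesis unfolding H2_star_inner_Qf by simp
  qed
qed

lemma hsq_integrable: "(\<And>j k. a j k \<in> L2 \<Omega>) \<Longrightarrow> integrable (lebesgue_on \<Omega>) (hsq a)"
  unfolding hsq_def[abs_def]
  by (intro Bochner_Integration.integrable_add integrable_mult_right) (auto simp: L2_def)

lemma hsq_le_B:
  assumes "weak2 \<Omega> u u1 u2" shows "(\<integral>p. hsq u2 p \<partial>lebesgue_on \<Omega>) \<le> 2 * B u u"
proof -
  have "(\<integral>p. hsq u2 p \<partial>lebesgue_on \<Omega>) \<le> (\<integral>p. 2 * Qf \<sigma> u2 u2 p \<partial>lebesgue_on \<Omega>)"
  proof (rule integral_mono)
    show "hsq u2 p \<le> 2 * Qf \<sigma> u2 u2 p" for p
    proof -
      have "(1/2) * hsq u2 p \<le> (1 - \<sigma>) * hsq u2 p" using sigma by (intro mult_right_mono) auto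
      also have "\<dots> \<le> Qf \<sigma> u2 u2 p" using sigma by (intro Qf_self_ge) simp
      finally show ?thesis by simp
    qed
  qed (use weak2D(3)[OF assms] in \<open>auto intro!: hsq_integrable Qf_integrable\<close>)
  then show ?thesis by (simp add: B_weak2[OF assms assms])
qed

lemma hess_le_B:
  assumes "weak2 \<Omega> u u1 u2" shows "L2_inner \<Omega> (u2 j k) (u2 j k) \<le> 2 * B u u"
proof -
  have s: "u2 False True = u2 True False" using weak2D(4)[OF assms] by blast
  have "L2_inner \<Omega> (u2 j k) (u2 j k) \<le> (\<integral>p. hsq u2 p \<partial>lebesgue_on \<Omega>)"
    unfolding L2_inner_def
    by (intro integral_mono L2_integrable_mult hsq_integrable weak2D(3)[OF assms])
       (cases j; cases k; simp add: hsq_def s power2_eq_square)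
  then show ?thesis using hsq_le_B[OF assms] by simp
qed

section \<open>Localisation by cutoffs\<close>

text \<open>A cutoff that vanishes off \<open>Bx s\<close>, the points at distance at least \<open>s\<close> from the sides, and is \<open>1\<close> on \<open>Bx (s + \<kappa>)\<close>.\<close>

definition bump :: "real \<Rightarrow> real \<Rightarrow> real \<times> real \<Rightarrow> real" where
  "bump \<kappa> s p = cutoff \<kappa> s (pi - s) (fst p) * cutoff \<kappa> (- l + s) (l - s) (snd p)"

definition Bx :: "real \<Rightarrow> (real \<times> real) set" where
  "Bx s = {s..pi - s} \<times> {- l + s..l - s}"

lemma closed_Bx: "closed (Bx s)" unfolding Bx_def by (intro closed_Times) auto

lemma bump_TS: "0 < \<kappa> \<Longrightarrow> 0 < s \<Longrightarrow> bump \<kappa> s \<in> TSO"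
  unfolding bump_def[abs_def] by (intro TS.tensor cutoff_Dfun) auto

lemma bump_range: "0 \<le> bump \<kappa> s p" "bump \<kappa> s p \<le> 1"
  unfolding bump_def using cutoff_range by (auto intro: mult_le_one)

lemma bump_0: "0 < \<kappa> \<Longrightarrow> p \<notin> Bx s \<Longrightarrow> bump \<kappa> s p = 0"
  using cutoff_0[of \<kappa> "fst p" s "pi - s"] cutoff_0[of \<kappa> "snd p" "- l + s" "l - s"]
  unfolding bump_def Bx_def by (cases p) auto

lemma bump_1: "0 < \<kappa> \<Longrightarrow> p \<in> Bx (s + \<kappa>) \<Longrightarrow> bump \<kappa> s p = 1"
  unfolding bump_def Bx_def by (cases p) (auto simp: cutoff_1)

lemma Bx_mono: "s \<le> t \<Longrightarrow> Bx t \<subseteq> Bx s" unfolding Bx_def by auto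

text \<open>The open variant of \<open>Bx\<close>; a function that is constant on it has vanishing derivatives there.\<close>

definition Bo :: "real \<Rightarrow> (real \<times> real) set" where
  "Bo s = {s<..<pi - s} \<times> {- l + s<..<l - s}"

lemma Bo: "open (Bo s)" "Bo s \<subseteq> Bx s" "s < t \<Longrightarrow> Bx t \<subseteq> Bo s"
  unfolding Bo_def Bx_def by (auto intro!: open_Times)

end

lemma pd_local:
  assumes d: "f differentiable_on UNIV" "g differentiable_on UNIV" and U: "open U" "\<And>p. p \<in> U \<Longrightarrow> f p = g p" and p: "p \<in> U"
  shows "pd k f p = pd k g p"
proof -
  have "((\<lambda>s. p + s *\<^sub>R dir k) \<longlongrightarrow> p + 0 *\<^sub>R dir k) (at (0::real))" by (intro tendsto_intros)
  then have "\<forall>\<^sub>F s in at (0::real). p + s *\<^sub>R dir k \<in> U"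
    using U(1) p by (intro topological_tendstoD) auto
  then have "\<forall>\<^sub>F s in nhds (0::real). f (p + s *\<^sub>R dir k) = g (p + s *\<^sub>R dir k)"
    unfolding eventually_at_filter
  proof (rule eventually_mono)
    fix s :: real assume h: "s \<noteq> 0 \<longrightarrow> s \<in> UNIV \<longrightarrow> p + s *\<^sub>R dir k \<in> U"
    show "f (p + s *\<^sub>R dir k) = g (p + s *\<^sub>R dir k)"
    proof (cases "s = 0")
      case True then show ?thesis using U(2)[OF p] by simp
    next
      case False then show ?thesis using h by (intro U(2)) simp
    qed
  qed
  then have "((\<lambda>s. f (p + s *\<^sub>R dir k)) has_real_derivative pd k g p) (at 0)"
    using DERIV_cong_ev[of 0 0 "\<lambda>s. f (p + s *\<^sub>R dir k)" "\<lambda>s. g (p + s *\<^sub>R dir k)" "pd k g p" "pd k g p"]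
      pd_line_DERIV[OF d(2), of p k 0] by simp
  then show ?thesis using DERIV_unique[OF pd_line_DERIV[OF d(1), of p k 0]] by simp
qed

lemma pd_const: "pd k (\<lambda>p. c) p = 0"
proof -
  have "partial_x (\<lambda>p. c) = (\<lambda>p. 0)" "partial_y (\<lambda>p. c) = (\<lambda>p. 0)"
    by (intro partial_x_eqI partial_y_eqI; simp)+
  then show ?thesis by (simp add: pd_def)
qed

lemma pd_locally_const:
  assumes "f differentiable_on UNIV" "open U" "\<And>p. p \<in> U \<Longrightarrow> f p = c" "p \<in> U"
  shows "pd k f p = 0"
  using pd_local[OF assms(1) differentiable_on_const assms(2,3,4), of k] pd_const by simp

context plate_setting
begin

lemma bump_flat:
  assumes k: "0 < \<kappa>" "0 < s" and p: "p \<in> Bx t" "s + \<kappa> < t"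
  shows "bump \<kappa> s p = 1" "pd k (bump \<kappa> s) p = 0" "pd j (pd k (bump \<kappa> s)) p = 0"
proof -
  note T = bump_TS[OF k]
  have U: "p \<in> Bo (s + \<kappa>)" using Bo(3)[OF p(2)] p(1) by blast
  have 1: "bump \<kappa> s q = 1" if "q \<in> Bo (s + \<kappa>)" for q
    by (rule bump_1[OF k(1)]) (use that Bo(2) in blast)
  show "bump \<kappa> s p = 1" by (rule 1[OF U])
  have 2: "pd k (bump \<kappa> s) q = 0" if "q \<in> Bo (s + \<kappa>)" for q k
    by (rule pd_locally_const[OF TS_differentiable[OF T] Bo(1) 1 that])
  show "pd k (bump \<kappa> s) p = 0" by (rule 2[OF U])
  show "pd j (pd k (bump \<kappa> s)) p = 0"
    by (rule pd_locally_const[OF TS_differentiable[OF TS_pd[OF T]] Bo(1) 2 U])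
qed

lemma TS_flat0:
  assumes "\<eta> \<in> TSO" "\<And>p. p \<notin> Bx s \<Longrightarrow> \<eta> p = 0" "p \<notin> Bx s"
  shows "\<eta> p = 0" "pd k \<eta> p = 0" "pd j (pd k \<eta>) p = 0"
proof -
  show "\<eta> p = 0" using assms by blast
  have 1: "pd k \<eta> q = 0" if "q \<notin> Bx s" for q k
    by (rule pd_support[OF TS_differentiable[OF assms(1)] closed_Bx assms(2) that])
  show "pd k \<eta> p = 0" by (rule 1[OF assms(3)])
  show "pd j (pd k \<eta>) p = 0"
    by (rule pd_support[OF TS_differentiable[OF TS_pd[OF assms(1)]] closed_Bx 1 assms(3)])
qed

end

lemma weak2_second:
  assumes w: "weak2 UNIV W W1 W2" and phi: "\<phi> \<in> TS UNIV UNIV"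
  shows "L2_inner UNIV (W1 j) (pd k \<phi>) = - L2_inner UNIV (W2 j k) \<phi>"
    "L2_inner UNIV W (pd k \<phi>) = - L2_inner UNIV (W1 k) \<phi>"
proof -
  note D = weak2D[OF w]
  have t: "\<psi> \<in> test_functions UNIV" if "\<psi> \<in> TS UNIV UNIV" for \<psi> using TS_test[OF that] by simp
  have "L2_inner UNIV W (pd j (pd k \<phi>)) = - L2_inner UNIV (W1 j) (pd k \<phi>)"
    by (rule D(5)[OF t[OF TS_pd[OF phi]]])
  moreover have "L2_inner UNIV W (pd j (pd k \<phi>)) = L2_inner UNIV (W2 j k) \<phi>"
  proof (cases "j \<or> \<not> k")
    case True then show ?thesis by (rule D(6)[OF t[OF phi]])
  next
    case False
    then have "L2_inner UNIV W (pd k (pd j \<phi>)) = L2_inner UNIV (W2 k j) \<phi>" by (intro D(6)[OF t[OF phi]]) simp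
    then show ?thesis using TS_pd_commute[OF phi, of j k] D(4)[of j k] by simp
  qed
  ultimately show "L2_inner UNIV (W1 j) (pd k \<phi>) = - L2_inner UNIV (W2 j k) \<phi>" by simp
  show "L2_inner UNIV W (pd k \<phi>) = - L2_inner UNIV (W1 k) \<phi>" by (rule D(5)[OF t[OF phi]])
qed

context plate_setting
begin

lemma TSO_L2: "\<phi> \<in> TSO \<Longrightarrow> f \<in> L2 \<Omega> \<Longrightarrow> (\<lambda>p. \<phi> p * f p) \<in> L2 \<Omega>"
  by (rule L2_UNIV_restrict[OF Om_sets TS_L2_mult[OF _ Om_sets]])

text \<open>Two integrations by parts. Each pairs a function carrying \<open>\<eta>\<close> or its derivative with a cutoff of \<open>u\<close>
  or \<open>u\<^sub>k\<close> that equals it where \<open>\<eta>\<close> lives; both factors then vanish outside the plate.\<close>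

lemma gradient_identity:
  assumes u: "weak2 \<Omega> u u1 u2" and chi: "\<eta> \<in> TSO" and s: "0 < s" and z: "\<And>p. p \<notin> Bx s \<Longrightarrow> \<eta> p = 0"
  shows "L2_inner \<Omega> (\<lambda>p. \<eta> p * u1 k p) (u1 k) =
    - L2_inner \<Omega> (\<lambda>p. \<eta> p * u p) (u2 k k) + 1 / 2 * L2_inner \<Omega> (\<lambda>p. pd k (pd k \<eta>) p * u p) u"
proof -
  define \<zeta> where "\<zeta> = bump (s / 4) (s / 4)"
  have k: "0 < s / 4" "s / 4 + s / 4 < s" using s by auto
  have zt: "\<zeta> \<in> TSO" unfolding \<zeta>_def by (rule bump_TS[OF k(1) k(1)])
  note flat = bump_flat[OF k(1) k(1) _ k(2), folded \<zeta>_def]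
  note off = TS_flat0[OF chi z]
  note D = weak2D[OF u]
  note W = weak2_mult[OF u zt Om_sets]
  note X = weak2_mult[OF u chi Om_sets]
  note Y = weak2_mult[OF u TS_pd[OF chi, of k] Om_sets]
  have L: "(\<lambda>p. \<phi> p * f p) \<in> L2 UNIV" if "\<phi> \<in> TSO" "f \<in> L2 \<Omega>" for \<phi> f by (rule TS_L2_mult[OF that(1) Om_sets that(2)])
  have zz: "p \<notin> \<Omega> \<Longrightarrow> \<phi> p * f p = 0" if "\<phi> \<in> TSO" for \<phi> f and p :: "real \<times> real"
  proof -
    assume "p \<notin> \<Omega>"
    from TS_zero[OF that this] show ?thesis by simp
  qed
  have Z1: "p \<notin> \<Omega> \<Longrightarrow> \<zeta> p * u1 k p + pd k \<zeta> p * u p = 0" for p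
  proof -
    assume p: "p \<notin> \<Omega>"
    show ?thesis unfolding zz[OF zt p] zz[OF TS_pd[OF zt] p] by simp
  qed
  have e1: "L2_inner UNIV (\<lambda>p. \<eta> p * u p) (\<lambda>p. \<zeta> p * u2 k k p + pd k \<zeta> p * u1 k p + pd k \<zeta> p * u1 k p + pd k (pd k \<zeta>) p * u p)
     = - L2_inner UNIV (\<lambda>p. \<eta> p * u1 k p + pd k \<eta> p * u p) (\<lambda>p. \<zeta> p * u1 k p + pd k \<zeta> p * u p)"
    by (rule Om.integration_by_parts[OF weak2D(1)[OF X] zz[OF chi, where f=u] weak2D(2)[OF X, where k=k] weak2_second(2)[OF X, where k=k]
        weak2D(2)[OF W, where k=k] Z1 weak2D(3)[OF W, where j=k and k=k] weak2_second(1)[OF W, where j=k and k=k]])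
  have e2: "L2_inner UNIV (\<lambda>p. pd k \<eta> p * u p) (\<lambda>p. \<zeta> p * u1 k p + pd k \<zeta> p * u p)
     = - L2_inner UNIV (\<lambda>p. pd k \<eta> p * u1 k p + pd k (pd k \<eta>) p * u p) (\<lambda>p. \<zeta> p * u p)"
    by (rule Om.integration_by_parts[OF weak2D(1)[OF Y] zz[OF TS_pd[OF chi], where f=u] weak2D(2)[OF Y, where k=k] weak2_second(2)[OF Y, where k=k]
        weak2D(1)[OF W] zz[OF zt, where f=u] weak2D(2)[OF W, where k=k] weak2_second(2)[OF W, where k=k]])
  have loc: "L2_inner UNIV (\<lambda>p. \<phi> p * f p) G = L2_inner \<Omega> (\<lambda>p. \<phi> p * f p) h"
    if "\<phi> \<in> TSO" "\<And>p. p \<notin> Bx s \<Longrightarrow> \<phi> p = 0" "\<And>p. p \<in> Bx s \<Longrightarrow> G p = h p" for \<phi> f G h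
  proof -
    have "L2_inner UNIV (\<lambda>p. \<phi> p * f p) G = L2_inner \<Omega> (\<lambda>p. \<phi> p * f p) G"
      by (rule L2_inner_UNIV[OF Om_sets]) (use zz[OF that(1)] in simp)
    also have "\<dots> = L2_inner \<Omega> (\<lambda>p. \<phi> p * f p) h"
    proof (rule L2_inner_cong)
      fix p show "\<phi> p * f p * G p = \<phi> p * f p * h p"
        using that(2)[of p] that(3)[of p] by (cases "p \<in> Bx s") simp_all
    qed
    finally show ?thesis .
  qed
  have f1: "\<zeta> p * u2 k k p + pd k \<zeta> p * u1 k p + pd k \<zeta> p * u1 k p + pd k (pd k \<zeta>) p * u p = u2 k k p"
    "\<zeta> p * u1 k p + pd k \<zeta> p * u p = u1 k p" "\<zeta> p * u p = u p" if "p \<in> Bx s" for p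
    by (simp_all only: flat[OF that] mult_1 mult_zero_left add_0_right)
  have W1L: "(\<lambda>p. \<zeta> p * u1 k p + pd k \<zeta> p * u p) \<in> L2 UNIV" by (rule weak2D(2)[OF W])
  have WL: "(\<lambda>p. \<zeta> p * u p) \<in> L2 UNIV" by (rule weak2D(1)[OF W])
  note t = chi TS_pd[OF chi, of k] TS_pd[OF TS_pd[OF chi, of k], of k]
  let ?W1 = "\<lambda>p. \<zeta> p * u1 k p + pd k \<zeta> p * u p"
  have g1: "L2_inner UNIV (\<lambda>p. \<eta> p * u p) (\<lambda>p. \<zeta> p * u2 k k p + pd k \<zeta> p * u1 k p + pd k \<zeta> p * u1 k p + pd k (pd k \<zeta>) p * u p)
     = L2_inner \<Omega> (\<lambda>p. \<eta> p * u p) (u2 k k)"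
    by (rule loc[OF t(1) off(1) f1(1)])
  have g2: "L2_inner UNIV (\<lambda>p. \<eta> p * u1 k p) ?W1 = L2_inner \<Omega> (\<lambda>p. \<eta> p * u1 k p) (u1 k)"
    by (rule loc[OF t(1) off(1) f1(2)])
  have g3: "L2_inner UNIV (\<lambda>p. pd k \<eta> p * u p) ?W1 = L2_inner \<Omega> (\<lambda>p. pd k \<eta> p * u p) (u1 k)"
    by (rule loc[OF t(2) off(2) f1(2)])
  have g4: "L2_inner UNIV (\<lambda>p. pd k \<eta> p * u1 k p) (\<lambda>p. \<zeta> p * u p) = L2_inner \<Omega> (\<lambda>p. pd k \<eta> p * u1 k p) u"
    by (rule loc[OF t(2) off(2) f1(3)])
  have g5: "L2_inner UNIV (\<lambda>p. pd k (pd k \<eta>) p * u p) (\<lambda>p. \<zeta> p * u p) = L2_inner \<Omega> (\<lambda>p. pd k (pd k \<eta>) p * u p) u"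
    by (rule loc[OF t(3) off(3) f1(3)])
  have a1: "L2_inner \<Omega> (\<lambda>p. \<eta> p * u p) (u2 k k) = - (L2_inner \<Omega> (\<lambda>p. \<eta> p * u1 k p) (u1 k) + L2_inner \<Omega> (\<lambda>p. pd k \<eta> p * u p) (u1 k))"
    using e1 unfolding L2.ip_add[OF L[OF t(1) D(2)] L[OF t(2) D(1)] W1L] g1 g2 g3 .
  have a2: "L2_inner \<Omega> (\<lambda>p. pd k \<eta> p * u p) (u1 k) = - (L2_inner \<Omega> (\<lambda>p. pd k \<eta> p * u1 k p) u + L2_inner \<Omega> (\<lambda>p. pd k (pd k \<eta>) p * u p) u)"
    using e2 unfolding L2.ip_add[OF L[OF t(2) D(2)] L[OF t(3) D(1)] WL] g3 g4 g5 .
  have a3: "L2_inner \<Omega> (\<lambda>p. pd k \<eta> p * u1 k p) u = L2_inner \<Omega> (\<lambda>p. pd k \<eta> p * u p) (u1 k)"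
    by (rule L2_inner_cong) simp
  show ?thesis using a1 a2 a3 by linarith
qed

section \<open>The Poincare inequality\<close>

text \<open>The gradient identity is tested with the concave weight \<open>x (\<pi> - x)\<close>, truncated near the boundary.
  Its second derivative is \<open>-2\<close>, so the identity bounds \<open>\<integral> u\<^sup>2\<close> by \<open>\<integral> u\<^sub>x\<^sub>x\<^sup>2\<close>. Truncation at distance
  \<open>\<kappa>\<close> from the sides costs \<open>O(1 / \<kappa>)\<close> times the integral of \<open>u\<^sup>2\<close> over strips of width \<open>O(\<kappa>)\<close>, which
  is small because the continuous representative vanishes on these sides.\<close>

lemma step_deriv_bounds:
  obtains K where "0 \<le> K" "\<And>x. \<bar>deriv step x\<bar> \<le> K" "\<And>x. \<bar>deriv (deriv step) x\<bar> \<le> K"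
proof -
  have s: "smooth1 (deriv step)" "smooth1 (deriv (deriv step))" by (intro smooth1_deriv smooth1_step)+
  have z1: "deriv step x = 0" if "x \<notin> {0..1}" for x
  proof -
    have "((\<lambda>x. if x < 0 then 0 else 1) has_real_derivative 0) (at x)"
      if "x < 0 \<or> 1 < x"
    proof (cases "x < 0")
      case True
      have "((\<lambda>x. 0::real) has_real_derivative 0) (at x)" by simp
      then show ?thesis by (rule has_field_derivative_transform_within_open[of _ _ _ "{..<0}"]) (use True in auto)
    next
      case False
      then have "1 < x" using that by simp
      have "((\<lambda>x. 1::real) has_real_derivative 0) (at x)" by simp
      then show ?thesis by (rule has_field_derivative_transform_within_open[of _ _ _ "{1<..}"]) (use \<open>1 < x\<close> in auto)
    qed
    then have "((\<lambda>x. if x < 0 then 0 else 1) has_real_derivative 0) (at x)" using that by auto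
    then have "(step has_real_derivative 0) (at x)"
      by (rule has_field_derivative_transform_within_open[of _ _ _ "- {0..1}"]) (use that step_0 step_1 in \<open>auto simp: not_le\<close>)
    then show ?thesis by (rule DERIV_imp_deriv)
  qed
  have z2: "deriv (deriv step) x = 0" if "x \<notin> {0..1}" for x by (rule deriv_outside[OF z1 that])
  have "deriv step \<in> Dfun UNIV" "deriv (deriv step) \<in> Dfun UNIV"
    unfolding Dfun_def using s z1 z2 by blast+
  then obtain K1 K2 where "0 \<le> K1" "\<And>x. \<bar>deriv step x\<bar> \<le> K1" "0 \<le> K2" "\<And>x. \<bar>deriv (deriv step) x\<bar> \<le> K2"
    using Dfun_bounded by metis
  then show ?thesis using that[of "K1 + K2"] by (simp add: add_increasing add_increasing2)
qed

lemma step_scaled_deriv: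
  assumes "f = step \<or> f = deriv step"
  shows "((\<lambda>x. f (a * x + b)) has_real_derivative a * deriv f (a * x + b)) (at x)"
proof -
  have "smooth1 f" using assms smooth1_step smooth1_deriv by blast
  then have "(f has_real_derivative deriv f (a * x + b)) (at (a * x + b))" by (rule smooth1_DERIV)
  then have "((\<lambda>x. f (a * x + b)) has_real_derivative deriv f (a * x + b) * a) (at x)"
    by (rule DERIV_chain2) (auto intro!: derivative_eq_intros)
  then show ?thesis by (simp add: mult.commute)
qed

text \<open>Where the cutoff varies, the weight is \<open>O(\<kappa>)\<close>, which tames one of the two powers of \<open>1 / \<kappa>\<close> in
  the second derivative of the cutoff.\<close>

lemma weight_second_derivative:
  "\<exists>K\<ge>0. \<forall>\<kappa> x. 0 < \<kappa> \<longrightarrow> 6 * \<kappa> < pi \<longrightarrow> x \<in> {0..pi} \<longrightarrow>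
       deriv (deriv (\<lambda>x. x * (pi - x) * cutoff \<kappa> \<kappa> (pi - \<kappa>) x)) x
         \<le> - 2 * cutoff \<kappa> \<kappa> (pi - \<kappa>) x + (if x \<le> 2 * \<kappa> \<or> pi - 2 * \<kappa> \<le> x then K / \<kappa> else 0)"
proof -
  obtain K where K: "0 \<le> K" "\<And>x. \<bar>deriv step x\<bar> \<le> K" "\<And>x. \<bar>deriv (deriv step) x\<bar> \<le> K"
    using step_deriv_bounds by metis
  define C where "C = 2 * (pi * (2 * K)) + 4 * pi * (2 * K + 2 * K\<^sup>2)"
  have C0: "0 \<le> C" unfolding C_def using K by (intro add_nonneg_nonneg mult_nonneg_nonneg) auto
  show ?thesis
  proof (intro exI[of _ C] conjI allI impI C0)
    fix \<kappa> x :: real assume k: "0 < \<kappa>" "6 * \<kappa> < pi" and x: "x \<in> {0..pi}"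
    define c where "c = cutoff \<kappa> \<kappa> (pi - \<kappa>)"
    define \<alpha> where "\<alpha> x = (1/\<kappa>) * x + (-1)" for x
    define \<beta> where "\<beta> x = (-1/\<kappa>) * x + (pi/\<kappa> - 1)" for x
    define c1 where "c1 x = step (\<alpha> x) * ((-1/\<kappa>) * deriv step (\<beta> x)) + ((1/\<kappa>) * deriv step (\<alpha> x)) * step (\<beta> x)" for x
    define c2 where "c2 x = (step (\<alpha> x) * ((-1/\<kappa>) * ((-1/\<kappa>) * deriv (deriv step) (\<beta> x)))
        + ((1/\<kappa>) * deriv step (\<alpha> x)) * ((-1/\<kappa>) * deriv step (\<beta> x)))
      + (((1/\<kappa>) * deriv step (\<alpha> x)) * ((-1/\<kappa>) * deriv step (\<beta> x))
        + ((1/\<kappa>) * ((1/\<kappa>) * deriv (deriv step) (\<alpha> x))) * step (\<beta> x))" for x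
    have cab: "c x = step (\<alpha> x) * step (\<beta> x)" for x
      using k by (simp add: c_def cutoff_def \<alpha>_def \<beta>_def diff_divide_distrib)
    note sd = step_scaled_deriv[OF disjI1[OF refl]] step_scaled_deriv[OF disjI2[OF refl]]
    have d1: "(c has_real_derivative c1 x) (at x)" for x
      unfolding cab[abs_def] c1_def \<alpha>_def \<beta>_def by (intro DERIV_mult' sd)
    have d2: "(c1 has_real_derivative c2 x) (at x)" for x
      unfolding c1_def[abs_def] c2_def \<alpha>_def \<beta>_def by (intro DERIV_add DERIV_mult' DERIV_cmult sd)
    have w: "((\<lambda>x. x * (pi - x)) has_real_derivative pi - 2 * x) (at x)" for x
      by (auto intro!: derivative_eq_intros)
    have w': "((\<lambda>x. pi - 2 * x) has_real_derivative - 2) (at x)" for x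
      by (auto intro!: derivative_eq_intros)
    have "deriv (\<lambda>x. x * (pi - x) * c x) = (\<lambda>x. x * (pi - x) * c1 x + (pi - 2 * x) * c x)"
      by (intro ext DERIV_imp_deriv DERIV_mult' w d1)
    moreover have "deriv (\<lambda>x. x * (pi - x) * c1 x + (pi - 2 * x) * c x) x
       = (x * (pi - x) * c2 x + (pi - 2 * x) * c1 x) + ((pi - 2 * x) * c1 x + (-2) * c x)"
      by (intro DERIV_imp_deriv DERIV_add DERIV_mult' w w' d1 d2)
    ultimately have e: "deriv (deriv (\<lambda>x. x * (pi - x) * c x)) x = - 2 * c x + (2 * ((pi - 2 * x) * c1 x) + x * (pi - x) * c2 x)"
      by simp
    show "deriv (deriv (\<lambda>x. x * (pi - x) * cutoff \<kappa> \<kappa> (pi - \<kappa>) x)) x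
         \<le> - 2 * cutoff \<kappa> \<kappa> (pi - \<kappa>) x + (if x \<le> 2 * \<kappa> \<or> pi - 2 * \<kappa> \<le> x then C / \<kappa> else 0)"
    proof (cases "x \<le> 2 * \<kappa> \<or> pi - 2 * \<kappa> \<le> x")
      case True
      have st: "\<bar>step y\<bar> \<le> 1" for y using step_range[of y] by simp
      have m1: "\<bar>step y * deriv step z\<bar> \<le> K" "\<bar>step y * deriv (deriv step) z\<bar> \<le> K" "\<bar>deriv step y * deriv step z\<bar> \<le> K\<^sup>2" for y z
        unfolding abs_mult power2_eq_square using mult_mono[OF st[of y] K(2)[of z]] mult_mono[OF st[of y] K(3)[of z]] mult_mono[OF K(2)[of y] K(2)[of z]] K(1) by auto
      have "c1 x = (deriv step (\<alpha> x) * step (\<beta> x) - step (\<alpha> x) * deriv step (\<beta> x)) / \<kappa>"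
        by (simp add: c1_def diff_divide_distrib)
      moreover have "\<bar>deriv step (\<alpha> x) * step (\<beta> x) - step (\<alpha> x) * deriv step (\<beta> x)\<bar> \<le> 2 * K"
        using m1(1)[of "\<beta> x" "\<alpha> x"] m1(1)[of "\<alpha> x" "\<beta> x"] by (simp add: mult.commute)
      ultimately have b1: "\<bar>c1 x\<bar> \<le> 2 * K / \<kappa>" using k(1) by (simp add: divide_right_mono)
      have "c2 x = (step (\<alpha> x) * deriv (deriv step) (\<beta> x) - 2 * (deriv step (\<alpha> x) * deriv step (\<beta> x)) + step (\<beta> x) * deriv (deriv step) (\<alpha> x)) / \<kappa>\<^sup>2"
        using k(1) by (simp add: c2_def power2_eq_square field_simps)
      moreover have "\<bar>step (\<alpha> x) * deriv (deriv step) (\<beta> x) - 2 * (deriv step (\<alpha> x) * deriv step (\<beta> x)) + step (\<beta> x) * deriv (deriv step) (\<alpha> x)\<bar> \<le> 2 * K + 2 * K\<^sup>2"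
        using m1(2)[of "\<alpha> x" "\<beta> x"] m1(2)[of "\<beta> x" "\<alpha> x"] m1(3)[of "\<alpha> x" "\<beta> x"] by linarith
      ultimately have b2: "\<bar>c2 x\<bar> \<le> (2 * K + 2 * K\<^sup>2) / \<kappa>\<^sup>2" using k(1) by (simp add: divide_right_mono)
      have w1: "\<bar>pi - 2 * x\<bar> \<le> pi" using x by auto
      have w2: "\<bar>x * (pi - x)\<bar> \<le> 2 * \<kappa> * pi"
      proof -
        have "x * (pi - x) \<le> 2 * \<kappa> * pi"
        proof (cases "x \<le> 2 * \<kappa>")
          case True then show ?thesis using x k by (intro mult_mono) auto
        next
          case False
          then have "pi - x \<le> 2 * \<kappa>" using \<open>x \<le> 2 * \<kappa> \<or> pi - 2 * \<kappa> \<le> x\<close> by simp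
          then have "(pi - x) * x \<le> 2 * \<kappa> * pi" using x k by (intro mult_mono) auto
          then show ?thesis by (simp add: mult.commute)
        qed
        then show ?thesis using x by simp
      qed
      have "\<bar>(pi - 2 * x) * c1 x\<bar> \<le> pi * (2 * K / \<kappa>)"
        unfolding abs_mult by (intro mult_mono w1 b1) auto
      moreover have "\<bar>x * (pi - x) * c2 x\<bar> \<le> (2 * \<kappa> * pi) * ((2 * K + 2 * K\<^sup>2) / \<kappa>\<^sup>2)"
        unfolding abs_mult[of "x * (pi - x)"] using k by (intro mult_mono w2 b2) auto
      moreover have "(2 * \<kappa> * pi) * ((2 * K + 2 * K\<^sup>2) / \<kappa>\<^sup>2) \<le> 4 * pi * (2 * K + 2 * K\<^sup>2) / \<kappa>"
        using k(1) K(1) by (simp add: power2_eq_square field_simps)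
      moreover have "2 * (pi * (2 * K / \<kappa>)) + 4 * pi * (2 * K + 2 * K\<^sup>2) / \<kappa> = C / \<kappa>"
        by (simp add: C_def add_divide_distrib)
      ultimately have "2 * ((pi - 2 * x) * c1 x) + x * (pi - x) * c2 x \<le> C / \<kappa>" by linarith
      then show ?thesis using e True by (simp add: c_def)
    next
      case False
      have "c y = 1" if "y \<in> {2 * \<kappa><..<pi - 2 * \<kappa>}" for y
        unfolding c_def using that k by (intro cutoff_1) auto
      then have ev: "\<And>y. y \<in> {2 * \<kappa><..<pi - 2 * \<kappa>} \<Longrightarrow> 1 = c y" by simp
      have z1: "c1 y = 0" if "y \<in> {2 * \<kappa><..<pi - 2 * \<kappa>}" for y
      proof -
        have "((\<lambda>x. 1) has_real_derivative 0) (at y)" by simp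
        then have "(c has_real_derivative 0) (at y)"
          by (rule has_field_derivative_transform_within_open[of _ _ _ "{2 * \<kappa><..<pi - 2 * \<kappa>}"]) (use that ev in auto)
        then show ?thesis using DERIV_unique[OF d1] by blast
      qed
      have xin: "x \<in> {2 * \<kappa><..<pi - 2 * \<kappa>}" using False by auto
      have "((\<lambda>x. 0) has_real_derivative 0) (at x)" by simp
      then have "(c1 has_real_derivative 0) (at x)"
        by (rule has_field_derivative_transform_within_open[of _ _ _ "{2 * \<kappa><..<pi - 2 * \<kappa>}"]) (use xin z1 in auto)
      then have "c2 x = 0" using DERIV_unique[OF d2] by blast
      then show ?thesis using e z1[OF xin] False by (simp add: c_def)
    qed
  qed
qed

lemma strip_integral:
  assumes k: "0 < \<kappa>"
  shows "(\<integral>p. (if fst p \<le> 2 * \<kappa> \<or> pi - 2 * \<kappa> \<le> fst p then 1 else 0) \<partial>lebesgue_on \<Omega>) \<le> 8 * \<kappa> * l"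
    "integrable (lebesgue_on \<Omega>) (\<lambda>p. if fst p \<le> 2 * \<kappa> \<or> pi - 2 * \<kappa> \<le> fst p then 1 else (0::real))"
proof -
  let ?A = "cbox (0, -l) (2 * \<kappa>, l)" and ?B = "cbox (pi - 2 * \<kappa>, -l) (pi, l)"
  let ?T = "{p::real \<times> real. fst p \<le> 2 * \<kappa> \<or> pi - 2 * \<kappa> \<le> fst p}"
  interpret finite_measure "lebesgue_on \<Omega>" by (rule Om.S_fin)
  have T: "closed ?T"
    by (intro closed_Collect_disj closed_Collect_le continuous_intros)
  have Tm: "\<Omega> \<inter> ?T \<in> sets lebesgue" using Om_sets T by auto
  have "\<Omega> \<inter> ?T \<in> sets (lebesgue_on \<Omega>)" using Tm Om_sets by (auto simp: sets_restrict_space_iff)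
  then have "integrable (lebesgue_on \<Omega>) (indicator (\<Omega> \<inter> ?T) :: _ \<Rightarrow> real)"
    by (intro integrable_real_indicator) (simp_all add: emeasure_eq_measure del: sets_restrict_space_iff)
  then show i: "integrable (lebesgue_on \<Omega>) (\<lambda>p. if fst p \<le> 2 * \<kappa> \<or> pi - 2 * \<kappa> \<le> fst p then 1 else (0::real))"
    by (rule Bochner_Integration.integrable_cong[THEN iffD1, rotated 2]) (auto simp: indicator_def)
  have "(\<integral>p. (if fst p \<le> 2 * \<kappa> \<or> pi - 2 * \<kappa> \<le> fst p then 1 else 0) \<partial>lebesgue_on \<Omega>)
     = (\<integral>p. indicator \<Omega> p *\<^sub>R (if fst p \<le> 2 * \<kappa> \<or> pi - 2 * \<kappa> \<le> fst p then 1 else (0::real)) \<partial>lebesgue)"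
    using Om_sets by (intro integral_restrict_space) simp
  also have "\<dots> = (\<integral>p. indicator (\<Omega> \<inter> ?T) p \<partial>lebesgue)"
    by (intro Bochner_Integration.integral_cong) (auto simp: indicator_def)
  also have "\<dots> = measure lebesgue (\<Omega> \<inter> ?T)" using Tm by simp
  also have "\<dots> \<le> measure lebesgue (?A \<union> ?B)"
  proof (rule measure_mono_fmeasurable[OF _ Tm])
    show "\<Omega> \<inter> ?T \<subseteq> ?A \<union> ?B" by (auto simp: cbox_Pair_eq)
  qed (auto intro: fmeasurable.Un)
  also have "\<dots> \<le> measure lebesgue ?A + measure lebesgue ?B"
    by (rule measure_Un_le) auto
  also have "\<dots> = 8 * \<kappa> * l"
    using k l content_Pair[of 0 "-l" "2 * \<kappa>" l] content_Pair[of "pi - 2 * \<kappa>" "-l" pi l] by simp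
  finally show "(\<integral>p. (if fst p \<le> 2 * \<kappa> \<or> pi - 2 * \<kappa> \<le> fst p then 1 else 0) \<partial>lebesgue_on \<Omega>) \<le> 8 * \<kappa> * l" .
qed

text \<open>The term with \<open>u\<^sub>x\<^sup>2\<close> in the gradient identity is nonnegative, so the identity bounds the
  part \<open>- \<onehalf> \<eta>\<^sub>x\<^sub>x u\<^sup>2\<close> by \<open>- \<eta> u u\<^sub>x\<^sub>x\<close>, and Young's inequality leaves half of \<open>u\<^sup>2\<close> on the left.\<close>

lemma truncated_poincare:
  assumes v: "v \<in> V"
    and K: "0 \<le> K" "\<And>\<kappa> x. 0 < \<kappa> \<Longrightarrow> 6 * \<kappa> < pi \<Longrightarrow> x \<in> {0..pi} \<Longrightarrow>
       deriv (deriv (\<lambda>x. x * (pi - x) * cutoff \<kappa> \<kappa> (pi - \<kappa>) x)) x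
         \<le> - 2 * cutoff \<kappa> \<kappa> (pi - \<kappa>) x + (if x \<le> 2 * \<kappa> \<or> pi - 2 * \<kappa> \<le> x then K / \<kappa> else 0)"
    and k: "0 < \<kappa>" "6 * \<kappa> < pi" and e: "0 \<le> \<epsilon>"
    and small: "AE p in lebesgue_on \<Omega>. fst p \<le> 2 * \<kappa> \<or> pi - 2 * \<kappa> \<le> fst p \<longrightarrow> (v p)\<^sup>2 \<le> \<epsilon>"
  shows "(\<integral>p. bump \<kappa> \<kappa> p * (v p)\<^sup>2 \<partial>lebesgue_on \<Omega>) \<le> 2 * pi ^ 4 * B v v + 8 * K * l * \<epsilon>"
proof -
  note w = V_weak2[OF v]
  note D = weak2D[OF w]
  define a where "a x = x * (pi - x) * cutoff \<kappa> \<kappa> (pi - \<kappa>) x" for x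
  define b where "b = cutoff \<kappa> (- l + \<kappa>) (l - \<kappa>)"
  define \<eta> where "\<eta> p = a (fst p) * b (snd p)" for p :: "real \<times> real"
  have sw: "smooth1 (\<lambda>x. x * (pi - x))"
  proof -
    have "smooth1 (\<lambda>x. x * ((-1) * x + pi))" by (intro smooth1_mult smooth1_id smooth1_affine[OF smooth1_id])
    then show ?thesis by simp
  qed
  have aD: "a \<in> Dfun {0<..<pi}" unfolding a_def[abs_def] by (intro Dfun_mult[OF sw] cutoff_Dfun k) (use k in auto)
  have bD: "b \<in> Dfun {-l<..<l}" unfolding b_def by (intro cutoff_Dfun k) (use k in auto)
  have et: "\<eta> \<in> TSO" unfolding \<eta>_def[abs_def] by (rule TS.tensor[OF aD bD])
  have ez: "\<eta> p = 0" if "p \<notin> Bx \<kappa>" for p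
  proof -
    have "\<eta> p = fst p * (pi - fst p) * bump \<kappa> \<kappa> p" by (simp add: \<eta>_def a_def b_def bump_def)
    then show ?thesis using bump_0[OF k(1) that] by simp
  qed
  have exx: "pd True (pd True \<eta>) = (\<lambda>p. deriv (deriv a) (fst p) * b (snd p))"
    unfolding \<eta>_def[abs_def] pd_def if_True partial_x_tensor[OF Dfun_smooth[OF aD], of b]
      partial_x_tensor[OF Dfun_smooth[OF Dfun_deriv[OF aD]], of b] by (rule refl)
  let ?u1 = "grad l v True" and ?u2 = "hess l v True True"
  let ?c = "bump \<kappa> \<kappa>"
  have id: "L2_inner \<Omega> (\<lambda>p. \<eta> p * ?u1 p) ?u1 = - L2_inner \<Omega> (\<lambda>p. \<eta> p * v p) ?u2 + 1 / 2 * L2_inner \<Omega> (\<lambda>p. pd True (pd True \<eta>) p * v p) v"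
    by (rule gradient_identity[OF w et k(1) ez])
  have eta: "\<eta> p = fst p * (pi - fst p) * ?c p" for p by (simp add: \<eta>_def a_def b_def bump_def)
  have w0: "0 \<le> fst p * (pi - fst p)" "fst p * (pi - fst p) \<le> pi\<^sup>2" if "p \<in> \<Omega>" for p
    using that by (auto simp: power2_eq_square intro!: mult_mono)
  have "0 \<le> L2_inner \<Omega> (\<lambda>p. \<eta> p * ?u1 p) ?u1"
    unfolding L2_inner_def
  proof (rule Bochner_Integration.integral_nonneg)
    fix p assume "p \<in> space (lebesgue_on \<Omega>)"
    then have "p \<in> \<Omega>" by simp
    then have "0 \<le> \<eta> p" unfolding eta by (rule mult_nonneg_nonneg[OF w0(1) bump_range(1)])
    then show "0 \<le> \<eta> p * ?u1 p * ?u1 p" by (simp add: mult.assoc)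
  qed
  with id have ge: "0 \<le> - L2_inner \<Omega> (\<lambda>p. \<eta> p * v p) ?u2 + 1 / 2 * L2_inner \<Omega> (\<lambda>p. pd True (pd True \<eta>) p * v p) v" by simp
  have ct: "?c \<in> TSO" by (rule bump_TS[OF k(1) k(1)])
  have ci: "integrable (lebesgue_on \<Omega>) (\<lambda>p. ?c p * (v p)\<^sup>2)"
    using L2_integrable_mult[OF TSO_L2[OF ct D(1)] D(1)] by (simp add: power2_eq_square mult.assoc)
  have vi: "integrable (lebesgue_on \<Omega>) (\<lambda>p. (v p)\<^sup>2)" "integrable (lebesgue_on \<Omega>) (\<lambda>p. (?u2 p)\<^sup>2)"
    using D(1) D(3)[of True True] by (auto simp: L2_def)
  have i1: "integrable (lebesgue_on \<Omega>) (\<lambda>p. - (\<eta> p * v p * ?u2 p))"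
    by (intro Bochner_Integration.integrable_minus L2_integrable_mult TSO_L2[OF et D(1)] D(3))
  have m1: "- L2_inner \<Omega> (\<lambda>p. \<eta> p * v p) ?u2 \<le> (\<integral>p. 1 / 2 * (?c p * (v p)\<^sup>2) + pi ^ 4 / 2 * (?u2 p)\<^sup>2 \<partial>lebesgue_on \<Omega>)"
  proof -
    have "- L2_inner \<Omega> (\<lambda>p. \<eta> p * v p) ?u2 = (\<integral>p. - (\<eta> p * v p * ?u2 p) \<partial>lebesgue_on \<Omega>)"
      by (simp add: L2_inner_def)
    also have "\<dots> \<le> (\<integral>p. 1 / 2 * (?c p * (v p)\<^sup>2) + pi ^ 4 / 2 * (?u2 p)\<^sup>2 \<partial>lebesgue_on \<Omega>)"
    proof (rule integral_mono[OF i1])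
      fix p assume "p \<in> space (lebesgue_on \<Omega>)"
      then have p: "p \<in> \<Omega>" by simp
      define x where "x = fst p * (pi - fst p)"
      have x: "0 \<le> x" "x \<le> pi\<^sup>2" unfolding x_def using w0[OF p] by auto
      have "0 \<le> (v p + x * ?u2 p)\<^sup>2" by simp
      then have "- (x * v p * ?u2 p) \<le> (v p)\<^sup>2 / 2 + x\<^sup>2 * (?u2 p)\<^sup>2 / 2"
        by (simp add: power2_sum power_mult_distrib mult_ac)
      then have "?c p * (- (x * v p * ?u2 p)) \<le> ?c p * ((v p)\<^sup>2 / 2 + x\<^sup>2 * (?u2 p)\<^sup>2 / 2)"
        using bump_range(1) by (rule mult_left_mono)
      also have "\<dots> \<le> ?c p * (v p)\<^sup>2 / 2 + 1 * (x\<^sup>2 * (?u2 p)\<^sup>2 / 2)"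
        unfolding distrib_left using bump_range(2)[of \<kappa> \<kappa> p] by (intro add_mono mult_right_mono) auto
      also have "x\<^sup>2 * (?u2 p)\<^sup>2 \<le> (pi\<^sup>2)\<^sup>2 * (?u2 p)\<^sup>2"
        using x by (intro mult_right_mono power_mono) auto
      finally show "- (\<eta> p * v p * ?u2 p) \<le> 1 / 2 * (?c p * (v p)\<^sup>2) + pi ^ 4 / 2 * (?u2 p)\<^sup>2"
        by (simp add: eta x_def[symmetric] mult_ac flip: power_mult)
    qed (intro Bochner_Integration.integrable_add integrable_mult_right ci vi)
    finally show ?thesis .
  qed
  have m2: "1 / 2 * L2_inner \<Omega> (\<lambda>p. pd True (pd True \<eta>) p * v p) v
     \<le> (\<integral>p. - (?c p * (v p)\<^sup>2) + (K * \<epsilon> / (2 * \<kappa>)) * (if fst p \<le> 2 * \<kappa> \<or> pi - 2 * \<kappa> \<le> fst p then 1 else 0) \<partial>lebesgue_on \<Omega>)"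
  proof -
    have i: "integrable (lebesgue_on \<Omega>) (\<lambda>p. 1 / 2 * (pd True (pd True \<eta>) p * v p * v p))"
      by (intro integrable_mult_right L2_integrable_mult TSO_L2[OF TS_pd[OF TS_pd[OF et]] D(1)] D(1))
    have "1 / 2 * L2_inner \<Omega> (\<lambda>p. pd True (pd True \<eta>) p * v p) v = (\<integral>p. 1 / 2 * (pd True (pd True \<eta>) p * v p * v p) \<partial>lebesgue_on \<Omega>)"
      by (simp add: L2_inner_def)
    also have "\<dots> \<le> (\<integral>p. - (?c p * (v p)\<^sup>2) + (K * \<epsilon> / (2 * \<kappa>)) * (if fst p \<le> 2 * \<kappa> \<or> pi - 2 * \<kappa> \<le> fst p then 1 else 0) \<partial>lebesgue_on \<Omega>)"
    proof (rule integral_mono_AE[OF i])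
      show "integrable (lebesgue_on \<Omega>) (\<lambda>p. - (?c p * (v p)\<^sup>2) + (K * \<epsilon> / (2 * \<kappa>)) * (if fst p \<le> 2 * \<kappa> \<or> pi - 2 * \<kappa> \<le> fst p then 1 else 0))"
        by (intro Bochner_Integration.integrable_add Bochner_Integration.integrable_minus integrable_mult_right ci strip_integral(2) k)
      have sp: "AE p in lebesgue_on \<Omega>. p \<in> \<Omega>" by (rule AE_I2) simp
      show "AE p in lebesgue_on \<Omega>. 1 / 2 * (pd True (pd True \<eta>) p * v p * v p) \<le> - (?c p * (v p)\<^sup>2) + (K * \<epsilon> / (2 * \<kappa>)) * (if fst p \<le> 2 * \<kappa> \<or> pi - 2 * \<kappa> \<le> fst p then 1 else 0)"
        using small sp
      proof eventually_elim
        case (elim p)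
        let ?s = "fst p \<le> 2 * \<kappa> \<or> pi - 2 * \<kappa> \<le> fst p"
        have b01: "0 \<le> b (snd p)" "b (snd p) \<le> 1" unfolding b_def by (rule cutoff_range)+
        have "deriv (deriv a) (fst p) \<le> - 2 * cutoff \<kappa> \<kappa> (pi - \<kappa>) (fst p) + (if ?s then K / \<kappa> else 0)"
          unfolding a_def[abs_def] using elim(2) by (intro K(2) k) auto
        then have "deriv (deriv a) (fst p) * b (snd p) \<le> (- 2 * cutoff \<kappa> \<kappa> (pi - \<kappa>) (fst p) + (if ?s then K / \<kappa> else 0)) * b (snd p)"
          using b01 by (intro mult_right_mono)
        also have "\<dots> = - 2 * ?c p + (if ?s then K / \<kappa> else 0) * b (snd p)"
          unfolding bump_def b_def by (simp only: distrib_right mult.assoc)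
        also have "(if ?s then K / \<kappa> else 0) * b (snd p) \<le> (if ?s then K / \<kappa> else 0) * 1"
          using b01 K(1) k by (intro mult_left_mono) auto
        finally have d: "deriv (deriv a) (fst p) * b (snd p) \<le> - 2 * ?c p + (if ?s then K / \<kappa> else 0) * 1" by simp
        define r where "r = (if ?s then K / \<kappa> else 0)"
        have "pd True (pd True \<eta>) p * (v p)\<^sup>2 \<le> (- 2 * ?c p + r) * (v p)\<^sup>2"
          unfolding exx r_def using d by (intro mult_right_mono) auto
        moreover have "r * (v p)\<^sup>2 \<le> r * \<epsilon>"
        proof (cases ?s)
          case True
          then have "(v p)\<^sup>2 \<le> \<epsilon>" using elim(1) by blast
          moreover have "0 \<le> r" using K(1) k by (simp add: r_def)
          ultimately show ?thesis by (rule mult_left_mono)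
        qed (simp add: r_def)
        ultimately have e: "pd True (pd True \<eta>) p * (v p)\<^sup>2 \<le> - 2 * (?c p * (v p)\<^sup>2) + r * \<epsilon>"
          by (simp only: distrib_right mult.assoc)
        have "1 / 2 * (r * \<epsilon>) = (K * \<epsilon> / (2 * \<kappa>)) * (if ?s then 1 else 0)" by (simp add: r_def)
        moreover have "1 / 2 * (pd True (pd True \<eta>) p * v p * v p) = 1 / 2 * (pd True (pd True \<eta>) p * (v p)\<^sup>2)"
          by (simp add: power2_eq_square)
        ultimately show ?case using e by linarith
      qed
    qed
    finally show ?thesis .
  qed
  have "0 \<le> (1 / 2 * (\<integral>p. ?c p * (v p)\<^sup>2 \<partial>lebesgue_on \<Omega>) + pi ^ 4 / 2 * (\<integral>p. (?u2 p)\<^sup>2 \<partial>lebesgue_on \<Omega>))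
     + (- (\<integral>p. ?c p * (v p)\<^sup>2 \<partial>lebesgue_on \<Omega>) + K * \<epsilon> / (2 * \<kappa>) * (\<integral>p. (if fst p \<le> 2 * \<kappa> \<or> pi - 2 * \<kappa> \<le> fst p then 1 else 0) \<partial>lebesgue_on \<Omega>))"
  proof -
    have "(\<integral>p. 1 / 2 * (?c p * (v p)\<^sup>2) + pi ^ 4 / 2 * (?u2 p)\<^sup>2 \<partial>lebesgue_on \<Omega>)
       = 1 / 2 * (\<integral>p. ?c p * (v p)\<^sup>2 \<partial>lebesgue_on \<Omega>) + pi ^ 4 / 2 * (\<integral>p. (?u2 p)\<^sup>2 \<partial>lebesgue_on \<Omega>)"
      by (subst Bochner_Integration.integral_add[OF integrable_mult_right[OF ci] integrable_mult_right[OF vi(2)]]) simp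
    moreover have "(\<integral>p. - (?c p * (v p)\<^sup>2) + (K * \<epsilon> / (2 * \<kappa>)) * (if fst p \<le> 2 * \<kappa> \<or> pi - 2 * \<kappa> \<le> fst p then 1 else 0) \<partial>lebesgue_on \<Omega>)
       = - (\<integral>p. ?c p * (v p)\<^sup>2 \<partial>lebesgue_on \<Omega>) + K * \<epsilon> / (2 * \<kappa>) * (\<integral>p. (if fst p \<le> 2 * \<kappa> \<or> pi - 2 * \<kappa> \<le> fst p then 1 else 0) \<partial>lebesgue_on \<Omega>)"
      by (subst Bochner_Integration.integral_add[OF Bochner_Integration.integrable_minus[OF ci] integrable_mult_right[OF strip_integral(2)[OF k(1)]]]) simp
    ultimately show ?thesis using ge m1 m2 by linarith
  qed
  moreover have "K * \<epsilon> / (2 * \<kappa>) * (\<integral>p. (if fst p \<le> 2 * \<kappa> \<or> pi - 2 * \<kappa> \<le> fst p then 1 else 0) \<partial>lebesgue_on \<Omega>) \<le> K * \<epsilon> / (2 * \<kappa>) * (8 * \<kappa> * l)"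
    using K e k by (intro mult_left_mono strip_integral(1)) auto
  moreover have "K * \<epsilon> / (2 * \<kappa>) * (8 * \<kappa> * l) = 4 * K * l * \<epsilon>" using k by simp
  moreover have "(\<integral>p. (?u2 p)\<^sup>2 \<partial>lebesgue_on \<Omega>) \<le> 2 * B v v"
    using hess_le_B[OF w, of True True] by (simp add: L2_inner_def power2_eq_square)
  then have "pi ^ 4 / 2 * (\<integral>p. (?u2 p)\<^sup>2 \<partial>lebesgue_on \<Omega>) \<le> pi ^ 4 / 2 * (2 * B v v)" by (rule mult_left_mono) simp
  ultimately show ?thesis by argo
qed

lemma divide_le_self_nat: "0 \<le> m \<Longrightarrow> m / real (Suc n) \<le> m"
  using mult_left_mono[of 1 "real (Suc n)" m] by (simp add: pos_divide_le_eq)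

lemma Poincare:
  assumes v: "v \<in> V" shows "L2_inner \<Omega> v v \<le> 2 * pi ^ 4 * B v v"
proof (rule field_le_epsilon)
  fix \<epsilon>' :: real assume e': "0 < \<epsilon>'"
  note D = weak2D[OF V_weak2[OF v]]
  obtain K where K: "0 \<le> K" "\<forall>\<kappa> x. 0 < \<kappa> \<longrightarrow> 6 * \<kappa> < pi \<longrightarrow> x \<in> {0..pi} \<longrightarrow>
       deriv (deriv (\<lambda>x. x * (pi - x) * cutoff \<kappa> \<kappa> (pi - \<kappa>) x)) x
         \<le> - 2 * cutoff \<kappa> \<kappa> (pi - \<kappa>) x + (if x \<le> 2 * \<kappa> \<or> pi - 2 * \<kappa> \<le> x then K / \<kappa> else 0)"
    using weight_second_derivative by blast
  \<comment> \<open>The summand 1 keeps the denominator positive when K vanishes.\<close>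
  define \<epsilon> where "\<epsilon> = \<epsilon>' / (8 * K * l + 1)"
  have Kl: "0 < 8 * K * l + 1" using K l by (simp add: add_nonneg_pos)
  have e: "0 < \<epsilon>" using e' Kl by (simp add: \<epsilon>_def)
  obtain g where g: "continuous_on (closure \<Omega>) g" "AE p in lebesgue_on \<Omega>. v p = g p" "\<And>p. p \<in> {0, pi} \<times> {-l<..<l} \<Longrightarrow> g p = 0"
    using V_rep[OF v] by blast
  have cl: "closure \<Omega> = {0..pi} \<times> {-l..l}" using l by (simp add: closure_Times)
  have "uniformly_continuous_on (closure \<Omega>) g"
    using g(1) by (rule compact_uniformly_continuous) (simp add: cl compact_Times)
  moreover have "0 < sqrt \<epsilon>" using e by simp
  ultimately obtain d where d: "0 < d" "\<And>p q. p \<in> closure \<Omega> \<Longrightarrow> q \<in> closure \<Omega> \<Longrightarrow> dist q p < d \<Longrightarrow> dist (g q) (g p) < sqrt \<epsilon>"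
    unfolding uniformly_continuous_on_def by metis
  \<comment> \<open>The strips of width \<open>2 \<kappa>\<close> then stay within distance \<open>d\<close> of the sides, and \<open>6 \<kappa> < \<pi>\<close>.\<close>
  define \<kappa> where "\<kappa> n = min (d / 4) (pi / 7) / real (Suc n)" for n
  have kp: "0 < \<kappa> n" for n using d by (simp add: \<kappa>_def)
  have kle: "\<kappa> n \<le> min (d / 4) (pi / 7)" for n
    unfolding \<kappa>_def using d by (intro divide_le_self_nat) simp_all
  have bound: "(\<integral>p. bump (\<kappa> n) (\<kappa> n) p * (v p)\<^sup>2 \<partial>lebesgue_on \<Omega>) \<le> 2 * pi ^ 4 * B v v + 8 * K * l * \<epsilon>" for n
  proof (rule truncated_poincare[OF v K(1) K(2)[rule_format] kp])
    have "7 * \<kappa> n \<le> pi" using kle[of n] by simp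
    then show "6 * \<kappa> n < pi" using kp[of n] by linarith
    have sp: "AE p in lebesgue_on \<Omega>. p \<in> \<Omega>" by (rule AE_I2) simp
    show "AE p in lebesgue_on \<Omega>. fst p \<le> 2 * \<kappa> n \<or> pi - 2 * \<kappa> n \<le> fst p \<longrightarrow> (v p)\<^sup>2 \<le> \<epsilon>"
      using g(2) sp
    proof eventually_elim
      case (elim p)
      show ?case
      proof
        assume s: "fst p \<le> 2 * \<kappa> n \<or> pi - 2 * \<kappa> n \<le> fst p"
        define x where "x = (if fst p \<le> 2 * \<kappa> n then 0 else pi)"
        have "\<bar>fst p - x\<bar> \<le> 2 * \<kappa> n" using s elim(2) by (auto simp: x_def)
        then have "\<bar>fst p - x\<bar> < d" using kle[of n] d(1) by linarith
        then have "dist p (x, snd p) < d" by (cases p) (simp add: dist_Pair_Pair dist_real_def)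
        moreover have "p \<in> closure \<Omega>" "(x, snd p) \<in> closure \<Omega>" using elim(2) unfolding cl by (auto simp: x_def)
        ultimately have "dist (g p) (g (x, snd p)) < sqrt \<epsilon>" using d(2) by blast
        moreover have "g (x, snd p) = 0" by (rule g(3)) (use elim(2) in \<open>auto simp: x_def\<close>)
        ultimately have "\<bar>v p\<bar> \<le> sqrt \<epsilon>" using elim(1) by (simp add: dist_real_def)
        then have "\<bar>v p\<bar>\<^sup>2 \<le> (sqrt \<epsilon>)\<^sup>2" by (rule power_mono) simp
        then show "(v p)\<^sup>2 \<le> \<epsilon>" using e by simp
      qed
    qed
  qed (rule less_imp_le[OF e] | assumption)+
  have k0: "\<kappa> \<longlonglongrightarrow> 0"
    unfolding \<kappa>_def[abs_def] by (rule LIMSEQ_Suc[OF lim_const_over_n])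
  have "(\<lambda>n. \<integral>p. bump (\<kappa> n) (\<kappa> n) p * (v p)\<^sup>2 \<partial>lebesgue_on \<Omega>) \<longlonglongrightarrow> (\<integral>p. (v p)\<^sup>2 \<partial>lebesgue_on \<Omega>)"
  proof (rule integral_dominated_convergence[where w="\<lambda>p. (v p)\<^sup>2"])
    show "integrable (lebesgue_on \<Omega>) (\<lambda>p. (v p)\<^sup>2)" using D(1) by (simp add: L2_def)
    show "(\<lambda>p. (v p)\<^sup>2) \<in> borel_measurable (lebesgue_on \<Omega>)" using L2_measurable[OF D(1)] by simp
    show "(\<lambda>p. bump (\<kappa> n) (\<kappa> n) p * (v p)\<^sup>2) \<in> borel_measurable (lebesgue_on \<Omega>)" for n
      using L2_measurable[OF Om.TS_L2[OF bump_TS[OF kp kp]]] L2_measurable[OF D(1)] by simp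
    show "AE p in lebesgue_on \<Omega>. (\<lambda>n. bump (\<kappa> n) (\<kappa> n) p * (v p)\<^sup>2) \<longlonglongrightarrow> (v p)\<^sup>2"
    proof (rule AE_I2)
      fix p assume "p \<in> space (lebesgue_on \<Omega>)"
      then have p: "p \<in> \<Omega>" by simp
      define m where "m = min (min (fst p) (pi - fst p)) (min (snd p + l) (l - snd p)) / 2"
      have m: "0 < m" using p by (auto simp: m_def)
      from order_tendstoD(2)[OF k0 m] have "\<forall>\<^sub>F n in sequentially. bump (\<kappa> n) (\<kappa> n) p * (v p)\<^sup>2 = (v p)\<^sup>2"
      proof eventually_elim
        case (elim n)
        have "p \<in> Bx (\<kappa> n + \<kappa> n)" using elim unfolding Bx_def m_def by (cases p) auto
        then show ?case using bump_1[OF kp] by simp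
      qed
      then show "(\<lambda>n. bump (\<kappa> n) (\<kappa> n) p * (v p)\<^sup>2) \<longlonglongrightarrow> (v p)\<^sup>2" by (rule tendsto_eventually)
    qed
    show "AE p in lebesgue_on \<Omega>. norm (bump (\<kappa> n) (\<kappa> n) p * (v p)\<^sup>2) \<le> (v p)\<^sup>2" for n
      using bump_range by (intro AE_I2) (simp add: abs_mult mult_left_le_one_le)
  qed
  then have "(\<integral>p. (v p)\<^sup>2 \<partial>lebesgue_on \<Omega>) \<le> 2 * pi ^ 4 * B v v + 8 * K * l * \<epsilon>"
    by (rule LIMSEQ_le_const2) (use bound in blast)
  moreover have "8 * K * l * \<epsilon> \<le> (8 * K * l + 1) * \<epsilon>" using e by simp
  moreover have "(8 * K * l + 1) * \<epsilon> = \<epsilon>'" using Kl by (simp add: \<epsilon>_def)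
  ultimately show "L2_inner \<Omega> v v \<le> 2 * pi ^ 4 * B v v + \<epsilon>'"
    by (simp add: L2_inner_def power2_eq_square)
qed

end


section \<open>Multipliers\<close>

lemma AE_shift: "AE p in lebesgue. Q p \<Longrightarrow> AE p in lebesgue. Q (p + v)" for v :: "real \<times> real"
proof -
  assume "AE p in lebesgue. Q p"
  then have "AE p in distr lebesgue lebesgue (\<lambda>p. v + p). Q p" by (simp only: lebesgue_shift)
  from AE_distrD[OF lebesgue_shift(2) this] show ?thesis by (simp add: add.commute)
qed

lemma dq_lin:
  "dq k h (\<lambda>p. f p + g p) = (\<lambda>p. dq k h f p + dq k h g p)"
  "dq k h (\<lambda>p. c * f p) = (\<lambda>p. c * dq k h f p)"
  by (auto simp: dq_def fun_eq_iff add_divide_distrib diff_divide_distrib right_diff_distrib)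

lemma weak2_dq:
  assumes w: "weak2 UNIV w w1 w2"
  shows "weak2 UNIV (dq k h w) (\<lambda>j. dq k h (w1 j)) (\<lambda>i j. dq k h (w2 i j))"
proof -
  have U: "(UNIV :: (real \<times> real) set) \<in> sets lebesgue" by simp
  have e: "dq k h f = (\<lambda>p. (1 / (2 * h)) * f (p + h *\<^sub>R dir k) + (- 1 / (2 * h)) * f (p + (- h) *\<^sub>R dir k))" for f
    by (auto simp: dq_def diff_divide_distrib)
  show ?thesis unfolding e
    by (rule weak2_add[OF weak2_scale[OF weak2_shift[OF w] U] weak2_scale[OF weak2_shift[OF w] U] U])
qed

lemma dq_nm:
  assumes "f \<in> L2 UNIV" shows "L2.nm UNIV (dq k h f) \<le> 2 / \<bar>2 * h\<bar> * L2.nm UNIV f"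
proof -
  have sh: "(\<lambda>p. f (p + v)) \<in> L2 UNIV" for v by (rule L2_shift[OF assms])
  have e: "dq k h f = (\<lambda>p. (1 / (2 * h)) * (f (p + h *\<^sub>R dir k) + (-1) * f (p + (- h) *\<^sub>R dir k)))"
    by (auto simp: dq_def)
  have "L2.nm UNIV (\<lambda>p. f (p + h *\<^sub>R dir k) + (-1) * f (p + (- h) *\<^sub>R dir k))
     \<le> L2.nm UNIV (\<lambda>p. f (p + h *\<^sub>R dir k)) + L2.nm UNIV (\<lambda>p. (-1) * f (p + (- h) *\<^sub>R dir k))"
    by (rule L2.nm_triangle[OF sh L2.scale[OF sh]])
  also have "\<dots> = 2 * L2.nm UNIV f"
    unfolding L2.nm_scale[OF sh] L2_nm_shift[OF assms] by simp
  finally have "L2.nm UNIV (\<lambda>p. f (p + h *\<^sub>R dir k) + (-1) * f (p + (- h) *\<^sub>R dir k)) \<le> 2 * L2.nm UNIV f" .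
  then show ?thesis unfolding e L2.nm_scale[OF L2.add[OF sh L2.scale[OF sh]]]
    by (simp add: abs_divide divide_right_mono)
qed

definition co :: "bool \<Rightarrow> real \<times> real \<Rightarrow> real" where "co k p = (if k then fst p else snd p)"

lemma co_pd: "co k differentiable_on UNIV" "pd j (co k) p = (if j = k then 1 else 0)"
proof -
  show "co k differentiable_on UNIV"
    unfolding co_def[abs_def] by (cases k) (auto intro!: linear_imp_differentiable_on linear_fst linear_snd)
  have "partial_x (co True) = (\<lambda>p. 1)" "partial_x (co False) = (\<lambda>p. 0)" "partial_y (co True) = (\<lambda>p. 0)" "partial_y (co False) = (\<lambda>p. 1)"
    by (intro partial_x_eqI partial_y_eqI; simp add: co_def)+
  then show "pd j (co k) p = (if j = k then 1 else 0)" by (cases j; cases k; simp add: pd_def)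
qed

context plate_setting
begin

text \<open>Multiplication by a function with compact support in the plate stays in \<open>V\<close>: the boundary
  condition becomes trivial.\<close>

lemma V_cutoff_mult:
  assumes u: "u \<in> V" and phi: "\<phi> \<in> TSO"
  shows "(\<lambda>p. \<phi> p * u p) \<in> V"
    "weak2 \<Omega> (\<lambda>p. \<phi> p * u p) (\<lambda>k p. \<phi> p * grad l u k p + pd k \<phi> p * u p)
      (\<lambda>j k p. \<phi> p * hess l u j k p + pd j \<phi> p * grad l u k p + pd k \<phi> p * grad l u j p + pd j (pd k \<phi>) p * u p)"
proof -
  have z: "\<phi> p = 0" "pd k \<phi> p = 0" "pd j (pd k \<phi>) p = 0" if "p \<notin> \<Omega>" for p j k
    by (rule TS_zero[OF phi that] TS_zero[OF TS_pd[OF phi] that] TS_zero[OF TS_pd[OF TS_pd[OF phi]] that])+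
  show w: "weak2 \<Omega> (\<lambda>p. \<phi> p * u p) (\<lambda>k p. \<phi> p * grad l u k p + pd k \<phi> p * u p)
      (\<lambda>j k p. \<phi> p * hess l u j k p + pd j \<phi> p * grad l u k p + pd k \<phi> p * grad l u j p + pd j (pd k \<phi>) p * u p)"
    by (rule weak2_restrict[OF weak2_mult[OF V_weak2[OF u] phi Om_sets] Om_sets]) (simp_all only: z mult_zero_left add_0_left not_False_eq_True)
  obtain g where g: "continuous_on (closure \<Omega>) g" "AE p in lebesgue_on \<Omega>. u p = g p"
    using V_rep[OF u] by blast
  show "(\<lambda>p. \<phi> p * u p) \<in> V"
  proof (rule V_I[OF w])
    show "continuous_on (closure \<Omega>) (\<lambda>p. \<phi> p * g p)" by (intro continuous_on_mult TS_cont[OF phi] g(1))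
    show "AE p in lebesgue_on \<Omega>. \<phi> p * u p = \<phi> p * g p" using g(2) by eventually_elim simp
    show "\<phi> p * g p = 0" if "p \<in> {0, pi} \<times> {-l<..<l}" for p
      using TS_zero[OF phi, of p] that by auto
  qed
qed

lemma cutoff_rep_continuous:
  assumes g: "continuous_on (closure \<Omega>) g" and phi: "\<phi> \<in> TSO"
  shows "continuous_on UNIV (\<lambda>p. \<phi> p * g p)"
proof -
  obtain K where K: "compact K" "K \<subseteq> \<Omega>" "\<forall>p. p \<notin> K \<longrightarrow> \<phi> p = 0" using TS_support[OF phi] by blast
  have "continuous_on (\<Omega> \<union> - K) (\<lambda>p. \<phi> p * g p)"
  proof (rule continuous_on_open_Un)
    show "open \<Omega>" by (intro open_Times) auto
    show "open (- K)" using K(1) compact_imp_closed by blast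
    show "continuous_on \<Omega> (\<lambda>p. \<phi> p * g p)"
      by (intro continuous_on_mult TS_cont[OF phi] continuous_on_subset[OF g closure_subset])
    have "continuous_on (- K) (\<lambda>p. 0 :: real)" by simp
    then show "continuous_on (- K) (\<lambda>p. \<phi> p * g p)"
    proof (rule continuous_on_cong[THEN iffD1, OF refl, rotated])
      fix p assume "p \<in> - K"
      then have "\<phi> p = 0" using K(3) by blast
      then show "0 = \<phi> p * g p" by simp
    qed
  qed
  moreover have "\<Omega> \<union> - K = UNIV" using K(2) by blast
  ultimately show ?thesis by (simp only:)
qed

subsection \<open>Bounds of cut-off derivatives by the energy\<close>

lemma nm_TSO_mult:
  assumes phi: "\<phi> \<in> TSO"
  shows "\<exists>C\<ge>0. \<forall>f\<in>L2 \<Omega>. L2.nm UNIV (\<lambda>p. \<phi> p * f p) \<le> C * L2.nm \<Omega> f"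
proof -
  obtain K where K: "0 \<le> K" "\<And>p. \<bar>\<phi> p\<bar> \<le> K" using TS_bounded[OF phi] by metis
  have "L2.nm UNIV (\<lambda>p. \<phi> p * f p) \<le> K * L2.nm \<Omega> f" if f: "f \<in> L2 \<Omega>" for f
  proof -
    have "L2.nm UNIV (\<lambda>p. \<phi> p * f p) = L2.nm \<Omega> (\<lambda>p. \<phi> p * f p)"
      by (rule Om.nm_UNIV) (simp add: TS_zero[OF phi])
    moreover have "L2_inner \<Omega> (\<lambda>p. \<phi> p * f p) (\<lambda>p. \<phi> p * f p) \<le> K\<^sup>2 * L2_inner \<Omega> f f"
      by (rule L2_inner_mono[OF TSO_L2[OF phi f] f]) (unfold abs_mult, intro mult_right_mono K(2), simp)
    from real_sqrt_le_mono[OF this] have "L2.nm \<Omega> (\<lambda>p. \<phi> p * f p) \<le> K * L2.nm \<Omega> f"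
      using K(1) by (simp add: L2.nm_def real_sqrt_mult)
    ultimately show ?thesis by simp
  qed
  then show ?thesis using K(1) by blast
qed

lemma nm_hess: "u \<in> V \<Longrightarrow> L2.nm \<Omega> (hess l u j k) \<le> 2 * sqrt (B u u)"
proof -
  assume u: "u \<in> V"
  have "L2.nm \<Omega> (hess l u j k) \<le> sqrt (2 * B u u)"
    unfolding L2.nm_def by (rule real_sqrt_le_mono[OF hess_le_B[OF V_weak2[OF u]]])
  also have "\<dots> \<le> sqrt (4 * B u u)" using V.ip_pos[OF u] by (intro real_sqrt_le_mono) simp
  also have "\<dots> = 2 * sqrt (B u u)" by (simp add: real_sqrt_mult)
  finally show ?thesis .
qed

lemma nm_u: "u \<in> V \<Longrightarrow> L2.nm \<Omega> u \<le> sqrt (2 * pi ^ 4) * sqrt (B u u)"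
  unfolding L2.nm_def real_sqrt_mult[symmetric] by (rule real_sqrt_le_mono[OF Poincare])

text \<open>The energy controls no first derivatives directly; away from the boundary they are
  interpolated by \<open>gradient_identity\<close>.\<close>

lemma gradient_bound:
  assumes phi: "\<phi> \<in> TSO" and s: "0 < s" and z: "\<And>p. p \<notin> Bx s \<Longrightarrow> \<phi> p = 0"
  shows "\<exists>C\<ge>0. \<forall>u\<in>V. L2.nm UNIV (\<lambda>p. \<phi> p * grad l u k p) \<le> C * sqrt (B u u)"
proof -
  define \<eta> where "\<eta> = bump (s / 2) (s / 2)"
  have s2: "0 < s / 2" using s by simp
  have et: "\<eta> \<in> TSO" unfolding \<eta>_def by (rule bump_TS[OF s2 s2])
  have e1: "\<eta> p = 1" if "p \<in> Bx s" for p unfolding \<eta>_def using that by (intro bump_1[OF s2]) simp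
  have er: "0 \<le> \<eta> p" "\<eta> p \<le> 1" for p unfolding \<eta>_def by (rule bump_range)+
  have e0: "\<eta> p = 0" if "p \<notin> Bx (s / 2)" for p unfolding \<eta>_def by (rule bump_0[OF s2 that])
  obtain K where K: "0 \<le> K" "\<And>p. \<bar>\<phi> p\<bar> \<le> K" using TS_bounded[OF phi] by metis
  obtain K1 where K1: "0 \<le> K1" "\<forall>f\<in>L2 \<Omega>. L2.nm UNIV (\<lambda>p. \<eta> p * f p) \<le> K1 * L2.nm \<Omega> f" using nm_TSO_mult[OF et] by blast
  obtain K2 where K2: "0 \<le> K2" "\<forall>f\<in>L2 \<Omega>. L2.nm UNIV (\<lambda>p. pd k (pd k \<eta>) p * f p) \<le> K2 * L2.nm \<Omega> f"
    using nm_TSO_mult[OF TS_pd[OF TS_pd[OF et]]] by blast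
  have Um: "L2.nm UNIV (\<lambda>p. \<psi> p * f p) = L2.nm \<Omega> (\<lambda>p. \<psi> p * f p)" if "\<psi> \<in> TSO" for \<psi> f
    by (rule Om.nm_UNIV) (simp add: TS_zero[OF that])
  define P where "P = sqrt (2 * pi ^ 4)"
  have P: "0 \<le> P" by (simp add: P_def)
  define C where "C = K\<^sup>2 * (K1 * P * 2 + K2 * P * P)"
  have C: "0 \<le> C" using K K1 K2 P by (simp add: C_def)
  have "L2.nm UNIV (\<lambda>p. \<phi> p * grad l u k p) \<le> sqrt C * sqrt (B u u)" if u: "u \<in> V" for u
  proof -
    note D = VD[OF u]
    have Bu: "0 \<le> B u u" by (rule V.ip_pos[OF u])
    let ?b = "sqrt (B u u)"
    have b: "0 \<le> ?b" "?b * ?b = B u u" using Bu by auto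
    have "L2_inner \<Omega> (\<lambda>p. \<eta> p * grad l u k p) (grad l u k)
       = - L2_inner \<Omega> (\<lambda>p. \<eta> p * u p) (hess l u k k) + 1 / 2 * L2_inner \<Omega> (\<lambda>p. pd k (pd k \<eta>) p * u p) u"
      by (rule gradient_identity[OF V_weak2[OF u] et s2 e0])
    also have "\<dots> \<le> L2.nm \<Omega> (\<lambda>p. \<eta> p * u p) * L2.nm \<Omega> (hess l u k k) + L2.nm \<Omega> (\<lambda>p. pd k (pd k \<eta>) p * u p) * L2.nm \<Omega> u"
      using L2.Cauchy_Schwarz[OF TSO_L2[OF et D(1)] D(3), of k k]
        L2.Cauchy_Schwarz[OF TSO_L2[OF TS_pd[OF TS_pd[OF et, of k], of k] D(1)] D(1)] by linarith
    also have "\<dots> \<le> (K1 * (P * ?b)) * (2 * ?b) + (K2 * (P * ?b)) * (P * ?b)"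
    proof (intro add_mono mult_mono nm_hess[OF u])
      have u0: "L2.nm \<Omega> u \<le> P * ?b" unfolding P_def by (rule nm_u[OF u])
      then show "L2.nm \<Omega> u \<le> P * ?b" .
      show "L2.nm \<Omega> (\<lambda>p. \<eta> p * u p) \<le> K1 * (P * ?b)"
        using K1(2)[rule_format, OF D(1)] mult_left_mono[OF u0 K1(1)] unfolding Um[OF et] by linarith
      show "L2.nm \<Omega> (\<lambda>p. pd k (pd k \<eta>) p * u p) \<le> K2 * (P * ?b)"
        using K2(2)[rule_format, OF D(1)] mult_left_mono[OF u0 K2(1)] unfolding Um[OF TS_pd[OF TS_pd[OF et]]] by linarith
    qed (use K1 K2 P b D in auto)
    also have "\<dots> = (K1 * P * 2 + K2 * P * P) * (?b * ?b)" by (simp add: algebra_simps)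
    finally have g: "L2_inner \<Omega> (\<lambda>p. \<eta> p * grad l u k p) (grad l u k) \<le> (K1 * P * 2 + K2 * P * P) * B u u"
      unfolding b(2) .
    have "L2_inner \<Omega> (\<lambda>p. \<phi> p * grad l u k p) (\<lambda>p. \<phi> p * grad l u k p) \<le> (\<integral>p. K\<^sup>2 * (\<eta> p * grad l u k p * grad l u k p) \<partial>lebesgue_on \<Omega>)"
      unfolding L2_inner_def
    proof (rule integral_mono)
      show "integrable (lebesgue_on \<Omega>) (\<lambda>p. \<phi> p * grad l u k p * (\<phi> p * grad l u k p))"
        by (intro L2_integrable_mult TSO_L2[OF phi D(2)])
      show "integrable (lebesgue_on \<Omega>) (\<lambda>p. K\<^sup>2 * (\<eta> p * grad l u k p * grad l u k p))"
        by (intro integrable_mult_right L2_integrable_mult TSO_L2[OF et D(2)] D(2))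
      fix p
      show "\<phi> p * grad l u k p * (\<phi> p * grad l u k p) \<le> K\<^sup>2 * (\<eta> p * grad l u k p * grad l u k p)"
      proof (cases "p \<in> Bx s")
        case True
        have "\<bar>\<phi> p\<bar>\<^sup>2 \<le> K\<^sup>2" using K by (intro power_mono) auto
        then have "(\<phi> p)\<^sup>2 * (grad l u k p)\<^sup>2 \<le> K\<^sup>2 * (grad l u k p)\<^sup>2" by (intro mult_right_mono) auto
        then show ?thesis using e1[OF True] by (simp add: power2_eq_square mult_ac)
      next
        case False
        have "0 \<le> K\<^sup>2 * (\<eta> p * (grad l u k p * grad l u k p))" by (intro mult_nonneg_nonneg[OF zero_le_power2] mult_nonneg_nonneg[OF er(1) zero_le_square])
        then show ?thesis using z[OF False] by (simp add: mult.assoc)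
      qed
    qed
    also have "\<dots> = K\<^sup>2 * L2_inner \<Omega> (\<lambda>p. \<eta> p * grad l u k p) (grad l u k)" by (simp add: L2_inner_def)
    also have "\<dots> \<le> C * B u u" unfolding C_def mult.assoc by (rule mult_left_mono[OF g[unfolded mult.assoc]]) simp
    finally have "L2.nm \<Omega> (\<lambda>p. \<phi> p * grad l u k p) \<le> sqrt (C * B u u)"
      unfolding L2.nm_def by (rule real_sqrt_le_mono)
    then show ?thesis by (simp add: Um[OF phi] real_sqrt_mult)
  qed
  then show ?thesis using C by (intro exI[of _ "sqrt C"]) auto
qed

definition dominated :: "((real \<times> real \<Rightarrow> real) \<Rightarrow> real) \<Rightarrow> bool" where
  "dominated F \<longleftrightarrow> (\<exists>C\<ge>0. \<forall>u\<in>V. F u \<le> C * sqrt (B u u))"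

lemma dominated_hess: "\<phi> \<in> TSO \<Longrightarrow> dominated (\<lambda>u. L2.nm UNIV (\<lambda>p. \<phi> p * hess l u j k p))"
proof -
  assume "\<phi> \<in> TSO"
  then obtain C where C: "0 \<le> C" "\<forall>f\<in>L2 \<Omega>. L2.nm UNIV (\<lambda>p. \<phi> p * f p) \<le> C * L2.nm \<Omega> f" using nm_TSO_mult by blast
  have "L2.nm UNIV (\<lambda>p. \<phi> p * hess l u j k p) \<le> (C * 2) * sqrt (B u u)" if u: "u \<in> V" for u
    using C(2)[rule_format, OF VD(3)[OF u, of j k]] mult_left_mono[OF nm_hess[OF u, of j k] C(1)] by linarith
  then show ?thesis unfolding dominated_def using C(1) by (intro exI[of _ "C * 2"]) auto
qed

lemma dominated_u: "\<phi> \<in> TSO \<Longrightarrow> dominated (\<lambda>u. L2.nm UNIV (\<lambda>p. \<phi> p * u p))"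
proof -
  assume "\<phi> \<in> TSO"
  then obtain C where C: "0 \<le> C" "\<forall>f\<in>L2 \<Omega>. L2.nm UNIV (\<lambda>p. \<phi> p * f p) \<le> C * L2.nm \<Omega> f" using nm_TSO_mult by blast
  have "L2.nm UNIV (\<lambda>p. \<phi> p * u p) \<le> (C * sqrt (2 * pi ^ 4)) * sqrt (B u u)" if u: "u \<in> V" for u
    using C(2)[rule_format, OF VD(1)[OF u]] mult_left_mono[OF nm_u[OF u] C(1)] by (simp only: mult.assoc)
  then show ?thesis unfolding dominated_def using C(1) by (intro exI[of _ "C * sqrt (2 * pi ^ 4)"]) auto
qed

lemma dominated_grad:
  "\<phi> \<in> TSO \<Longrightarrow> 0 < s \<Longrightarrow> (\<And>p. p \<notin> Bx s \<Longrightarrow> \<phi> p = 0) \<Longrightarrow> dominated (\<lambda>u. L2.nm UNIV (\<lambda>p. \<phi> p * grad l u k p))"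
  unfolding dominated_def by (rule gradient_bound)

lemma dominated_add: "dominated F \<Longrightarrow> dominated G \<Longrightarrow> (\<And>u. u \<in> V \<Longrightarrow> H u \<le> F u + G u) \<Longrightarrow> dominated H"
proof -
  assume FG: "dominated F" "dominated G" and H: "\<And>u. u \<in> V \<Longrightarrow> H u \<le> F u + G u"
  obtain C where C: "0 \<le> C" "\<forall>u\<in>V. F u \<le> C * sqrt (B u u)" using FG(1) unfolding dominated_def by blast
  obtain D where D: "0 \<le> D" "\<forall>u\<in>V. G u \<le> D * sqrt (B u u)" using FG(2) unfolding dominated_def by blast
  have "H u \<le> (C + D) * sqrt (B u u)" if u: "u \<in> V" for u
    using H[OF u] bspec[OF C(2) u] bspec[OF D(2) u] by (simp only: distrib_right)
  then show ?thesis unfolding dominated_def using C(1) D(1) by (intro exI[of _ "C + D"]) auto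
qed

end

text \<open>The width \<open>\<delta>\<close> fixes a family of nested cutoffs: \<open>\<zeta>\<close> is \<open>1\<close> on \<open>Bx \<delta>\<close>, and \<open>q\<close>, the truncated
  field \<open>q(p) = p\<close>, vanishes off \<open>Bx \<delta>\<close> and is not truncated on \<open>Bx (2 \<delta>)\<close>.\<close>

locale plate_layer = plate_setting +
  fixes \<delta> :: real
  assumes delta: "0 < \<delta>"
begin

definition \<zeta> :: "real \<times> real \<Rightarrow> real" where "\<zeta> = bump (\<delta> / 4) (\<delta> / 4)"

definition q :: "bool \<Rightarrow> real \<times> real \<Rightarrow> real" where "q k p = co k p * bump \<delta> \<delta> p"

text \<open>\<open>W u\<close> is \<open>u\<close> cut off so that it extends by zero to the plane and can be translated; \<open>W1\<close> and \<open>W2\<close>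
  are its derivatives.\<close>

definition W :: "(real \<times> real \<Rightarrow> real) \<Rightarrow> real \<times> real \<Rightarrow> real" where "W u p = \<zeta> p * u p"
definition W1 :: "(real \<times> real \<Rightarrow> real) \<Rightarrow> bool \<Rightarrow> real \<times> real \<Rightarrow> real" where
  "W1 u k p = \<zeta> p * grad l u k p + pd k \<zeta> p * u p"
definition W2 :: "(real \<times> real \<Rightarrow> real) \<Rightarrow> bool \<Rightarrow> bool \<Rightarrow> real \<times> real \<Rightarrow> real" where
  "W2 u j k p = \<zeta> p * hess l u j k p + pd j \<zeta> p * grad l u k p + pd k \<zeta> p * grad l u j p + pd j (pd k \<zeta>) p * u p"

lemma d4: "0 < \<delta> / 4" "\<delta> / 4 + \<delta> / 4 < \<delta>" using delta by auto

lemma zeta_TS: "\<zeta> \<in> TSO" unfolding \<zeta>_def by (rule bump_TS[OF d4(1) d4(1)])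

lemma zeta_flat: "p \<in> Bx \<delta> \<Longrightarrow> \<zeta> p = 1" "p \<in> Bx \<delta> \<Longrightarrow> pd k \<zeta> p = 0" "p \<in> Bx \<delta> \<Longrightarrow> pd j (pd k \<zeta>) p = 0"
  unfolding \<zeta>_def by (rule bump_flat[OF d4(1) d4(1) _ d4(2)], assumption)+

lemma zeta_0: "p \<notin> Bx (\<delta> / 4) \<Longrightarrow> \<zeta> p = 0" unfolding \<zeta>_def by (rule bump_0[OF d4(1)])

lemma W_eq: "p \<in> Bx \<delta> \<Longrightarrow> W u p = u p" "p \<in> Bx \<delta> \<Longrightarrow> W1 u k p = grad l u k p" "p \<in> Bx \<delta> \<Longrightarrow> W2 u j k p = hess l u j k p"
  unfolding W_def W1_def W2_def by (simp_all add: zeta_flat)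

lemma W_weak2: "u \<in> V \<Longrightarrow> weak2 UNIV (W u) (W1 u) (W2 u)"
  unfolding W_def[abs_def] W1_def[abs_def] W2_def[abs_def] by (rule weak2_mult[OF V_weak2 zeta_TS Om_sets])

lemma W_off: "p \<notin> \<Omega> \<Longrightarrow> W u p = 0" "p \<notin> \<Omega> \<Longrightarrow> W1 u k p = 0" "p \<notin> \<Omega> \<Longrightarrow> W2 u j k p = 0"
  unfolding W_def W1_def W2_def
  by (simp_all only: TS_zero[OF zeta_TS] TS_zero[OF TS_pd[OF zeta_TS]] TS_zero[OF TS_pd[OF TS_pd[OF zeta_TS]]] mult_zero_left add_0_left not_False_eq_True)

lemma q_TS: "q k \<in> TSO"
proof -
  have c: "cutoff \<delta> \<delta> (pi - \<delta>) \<in> Dfun {0<..<pi}" "cutoff \<delta> (- l + \<delta>) (l - \<delta>) \<in> Dfun {-l<..<l}"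
    by (intro cutoff_Dfun delta; use delta in auto)+
  show ?thesis
  proof (cases k)
    case True
    have "q k = (\<lambda>p. (\<lambda>x. x * cutoff \<delta> \<delta> (pi - \<delta>) x) (fst p) * cutoff \<delta> (- l + \<delta>) (l - \<delta>) (snd p))"
      using True by (simp add: q_def[abs_def] co_def bump_def mult.assoc)
    then show ?thesis using TS.tensor[OF Dfun_mult[OF smooth1_id c(1)] c(2)] by (simp only:)
  next
    case False
    have "q k = (\<lambda>p. cutoff \<delta> \<delta> (pi - \<delta>) (fst p) * (\<lambda>x. x * cutoff \<delta> (- l + \<delta>) (l - \<delta>) x) (snd p))"
      using False by (simp add: q_def[abs_def] co_def bump_def mult_ac)
    then show ?thesis using TS.tensor[OF c(1) Dfun_mult[OF smooth1_id c(2)]] by (simp only:)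
  qed
qed

lemma q_off0: "p \<notin> Bx \<delta> \<Longrightarrow> q k p = 0"
  unfolding q_def using bump_0[OF delta] by simp

lemma q_off: "p \<notin> Bx \<delta> \<Longrightarrow> q k p = 0" "p \<notin> Bx \<delta> \<Longrightarrow> pd i (q k) p = 0" "p \<notin> Bx \<delta> \<Longrightarrow> pd j (pd i (q k)) p = 0"
  by (rule TS_flat0[OF q_TS q_off0], assumption, assumption)+

lemma q_in:
  assumes "p \<in> Bx t" "2 * \<delta> < t"
  shows "pd i (q k) p = (if i = k then 1 else 0)" "pd j (pd i (q k)) p = 0"
proof -
  have U: "p \<in> Bo (2 * \<delta>)" using Bo(3)[OF assms(2)] assms(1) by blast
  have "q k x = co k x" if "x \<in> Bo (2 * \<delta>)" for x
  proof -
    have "x \<in> Bx (\<delta> + \<delta>)" using Bo(2)[of "2 * \<delta>"] that by auto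
    then show ?thesis unfolding q_def using bump_1[OF delta] by simp
  qed
  then have 1: "pd i (q k) x = (if i = k then 1 else 0)" if "x \<in> Bo (2 * \<delta>)" for x i
    using pd_local[OF TS_differentiable[OF q_TS] co_pd(1) Bo(1) _ that, of k k i] co_pd(2) by simp
  show "pd i (q k) p = (if i = k then 1 else 0)" by (rule 1[OF U])
  show "pd j (pd i (q k)) p = 0"
    by (rule pd_locally_const[OF TS_differentiable[OF TS_pd[OF q_TS]] Bo(1) 1 U])
qed

text \<open>The multiplier \<open>q\<^sub>k \<partial>\<^sub>k u\<close> with the derivative replaced by a difference quotient. The inner cutoff of \<open>W\<close>
  permits translations by arbitrary \<open>h\<close>; the outer factor \<open>q\<close> brings the result back into the plate.\<close>

definition Mh :: "bool \<Rightarrow> real \<Rightarrow> (real \<times> real \<Rightarrow> real) \<Rightarrow> real \<times> real \<Rightarrow> real" where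
  "Mh k h u p = q k p * dq k h (W u) p"

lemma Mh_weak2:
  assumes u: "u \<in> V"
  shows "weak2 \<Omega> (Mh k h u) (\<lambda>i p. q k p * dq k h (W1 u i) p + pd i (q k) p * dq k h (W u) p)
    (\<lambda>i j p. q k p * dq k h (W2 u i j) p + pd i (q k) p * dq k h (W1 u j) p + pd j (q k) p * dq k h (W1 u i) p + pd i (pd j (q k)) p * dq k h (W u) p)"
proof -
  have "weak2 (UNIV \<times> UNIV) (dq k h (W u)) (\<lambda>j. dq k h (W1 u j)) (\<lambda>i j. dq k h (W2 u i j))"
    using weak2_dq[OF W_weak2[OF u]] by simp
  from weak2_mult[OF this TS_mono[OF q_TS]]
  have w: "weak2 UNIV (Mh k h u) (\<lambda>i p. q k p * dq k h (W1 u i) p + pd i (q k) p * dq k h (W u) p)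
    (\<lambda>i j p. q k p * dq k h (W2 u i j) p + pd i (q k) p * dq k h (W1 u j) p + pd j (q k) p * dq k h (W1 u i) p + pd i (pd j (q k)) p * dq k h (W u) p)"
    unfolding Mh_def[abs_def] by simp
  show ?thesis
    by (rule weak2_restrict[OF w Om_sets])
       (simp_all only: Mh_def TS_zero[OF q_TS] TS_zero[OF TS_pd[OF q_TS]] TS_zero[OF TS_pd[OF TS_pd[OF q_TS]]] mult_zero_left add_0_left not_False_eq_True)
qed

lemma Mh_V:
  assumes u: "u \<in> V" shows "Mh k h u \<in> V"
proof -
  obtain g where g: "continuous_on (closure \<Omega>) g" "AE p in lebesgue_on \<Omega>. u p = g p"
    using V_rep[OF u] by blast
  \<comment> \<open>The multiplier applied to the continuous representative of \<open>u\<close> represents \<open>Mh k h u\<close>.\<close>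
  have c: "continuous_on UNIV (W g)" unfolding W_def[abs_def] by (rule cutoff_rep_continuous[OF g(1) zeta_TS])
  have sh: "continuous_on UNIV (\<lambda>p. W g (p + v))" for v
    by (rule continuous_on_compose2[OF c]) (auto intro!: continuous_intros)
  have "AE p in lebesgue. p \<in> \<Omega> \<longrightarrow> u p = g p"
    using g(2) Om_sets by (simp add: AE_restrict_space_iff)
  then have "AE p in lebesgue. W u p = W g p"
  proof eventually_elim
    case (elim p)
    then show ?case using TS_zero[OF zeta_TS, of p] by (cases "p \<in> \<Omega>") (auto simp: W_def)
  qed
  note ae = AE_shift[OF this]
  have "AE p in lebesgue. Mh k h u p = Mh k h g p"
    using ae[of "h *\<^sub>R dir k"] ae[of "(- h) *\<^sub>R dir k"]
    by eventually_elim (simp add: Mh_def dq_def)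
  then have ae': "AE p in lebesgue_on \<Omega>. Mh k h u p = Mh k h g p"
    using Om_sets by (simp add: AE_restrict_space_iff) (elim eventually_mono, simp)
  show ?thesis
  proof (rule V_I[OF Mh_weak2[OF u] _ ae'])
    have "continuous_on UNIV (\<lambda>p. q k p * ((W g (p + h *\<^sub>R dir k) - W g (p + (- h) *\<^sub>R dir k)) * (1 / (2 * h))))"
      by (intro continuous_on_mult continuous_on_diff sh TS_cont[OF q_TS] continuous_on_const)
    then have "continuous_on UNIV (Mh k h g)" by (simp add: Mh_def[abs_def] dq_def)
    then show "continuous_on (closure \<Omega>) (Mh k h g)" using continuous_on_subset by blast
    show "Mh k h g p = 0" if "p \<in> {0, pi} \<times> {-l<..<l}" for p
      using TS_zero[OF q_TS, of p] that by (auto simp: Mh_def)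
  qed
qed

lemma Mh_bounded: "L2.bounded_op \<Omega> (Mh k h)"
  unfolding L2.bounded_op_def
proof (intro conjI ballI allI)
  have Wl: "f \<in> L2 \<Omega> \<Longrightarrow> W f \<in> L2 UNIV" for f unfolding W_def[abs_def] by (rule TS_L2_mult[OF zeta_TS Om_sets])
  have m: "Mh k h f \<in> L2 \<Omega>" if "f \<in> L2 \<Omega>" for f
    unfolding Mh_def[abs_def] by (rule TSO_L2[OF q_TS L2_UNIV_restrict[OF Om_sets dq_L2[OF Wl[OF that]]]])
  then show "f \<in> L2 \<Omega> \<Longrightarrow> Mh k h f \<in> L2 \<Omega>" for f .
  have W: "W (\<lambda>p. f p + g p) = (\<lambda>p. W f p + W g p)" "W (\<lambda>p. c * f p) = (\<lambda>p. c * W f p)" for f g c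
    by (auto simp: W_def distrib_left mult_ac)
  show "Mh k h (\<lambda>p. f p + g p) = (\<lambda>p. Mh k h f p + Mh k h g p)" for f g
    unfolding Mh_def[abs_def] W dq_lin by (simp add: distrib_left)
  show "Mh k h (\<lambda>p. c * f p) = (\<lambda>p. c * Mh k h f p)" for c f
    unfolding Mh_def[abs_def] W dq_lin by (simp add: mult_ac)
  obtain C where C: "0 \<le> C" "\<forall>f\<in>L2 \<Omega>. L2.nm UNIV (\<lambda>p. q k p * f p) \<le> C * L2.nm \<Omega> f" using nm_TSO_mult[OF q_TS] by blast
  obtain D where D: "0 \<le> D" "\<forall>f\<in>L2 \<Omega>. L2.nm UNIV (\<lambda>p. \<zeta> p * f p) \<le> D * L2.nm \<Omega> f" using nm_TSO_mult[OF zeta_TS] by blast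
  have "L2.nm \<Omega> (Mh k h f) \<le> (C * (2 / \<bar>2 * h\<bar> * D)) * L2.nm \<Omega> f" if f: "f \<in> L2 \<Omega>" for f
  proof -
    note d = dq_L2[OF Wl[OF f], of k h]
    have "L2.nm \<Omega> (Mh k h f) = L2.nm UNIV (\<lambda>p. q k p * dq k h (W f) p)"
      unfolding Mh_def[abs_def] by (rule Om.nm_UNIV[symmetric]) (simp add: TS_zero[OF q_TS])
    also have "\<dots> \<le> C * L2.nm \<Omega> (dq k h (W f))" using C(2) L2_UNIV_restrict[OF Om_sets d] by blast
    also have "L2.nm \<Omega> (dq k h (W f)) \<le> L2.nm UNIV (dq k h (W f))"
    proof -
      have "L2_inner \<Omega> (dq k h (W f)) (dq k h (W f)) \<le> L2_inner UNIV (dq k h (W f)) (dq k h (W f))"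
      proof -
        have i: "integrable lebesgue (\<lambda>p. dq k h (W f) p * dq k h (W f) p)"
          using L2_integrable_mult[OF d d] by (simp add: lebesgue_on_UNIV_eq)
        have "L2_inner \<Omega> (dq k h (W f)) (dq k h (W f)) = (\<integral>p. indicator \<Omega> p *\<^sub>R (dq k h (W f) p * dq k h (W f) p) \<partial>lebesgue)"
          unfolding L2_inner_def using Om_sets by (intro integral_restrict_space) simp
        also have "\<dots> \<le> (\<integral>p. dq k h (W f) p * dq k h (W f) p \<partial>lebesgue)"
          by (intro integral_mono i integrable_mult_indicator) (use Om_sets in \<open>auto simp: indicator_def\<close>)
        finally show ?thesis by (simp add: L2_inner_def lebesgue_on_UNIV_eq)
      qed
      then show ?thesis unfolding L2.nm_def by (rule real_sqrt_le_mono)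
    qed
    also have "\<dots> \<le> 2 / \<bar>2 * h\<bar> * L2.nm UNIV (W f)" by (rule dq_nm[OF Wl[OF f]])
    also have "L2.nm UNIV (W f) \<le> D * L2.nm \<Omega> f" unfolding W_def[abs_def] using D(2) f by blast
    finally show ?thesis using C(1) by (simp add: mult_left_mono mult.assoc divide_right_mono)
  qed
  moreover have "0 \<le> C * (2 / \<bar>2 * h\<bar> * D)" using C D by simp
  ultimately show "\<exists>K\<ge>0. \<forall>f\<in>L2 \<Omega>. L2.nm \<Omega> (Mh k h f) \<le> K * L2.nm \<Omega> f" by blast
qed

section \<open>The limit of the difference-quotient multipliers\<close>

text \<open>Here \<open>Y\<close> is the cut-off version of \<open>X\<close> and \<open>dq_square_limit\<close> applies: the highest-order terms of the
  multiplier identity have this form.\<close>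

lemma main_term:
  assumes X: "X \<in> L2 \<Omega>" and Y: "Y \<in> L2 UNIV" "\<And>p. p \<notin> \<Omega> \<Longrightarrow> Y p = 0" and XY: "\<And>p. p \<in> Bx \<delta> \<Longrightarrow> X p = Y p"
  shows "L2_inner \<Omega> X (\<lambda>p. q k p * dq k h Y p) = L2_inner UNIV (\<lambda>p. q k p * Y p) (dq k h Y)"
    "((\<lambda>h. L2_inner \<Omega> X (\<lambda>p. q k p * dq k h Y p)) \<longlongrightarrow> - (1 / 2) * L2_inner \<Omega> (\<lambda>p. pd k (q k) p * X p) X) (at 0)"
proof -
  have e: "L2_inner \<Omega> X (\<lambda>p. q k p * dq k h Y p) = L2_inner UNIV (\<lambda>p. q k p * Y p) (dq k h Y)" for h
  proof -
    have "L2_inner UNIV (\<lambda>p. q k p * Y p) (dq k h Y) = L2_inner \<Omega> (\<lambda>p. q k p * Y p) (dq k h Y)"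
      by (rule L2_inner_UNIV[OF Om_sets]) (simp add: TS_zero[OF q_TS])
    also have "\<dots> = L2_inner \<Omega> X (\<lambda>p. q k p * dq k h Y p)"
    proof (rule L2_inner_cong)
      fix p show "q k p * Y p * dq k h Y p = X p * (q k p * dq k h Y p)"
        using XY[of p] q_off(1)[of p k] by (cases "p \<in> Bx \<delta>") simp_all
    qed
    finally show ?thesis by simp
  qed
  show "L2_inner \<Omega> X (\<lambda>p. q k p * dq k h Y p) = L2_inner UNIV (\<lambda>p. q k p * Y p) (dq k h Y)" by (rule e)
  have "L2_inner UNIV (\<lambda>p. pd k (q k) p * Y p) Y = L2_inner \<Omega> (\<lambda>p. pd k (q k) p * Y p) Y"
    by (rule L2_inner_UNIV[OF Om_sets]) (simp add: TS_zero[OF TS_pd[OF q_TS]])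
  also have "\<dots> = L2_inner \<Omega> (\<lambda>p. pd k (q k) p * X p) X"
  proof (rule L2_inner_cong)
    fix p show "pd k (q k) p * Y p * Y p = pd k (q k) p * X p * X p"
      using XY[of p] q_off(2)[of p k k] by (cases "p \<in> Bx \<delta>") simp_all
  qed
  finally show "((\<lambda>h. L2_inner \<Omega> X (\<lambda>p. q k p * dq k h Y p)) \<longlongrightarrow> - (1 / 2) * L2_inner \<Omega> (\<lambda>p. pd k (q k) p * X p) X) (at 0)"
    using Om.dq_square_limit(2)[OF Y q_TS, of k k] unfolding e by simp
qed

text \<open>A weakly differentiable \<open>Y\<close> has difference quotients that are bounded in \<open>L2\<close> and converge weakly to \<open>Y'\<close>.\<close>

lemma cross_term:
  assumes phi: "\<phi> \<in> TSO" "\<And>p. p \<notin> Bx \<delta> \<Longrightarrow> \<phi> p = 0" and X: "X \<in> L2 \<Omega>"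
    and Y: "Y \<in> L2 UNIV" "\<And>p. p \<notin> \<Omega> \<Longrightarrow> Y p = 0" "Y' \<in> L2 UNIV"
    and wk: "\<And>\<psi>. \<psi> \<in> TS UNIV UNIV \<Longrightarrow> L2_inner UNIV Y (pd k \<psi>) = - L2_inner UNIV Y' \<psi>"
    and X': "\<And>p. p \<in> Bx \<delta> \<Longrightarrow> Y' p = X' p"
  shows "\<bar>L2_inner \<Omega> X (\<lambda>p. \<phi> p * dq k h Y p)\<bar> \<le> L2.nm UNIV (\<lambda>p. \<phi> p * X p) * L2.nm UNIV Y'"
    "((\<lambda>h. L2_inner \<Omega> X (\<lambda>p. \<phi> p * dq k h Y p)) \<longlongrightarrow> L2_inner \<Omega> X (\<lambda>p. \<phi> p * X' p)) (at 0)"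
proof -
  have F: "(\<lambda>p. \<phi> p * X p) \<in> L2 UNIV" by (rule TS_L2_mult[OF phi(1) Om_sets X])
  have Fz: "\<phi> p * X p = 0" if "p \<notin> \<Omega>" for p using TS_zero[OF phi(1) that] by simp
  note i = TS_inner[OF phi(1) Om_sets, symmetric]
  show "\<bar>L2_inner \<Omega> X (\<lambda>p. \<phi> p * dq k h Y p)\<bar> \<le> L2.nm UNIV (\<lambda>p. \<phi> p * X p) * L2.nm UNIV Y'"
    unfolding i by (rule Om.dq_weak_limit(1)[OF Y wk F Fz])
  have "L2_inner \<Omega> X (\<lambda>p. \<phi> p * X' p) = L2_inner \<Omega> X (\<lambda>p. \<phi> p * Y' p)"
  proof (rule L2_inner_cong)
    fix p show "X p * (\<phi> p * X' p) = X p * (\<phi> p * Y' p)"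
      using X'[of p] phi(2)[of p] by (cases "p \<in> Bx \<delta>") simp_all
  qed
  then show "((\<lambda>h. L2_inner \<Omega> X (\<lambda>p. \<phi> p * dq k h Y p)) \<longlongrightarrow> L2_inner \<Omega> X (\<lambda>p. \<phi> p * X' p)) (at 0)"
    using Om.dq_weak_limit(2)[OF Y wk F Fz] unfolding i by simp
qed

text \<open>The second derivatives of \<open>Mh k h u\<close> are \<open>q\<^sub>k\<close> times a quotient of second derivatives, plus \<open>cr\<close>; the
  limit of \<open>cr\<close> as \<open>h\<close> tends to \<open>0\<close> is \<open>N\<close>.\<close>

definition cr :: "(real \<times> real \<Rightarrow> real) \<Rightarrow> bool \<Rightarrow> real \<Rightarrow> bool \<Rightarrow> bool \<Rightarrow> real \<times> real \<Rightarrow> real" where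
  "cr u k h i j p = pd i (q k) p * dq k h (W1 u j) p + pd j (q k) p * dq k h (W1 u i) p + pd i (pd j (q k)) p * dq k h (W u) p"

definition N :: "(real \<times> real \<Rightarrow> real) \<Rightarrow> bool \<Rightarrow> bool \<Rightarrow> bool \<Rightarrow> real \<times> real \<Rightarrow> real" where
  "N u k i j p = pd i (q k) p * hess l u j k p + pd j (q k) p * hess l u i k p + pd i (pd j (q k)) p * grad l u k p"

lemma N_L2: "u \<in> V \<Longrightarrow> N u k i j \<in> L2 \<Omega>"
  unfolding N_def[abs_def] by (intro L2.add TSO_L2[OF TS_pd[OF q_TS]] TSO_L2[OF TS_pd[OF TS_pd[OF q_TS]]] VD)

lemma cr_L2: assumes "u \<in> V" shows "cr u k h i j \<in> L2 \<Omega>"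
proof -
  note D = weak2D[OF W_weak2[OF assms]]
  have d: "dq k h f \<in> L2 \<Omega>" if "f \<in> L2 UNIV" for f by (rule L2_UNIV_restrict[OF Om_sets dq_L2[OF that]])
  show ?thesis unfolding cr_def[abs_def]
    by (intro L2.add TSO_L2[OF TS_pd[OF q_TS]] TSO_L2[OF TS_pd[OF TS_pd[OF q_TS]]] d D)
qed

lemma cr_inner:
  assumes u: "u \<in> V" and X: "X \<in> L2 \<Omega>"
  shows "L2_inner \<Omega> X (cr u k h i j) = L2_inner \<Omega> X (\<lambda>p. pd i (q k) p * dq k h (W1 u j) p)
     + L2_inner \<Omega> X (\<lambda>p. pd j (q k) p * dq k h (W1 u i) p) + L2_inner \<Omega> X (\<lambda>p. pd i (pd j (q k)) p * dq k h (W u) p)"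
proof -
  note D = weak2D[OF W_weak2[OF u]]
  have d: "dq k h f \<in> L2 \<Omega>" if "f \<in> L2 UNIV" for f by (rule L2_UNIV_restrict[OF Om_sets dq_L2[OF that]])
  note t = TSO_L2[OF TS_pd[OF q_TS] d[OF D(2)]] TSO_L2[OF TS_pd[OF TS_pd[OF q_TS]] d[OF D(1)]]
  show ?thesis unfolding cr_def[abs_def] by (simp only: L2.ip_add_right[OF L2.add[OF t(1) t(1)] t(2) X] L2.ip_add_right[OF t(1) t(1) X])
qed

lemma N_inner:
  assumes u: "u \<in> V" and X: "X \<in> L2 \<Omega>"
  shows "L2_inner \<Omega> X (N u k i j) = L2_inner \<Omega> X (\<lambda>p. pd i (q k) p * hess l u j k p)
     + L2_inner \<Omega> X (\<lambda>p. pd j (q k) p * hess l u i k p) + L2_inner \<Omega> X (\<lambda>p. pd i (pd j (q k)) p * grad l u k p)"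
proof -
  note t = TSO_L2[OF TS_pd[OF q_TS] VD(3)[OF u]] TSO_L2[OF TS_pd[OF TS_pd[OF q_TS]] VD(2)[OF u]]
  show ?thesis unfolding N_def[abs_def] by (simp only: L2.ip_add_right[OF L2.add[OF t(1) t(1)] t(2) X] L2.ip_add_right[OF t(1) t(1) X])
qed

lemma cr_limit:
  assumes u: "u \<in> V" and X: "X \<in> L2 \<Omega>"
  shows "((\<lambda>h. L2_inner \<Omega> X (cr u k h i j)) \<longlongrightarrow> L2_inner \<Omega> X (N u k i j)) (at 0)"
  unfolding cr_inner[OF u X] N_inner[OF u X]
proof (intro tendsto_add)
  show "((\<lambda>h. L2_inner \<Omega> X (\<lambda>p. pd i (q k) p * dq k h (W1 u j) p)) \<longlongrightarrow> L2_inner \<Omega> X (\<lambda>p. pd i (q k) p * hess l u j k p)) (at 0)"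
    by (rule cross_term(2)[OF TS_pd[OF q_TS] q_off(2) X weak2D(2)[OF W_weak2[OF u]] W_off(2) weak2D(3)[OF W_weak2[OF u]] weak2_second(1)[OF W_weak2[OF u]] W_eq(3)])
  show "((\<lambda>h. L2_inner \<Omega> X (\<lambda>p. pd j (q k) p * dq k h (W1 u i) p)) \<longlongrightarrow> L2_inner \<Omega> X (\<lambda>p. pd j (q k) p * hess l u i k p)) (at 0)"
    by (rule cross_term(2)[OF TS_pd[OF q_TS] q_off(2) X weak2D(2)[OF W_weak2[OF u]] W_off(2) weak2D(3)[OF W_weak2[OF u]] weak2_second(1)[OF W_weak2[OF u]] W_eq(3)])
  show "((\<lambda>h. L2_inner \<Omega> X (\<lambda>p. pd i (pd j (q k)) p * dq k h (W u) p)) \<longlongrightarrow> L2_inner \<Omega> X (\<lambda>p. pd i (pd j (q k)) p * grad l u k p)) (at 0)"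
    by (rule cross_term(2)[OF TS_pd[OF TS_pd[OF q_TS]] q_off(3) X weak2D(1)[OF W_weak2[OF u]] W_off(1) weak2D(2)[OF W_weak2[OF u]] weak2_second(2)[OF W_weak2[OF u]] W_eq(2)])
qed

lemma W1_dominated: "dominated (\<lambda>u. L2.nm UNIV (W1 u j))"
proof (rule dominated_add[OF dominated_grad[OF zeta_TS d4(1) zeta_0] dominated_u[OF TS_pd[OF zeta_TS]]])
  fix u assume u: "u \<in> V"
  show "L2.nm UNIV (W1 u j) \<le> L2.nm UNIV (\<lambda>p. \<zeta> p * grad l u j p) + L2.nm UNIV (\<lambda>p. pd j \<zeta> p * u p)"
    unfolding W1_def[abs_def]
    by (rule L2.nm_triangle[OF TS_L2_mult[OF zeta_TS Om_sets VD(2)[OF u]] TS_L2_mult[OF TS_pd[OF zeta_TS] Om_sets VD(1)[OF u]]])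
qed

lemma W2_dominated: "dominated (\<lambda>u. L2.nm UNIV (W2 u i j))"
proof -
  have z: "p \<notin> Bx (\<delta> / 4) \<Longrightarrow> pd k \<zeta> p = 0" for p k by (rule TS_flat0(2)[OF zeta_TS zeta_0])
  note t = TS_L2_mult[OF zeta_TS Om_sets VD(3)] TS_L2_mult[OF TS_pd[OF zeta_TS] Om_sets VD(2)] TS_L2_mult[OF TS_pd[OF TS_pd[OF zeta_TS]] Om_sets VD(1)]
  have 1: "dominated (\<lambda>u. L2.nm UNIV (\<lambda>p. \<zeta> p * hess l u i j p + pd i \<zeta> p * grad l u j p))"
  proof (rule dominated_add[OF dominated_hess[OF zeta_TS, where j=i and k=j] dominated_grad[OF TS_pd[OF zeta_TS, where k=i] d4(1) z, where k=j]])
    fix u assume u: "u \<in> V"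
    show "L2.nm UNIV (\<lambda>p. \<zeta> p * hess l u i j p + pd i \<zeta> p * grad l u j p)
      \<le> L2.nm UNIV (\<lambda>p. \<zeta> p * hess l u i j p) + L2.nm UNIV (\<lambda>p. pd i \<zeta> p * grad l u j p)"
      by (rule L2.nm_triangle[OF t(1)[OF u] t(2)[OF u]])
  qed
  have 2: "dominated (\<lambda>u. L2.nm UNIV (\<lambda>p. \<zeta> p * hess l u i j p + pd i \<zeta> p * grad l u j p + pd j \<zeta> p * grad l u i p))"
  proof (rule dominated_add[OF 1 dominated_grad[OF TS_pd[OF zeta_TS, where k=j] d4(1) z, where k=i]])
    fix u assume u: "u \<in> V"
    show "L2.nm UNIV (\<lambda>p. \<zeta> p * hess l u i j p + pd i \<zeta> p * grad l u j p + pd j \<zeta> p * grad l u i p)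
      \<le> L2.nm UNIV (\<lambda>p. \<zeta> p * hess l u i j p + pd i \<zeta> p * grad l u j p) + L2.nm UNIV (\<lambda>p. pd j \<zeta> p * grad l u i p)"
      by (rule L2.nm_triangle[OF L2.add[OF t(1)[OF u] t(2)[OF u]] t(2)[OF u]])
  qed
  show ?thesis
  proof (rule dominated_add[OF 2 dominated_u[OF TS_pd[OF TS_pd[OF zeta_TS, where k=j], where k=i]]])
    fix u assume u: "u \<in> V"
    show "L2.nm UNIV (W2 u i j)
      \<le> L2.nm UNIV (\<lambda>p. \<zeta> p * hess l u i j p + pd i \<zeta> p * grad l u j p + pd j \<zeta> p * grad l u i p) + L2.nm UNIV (\<lambda>p. pd i (pd j \<zeta>) p * u p)"
      unfolding W2_def[abs_def]
      by (rule L2.nm_triangle[OF L2.add[OF L2.add[OF t(1)[OF u] t(2)[OF u]] t(2)[OF u]] t(3)[OF u]])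
  qed
qed

lemma inner_dominated:
  assumes phi: "\<phi> \<in> TSO" and G: "dominated (\<lambda>u. L2.nm UNIV (G u))"
    and b: "\<And>u X h. u \<in> V \<Longrightarrow> X \<in> L2 \<Omega> \<Longrightarrow> \<bar>L2_inner \<Omega> X (F u h)\<bar> \<le> L2.nm UNIV (\<lambda>p. \<phi> p * X p) * L2.nm UNIV (G u)"
    and GL: "\<And>u. u \<in> V \<Longrightarrow> G u \<in> L2 UNIV"
  shows "\<exists>C\<ge>0. \<forall>u\<in>V. \<forall>X\<in>L2 \<Omega>. \<forall>h. \<bar>L2_inner \<Omega> X (F u h)\<bar> \<le> C * (L2.nm \<Omega> X * sqrt (B u u))"
proof -
  obtain C where C: "0 \<le> C" "\<forall>f\<in>L2 \<Omega>. L2.nm UNIV (\<lambda>p. \<phi> p * f p) \<le> C * L2.nm \<Omega> f" using nm_TSO_mult[OF phi] by blast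
  obtain D where D: "0 \<le> D" "\<forall>u\<in>V. L2.nm UNIV (G u) \<le> D * sqrt (B u u)" using G unfolding dominated_def by blast
  have "\<bar>L2_inner \<Omega> X (F u h)\<bar> \<le> (C * D) * (L2.nm \<Omega> X * sqrt (B u u))" if u: "u \<in> V" and X: "X \<in> L2 \<Omega>" for u X h
  proof -
    have "\<bar>L2_inner \<Omega> X (F u h)\<bar> \<le> L2.nm UNIV (\<lambda>p. \<phi> p * X p) * L2.nm UNIV (G u)" by (rule b[OF u X])
    also have "\<dots> \<le> (C * L2.nm \<Omega> X) * (D * sqrt (B u u))"
      using C D u X GL[OF u] by (intro mult_mono) auto
    finally show ?thesis by (simp add: mult_ac)
  qed
  then show ?thesis using C(1) D(1) by (intro exI[of _ "C * D"]) auto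
qed

lemma cr_bound: "\<exists>C\<ge>0. \<forall>u\<in>V. \<forall>X\<in>L2 \<Omega>. \<forall>h. \<bar>L2_inner \<Omega> X (cr u k h i j)\<bar> \<le> C * (L2.nm \<Omega> X * sqrt (B u u))"
proof -
  have a: "\<exists>C\<ge>0. \<forall>u\<in>V. \<forall>X\<in>L2 \<Omega>. \<forall>h. \<bar>L2_inner \<Omega> X (\<lambda>p. pd i (q k) p * dq k h (W1 u j) p)\<bar> \<le> C * (L2.nm \<Omega> X * sqrt (B u u))" for i j
  proof (rule inner_dominated[where F="\<lambda>u h p. pd i (q k) p * dq k h (W1 u j) p" and G="\<lambda>u. W2 u j k", OF TS_pd[OF q_TS, of i k] W2_dominated[of j k]])
    show "W2 u j k \<in> L2 UNIV" if u: "u \<in> V" for u by (rule weak2D(3)[OF W_weak2[OF u]])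
    fix u X h assume u: "u \<in> V" and X: "X \<in> L2 \<Omega>"
    show "\<bar>L2_inner \<Omega> X (\<lambda>p. pd i (q k) p * dq k h (W1 u j) p)\<bar> \<le> L2.nm UNIV (\<lambda>p. pd i (q k) p * X p) * L2.nm UNIV (W2 u j k)"
      by (rule cross_term(1)[OF TS_pd[OF q_TS] q_off(2) X weak2D(2)[OF W_weak2[OF u]] W_off(2) weak2D(3)[OF W_weak2[OF u]] weak2_second(1)[OF W_weak2[OF u]] W_eq(3)])
  qed
  have b: "\<exists>C\<ge>0. \<forall>u\<in>V. \<forall>X\<in>L2 \<Omega>. \<forall>h. \<bar>L2_inner \<Omega> X (\<lambda>p. pd i (pd j (q k)) p * dq k h (W u) p)\<bar> \<le> C * (L2.nm \<Omega> X * sqrt (B u u))"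
  proof (rule inner_dominated[where F="\<lambda>u h p. pd i (pd j (q k)) p * dq k h (W u) p" and G="\<lambda>u. W1 u k", OF TS_pd[OF TS_pd[OF q_TS, of j k], of i] W1_dominated[of k]])
    show "W1 u k \<in> L2 UNIV" if u: "u \<in> V" for u by (rule weak2D(2)[OF W_weak2[OF u]])
    fix u X h assume u: "u \<in> V" and X: "X \<in> L2 \<Omega>"
    show "\<bar>L2_inner \<Omega> X (\<lambda>p. pd i (pd j (q k)) p * dq k h (W u) p)\<bar> \<le> L2.nm UNIV (\<lambda>p. pd i (pd j (q k)) p * X p) * L2.nm UNIV (W1 u k)"
      by (rule cross_term(1)[OF TS_pd[OF TS_pd[OF q_TS]] q_off(3) X weak2D(1)[OF W_weak2[OF u]] W_off(1) weak2D(2)[OF W_weak2[OF u]] weak2_second(2)[OF W_weak2[OF u]] W_eq(2)])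
  qed
  obtain C1 where C1: "0 \<le> C1" "\<And>u X h. u \<in> V \<Longrightarrow> X \<in> L2 \<Omega> \<Longrightarrow> \<bar>L2_inner \<Omega> X (\<lambda>p. pd i (q k) p * dq k h (W1 u j) p)\<bar> \<le> C1 * (L2.nm \<Omega> X * sqrt (B u u))"
    using a[of i j] by blast
  obtain C2 where C2: "0 \<le> C2" "\<And>u X h. u \<in> V \<Longrightarrow> X \<in> L2 \<Omega> \<Longrightarrow> \<bar>L2_inner \<Omega> X (\<lambda>p. pd j (q k) p * dq k h (W1 u i) p)\<bar> \<le> C2 * (L2.nm \<Omega> X * sqrt (B u u))"
    using a[of j i] by blast
  obtain C3 where C3: "0 \<le> C3" "\<And>u X h. u \<in> V \<Longrightarrow> X \<in> L2 \<Omega> \<Longrightarrow> \<bar>L2_inner \<Omega> X (\<lambda>p. pd i (pd j (q k)) p * dq k h (W u) p)\<bar> \<le> C3 * (L2.nm \<Omega> X * sqrt (B u u))"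
    using b by blast
  have "\<bar>L2_inner \<Omega> X (cr u k h i j)\<bar> \<le> (C1 + C2 + C3) * (L2.nm \<Omega> X * sqrt (B u u))" if "u \<in> V" "X \<in> L2 \<Omega>" for u X h
    unfolding cr_inner[OF that] distrib_right using C1(2)[OF that, of h] C2(2)[OF that, of h] C3(2)[OF that, of h] by linarith
  then show ?thesis using C1 C2 C3 by (intro exI[of _ "C1 + C2 + C3"]) auto
qed

text \<open>The integrand of the pairing identity for the multiplier \<open>Mh k h\<close>, with \<open>z\<close> for \<open>u\<^sub>t\<close>.\<close>

definition R :: "bool \<Rightarrow> real \<Rightarrow> (real \<times> real \<Rightarrow> real) \<Rightarrow> (real \<times> real \<Rightarrow> real) \<Rightarrow> real" where
  "R k h u z = L2_inner \<Omega> z (Mh k h z) - B u (Mh k h u)"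

abbreviation "tr a p \<equiv> a True True p + a False False p"

text \<open>Each quotient of second derivatives is paired with the same second derivative of \<open>u\<close>, or the
  quotient of the Laplacian with the Laplacian, as \<open>main_term\<close> requires.\<close>

lemma Mh_expand:
  assumes u: "u \<in> V"
  shows "B u (Mh k h u) = (1 - \<sigma>) * (
      (L2_inner \<Omega> (hess l u True True) (\<lambda>p. q k p * dq k h (W2 u True True) p) + L2_inner \<Omega> (hess l u True True) (cr u k h True True))
      + 2 * (L2_inner \<Omega> (hess l u True False) (\<lambda>p. q k p * dq k h (W2 u True False) p) + L2_inner \<Omega> (hess l u True False) (cr u k h True False))
      + (L2_inner \<Omega> (hess l u False False) (\<lambda>p. q k p * dq k h (W2 u False False) p) + L2_inner \<Omega> (hess l u False False) (cr u k h False False)))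
    + \<sigma> * (L2_inner \<Omega> (tr (hess l u)) (\<lambda>p. q k p * dq k h (tr (W2 u)) p)
        + (L2_inner \<Omega> (tr (hess l u)) (cr u k h True True) + L2_inner \<Omega> (tr (hess l u)) (cr u k h False False)))"
proof -
  note D = VD[OF u] and E = weak2D[OF W_weak2[OF u]]
  define v where "v i j p = q k p * dq k h (W2 u i j) p + cr u k h i j p" for i j p
  have "(\<lambda>i j p. q k p * dq k h (W2 u i j) p + pd i (q k) p * dq k h (W1 u j) p + pd j (q k) p * dq k h (W1 u i) p + pd i (pd j (q k)) p * dq k h (W u) p) = v"
    by (simp add: v_def[abs_def] cr_def add.assoc)
  with Mh_weak2[OF u, of k h] have w: "weak2 \<Omega> (Mh k h u) (\<lambda>i p. q k p * dq k h (W1 u i) p + pd i (q k) p * dq k h (W u) p) v" by simp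
  have m: "(\<lambda>p. q k p * dq k h f p) \<in> L2 \<Omega>" if "f \<in> L2 UNIV" for f
    by (rule TSO_L2[OF q_TS L2_UNIV_restrict[OF Om_sets dq_L2[OF that]]])
  have trW: "tr (W2 u) \<in> L2 UNIV" by (intro L2.add E)
  have "B u (Mh k h u) = (\<integral>p. Qf \<sigma> (hess l u) v p \<partial>lebesgue_on \<Omega>)" by (rule B_weak2[OF V_weak2[OF u] w])
  also have "\<dots> = (1 - \<sigma>) * (L2_inner \<Omega> (hess l u True True) (v True True) + 2 * L2_inner \<Omega> (hess l u True False) (v True False) + L2_inner \<Omega> (hess l u False False) (v False False))
     + \<sigma> * L2_inner \<Omega> (tr (hess l u)) (tr v)"
    by (rule integral_Qf[OF D(3) weak2D(3)[OF w]])
  also have "tr v = (\<lambda>p. q k p * dq k h (tr (W2 u)) p + (cr u k h True True p + cr u k h False False p))"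
    by (simp add: v_def dq_lin distrib_left add_ac)
  also have "L2_inner \<Omega> (tr (hess l u)) \<dots> = L2_inner \<Omega> (tr (hess l u)) (\<lambda>p. q k p * dq k h (tr (W2 u)) p)
        + (L2_inner \<Omega> (tr (hess l u)) (cr u k h True True) + L2_inner \<Omega> (tr (hess l u)) (cr u k h False False))"
    by (simp only: L2.ip_add_right[OF m[OF trW] L2.add[OF cr_L2[OF u] cr_L2[OF u]] L2.add[OF D(3) D(3)]] L2.ip_add_right[OF cr_L2[OF u] cr_L2[OF u] L2.add[OF D(3) D(3)]])
  finally have e: "B u (Mh k h u) = (1 - \<sigma>) * (L2_inner \<Omega> (hess l u True True) (v True True) + 2 * L2_inner \<Omega> (hess l u True False) (v True False) + L2_inner \<Omega> (hess l u False False) (v False False))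
     + \<sigma> * (L2_inner \<Omega> (tr (hess l u)) (\<lambda>p. q k p * dq k h (tr (W2 u)) p)
        + (L2_inner \<Omega> (tr (hess l u)) (cr u k h True True) + L2_inner \<Omega> (tr (hess l u)) (cr u k h False False)))" .
  have vij: "L2_inner \<Omega> (hess l u i j) (v i j) = L2_inner \<Omega> (hess l u i j) (\<lambda>p. q k p * dq k h (W2 u i j) p) + L2_inner \<Omega> (hess l u i j) (cr u k h i j)" for i j
    unfolding v_def[abs_def] by (rule L2.ip_add_right[OF m[OF E(3)] cr_L2[OF u] D(3)])
  show ?thesis unfolding e vij by (rule refl)
qed

text \<open>The limit of \<open>R k h\<close>: integration by parts has removed all third derivatives of \<open>u\<close>.\<close>

definition R0 :: "bool \<Rightarrow> (real \<times> real \<Rightarrow> real) \<Rightarrow> (real \<times> real \<Rightarrow> real) \<Rightarrow> real" where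
  "R0 k u z = - (1 / 2) * L2_inner \<Omega> (\<lambda>p. pd k (q k) p * z p) z
     + 1 / 2 * (\<integral>p. Qf \<sigma> (\<lambda>i j p. pd k (q k) p * hess l u i j p) (hess l u) p \<partial>lebesgue_on \<Omega>)
     - (\<integral>p. Qf \<sigma> (hess l u) (N u k) p \<partial>lebesgue_on \<Omega>)"

lemma W_L2: "z \<in> L2 \<Omega> \<Longrightarrow> W z \<in> L2 UNIV"
  unfolding W_def[abs_def] by (rule TS_L2_mult[OF zeta_TS Om_sets])

lemma R_limit:
  assumes u: "u \<in> V" and z: "z \<in> L2 \<Omega>"
  shows "((\<lambda>h. R k h u z) \<longlongrightarrow> R0 k u z) (at 0)"
proof -
  note D = VD[OF u] and E = weak2D[OF W_weak2[OF u]]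
  have lz: "((\<lambda>h. L2_inner \<Omega> z (Mh k h z)) \<longlongrightarrow> - (1 / 2) * L2_inner \<Omega> (\<lambda>p. pd k (q k) p * z p) z) (at 0)"
    unfolding Mh_def[abs_def] by (rule main_term(2)[OF z W_L2[OF z] W_off(1)]) (simp_all add: W_eq)
  have lh: "((\<lambda>h. L2_inner \<Omega> (hess l u i j) (\<lambda>p. q k p * dq k h (W2 u i j) p)) \<longlongrightarrow> - (1 / 2) * L2_inner \<Omega> (\<lambda>p. pd k (q k) p * hess l u i j p) (hess l u i j)) (at 0)" for i j
    by (rule main_term(2)[OF D(3) E(3) W_off(3)]) (simp_all add: W_eq)
  have lt: "((\<lambda>h. L2_inner \<Omega> (tr (hess l u)) (\<lambda>p. q k p * dq k h (tr (W2 u)) p)) \<longlongrightarrow> - (1 / 2) * L2_inner \<Omega> (\<lambda>p. pd k (q k) p * tr (hess l u) p) (tr (hess l u))) (at 0)"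
  proof (rule main_term(2)[OF L2.add[OF D(3) D(3)] L2.add[OF E(3) E(3)]])
    show "tr (W2 u) p = 0" if "p \<notin> \<Omega>" for p using W_off(3)[OF that] by simp
    show "tr (hess l u) p = tr (W2 u) p" if "p \<in> Bx \<delta>" for p using W_eq(3)[OF that] by simp
  qed
  note lc = cr_limit[OF u D(3)] cr_limit[OF u L2.add[OF D(3) D(3)]]
  have qh: "(\<lambda>p. pd k (q k) p * hess l u i j p) \<in> L2 \<Omega>" for i j by (rule TSO_L2[OF TS_pd[OF q_TS] D(3)])
  have i1: "(\<integral>p. Qf \<sigma> (\<lambda>i j p. pd k (q k) p * hess l u i j p) (hess l u) p \<partial>lebesgue_on \<Omega>) =
     (1 - \<sigma>) * (L2_inner \<Omega> (\<lambda>p. pd k (q k) p * hess l u True True p) (hess l u True True) + 2 * L2_inner \<Omega> (\<lambda>p. pd k (q k) p * hess l u True False p) (hess l u True False) + L2_inner \<Omega> (\<lambda>p. pd k (q k) p * hess l u False False p) (hess l u False False))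
     + \<sigma> * L2_inner \<Omega> (\<lambda>p. pd k (q k) p * tr (hess l u) p) (tr (hess l u))"
    using integral_Qf[OF qh D(3), of \<sigma>] by (simp add: distrib_left)
  have i2: "(\<integral>p. Qf \<sigma> (hess l u) (N u k) p \<partial>lebesgue_on \<Omega>) =
     (1 - \<sigma>) * (L2_inner \<Omega> (hess l u True True) (N u k True True) + 2 * L2_inner \<Omega> (hess l u True False) (N u k True False) + L2_inner \<Omega> (hess l u False False) (N u k False False))
     + \<sigma> * (L2_inner \<Omega> (tr (hess l u)) (N u k True True) + L2_inner \<Omega> (tr (hess l u)) (N u k False False))"
    unfolding integral_Qf[OF D(3) N_L2[OF u]] L2.ip_add_right[OF N_L2[OF u] N_L2[OF u] L2.add[OF D(3) D(3)]] by (rule refl)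
  have "((\<lambda>h. R k h u z) \<longlongrightarrow> - (1 / 2) * L2_inner \<Omega> (\<lambda>p. pd k (q k) p * z p) z - ((1 - \<sigma>) * (
      (- (1 / 2) * L2_inner \<Omega> (\<lambda>p. pd k (q k) p * hess l u True True p) (hess l u True True) + L2_inner \<Omega> (hess l u True True) (N u k True True))
      + 2 * (- (1 / 2) * L2_inner \<Omega> (\<lambda>p. pd k (q k) p * hess l u True False p) (hess l u True False) + L2_inner \<Omega> (hess l u True False) (N u k True False))
      + (- (1 / 2) * L2_inner \<Omega> (\<lambda>p. pd k (q k) p * hess l u False False p) (hess l u False False) + L2_inner \<Omega> (hess l u False False) (N u k False False)))
    + \<sigma> * (- (1 / 2) * L2_inner \<Omega> (\<lambda>p. pd k (q k) p * tr (hess l u) p) (tr (hess l u))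
        + (L2_inner \<Omega> (tr (hess l u)) (N u k True True) + L2_inner \<Omega> (tr (hess l u)) (N u k False False))))) (at 0)"
    unfolding R_def Mh_expand[OF u] by (intro tendsto_diff tendsto_add tendsto_mult tendsto_const lz lh lt lc)
  moreover have "- (1 / 2) * L2_inner \<Omega> (\<lambda>p. pd k (q k) p * z p) z - ((1 - \<sigma>) * (
      (- (1 / 2) * L2_inner \<Omega> (\<lambda>p. pd k (q k) p * hess l u True True p) (hess l u True True) + L2_inner \<Omega> (hess l u True True) (N u k True True))
      + 2 * (- (1 / 2) * L2_inner \<Omega> (\<lambda>p. pd k (q k) p * hess l u True False p) (hess l u True False) + L2_inner \<Omega> (hess l u True False) (N u k True False))
      + (- (1 / 2) * L2_inner \<Omega> (\<lambda>p. pd k (q k) p * hess l u False False p) (hess l u False False) + L2_inner \<Omega> (hess l u False False) (N u k False False)))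
    + \<sigma> * (- (1 / 2) * L2_inner \<Omega> (\<lambda>p. pd k (q k) p * tr (hess l u) p) (tr (hess l u))
        + (L2_inner \<Omega> (tr (hess l u)) (N u k True True) + L2_inner \<Omega> (tr (hess l u)) (N u k False False)))) = R0 k u z"
    unfolding R0_def i1 i2 by (simp only: algebra_simps)
  ultimately show ?thesis by simp
qed

text \<open>The uniform bound that allows the limit in \<open>h\<close> to be taken under the time integral.\<close>

lemma R_bound: "\<exists>C\<ge>0. \<forall>u\<in>V. \<forall>z\<in>L2 \<Omega>. \<forall>h. \<bar>R k h u z\<bar> \<le> C * (L2_inner \<Omega> z z + B u u)"
proof -
  obtain C1 where C1: "0 \<le> C1" "\<And>f h. f \<in> L2 UNIV \<Longrightarrow> \<bar>L2_inner UNIV (\<lambda>p. q k p * f p) (dq k h f)\<bar> \<le> C1 * L2_inner UNIV f f"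
    using Om.dq_square_limit(1)[OF TS_UNIV_L2[OF zeta_TS] TS_zero[OF zeta_TS] q_TS, of k k] by blast
  obtain D0 where D0: "0 \<le> D0" "\<forall>f\<in>L2 \<Omega>. L2.nm UNIV (\<lambda>p. \<zeta> p * f p) \<le> D0 * L2.nm \<Omega> f" using nm_TSO_mult[OF zeta_TS] by blast
  have Wz: "\<bar>L2_inner \<Omega> z (Mh k h z)\<bar> \<le> C1 * D0\<^sup>2 * L2_inner \<Omega> z z" if z: "z \<in> L2 \<Omega>" for z h
  proof -
    have "\<bar>L2_inner \<Omega> z (Mh k h z)\<bar> = \<bar>L2_inner UNIV (\<lambda>p. q k p * W z p) (dq k h (W z))\<bar>"
      unfolding Mh_def[abs_def] by (subst main_term(1)[OF z W_L2[OF z] W_off(1)]) (simp_all add: W_eq)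
    also have "\<dots> \<le> C1 * L2_inner UNIV (W z) (W z)" by (rule C1(2)[OF W_L2[OF z]])
    also have "L2_inner UNIV (W z) (W z) = (L2.nm UNIV (W z))\<^sup>2" by (rule L2.nm_sq[OF W_L2[OF z], symmetric])
    also have "C1 * (L2.nm UNIV (W z))\<^sup>2 \<le> C1 * (D0 * L2.nm \<Omega> z)\<^sup>2"
      using D0(2) z W_L2[OF z] C1(1) unfolding W_def[abs_def] by (intro mult_left_mono power_mono) auto
    also have "\<dots> = C1 * D0\<^sup>2 * L2_inner \<Omega> z z" by (simp add: power_mult_distrib L2.nm_sq[OF z])
    finally show ?thesis .
  qed
  have "\<exists>C\<ge>0. \<forall>u\<in>V. L2.nm UNIV (W2 u i j) \<le> C * sqrt (B u u)" for i j
    using W2_dominated unfolding dominated_def by blast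
  then obtain w where w: "\<And>i j. 0 \<le> w i j" "\<And>i j u. u \<in> V \<Longrightarrow> L2.nm UNIV (W2 u i j) \<le> w i j * sqrt (B u u)" by metis
  define D where "D = w True True + w True False + w False False"
  have D: "0 \<le> D" using w(1) by (simp add: D_def)
  have mt: "\<bar>L2_inner \<Omega> (hess l u i j) (\<lambda>p. q k p * dq k h (W2 u i j) p)\<bar> \<le> C1 * (w i j)\<^sup>2 * B u u" if u: "u \<in> V" for u h i j
  proof -
    note E = weak2D(3)[OF W_weak2[OF u]]
    have "\<bar>L2_inner \<Omega> (hess l u i j) (\<lambda>p. q k p * dq k h (W2 u i j) p)\<bar> \<le> C1 * L2_inner UNIV (W2 u i j) (W2 u i j)"
      by (subst main_term(1)[OF VD(3)[OF u] E W_off(3)]) (use C1(2)[OF E] in \<open>simp_all add: W_eq\<close>)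
    also have "\<dots> \<le> C1 * (w i j * sqrt (B u u))\<^sup>2"
      unfolding L2.nm_sq[OF E, symmetric] using w(2)[OF u] E C1(1) by (intro mult_left_mono power_mono) auto
    also have "\<dots> = C1 * (w i j)\<^sup>2 * B u u" using V.ip_pos[OF u] by (simp add: power_mult_distrib)
    finally show ?thesis .
  qed
  have mtt: "\<bar>L2_inner \<Omega> (tr (hess l u)) (\<lambda>p. q k p * dq k h (tr (W2 u)) p)\<bar> \<le> C1 * D\<^sup>2 * B u u" if u: "u \<in> V" for u h
  proof -
    note E = weak2D(3)[OF W_weak2[OF u]] and H = VD(3)[OF u]
    have T: "tr (W2 u) \<in> L2 UNIV" by (intro L2.add E)
    have "\<bar>L2_inner \<Omega> (tr (hess l u)) (\<lambda>p. q k p * dq k h (tr (W2 u)) p)\<bar> \<le> C1 * L2_inner UNIV (tr (W2 u)) (tr (W2 u))"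
      by (subst main_term(1)[OF L2.add[OF H H] T]) (use C1(2)[OF T] in \<open>simp_all add: W_eq W_off\<close>)
    also have "\<dots> \<le> C1 * (D * sqrt (B u u))\<^sup>2"
      unfolding L2.nm_sq[OF T, symmetric]
    proof (intro mult_left_mono power_mono C1(1))
      have "L2.nm UNIV (tr (W2 u)) \<le> L2.nm UNIV (W2 u True True) + L2.nm UNIV (W2 u False False)" by (rule L2.nm_triangle[OF E E])
      also have "\<dots> \<le> w True True * sqrt (B u u) + w False False * sqrt (B u u)" by (intro add_mono w(2) u)
      also have "\<dots> \<le> D * sqrt (B u u)" unfolding D_def distrib_right using w(1) V.ip_pos[OF u] by simp
      finally show "L2.nm UNIV (tr (W2 u)) \<le> D * sqrt (B u u)" .
    qed (use T in simp)
    also have "\<dots> = C1 * D\<^sup>2 * B u u" using V.ip_pos[OF u] by (simp add: power_mult_distrib)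
    finally show ?thesis .
  qed
  have "\<exists>C\<ge>0. \<forall>u\<in>V. \<forall>X\<in>L2 \<Omega>. \<forall>h. \<bar>L2_inner \<Omega> X (cr u k h i j)\<bar> \<le> C * (L2.nm \<Omega> X * sqrt (B u u))" for i j by (rule cr_bound)
  then obtain c where c: "\<And>i j. 0 \<le> c i j" "\<And>i j u X h. u \<in> V \<Longrightarrow> X \<in> L2 \<Omega> \<Longrightarrow> \<bar>L2_inner \<Omega> X (cr u k h i j)\<bar> \<le> c i j * (L2.nm \<Omega> X * sqrt (B u u))"
    by metis
  have ct: "\<bar>L2_inner \<Omega> (hess l u i j) (cr u k h i j)\<bar> \<le> 2 * c i j * B u u" if u: "u \<in> V" for u h i j
  proof -
    have "\<bar>L2_inner \<Omega> (hess l u i j) (cr u k h i j)\<bar> \<le> c i j * (L2.nm \<Omega> (hess l u i j) * sqrt (B u u))" by (rule c(2)[OF u VD(3)[OF u]])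
    also have "\<dots> \<le> c i j * (2 * sqrt (B u u) * sqrt (B u u))"
      using V.ip_pos[OF u] by (intro mult_left_mono mult_right_mono nm_hess[OF u] c(1)) auto
    also have "\<dots> = 2 * c i j * B u u" using V.ip_pos[OF u] by simp
    finally show ?thesis .
  qed
  have ctt: "\<bar>L2_inner \<Omega> (tr (hess l u)) (cr u k h i j)\<bar> \<le> 4 * c i j * B u u" if u: "u \<in> V" for u h i j
  proof -
    note H = VD(3)[OF u]
    have "L2.nm \<Omega> (tr (hess l u)) \<le> L2.nm \<Omega> (hess l u True True) + L2.nm \<Omega> (hess l u False False)" by (rule L2.nm_triangle[OF H H])
    also have "\<dots> \<le> 4 * sqrt (B u u)" using nm_hess[OF u, of True True] nm_hess[OF u, of False False] by linarith
    finally have n: "L2.nm \<Omega> (tr (hess l u)) \<le> 4 * sqrt (B u u)" .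
    have "\<bar>L2_inner \<Omega> (tr (hess l u)) (cr u k h i j)\<bar> \<le> c i j * (L2.nm \<Omega> (tr (hess l u)) * sqrt (B u u))" by (rule c(2)[OF u L2.add[OF H H]])
    also have "\<dots> \<le> c i j * (4 * sqrt (B u u) * sqrt (B u u))"
      using V.ip_pos[OF u] by (intro mult_left_mono mult_right_mono n c(1)) auto
    also have "\<dots> = 4 * c i j * B u u" using V.ip_pos[OF u] by simp
    finally show ?thesis .
  qed
  define A where "A i j = C1 * (w i j)\<^sup>2 + 2 * c i j" for i j
  define A' where "A' = C1 * D\<^sup>2 + 4 * c True True + 4 * c False False"
  define C where "C = C1 * D0\<^sup>2 + (A True True + 2 * A True False + A False False + A')"
  have A0: "0 \<le> A i j" "0 \<le> A'" for i j using C1 c(1) by (auto simp: A_def A'_def)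
  have C0: "0 \<le> C" using C1 A0 by (simp add: C_def)
  have "\<bar>R k h u z\<bar> \<le> C * (L2_inner \<Omega> z z + B u u)" if u: "u \<in> V" and z: "z \<in> L2 \<Omega>" for u z h
  proof -
    have Bp: "0 \<le> B u u" and zp: "0 \<le> L2_inner \<Omega> z z" by (rule V.ip_pos[OF u], rule L2.ip_pos[OF z])
    have t: "\<bar>L2_inner \<Omega> (hess l u i j) (\<lambda>p. q k p * dq k h (W2 u i j) p) + L2_inner \<Omega> (hess l u i j) (cr u k h i j)\<bar> \<le> A i j * B u u" for i j
      using mt[OF u, where h=h and i=i and j=j] ct[OF u, where h=h and i=i and j=j] unfolding A_def distrib_right by linarith
    have tt: "\<bar>L2_inner \<Omega> (tr (hess l u)) (\<lambda>p. q k p * dq k h (tr (W2 u)) p)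
        + (L2_inner \<Omega> (tr (hess l u)) (cr u k h True True) + L2_inner \<Omega> (tr (hess l u)) (cr u k h False False))\<bar> \<le> A' * B u u"
      using mtt[OF u, where h=h] ctt[OF u, where h=h and i=True and j=True] ctt[OF u, where h=h and i=False and j=False] unfolding A'_def distrib_right by linarith
    have comb: "\<bar>(1 - \<sigma>) * (x + 2 * y + w) + \<sigma> * v\<bar> \<le> a + 2 * b + c + d"
      if "\<bar>x\<bar> \<le> a" "\<bar>y\<bar> \<le> b" "\<bar>w\<bar> \<le> c" "\<bar>v\<bar> \<le> d" for x y w v a b c d :: real
    proof -
      have "\<bar>(1 - \<sigma>) * (x + 2 * y + w)\<bar> \<le> 1 * (a + 2 * b + c)"
        unfolding abs_mult using sigma that by (intro mult_mono) auto
      moreover have "\<bar>\<sigma> * v\<bar> \<le> 1 * d" unfolding abs_mult using sigma that by (intro mult_mono) auto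
      ultimately have "\<bar>(1 - \<sigma>) * (x + 2 * y + w) + \<sigma> * v\<bar> \<le> 1 * (a + 2 * b + c) + 1 * d"
        by (rule order_trans[OF abs_triangle_ineq add_mono])
      then show ?thesis by (simp only: mult_1)
    qed
    have "\<bar>B u (Mh k h u)\<bar> \<le> A True True * B u u + 2 * (A True False * B u u) + A False False * B u u + A' * B u u"
      unfolding Mh_expand[OF u] by (intro comb t tt)
    then have "\<bar>R k h u z\<bar> \<le> C1 * D0\<^sup>2 * L2_inner \<Omega> z z + (A True True * B u u + 2 * (A True False * B u u) + A False False * B u u + A' * B u u)"
      using Wz[OF z, where h=h] unfolding R_def by linarith
    also have "\<dots> = C1 * D0\<^sup>2 * L2_inner \<Omega> z z + (A True True + 2 * A True False + A False False + A') * B u u" by (simp add: algebra_simps)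
    also have "\<dots> \<le> C * L2_inner \<Omega> z z + C * B u u"
    proof -
      have "C1 * D0\<^sup>2 \<le> C" "A True True + 2 * A True False + A False False + A' \<le> C" using C1(1) A0 unfolding C_def by simp_all
      from add_mono[OF mult_right_mono[OF this(1) zp] mult_right_mono[OF this(2) Bp]] show ?thesis .
    qed
    finally show ?thesis by (simp add: distrib_left)
  qed
  then show ?thesis using C0 by blast
qed

lemma Mh_pairing_bound: "\<exists>C\<ge>0. \<forall>u\<in>V. \<forall>z\<in>L2 \<Omega>. \<forall>h. \<bar>L2_inner \<Omega> z (Mh k h u)\<bar> \<le> C * (L2.nm \<Omega> z * sqrt (B u u))"
  unfolding Mh_def[abs_def]
proof (rule inner_dominated[where F="\<lambda>u h p. q k p * dq k h (W u) p" and G="\<lambda>u. W1 u k", OF q_TS[of k] W1_dominated[of k]])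
  show "W1 u k \<in> L2 UNIV" if u: "u \<in> V" for u by (rule weak2D(2)[OF W_weak2[OF u]])
  fix u X h assume u: "u \<in> V" and X: "X \<in> L2 \<Omega>"
  show "\<bar>L2_inner \<Omega> X (\<lambda>p. q k p * dq k h (W u) p)\<bar> \<le> L2.nm UNIV (\<lambda>p. q k p * X p) * L2.nm UNIV (W1 u k)"
    by (rule cross_term(1)[OF q_TS q_off(1) X weak2D(1)[OF W_weak2[OF u]] W_off(1) weak2D(2)[OF W_weak2[OF u]] weak2_second(2)[OF W_weak2[OF u]] W_eq(2)])
qed

end


section \<open>The multiplier inequality at a fixed time\<close>

locale plate_region = plate_layer +
  fixes \<omega> :: "(real \<times> real) set"
  assumes om_open: "open \<omega>" and om_layer: "\<Omega> - Bx (7 * \<delta>) \<subseteq> \<omega>"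
begin

text \<open>Both cutoffs vary only in the layer: \<open>chi3\<close> between \<open>Bx (3 \<delta>)\<close> and \<open>Bx (5 \<delta>)\<close>, \<open>chi5\<close> between
  \<open>Bx (5 \<delta>)\<close> and \<open>Bx (7 \<delta>)\<close>. The weight \<open>layer_wt\<close> is \<open>1\<close> between \<open>Bx \<delta>\<close> and \<open>Bx (5 \<delta>)\<close>, where the
  derivatives of \<open>chi3\<close> and the truncation of \<open>q\<close> are located, and vanishes on \<open>Bx (7 \<delta>)\<close>.\<close>

definition chi3 :: "real \<times> real \<Rightarrow> real" where "chi3 = bump \<delta> (3 * \<delta>)"
definition chi5 :: "real \<times> real \<Rightarrow> real" where "chi5 = bump \<delta> (5 * \<delta>)"
definition layer_wt :: "real \<times> real \<Rightarrow> real" where "layer_wt p = \<zeta> p - chi5 p"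

definition obs :: "(real \<times> real \<Rightarrow> real) \<Rightarrow> real" where
  "obs f = (\<integral>p. indicator \<omega> p * (f p)\<^sup>2 \<partial>lebesgue_on \<Omega>)"

definition gsq :: "(bool \<Rightarrow> real \<times> real \<Rightarrow> real) \<Rightarrow> real \<times> real \<Rightarrow> real" where
  "gsq b p = (b True p)\<^sup>2 + (b False p)\<^sup>2"

lemma gsq_nonneg [simp]: "0 \<le> gsq b p" by (simp add: gsq_def)

lemma chi3_TS: "chi3 \<in> TSO" unfolding chi3_def by (rule bump_TS) (use delta in auto)
lemma chi5_TS: "chi5 \<in> TSO" unfolding chi5_def by (rule bump_TS) (use delta in auto)

lemma chi3_range: "0 \<le> chi3 p" "chi3 p \<le> 1" unfolding chi3_def by (rule bump_range)+

lemma chi3_0: "p \<notin> Bx (3 * \<delta>) \<Longrightarrow> chi3 p = 0" unfolding chi3_def by (rule bump_0[OF delta])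
lemma chi5_0: "p \<notin> Bx (5 * \<delta>) \<Longrightarrow> chi5 p = 0" unfolding chi5_def by (rule bump_0[OF delta])

lemma chi3_deriv_0:
  assumes "p \<notin> Bx (3 * \<delta>) \<or> p \<in> Bx (5 * \<delta>)" shows "pd k chi3 p = 0" "pd j (pd k chi3) p = 0"
proof -
  have d: "0 < 3 * \<delta>" "3 * \<delta> + \<delta> < 5 * \<delta>" using delta by auto
  have in5: "pd k chi3 p = 0 \<and> pd j (pd k chi3) p = 0" if "p \<in> Bx (5 * \<delta>)"
    unfolding chi3_def by (intro conjI bump_flat(2,3)[OF delta d(1) that d(2)])
  have off: "pd k chi3 p = 0 \<and> pd j (pd k chi3) p = 0" if "p \<notin> Bx (3 * \<delta>)"
    by (intro conjI TS_flat0(2,3)[OF chi3_TS chi3_0 that])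
  show "pd k chi3 p = 0" "pd j (pd k chi3) p = 0" using assms in5 off by blast+
qed

lemma layer_wt_range: "0 \<le> layer_wt p" "layer_wt p \<le> 1"
proof -
  have z: "0 \<le> \<zeta> p" "\<zeta> p \<le> 1" "0 \<le> chi5 p" "chi5 p \<le> 1" unfolding \<zeta>_def chi5_def by (rule bump_range)+
  show "layer_wt p \<le> 1" using z by (simp add: layer_wt_def)
  show "0 \<le> layer_wt p"
  proof (cases "p \<in> Bx (5 * \<delta>)")
    case True
    then have "p \<in> Bx \<delta>" using Bx_mono[of \<delta> "5 * \<delta>"] delta by auto
    then show ?thesis using z zeta_flat(1) by (simp add: layer_wt_def)
  next
    case False then show ?thesis using z chi5_0 by (simp add: layer_wt_def)
  qed
qed

lemma layer_wt_1: "p \<in> Bx \<delta> \<Longrightarrow> p \<notin> Bx (5 * \<delta>) \<Longrightarrow> layer_wt p = 1"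
  by (simp add: layer_wt_def zeta_flat(1) chi5_0)

lemma layer_wt_0:
  assumes "p \<in> Bx (7 * \<delta>)" shows "layer_wt p = 0" "pd k (pd k \<zeta>) p - pd k (pd k chi5) p = 0"
proof -
  have d: "0 < 5 * \<delta>" "5 * \<delta> + \<delta> < 7 * \<delta>" using delta by auto
  have p: "p \<in> Bx \<delta>" using Bx_mono[of \<delta> "7 * \<delta>"] delta assms by auto
  show "layer_wt p = 0" using bump_flat(1)[OF delta d(1) assms d(2)] zeta_flat(1)[OF p] by (simp add: layer_wt_def chi5_def)
  show "pd k (pd k \<zeta>) p - pd k (pd k chi5) p = 0"
    using bump_flat(3)[OF delta d(1) assms d(2), of k k] zeta_flat(3)[OF p, of k k] by (simp add: chi5_def)
qed

lemma ind_om: "p \<in> \<Omega> \<Longrightarrow> p \<notin> Bx (7 * \<delta>) \<Longrightarrow> indicator \<omega> p = (1::real)"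
  using om_layer by (auto simp: indicator_def)

lemma ind_om3: "p \<in> \<Omega> \<Longrightarrow> p \<notin> Bx (5 * \<delta>) \<Longrightarrow> indicator \<omega> p = (1::real)"
  using ind_om[of p] Bx_mono[of "5 * \<delta>" "7 * \<delta>"] delta by auto

lemma hess_sym: "hess l u False True = hess l u True False"
  by (auto simp: hess_def)

lemma sum3_sq: "(x + y + z)\<^sup>2 \<le> 3 * (x\<^sup>2 + y\<^sup>2 + z\<^sup>2)" for x y z :: real
proof -
  have "0 \<le> (x - y)\<^sup>2 + (y - z)\<^sup>2 + (x - z)\<^sup>2" by simp
  then show ?thesis by (simp add: power2_eq_square algebra_simps)
qed

lemma hsq_le_bound:
  assumes "\<And>i j. (a i j p)\<^sup>2 \<le> c" shows "hsq a p \<le> 4 * c"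
  unfolding hsq_def using assms[of True True] assms[of True False] assms[of False False] by linarith

lemma hess_le_hsq: "(hess l u i j p)\<^sup>2 \<le> hsq (hess l u) p"
  by (cases i; cases j; simp add: hsq_def hess_sym)

definition R0_density :: "bool \<Rightarrow> (real \<times> real \<Rightarrow> real) \<Rightarrow> (real \<times> real \<Rightarrow> real) \<Rightarrow> real \<times> real \<Rightarrow> real" where
  "R0_density k u z p = - (1 / 2) * (pd k (q k) p * z p * z p)
     + 1 / 2 * Qf \<sigma> (\<lambda>i j p. pd k (q k) p * hess l u i j p) (hess l u) p - Qf \<sigma> (hess l u) (N u k) p"

lemma R0_density_in: "p \<in> Bx (3 * \<delta>) \<Longrightarrow> R0_density True u z p + R0_density False u z p = - (z p)\<^sup>2 - Qf \<sigma> (hess l u) (hess l u) p"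
proof -
  assume p: "p \<in> Bx (3 * \<delta>)"
  have d: "2 * \<delta> < 3 * \<delta>" using delta by simp
  show ?thesis
    by (simp add: R0_density_def Qf_def N_def q_in[OF p d] hess_sym power2_eq_square algebra_simps)
qed

lemma R0_density_out: "p \<notin> Bx \<delta> \<Longrightarrow> R0_density k u z p = 0"
  by (simp add: R0_density_def Qf_def N_def q_off)

lemma Qf_self_nonneg: "0 \<le> Qf \<sigma> a a p"
proof -
  have "0 \<le> (1 - \<sigma>) * hsq a p" using sigma by simp
  then show ?thesis using Qf_self_ge[of \<sigma> a p] sigma by linarith
qed

lemma Qf_self_ge_half: "hsq a p \<le> 2 * Qf \<sigma> a a p"
proof -
  have "(1/2) * hsq a p \<le> (1 - \<sigma>) * hsq a p" using sigma by (intro mult_right_mono) auto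
  also have "\<dots> \<le> Qf \<sigma> a a p" using sigma by (intro Qf_self_ge) simp
  finally show ?thesis by simp
qed

text \<open>On \<open>Bx (3 \<delta>)\<close> the field \<open>q\<close> is not truncated and the density is exactly the negative energy density. The
  remaining points belong to \<open>\<omega>\<close>, and \<open>1 - chi3\<close> is \<open>1\<close> there.\<close>

lemma R0_density_bound:
  "\<exists>C>0. \<forall>u z. \<forall>p\<in>\<Omega>. R0_density True u z p + R0_density False u z p \<le> - (z p)\<^sup>2 - Qf \<sigma> (hess l u) (hess l u) p
     + C * (indicator \<omega> p * (z p)\<^sup>2 + (1 - chi3 p) * hsq (hess l u) p + layer_wt p * gsq (grad l u) p)"
proof -
  have "\<exists>K\<ge>0. \<forall>p. \<bar>pd i (q k) p\<bar> \<le> K" for i k using TS_bounded[OF TS_pd[OF q_TS]] by metis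
  then obtain K1 where K1: "\<And>i k. 0 \<le> K1 i k" "\<And>i k p. \<bar>pd i (q k) p\<bar> \<le> K1 i k" by metis
  have "\<exists>K\<ge>0. \<forall>p. \<bar>pd i (pd j (q k)) p\<bar> \<le> K" for i j k using TS_bounded[OF TS_pd[OF TS_pd[OF q_TS]]] by metis
  then obtain K2 where K2: "\<And>i j k. 0 \<le> K2 i j k" "\<And>i j k p. \<bar>pd i (pd j (q k)) p\<bar> \<le> K2 i j k" by metis
  define K where "K = (K1 True True + K1 True False + K1 False True + K1 False False)
    + (K2 True True True + K2 True False True + K2 False True True + K2 False False True
      + K2 True True False + K2 True False False + K2 False True False + K2 False False False)"
  have "K1 i k \<le> K" for i k
    unfolding K_def using K1(1)[of True True] K1(1)[of True False] K1(1)[of False True] K1(1)[of False False]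
      K2(1)[of True True True] K2(1)[of True False True] K2(1)[of False True True] K2(1)[of False False True]
      K2(1)[of True True False] K2(1)[of True False False] K2(1)[of False True False] K2(1)[of False False False]
    by (cases i; cases k; simp)
  then have k1: "\<bar>pd i (q k) p\<bar> \<le> K" for i k p using K1(2)[of i k p] order_trans by blast
  have "K2 i j k \<le> K" for i j k
    unfolding K_def using K1(1)[of True True] K1(1)[of True False] K1(1)[of False True] K1(1)[of False False]
      K2(1)[of True True True] K2(1)[of True False True] K2(1)[of False True True] K2(1)[of False False True]
      K2(1)[of True True False] K2(1)[of True False False] K2(1)[of False True False] K2(1)[of False False False]
    by (cases i; cases j; cases k; simp)
  then have k2: "\<bar>pd i (pd j (q k)) p\<bar> \<le> K" for i j k p using K2(2)[of i j k p] order_trans by blast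
  have K0: "0 \<le> K" using k1[of True True undefined] by linarith
  have sqb: "(c * x)\<^sup>2 \<le> K\<^sup>2 * x\<^sup>2" if "\<bar>c\<bar> \<le> K" for c x
  proof -
    have "\<bar>c\<bar>\<^sup>2 \<le> K\<^sup>2" using that by (intro power_mono) auto
    then show ?thesis by (simp add: power_mult_distrib mult_right_mono)
  qed
  have s01: "0 \<le> \<sigma>" "\<sigma> \<le> 1" using sigma by auto
  have Nb: "hsq (N u k) p \<le> 24 * K\<^sup>2 * (hsq (hess l u) p + gsq (grad l u) p)" for u k p
  proof -
    have "(N u k i j p)\<^sup>2 \<le> 3 * K\<^sup>2 * (2 * hsq (hess l u) p + gsq (grad l u) p)" for i j
    proof -
      have "(N u k i j p)\<^sup>2 \<le> 3 * ((pd i (q k) p * hess l u j k p)\<^sup>2 + (pd j (q k) p * hess l u i k p)\<^sup>2 + (pd i (pd j (q k)) p * grad l u k p)\<^sup>2)"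
        unfolding N_def by (rule sum3_sq)
      also have "\<dots> \<le> 3 * (K\<^sup>2 * (hess l u j k p)\<^sup>2 + K\<^sup>2 * (hess l u i k p)\<^sup>2 + K\<^sup>2 * (grad l u k p)\<^sup>2)"
        by (intro mult_left_mono add_mono sqb k1 k2) simp
      also have "\<dots> \<le> 3 * (K\<^sup>2 * hsq (hess l u) p + K\<^sup>2 * hsq (hess l u) p + K\<^sup>2 * gsq (grad l u) p)"
        by (intro mult_left_mono add_mono hess_le_hsq) (cases k; simp add: gsq_def)+
      finally show ?thesis by (simp add: algebra_simps)
    qed
    from hsq_le_bound[of "N u k" p, OF this] have "hsq (N u k) p \<le> 4 * (3 * K\<^sup>2 * (2 * hsq (hess l u) p + gsq (grad l u) p))" .
    moreover have "4 * (3 * K\<^sup>2 * (2 * hsq (hess l u) p + gsq (grad l u) p)) = 24 * (K\<^sup>2 * hsq (hess l u) p) + 12 * (K\<^sup>2 * gsq (grad l u) p)"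
      by (simp add: algebra_simps)
    moreover have "0 \<le> K\<^sup>2 * gsq (grad l u) p" by simp
    moreover have "24 * K\<^sup>2 * (hsq (hess l u) p + gsq (grad l u) p) = 24 * (K\<^sup>2 * hsq (hess l u) p) + 24 * (K\<^sup>2 * gsq (grad l u) p)"
      by (simp add: algebra_simps)
    ultimately show ?thesis by linarith
  qed
  have rb: "R0_density k u z p \<le> K / 2 * (z p)\<^sup>2 + (K + 1) * hsq (hess l u) p + 24 * K\<^sup>2 * (hsq (hess l u) p + gsq (grad l u) p)" for k u z p
  proof -
    let ?c = "pd k (q k) p"
    have c: "\<bar>?c\<bar> \<le> K" by (rule k1)
    have "- (?c * z p * z p) \<le> K * (z p)\<^sup>2"
      using mult_right_mono[of "- ?c" K "(z p)\<^sup>2"] c by (simp add: power2_eq_square mult.assoc)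
    moreover have "Qf \<sigma> (\<lambda>i j p. pd k (q k) p * hess l u i j p) (hess l u) p = ?c * Qf \<sigma> (hess l u) (hess l u) p"
      by (simp add: Qf_def algebra_simps)
    moreover have "?c * Qf \<sigma> (hess l u) (hess l u) p \<le> K * (2 * hsq (hess l u) p)"
    proof -
      have "?c * Qf \<sigma> (hess l u) (hess l u) p \<le> K * Qf \<sigma> (hess l u) (hess l u) p"
        using c by (intro mult_right_mono Qf_self_nonneg) auto
      also have "\<dots> \<le> K * (2 * hsq (hess l u) p)" by (intro mult_left_mono Qf_self_le s01 K0)
      finally show ?thesis .
    qed
    moreover have "- Qf \<sigma> (hess l u) (N u k) p \<le> 1 * hsq (hess l u) p + hsq (N u k) p / 1"
      using Qf_young[OF s01, of 1 "hess l u" "N u k" p] by simp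
    moreover have "(K + 1) * hsq (hess l u) p = K * hsq (hess l u) p + hsq (hess l u) p" by (simp add: algebra_simps)
    ultimately show ?thesis using Nb[of u k p] unfolding R0_density_def by (simp add: mult.assoc)
  qed
  define C where "C = 2 * K + 48 * K\<^sup>2 + 5"
  have C: "0 < C" unfolding C_def using K0 by (intro add_nonneg_pos add_nonneg_nonneg) auto
  have "R0_density True u z p + R0_density False u z p \<le> - (z p)\<^sup>2 - Qf \<sigma> (hess l u) (hess l u) p
     + C * (indicator \<omega> p * (z p)\<^sup>2 + (1 - chi3 p) * hsq (hess l u) p + layer_wt p * gsq (grad l u) p)" if p: "p \<in> \<Omega>" for u z p
  proof -
    let ?h = "hsq (hess l u) p" and ?g = "gsq (grad l u) p" and ?z = "(z p)\<^sup>2"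
    have n: "0 \<le> indicator \<omega> p * ?z" "0 \<le> (1 - chi3 p) * ?h" "0 \<le> layer_wt p * ?g"
      using chi3_range[of p] layer_wt_range[of p] by auto
    have Q2: "Qf \<sigma> (hess l u) (hess l u) p \<le> 2 * ?h" by (rule Qf_self_le[OF s01])
    show ?thesis
    proof (cases "p \<in> Bx (3 * \<delta>)")
      case True
      have "0 \<le> C * (indicator \<omega> p * ?z + (1 - chi3 p) * ?h + layer_wt p * ?g)" by (rule mult_nonneg_nonneg[OF less_imp_le[OF C] add_nonneg_nonneg[OF add_nonneg_nonneg[OF n(1,2)] n(3)]])
      then show ?thesis using R0_density_in[OF True, of u z] by linarith
    next
      case False
      then have p5: "p \<notin> Bx (5 * \<delta>)" using Bx_mono[of "3 * \<delta>" "5 * \<delta>"] delta by auto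
      have i: "indicator \<omega> p = (1::real)" by (rule ind_om3[OF p p5])
      have c: "1 - chi3 p = 1" using chi3_0[OF False] by simp
      have zero: "0 \<le> ?z" "0 \<le> ?h" "0 \<le> ?g" by auto
      show ?thesis
      proof (cases "p \<in> Bx \<delta>")
        case True
        have t: "layer_wt p = 1" by (rule layer_wt_1[OF True p5])
        have "R0_density True u z p + R0_density False u z p \<le> 2 * (K / 2 * ?z + (K + 1) * ?h + 24 * K\<^sup>2 * (?h + ?g))"
          unfolding mult_2 by (rule add_mono[OF rb rb])
        also have "\<dots> = K * ?z + (2 * K + 2 + 48 * K\<^sup>2) * ?h + 48 * K\<^sup>2 * ?g" by (simp add: algebra_simps)
        also have "\<dots> \<le> (C - 1) * ?z + (C - 2) * ?h + C * ?g"
          unfolding C_def using K0 zero by (intro add_mono mult_right_mono) auto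
        finally have "R0_density True u z p + R0_density False u z p \<le> (C - 1) * ?z + (C - 2) * ?h + C * ?g" .
        moreover have "C * (1 * ?z + 1 * ?h + 1 * ?g) = (C - 1) * ?z + (C - 2) * ?h + C * ?g + ?z + 2 * ?h" by (simp add: algebra_simps)
        ultimately show ?thesis unfolding i c t using Q2 by linarith
      next
        case False
        have "5 \<le> C" unfolding C_def using K0 by simp
        then have "5 * ?z \<le> C * ?z" "5 * ?h \<le> C * ?h" using zero by (auto intro: mult_right_mono)
        moreover have "0 \<le> C * (layer_wt p * ?g)" using C n(3) by simp
        moreover have "C * (1 * ?z + 1 * ?h + layer_wt p * ?g) = C * ?z + C * ?h + C * (layer_wt p * ?g)" by (simp add: algebra_simps)
        ultimately show ?thesis unfolding i c R0_density_out[OF False] using Q2 zero by linarith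
      qed
    qed
  qed
  then show ?thesis using C by blast
qed

lemma sq_integrable:
  assumes "f \<in> L2 \<Omega>" "\<phi> \<in> borel_measurable (lebesgue_on \<Omega>)" "\<And>p. p \<in> \<Omega> \<Longrightarrow> \<bar>\<phi> p\<bar> \<le> 1"
  shows "integrable (lebesgue_on \<Omega>) (\<lambda>p. \<phi> p * (f p)\<^sup>2)"
  using L2_integrable_mult[OF L2_mult_bounded[OF assms(2,1,3)] assms(1)] by (simp add: power2_eq_square mult.assoc)

lemma meas: "(indicator \<omega> :: _ \<Rightarrow> real) \<in> borel_measurable (lebesgue_on \<Omega>)"
  "chi3 \<in> borel_measurable (lebesgue_on \<Omega>)" "layer_wt \<in> borel_measurable (lebesgue_on \<Omega>)"
proof -
  show "(indicator \<omega> :: _ \<Rightarrow> real) \<in> borel_measurable (lebesgue_on \<Omega>)" by (rule Om.borel_ind) (use om_open in auto)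
  show "chi3 \<in> borel_measurable (lebesgue_on \<Omega>)" by (rule L2_measurable[OF Om.TS_L2[OF chi3_TS]])
  show "layer_wt \<in> borel_measurable (lebesgue_on \<Omega>)"
    unfolding layer_wt_def[abs_def] by (intro borel_measurable_diff L2_measurable[OF Om.TS_L2[OF zeta_TS]] L2_measurable[OF Om.TS_L2[OF chi5_TS]])
qed

lemma obs_integrable: "f \<in> L2 \<Omega> \<Longrightarrow> integrable (lebesgue_on \<Omega>) (\<lambda>p. indicator \<omega> p * (f p)\<^sup>2)"
  by (rule sq_integrable[OF _ meas(1)]) (auto simp: indicator_def)

lemma hsq_chi3_integrable: "u \<in> V \<Longrightarrow> integrable (lebesgue_on \<Omega>) (\<lambda>p. (1 - chi3 p) * hsq (hess l u) p)"
proof -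
  assume u: "u \<in> V"
  have "integrable (lebesgue_on \<Omega>) (\<lambda>p. (1 - chi3 p) * (hess l u i j p)\<^sup>2)" for i j
    by (rule sq_integrable[OF VD(3)[OF u]]) (use meas(2) chi3_range in auto)
  then have "integrable (lebesgue_on \<Omega>) (\<lambda>p. (1 - chi3 p) * (hess l u True True p)\<^sup>2 + 2 * ((1 - chi3 p) * (hess l u True False p)\<^sup>2) + (1 - chi3 p) * (hess l u False False p)\<^sup>2)"
    by (intro Bochner_Integration.integrable_add integrable_mult_right)
  then show ?thesis by (simp add: hsq_def algebra_simps)
qed

lemma layer_wt_integrable: "u \<in> V \<Longrightarrow> integrable (lebesgue_on \<Omega>) (\<lambda>p. layer_wt p * gsq (grad l u) p)"
proof -
  assume u: "u \<in> V"
  have "integrable (lebesgue_on \<Omega>) (\<lambda>p. layer_wt p * (grad l u k p)\<^sup>2)" for k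
    by (rule sq_integrable[OF VD(2)[OF u] meas(3)]) (use layer_wt_range in \<open>auto simp: abs_of_nonneg\<close>)
  then have "integrable (lebesgue_on \<Omega>) (\<lambda>p. layer_wt p * (grad l u True p)\<^sup>2 + layer_wt p * (grad l u False p)\<^sup>2)"
    by (intro Bochner_Integration.integrable_add)
  then show ?thesis by (simp add: gsq_def distrib_left)
qed

definition layer_hess where "layer_hess u = (\<integral>p. (1 - chi3 p) * hsq (hess l u) p \<partial>lebesgue_on \<Omega>)"
definition layer_grad where "layer_grad u = (\<integral>p. layer_wt p * gsq (grad l u) p \<partial>lebesgue_on \<Omega>)"
definition total_hess where "total_hess u = (\<integral>p. hsq (hess l u) p \<partial>lebesgue_on \<Omega>)"

lemma Q_integrable: "u \<in> V \<Longrightarrow> integrable (lebesgue_on \<Omega>) (Qf \<sigma> (hess l u) (hess l u))"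
  by (intro Qf_integrable VD)

lemma R0_integral:
  assumes u: "u \<in> V" and z: "z \<in> L2 \<Omega>"
  shows "integrable (lebesgue_on \<Omega>) (R0_density k u z)" "R0 k u z = (\<integral>p. R0_density k u z p \<partial>lebesgue_on \<Omega>)"
proof -
  have i1: "integrable (lebesgue_on \<Omega>) (\<lambda>p. pd k (q k) p * z p * z p)"
    by (intro L2_integrable_mult TSO_L2[OF TS_pd[OF q_TS]] z)
  have i2: "integrable (lebesgue_on \<Omega>) (Qf \<sigma> (\<lambda>i j p. pd k (q k) p * hess l u i j p) (hess l u))"
    by (intro Qf_integrable TSO_L2[OF TS_pd[OF q_TS]] VD[OF u])
  have i3: "integrable (lebesgue_on \<Omega>) (Qf \<sigma> (hess l u) (N u k))"
    by (intro Qf_integrable VD[OF u] N_L2[OF u])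
  have a: "integrable (lebesgue_on \<Omega>) (\<lambda>p. - (1 / 2) * (pd k (q k) p * z p * z p) + 1 / 2 * Qf \<sigma> (\<lambda>i j p. pd k (q k) p * hess l u i j p) (hess l u) p)"
    by (intro Bochner_Integration.integrable_add integrable_mult_right i1 i2)
  show "integrable (lebesgue_on \<Omega>) (R0_density k u z)"
    unfolding R0_density_def[abs_def] by (rule Bochner_Integration.integrable_diff[OF a i3])
  show "R0 k u z = (\<integral>p. R0_density k u z p \<partial>lebesgue_on \<Omega>)"
    unfolding R0_density_def Bochner_Integration.integral_diff[OF a i3] Bochner_Integration.integral_add[OF integrable_mult_right[OF i1] integrable_mult_right[OF i2]]
    by (simp add: R0_def L2_inner_def)
qed

lemma B_hess: "u \<in> V \<Longrightarrow> B u u = (\<integral>p. Qf \<sigma> (hess l u) (hess l u) p \<partial>lebesgue_on \<Omega>)"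
  by (rule B_weak2[OF V_weak2 V_weak2])

lemma interior_estimate:
  "\<exists>C>0. \<forall>u\<in>V. \<forall>z\<in>L2 \<Omega>. R0 True u z + R0 False u z \<le> - L2_inner \<Omega> z z - B u u + C * (obs z + layer_hess u + layer_grad u)"
proof -
  obtain C where C: "0 < C" "\<forall>u z. \<forall>p\<in>\<Omega>. R0_density True u z p + R0_density False u z p \<le> - (z p)\<^sup>2 - Qf \<sigma> (hess l u) (hess l u) p
     + C * (indicator \<omega> p * (z p)\<^sup>2 + (1 - chi3 p) * hsq (hess l u) p + layer_wt p * gsq (grad l u) p)" using R0_density_bound by blast
  have "R0 True u z + R0 False u z \<le> - L2_inner \<Omega> z z - B u u + C * (obs z + layer_hess u + layer_grad u)" if u: "u \<in> V" and z: "z \<in> L2 \<Omega>" for u z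
  proof -
    note i = obs_integrable[OF z] hsq_chi3_integrable[OF u] layer_wt_integrable[OF u]
    have zi: "integrable (lebesgue_on \<Omega>) (\<lambda>p. (z p)\<^sup>2)" using z by (simp add: L2_def)
    note qi = Q_integrable[OF u]
    have a1: "integrable (lebesgue_on \<Omega>) (\<lambda>p. - (z p)\<^sup>2 - Qf \<sigma> (hess l u) (hess l u) p)"
      by (intro Bochner_Integration.integrable_diff Bochner_Integration.integrable_minus zi qi)
    have a2: "integrable (lebesgue_on \<Omega>) (\<lambda>p. indicator \<omega> p * (z p)\<^sup>2 + (1 - chi3 p) * hsq (hess l u) p + layer_wt p * gsq (grad l u) p)"
      by (intro Bochner_Integration.integrable_add i)
    have "R0 True u z + R0 False u z = (\<integral>p. R0_density True u z p + R0_density False u z p \<partial>lebesgue_on \<Omega>)"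
      unfolding R0_integral(2)[OF u z] by (rule Bochner_Integration.integral_add[symmetric]; rule R0_integral(1)[OF u z])
    also have "\<dots> \<le> (\<integral>p. (- (z p)\<^sup>2 - Qf \<sigma> (hess l u) (hess l u) p) + C * (indicator \<omega> p * (z p)\<^sup>2 + (1 - chi3 p) * hsq (hess l u) p + layer_wt p * gsq (grad l u) p) \<partial>lebesgue_on \<Omega>)"
    proof (rule integral_mono)
      show "integrable (lebesgue_on \<Omega>) (\<lambda>p. R0_density True u z p + R0_density False u z p)" by (intro Bochner_Integration.integrable_add R0_integral(1)[OF u z])
      show "integrable (lebesgue_on \<Omega>) (\<lambda>p. (- (z p)\<^sup>2 - Qf \<sigma> (hess l u) (hess l u) p) + C * (indicator \<omega> p * (z p)\<^sup>2 + (1 - chi3 p) * hsq (hess l u) p + layer_wt p * gsq (grad l u) p))"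
        by (intro Bochner_Integration.integrable_add a1 integrable_mult_right i)
      fix p assume "p \<in> space (lebesgue_on \<Omega>)"
      then have p: "p \<in> \<Omega>" by simp
      show "R0_density True u z p + R0_density False u z p \<le> (- (z p)\<^sup>2 - Qf \<sigma> (hess l u) (hess l u) p)
        + C * (indicator \<omega> p * (z p)\<^sup>2 + (1 - chi3 p) * hsq (hess l u) p + layer_wt p * gsq (grad l u) p)"
        using C(2)[rule_format, OF p, of u z] .
    qed
    also have "\<dots> = (\<integral>p. - (z p)\<^sup>2 - Qf \<sigma> (hess l u) (hess l u) p \<partial>lebesgue_on \<Omega>) + C * (\<integral>p. indicator \<omega> p * (z p)\<^sup>2 + (1 - chi3 p) * hsq (hess l u) p + layer_wt p * gsq (grad l u) p \<partial>lebesgue_on \<Omega>)"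
      by (subst Bochner_Integration.integral_add[OF a1 integrable_mult_right[OF a2]]) simp
    also have "(\<integral>p. - (z p)\<^sup>2 - Qf \<sigma> (hess l u) (hess l u) p \<partial>lebesgue_on \<Omega>) = - L2_inner \<Omega> z z - B u u"
      by (subst Bochner_Integration.integral_diff[OF Bochner_Integration.integrable_minus[OF zi] qi]) (simp add: B_hess[OF u] L2_inner_def power2_eq_square)
    also have "(\<integral>p. indicator \<omega> p * (z p)\<^sup>2 + (1 - chi3 p) * hsq (hess l u) p + layer_wt p * gsq (grad l u) p \<partial>lebesgue_on \<Omega>) = obs z + layer_hess u + layer_grad u"
      by (subst Bochner_Integration.integral_add[OF Bochner_Integration.integrable_add[OF i(1,2)] i(3)], subst Bochner_Integration.integral_add[OF i(1,2)]) (simp add: obs_def layer_hess_def layer_grad_def)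
    finally show ?thesis .
  qed
  then show ?thesis using C(1) by blast
qed

text \<open>The second multiplier, \<open>u\<close> localised to the layer.\<close>

definition M1 :: "(real \<times> real \<Rightarrow> real) \<Rightarrow> real \<times> real \<Rightarrow> real" where "M1 f p = f p - chi3 p * f p"
definition R1 where "R1 u z = L2_inner \<Omega> z (M1 z) - B u (M1 u)"

lemma M1_V: "u \<in> V \<Longrightarrow> M1 u \<in> V"
  unfolding M1_def[abs_def] by (rule V.diff[OF _ V_cutoff_mult(1)[OF _ chi3_TS]])

lemma M1_L2: "f \<in> L2 \<Omega> \<Longrightarrow> M1 f \<in> L2 \<Omega>"
  unfolding M1_def[abs_def] by (rule L2.diff[OF _ TSO_L2[OF chi3_TS]])

text \<open>Expanding \<open>B u ((1 - chi3) u)\<close> gives the weighted energy density of the layer, plus terms with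
  derivatives of \<open>chi3\<close> in which the Hessian is paired with lower-order factors; Young's inequality
  separates these.\<close>

lemma boundary_estimate:
  "\<exists>C\<ge>0. \<forall>u\<in>V. \<forall>z\<in>L2 \<Omega>. \<forall>\<epsilon>>0. R1 u z \<le> obs z - 1 / 2 * layer_hess u + \<epsilon> * total_hess u + C / \<epsilon> * (layer_grad u + obs u)"
proof -
  have "\<exists>K\<ge>0. \<forall>p. \<bar>pd i chi3 p\<bar> \<le> K" for i using TS_bounded[OF TS_pd[OF chi3_TS]] by metis
  then obtain K1 where K1: "\<And>i. 0 \<le> K1 i" "\<And>i p. \<bar>pd i chi3 p\<bar> \<le> K1 i" by metis
  have "\<exists>K\<ge>0. \<forall>p. \<bar>pd i (pd j chi3) p\<bar> \<le> K" for i j using TS_bounded[OF TS_pd[OF TS_pd[OF chi3_TS]]] by metis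
  then obtain K2 where K2: "\<And>i j. 0 \<le> K2 i j" "\<And>i j p. \<bar>pd i (pd j chi3) p\<bar> \<le> K2 i j" by metis
  define K where "K = (K1 True + K1 False) + (K2 True True + K2 True False + K2 False True + K2 False False)"
  have "K1 i \<le> K" for i
    unfolding K_def using K1(1)[of True] K1(1)[of False] K2(1)[of True True] K2(1)[of True False] K2(1)[of False True] K2(1)[of False False]
    by (cases i; simp)
  then have k1: "\<bar>pd i chi3 p\<bar> \<le> K" for i p using K1(2)[of i p] order_trans by blast
  have "K2 i j \<le> K" for i j
    unfolding K_def using K1(1)[of True] K1(1)[of False] K2(1)[of True True] K2(1)[of True False] K2(1)[of False True] K2(1)[of False False]
    by (cases i; cases j; simp)
  then have k2: "\<bar>pd i (pd j chi3) p\<bar> \<le> K" for i j p using K2(2)[of i j p] order_trans by blast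
  have s01: "0 \<le> \<sigma>" "\<sigma> \<le> 1" using sigma by auto
  have sqb: "(c * x)\<^sup>2 \<le> K\<^sup>2 * x\<^sup>2" if "\<bar>c\<bar> \<le> K" for c x
  proof -
    have "\<bar>c\<bar>\<^sup>2 \<le> K\<^sup>2" using that by (intro power_mono) auto
    then show ?thesis by (simp add: power_mult_distrib mult_right_mono)
  qed
  define Nc where "Nc u i j p = pd i chi3 p * grad l u j p + pd j chi3 p * grad l u i p + pd i (pd j chi3) p * u p" for u i j p
  have Nb: "hsq (Nc u) p \<le> 24 * K\<^sup>2 * (layer_wt p * gsq (grad l u) p + indicator \<omega> p * (u p)\<^sup>2)" if p: "p \<in> \<Omega>" for u p
  proof (cases "p \<notin> Bx (3 * \<delta>) \<or> p \<in> Bx (5 * \<delta>)")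
    case True
    have "0 \<le> 24 * K\<^sup>2 * (layer_wt p * gsq (grad l u) p + indicator \<omega> p * (u p)\<^sup>2)" using layer_wt_range[of p] by simp
    then show ?thesis using True by (simp add: hsq_def Nc_def chi3_deriv_0)
  next
    case False
    then have p5: "p \<notin> Bx (5 * \<delta>)" and pd: "p \<in> Bx \<delta>" using Bx_mono[of \<delta> "3 * \<delta>"] delta by auto
    have "(Nc u i j p)\<^sup>2 \<le> 3 * K\<^sup>2 * (2 * gsq (grad l u) p + (u p)\<^sup>2)" for i j
    proof -
      have "(Nc u i j p)\<^sup>2 \<le> 3 * ((pd i chi3 p * grad l u j p)\<^sup>2 + (pd j chi3 p * grad l u i p)\<^sup>2 + (pd i (pd j chi3) p * u p)\<^sup>2)"
        unfolding Nc_def by (rule sum3_sq)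
      also have "\<dots> \<le> 3 * (K\<^sup>2 * (grad l u j p)\<^sup>2 + K\<^sup>2 * (grad l u i p)\<^sup>2 + K\<^sup>2 * (u p)\<^sup>2)"
        by (intro mult_left_mono add_mono sqb k1 k2) simp
      also have "\<dots> \<le> 3 * (K\<^sup>2 * gsq (grad l u) p + K\<^sup>2 * gsq (grad l u) p + K\<^sup>2 * (u p)\<^sup>2)"
        by (intro mult_left_mono add_mono order_refl; cases i; cases j; simp add: gsq_def)
      finally show ?thesis by (simp add: algebra_simps)
    qed
    from hsq_le_bound[of "Nc u" p, OF this] have "hsq (Nc u) p \<le> 4 * (3 * K\<^sup>2 * (2 * gsq (grad l u) p + (u p)\<^sup>2))" .
    moreover have "4 * (3 * K\<^sup>2 * (2 * gsq (grad l u) p + (u p)\<^sup>2)) = 24 * (K\<^sup>2 * gsq (grad l u) p) + 12 * (K\<^sup>2 * (u p)\<^sup>2)"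
      by (simp add: algebra_simps)
    moreover have "0 \<le> K\<^sup>2 * (u p)\<^sup>2" by simp
    moreover have "24 * K\<^sup>2 * (1 * gsq (grad l u) p + 1 * (u p)\<^sup>2) = 24 * (K\<^sup>2 * gsq (grad l u) p) + 24 * (K\<^sup>2 * (u p)\<^sup>2)"
      by (simp add: algebra_simps)
    ultimately show ?thesis unfolding layer_wt_1[OF pd p5] ind_om3[OF p p5] by linarith
  qed
  have "R1 u z \<le> obs z - 1 / 2 * layer_hess u + \<epsilon> * total_hess u + (24 * K\<^sup>2) / \<epsilon> * (layer_grad u + obs u)" if u: "u \<in> V" and z: "z \<in> L2 \<Omega>" and e: "0 < \<epsilon>" for u z \<epsilon>
  proof -
    let ?cN = "\<lambda>i j p. chi3 p * hess l u i j p + pd i chi3 p * grad l u j p + pd j chi3 p * grad l u i p + pd i (pd j chi3) p * u p"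
    note w = V_cutoff_mult[OF u chi3_TS]
    have Bc: "B u (\<lambda>p. chi3 p * u p) = (\<integral>p. Qf \<sigma> (hess l u) ?cN p \<partial>lebesgue_on \<Omega>)" by (rule B_weak2[OF V_weak2[OF u] w(2)])
    have ci: "integrable (lebesgue_on \<Omega>) (Qf \<sigma> (hess l u) ?cN)" by (rule Qf_integrable[OF VD(3)[OF u] weak2D(3)[OF w(2)]])
    have BM: "B u (M1 u) = B u u - B u (\<lambda>p. chi3 p * u p)" unfolding M1_def[abs_def] by (rule V.ip_diff_right[OF u w(1) u])
    have zi: "integrable (lebesgue_on \<Omega>) (\<lambda>p. z p * M1 z p)" by (intro L2_integrable_mult z M1_L2)
    note qi = Q_integrable[OF u]
    have hi: "integrable (lebesgue_on \<Omega>) (hsq (hess l u))" by (rule hsq_integrable[OF VD(3)[OF u]])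
    note i = obs_integrable[OF z] hsq_chi3_integrable[OF u] layer_wt_integrable[OF u] obs_integrable[OF VD(1)[OF u]]
    have "R1 u z = (\<integral>p. z p * M1 z p - Qf \<sigma> (hess l u) (hess l u) p + Qf \<sigma> (hess l u) ?cN p \<partial>lebesgue_on \<Omega>)"
      unfolding R1_def BM Bc B_hess[OF u] Bochner_Integration.integral_add[OF Bochner_Integration.integrable_diff[OF zi qi] ci]
        Bochner_Integration.integral_diff[OF zi qi] by (simp add: L2_inner_def)
    also have "\<dots> \<le> (\<integral>p. (indicator \<omega> p * (z p)\<^sup>2 + (- 1 / 2) * ((1 - chi3 p) * hsq (hess l u) p)) + (\<epsilon> * hsq (hess l u) p + 24 * K\<^sup>2 / \<epsilon> * (layer_wt p * gsq (grad l u) p + indicator \<omega> p * (u p)\<^sup>2)) \<partial>lebesgue_on \<Omega>)"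
    proof (rule integral_mono)
      show "integrable (lebesgue_on \<Omega>) (\<lambda>p. z p * M1 z p - Qf \<sigma> (hess l u) (hess l u) p + Qf \<sigma> (hess l u) ?cN p)"
        by (rule Bochner_Integration.integrable_add[OF Bochner_Integration.integrable_diff[OF zi qi] ci])
      show "integrable (lebesgue_on \<Omega>) (\<lambda>p. (indicator \<omega> p * (z p)\<^sup>2 + (- 1 / 2) * ((1 - chi3 p) * hsq (hess l u) p)) + (\<epsilon> * hsq (hess l u) p + 24 * K\<^sup>2 / \<epsilon> * (layer_wt p * gsq (grad l u) p + indicator \<omega> p * (u p)\<^sup>2)))"
        by (intro Bochner_Integration.integrable_add integrable_mult_right i hi)
      fix p assume "p \<in> space (lebesgue_on \<Omega>)"
      then have p: "p \<in> \<Omega>" by simp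
      have "?cN = (\<lambda>i j p. chi3 p * hess l u i j p + Nc u i j p)" by (simp add: Nc_def[abs_def] add.assoc)
      then have "Qf \<sigma> (hess l u) ?cN p = chi3 p * Qf \<sigma> (hess l u) (hess l u) p + Qf \<sigma> (hess l u) (Nc u) p"
        by (simp add: Qf_def algebra_simps)
      moreover have "Qf \<sigma> (hess l u) (Nc u) p \<le> \<epsilon> * hsq (hess l u) p + hsq (Nc u) p / \<epsilon>"
        using Qf_young[OF s01 e, of "hess l u" "Nc u" p] by simp
      moreover have "hsq (Nc u) p / \<epsilon> \<le> 24 * K\<^sup>2 / \<epsilon> * (layer_wt p * gsq (grad l u) p + indicator \<omega> p * (u p)\<^sup>2)"
        using divide_right_mono[OF Nb[OF p, of u], of \<epsilon>] e by simp
      moreover have "z p * M1 z p \<le> indicator \<omega> p * (z p)\<^sup>2"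
      proof (cases "p \<in> Bx (5 * \<delta>)")
        case True
        have d: "0 < 3 * \<delta>" "3 * \<delta> + \<delta> < 5 * \<delta>" using delta by auto
        have "chi3 p = 1" unfolding chi3_def by (rule bump_flat(1)[OF delta d(1) True d(2)])
        then show ?thesis by (simp add: M1_def)
      next
        case False
        have "z p * M1 z p = (1 - chi3 p) * (z p)\<^sup>2" by (simp add: M1_def power2_eq_square algebra_simps)
        also have "\<dots> \<le> 1 * (z p)\<^sup>2" using chi3_range[of p] by (intro mult_right_mono) auto
        finally show ?thesis using ind_om3[OF p False] by simp
      qed
      moreover have "(1 - chi3 p) * hsq (hess l u) p \<le> (1 - chi3 p) * (2 * Qf \<sigma> (hess l u) (hess l u) p)"
        using chi3_range[of p] by (intro mult_left_mono Qf_self_ge_half) auto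
      then have "- Qf \<sigma> (hess l u) (hess l u) p + chi3 p * Qf \<sigma> (hess l u) (hess l u) p \<le> (- 1 / 2) * ((1 - chi3 p) * hsq (hess l u) p)"
        by (simp add: algebra_simps)
      ultimately show "z p * M1 z p - Qf \<sigma> (hess l u) (hess l u) p + Qf \<sigma> (hess l u) ?cN p
         \<le> (indicator \<omega> p * (z p)\<^sup>2 + (- 1 / 2) * ((1 - chi3 p) * hsq (hess l u) p)) + (\<epsilon> * hsq (hess l u) p + 24 * K\<^sup>2 / \<epsilon> * (layer_wt p * gsq (grad l u) p + indicator \<omega> p * (u p)\<^sup>2))"
        by linarith
    qed
    also have "\<dots> = (\<integral>p. indicator \<omega> p * (z p)\<^sup>2 + (- 1 / 2) * ((1 - chi3 p) * hsq (hess l u) p) \<partial>lebesgue_on \<Omega>)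
        + (\<integral>p. \<epsilon> * hsq (hess l u) p + 24 * K\<^sup>2 / \<epsilon> * (layer_wt p * gsq (grad l u) p + indicator \<omega> p * (u p)\<^sup>2) \<partial>lebesgue_on \<Omega>)"
      by (rule Bochner_Integration.integral_add; intro Bochner_Integration.integrable_add integrable_mult_right i hi)
    also have "\<dots> = (obs z + (- 1 / 2) * layer_hess u) + (\<epsilon> * total_hess u + 24 * K\<^sup>2 / \<epsilon> * (layer_grad u + obs u))"
      unfolding obs_def layer_hess_def total_hess_def layer_grad_def Bochner_Integration.integral_add[OF i(1) integrable_mult_right[OF i(2)]]
        Bochner_Integration.integral_add[OF integrable_mult_right[OF hi] integrable_mult_right[OF Bochner_Integration.integrable_add[OF i(3,4)]]]
        integral_mult_right_zero Bochner_Integration.integral_add[OF i(3,4)] by (rule refl)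
    finally show ?thesis by simp
  qed
  then show ?thesis by (intro exI[of _ "24 * K\<^sup>2"]) auto
qed

text \<open>Apply \<open>gradient_identity\<close> to \<open>\<zeta>\<close> and to \<open>chi5\<close> and subtract; the weight and its derivatives
  vanish outside \<open>\<omega>\<close>.\<close>

lemma gradient_estimate:
  "\<exists>C\<ge>0. \<forall>u\<in>V. \<forall>\<epsilon>>0. layer_grad u \<le> \<epsilon> * total_hess u + (1 / (2 * \<epsilon>) + C) * obs u"
proof -
  have "\<exists>K\<ge>0. \<forall>p. \<bar>pd k (pd k \<zeta>) p\<bar> \<le> K" for k using TS_bounded[OF TS_pd[OF TS_pd[OF zeta_TS]]] by metis
  then obtain K1 where K1: "\<And>k. 0 \<le> K1 k" "\<And>k p. \<bar>pd k (pd k \<zeta>) p\<bar> \<le> K1 k" by metis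
  have "\<exists>K\<ge>0. \<forall>p. \<bar>pd k (pd k chi5) p\<bar> \<le> K" for k using TS_bounded[OF TS_pd[OF TS_pd[OF chi5_TS]]] by metis
  then obtain K2 where K2: "\<And>k. 0 \<le> K2 k" "\<And>k p. \<bar>pd k (pd k chi5) p\<bar> \<le> K2 k" by metis
  define K where "K = K1 True + K1 False + K2 True + K2 False"
  have K0: "0 \<le> K" unfolding K_def using K1(1) K2(1) by (simp add: add_nonneg_nonneg)
  have kk: "\<bar>pd k (pd k \<zeta>) p - pd k (pd k chi5) p\<bar> \<le> K" for k p
    unfolding K_def using K1(2)[of k p] K2(2)[of k p] K1(1)[of True] K1(1)[of False] K2(1)[of True] K2(1)[of False] by (cases k) auto
  have "layer_grad u \<le> \<epsilon> * total_hess u + (1 / (2 * \<epsilon>) + K) * obs u" if u: "u \<in> V" and e: "0 < \<epsilon>" for u \<epsilon>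
  proof -
    note D = VD[OF u]
    have s5: "0 < 5 * \<delta>" using delta by simp
    let ?t = "\<lambda>k p. pd k (pd k \<zeta>) p - pd k (pd k chi5) p"
    let ?f = "\<lambda>k p. - (layer_wt p * u p * hess l u k k p) + 1 / 2 * (?t k p * u p * u p)"
    note t = zeta_TS chi5_TS TS_pd[OF TS_pd[OF zeta_TS]] TS_pd[OF TS_pd[OF chi5_TS]]
    have I: "integrable (lebesgue_on \<Omega>) (\<lambda>p. \<phi> p * f p * g p)" if "\<phi> \<in> TSO" "f \<in> L2 \<Omega>" "g \<in> L2 \<Omega>" for \<phi> f g
      by (intro L2_integrable_mult TSO_L2 that)
    have fk: "integrable (lebesgue_on \<Omega>) (?f k)" "(\<integral>p. layer_wt p * (grad l u k p)\<^sup>2 \<partial>lebesgue_on \<Omega>) = (\<integral>p. ?f k p \<partial>lebesgue_on \<Omega>)" for k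
    proof -
      have g1: "L2_inner \<Omega> (\<lambda>p. \<zeta> p * grad l u k p) (grad l u k) =
          - L2_inner \<Omega> (\<lambda>p. \<zeta> p * u p) (hess l u k k) + 1 / 2 * L2_inner \<Omega> (\<lambda>p. pd k (pd k \<zeta>) p * u p) u"
        by (rule gradient_identity[OF V_weak2[OF u] zeta_TS d4(1)]) (rule zeta_0)
      have g2: "L2_inner \<Omega> (\<lambda>p. chi5 p * grad l u k p) (grad l u k) =
          - L2_inner \<Omega> (\<lambda>p. chi5 p * u p) (hess l u k k) + 1 / 2 * L2_inner \<Omega> (\<lambda>p. pd k (pd k chi5) p * u p) u"
        by (rule gradient_identity[OF V_weak2[OF u] chi5_TS s5]) (rule chi5_0)
      note i1 = I[OF t(1) D(2) D(2), of k k] I[OF t(2) D(2) D(2), of k k]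
      note i2 = I[OF t(1) D(1) D(3), of k k] I[OF t(2) D(1) D(3), of k k]
      note i3 = I[OF t(3) D(1) D(1), of k k] I[OF t(4) D(1) D(1), of k k]
      have e1: "(\<integral>p. layer_wt p * (grad l u k p)\<^sup>2 \<partial>lebesgue_on \<Omega>) = L2_inner \<Omega> (\<lambda>p. \<zeta> p * grad l u k p) (grad l u k) - L2_inner \<Omega> (\<lambda>p. chi5 p * grad l u k p) (grad l u k)"
        unfolding L2_inner_def Bochner_Integration.integral_diff[OF i1, symmetric]
        by (intro Bochner_Integration.integral_cong) (auto simp: layer_wt_def power2_eq_square algebra_simps)
      have fe: "?f k = (\<lambda>p. - (\<zeta> p * u p * hess l u k k p - chi5 p * u p * hess l u k k p) + 1 / 2 * (pd k (pd k \<zeta>) p * u p * u p - pd k (pd k chi5) p * u p * u p))"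
        by (simp add: layer_wt_def algebra_simps)
      show "integrable (lebesgue_on \<Omega>) (?f k)"
        unfolding fe by (intro Bochner_Integration.integrable_add Bochner_Integration.integrable_minus Bochner_Integration.integrable_diff integrable_mult_right i2 i3)
      have "(\<integral>p. ?f k p \<partial>lebesgue_on \<Omega>) = - (L2_inner \<Omega> (\<lambda>p. \<zeta> p * u p) (hess l u k k) - L2_inner \<Omega> (\<lambda>p. chi5 p * u p) (hess l u k k))
         + 1 / 2 * (L2_inner \<Omega> (\<lambda>p. pd k (pd k \<zeta>) p * u p) u - L2_inner \<Omega> (\<lambda>p. pd k (pd k chi5) p * u p) u)"
        unfolding fe L2_inner_def
        by (subst Bochner_Integration.integral_add; (intro Bochner_Integration.integrable_minus Bochner_Integration.integrable_diff integrable_mult_right i2 i3)?)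
           (simp only: Bochner_Integration.integral_minus integral_mult_right_zero Bochner_Integration.integral_diff[OF i2] Bochner_Integration.integral_diff[OF i3])
      then show "(\<integral>p. layer_wt p * (grad l u k p)\<^sup>2 \<partial>lebesgue_on \<Omega>) = (\<integral>p. ?f k p \<partial>lebesgue_on \<Omega>)"
        using e1 g1 g2 by argo
    qed
    have gi: "integrable (lebesgue_on \<Omega>) (\<lambda>p. layer_wt p * (grad l u k p)\<^sup>2)" for k
      by (rule sq_integrable[OF D(2) meas(3)]) (use layer_wt_range in \<open>auto simp: abs_of_nonneg\<close>)
    have hi: "integrable (lebesgue_on \<Omega>) (hsq (hess l u))" by (rule hsq_integrable[OF D(3)])
    note ui = obs_integrable[OF D(1)]
    have "layer_grad u = (\<integral>p. layer_wt p * (grad l u True p)\<^sup>2 + layer_wt p * (grad l u False p)\<^sup>2 \<partial>lebesgue_on \<Omega>)"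
      unfolding layer_grad_def gsq_def by (simp only: distrib_left)
    also have "\<dots> = (\<integral>p. ?f True p + ?f False p \<partial>lebesgue_on \<Omega>)"
      unfolding Bochner_Integration.integral_add[OF gi gi] Bochner_Integration.integral_add[OF fk(1) fk(1)] fk(2) by (rule refl)
    also have "\<dots> \<le> (\<integral>p. \<epsilon> * hsq (hess l u) p + (1 / (2 * \<epsilon>) + K) * (indicator \<omega> p * (u p)\<^sup>2) \<partial>lebesgue_on \<Omega>)"
    proof (rule integral_mono)
      show "integrable (lebesgue_on \<Omega>) (\<lambda>p. ?f True p + ?f False p)" by (rule Bochner_Integration.integrable_add[OF fk(1) fk(1)])
      show "integrable (lebesgue_on \<Omega>) (\<lambda>p. \<epsilon> * hsq (hess l u) p + (1 / (2 * \<epsilon>) + K) * (indicator \<omega> p * (u p)\<^sup>2))"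
        by (intro Bochner_Integration.integrable_add integrable_mult_right hi ui)
      fix p assume "p \<in> space (lebesgue_on \<Omega>)"
      then have p: "p \<in> \<Omega>" by simp
      show "?f True p + ?f False p \<le> \<epsilon> * hsq (hess l u) p + (1 / (2 * \<epsilon>) + K) * (indicator \<omega> p * (u p)\<^sup>2)"
      proof (cases "p \<in> Bx (7 * \<delta>)")
        case True
        have "0 \<le> \<epsilon> * hsq (hess l u) p + (1 / (2 * \<epsilon>) + K) * (indicator \<omega> p * (u p)\<^sup>2)" using e K0 by simp
        then show ?thesis by (simp add: layer_wt_0[OF True])
      next
        case False
        have o: "indicator \<omega> p = (1::real)" by (rule ind_om[OF p False])
        have b: "?f k p \<le> \<epsilon> * (hess l u k k p)\<^sup>2 + (1 / (4 * \<epsilon>) + K / 2) * (u p)\<^sup>2" for k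
        proof -
          have "0 \<le> (2 * \<epsilon> * hess l u k k p + layer_wt p * u p)\<^sup>2" by simp
          then have "- (layer_wt p * u p * hess l u k k p) * (4 * \<epsilon>) \<le> (4 * \<epsilon>\<^sup>2 * (hess l u k k p)\<^sup>2 + (layer_wt p)\<^sup>2 * (u p)\<^sup>2)"
            by (simp add: power2_sum power_mult_distrib mult_ac)
          moreover have "(layer_wt p)\<^sup>2 * (u p)\<^sup>2 \<le> 1 * (u p)\<^sup>2"
            using layer_wt_range[of p] by (intro mult_right_mono) (auto simp: power_le_one)
          ultimately have "- (layer_wt p * u p * hess l u k k p) * (4 * \<epsilon>) \<le> 4 * \<epsilon>\<^sup>2 * (hess l u k k p)\<^sup>2 + (u p)\<^sup>2" by linarith
          then have "- (layer_wt p * u p * hess l u k k p) \<le> (4 * \<epsilon>\<^sup>2 * (hess l u k k p)\<^sup>2 + (u p)\<^sup>2) / (4 * \<epsilon>)"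
            using e by (subst pos_le_divide_eq) auto
          also have "\<dots> = \<epsilon> * (hess l u k k p)\<^sup>2 + 1 / (4 * \<epsilon>) * (u p)\<^sup>2"
            using e by (simp add: add_divide_distrib power2_eq_square)
          finally have 1: "- (layer_wt p * u p * hess l u k k p) \<le> \<epsilon> * (hess l u k k p)\<^sup>2 + 1 / (4 * \<epsilon>) * (u p)\<^sup>2" .
          have "?t k p * (u p)\<^sup>2 \<le> K * (u p)\<^sup>2" using kk[of k p] by (intro mult_right_mono) auto
          then have 2: "1 / 2 * (?t k p * u p * u p) \<le> K / 2 * (u p)\<^sup>2" by (simp add: power2_eq_square mult.assoc)
          show ?thesis using add_mono[OF 1 2] by (simp add: distrib_right)
        qed
        let ?D = "(1 / (4 * \<epsilon>) + K / 2) * (u p)\<^sup>2"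
        have h: "\<epsilon> * ((hess l u True True p)\<^sup>2 + (hess l u False False p)\<^sup>2) \<le> \<epsilon> * hsq (hess l u) p"
          using e by (intro mult_left_mono) (auto simp: hsq_def)
        have D2: "?D + ?D = (1 / (2 * \<epsilon>) + K) * (u p)\<^sup>2"
          by (simp add: field_simps)
        have "?f True p + ?f False p \<le> (\<epsilon> * (hess l u True True p)\<^sup>2 + ?D) + (\<epsilon> * (hess l u False False p)\<^sup>2 + ?D)"
          by (rule add_mono[OF b b])
        also have "\<dots> = \<epsilon> * ((hess l u True True p)\<^sup>2 + (hess l u False False p)\<^sup>2) + (?D + ?D)" by (simp only: distrib_left add_ac)
        also have "\<dots> \<le> \<epsilon> * hsq (hess l u) p + (1 / (2 * \<epsilon>) + K) * (u p)\<^sup>2"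
          unfolding D2 using h by (rule add_right_mono)
        finally show ?thesis unfolding o by (simp only: mult_1)
      qed
    qed
    also have "\<dots> = \<epsilon> * total_hess u + (1 / (2 * \<epsilon>) + K) * obs u"
      unfolding total_hess_def obs_def Bochner_Integration.integral_add[OF integrable_mult_right[OF hi] integrable_mult_right[OF ui]] by simp
    finally show ?thesis .
  qed
  then show ?thesis using K0 by blast
qed

lemma multiplier_inequality:
  "\<exists>\<kappa>\<ge>0. \<exists>C\<ge>0. \<forall>u\<in>V. \<forall>z\<in>L2 \<Omega>. R0 True u z + R0 False u z + \<kappa> * R1 u z
     \<le> - (1 / 2) * (L2_inner \<Omega> z z + B u u) + C * (obs z + obs u)"
proof -
  obtain A where A: "0 < A" "\<forall>u\<in>V. \<forall>z\<in>L2 \<Omega>. R0 True u z + R0 False u z \<le> - L2_inner \<Omega> z z - B u u + A * (obs z + layer_hess u + layer_grad u)"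
    using interior_estimate by blast
  obtain D where D: "0 \<le> D" "\<forall>u\<in>V. \<forall>z\<in>L2 \<Omega>. \<forall>\<epsilon>>0. R1 u z \<le> obs z - 1 / 2 * layer_hess u + \<epsilon> * total_hess u + D / \<epsilon> * (layer_grad u + obs u)"
    using boundary_estimate by blast
  obtain E where E: "0 \<le> E" "\<forall>u\<in>V. \<forall>\<epsilon>>0. layer_grad u \<le> \<epsilon> * total_hess u + (1 / (2 * \<epsilon>) + E) * obs u"
    using gradient_estimate by blast
  \<comment> \<open>With \<open>\<kappa> = 2 A\<close> the weighted Hessian cancels. The parameters \<open>e1\<close> and \<open>e2\<close> make the total multiple of
    the full Hessian at most \<open>1/4\<close>, hence at most half of \<open>B u u\<close>.\<close>
  define \<kappa> where "\<kappa> = 2 * A"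
  define e1 where "e1 = 1 / (8 * \<kappa>)"
  define F where "F = A + \<kappa> * (D / e1)"
  define e2 where "e2 = 1 / (8 * (F + 1))"
  define G where "G = 1 / (2 * e2) + E"
  define C where "C = (A + \<kappa>) + (F * G + \<kappa> * (D / e1))"
  have k: "0 < \<kappa>" using A by (simp add: \<kappa>_def)
  have e1: "0 < e1" using k by (simp add: e1_def)
  have De: "0 \<le> \<kappa> * (D / e1)" using D(1) k e1 by simp
  have F: "0 \<le> F" using A(1) De by (simp add: F_def)
  have e2: "0 < e2" using F by (simp add: e2_def)
  have G: "0 \<le> G" using E(1) e2 by (simp add: G_def)
  have C: "0 \<le> C" unfolding C_def using A(1) k mult_nonneg_nonneg[OF F G] De by linarith
  have "R0 True u z + R0 False u z + \<kappa> * R1 u z \<le> - (1 / 2) * (L2_inner \<Omega> z z + B u u) + C * (obs z + obs u)"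
    if u: "u \<in> V" and z: "z \<in> L2 \<Omega>" for u z
  proof -
    have a: "R0 True u z + R0 False u z \<le> - L2_inner \<Omega> z z - B u u + A * (obs z + layer_hess u + layer_grad u)" using A(2) u z by blast
    have b: "R1 u z \<le> obs z - 1 / 2 * layer_hess u + e1 * total_hess u + D / e1 * (layer_grad u + obs u)" using D(2) u z e1 by blast
    have c: "layer_grad u \<le> e2 * total_hess u + G * obs u" unfolding G_def using E(2) u e2 by blast
    have total_hess: "0 \<le> total_hess u" "total_hess u \<le> 2 * B u u" unfolding total_hess_def by (simp, rule hsq_le_B[OF V_weak2[OF u]])
    have obs: "0 \<le> obs f" for f unfolding obs_def by simp
    have zz: "0 \<le> L2_inner \<Omega> z z" and Bp: "0 \<le> B u u" by (rule L2.ip_pos[OF z], rule V.ip_pos[OF u])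
    have b': "\<kappa> * R1 u z \<le> \<kappa> * obs z - A * layer_hess u + (\<kappa> * e1) * total_hess u + \<kappa> * (D / e1) * layer_grad u + \<kappa> * (D / e1) * obs u"
      using mult_left_mono[OF b less_imp_le[OF k]] by (simp add: \<kappa>_def algebra_simps)
    have c': "F * layer_grad u \<le> (F * e2) * total_hess u + (F * G) * obs u"
      using mult_left_mono[OF c F] by (simp add: algebra_simps)
    have "\<kappa> * e1 = 1 / 8" using k by (simp add: e1_def)
    moreover have "F * e2 \<le> 1 / 8" using F by (simp add: e2_def divide_le_eq)
    ultimately have h: "(\<kappa> * e1) * total_hess u + (F * e2) * total_hess u \<le> 1 / 8 * total_hess u + 1 / 8 * total_hess u"
      using total_hess(1) by (intro add_mono mult_right_mono) auto
    have FG: "A * layer_grad u + \<kappa> * (D / e1) * layer_grad u = F * layer_grad u" by (simp add: F_def distrib_right)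
    have a': "A * (obs z + layer_hess u + layer_grad u) = A * obs z + A * layer_hess u + A * layer_grad u" by (simp add: algebra_simps)
    have "R0 True u z + R0 False u z + \<kappa> * R1 u z \<le> - L2_inner \<Omega> z z - B u u + (A * obs z + \<kappa> * obs z) + (1 / 2) * B u u + (F * G) * obs u + \<kappa> * (D / e1) * obs u"
      using a b' c' h FG a' total_hess(2) by linarith
    also have "\<dots> \<le> - (1 / 2) * (L2_inner \<Omega> z z + B u u) + ((A + \<kappa>) * obs z + (F * G + \<kappa> * (D / e1)) * obs u)"
      using zz by (simp add: algebra_simps)
    also have "(A + \<kappa>) * obs z + (F * G + \<kappa> * (D / e1)) * obs u \<le> C * obs z + C * obs u"
    proof -
      have "A + \<kappa> \<le> C" "F * G + \<kappa> * (D / e1) \<le> C" unfolding C_def using A(1) k mult_nonneg_nonneg[OF F G] De by linarith+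
      then show ?thesis using obs by (intro add_mono mult_right_mono)
    qed
    finally show ?thesis by (simp add: distrib_left)
  qed
  then show ?thesis using k C by (intro exI[of _ \<kappa>] conjI exI[of _ C]) auto
qed

end


section \<open>The observability estimate\<close>

text \<open>The boundary is compact, so a neighbourhood of it contains all points within some distance \<open>e\<close>; a
  point off \<open>Bx (e / 2)\<close> is closer than \<open>e\<close> to its projection onto one of the sides.\<close>

lemma boundary_layer:
  assumes l: "0 < l" and nb: "boundary_neighbourhood (Om l) \<omega>"
  shows "\<exists>\<delta>>0. \<forall>p\<in>Om l. p \<notin> plate_setting.Bx l (7 * \<delta>) \<longrightarrow> p \<in> \<omega>"
proof -
  interpret plate_setting l "1 / 4" by unfold_locales (use l in auto)
  obtain U where U: "open U" "frontier (Om l) \<subseteq> U" "Om l \<inter> U \<subseteq> \<omega>"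
    using nb unfolding boundary_neighbourhood_def by blast
  have cl: "closure (Om l) = {0..pi} \<times> {-l..l}"
    using l by (simp add: closure_Times)
  have op: "open (Om l)" by (intro open_Times) auto
  have fr: "frontier (Om l) = {0..pi} \<times> {-l..l} - Om l"
    by (simp only: frontier_def interior_open[OF op] cl)
  have "compact (frontier (Om l))" by (rule compact_frontier_bounded[OF bounded_Times]) auto
  then obtain e where e: "0 < e" "\<And>x. x \<in> frontier (Om l) \<Longrightarrow> \<exists>G\<in>{U}. ball x e \<subseteq> G"
    by (rule Heine_Borel_lemma[of _ "{U}"]) (use U(1,2) in auto)
  have near: "p \<in> \<omega>" if "p \<in> Om l" "q \<in> frontier (Om l)" "dist q p < e" for p q
    using that U(3) e(2)[OF that(2)] by auto
  have "p \<in> \<omega>" if p: "p \<in> Om l" and n: "p \<notin> Bx (7 * (e / 14))" for p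
  proof -
    obtain x y where xy: "p = (x, y)" by (cases p)
    have r: "0 < x" "x < pi" "-l < y" "y < l" using p by (auto simp: xy)
    have d: "x < e / 2 \<or> pi - e / 2 < x \<or> y < - l + e / 2 \<or> l - e / 2 < y"
      using n by (auto simp: xy Bx_def)
    have f: "(0, y) \<in> frontier (Om l)" "(pi, y) \<in> frontier (Om l)" "(x, -l) \<in> frontier (Om l)" "(x, l) \<in> frontier (Om l)"
      using r l by (auto simp: fr)
    from d consider "x < e / 2" | "pi - e / 2 < x" | "y < - l + e / 2" | "l - e / 2 < y" by blast
    then show ?thesis
    proof cases
      case 1 then show ?thesis using near[OF p f(1)] e r by (simp add: xy dist_Pair_Pair dist_real_def)
    next
      case 2 then show ?thesis using near[OF p f(2)] e r by (simp add: xy dist_Pair_Pair dist_real_def)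
    next
      case 3 then show ?thesis using near[OF p f(3)] e r by (simp add: xy dist_Pair_Pair dist_real_def)
    next
      case 4 then show ?thesis using near[OF p f(4)] e r by (simp add: xy dist_Pair_Pair dist_real_def)
    qed
  qed
  then show ?thesis using e(1) by (intro exI[of _ "e / 14"]) auto
qed

context plate_region
begin

definition J :: "(real \<times> real \<Rightarrow> real) \<Rightarrow> real \<times> real \<Rightarrow> real" where
  "J f p = indicator \<omega> p * f p"

lemma J_bounded: "L2.bounded_op \<Omega> J"
  unfolding L2.bounded_op_def
proof (intro conjI ballI allI)
  show JL: "J f \<in> L2 \<Omega>" if "f \<in> L2 \<Omega>" for f
    unfolding J_def[abs_def] by (rule L2_mult_bounded[OF meas(1) that, of 1]) (simp add: indicator_def)
  show "\<exists>K\<ge>0. \<forall>f\<in>L2 \<Omega>. L2.nm \<Omega> (J f) \<le> K * L2.nm \<Omega> f"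
  proof (intro exI[of _ 1] conjI ballI)
    fix f assume f: "f \<in> L2 \<Omega>"
    have "L2_inner \<Omega> (J f) (J f) \<le> 1\<^sup>2 * L2_inner \<Omega> f f"
      by (rule L2_inner_mono[OF JL[OF f] f]) (simp add: J_def indicator_def)
    then show "L2.nm \<Omega> (J f) \<le> 1 * L2.nm \<Omega> f" by (simp add: L2.nm_def)
  qed simp
qed (auto simp: J_def fun_eq_iff algebra_simps)

lemma J_sym: "L2_inner \<Omega> (J f) g = L2_inner \<Omega> f (J g)"
  by (rule L2_inner_cong) (simp add: J_def)

lemma J_idem: "J (J f) = J f"
  by (auto simp: J_def indicator_def fun_eq_iff)

lemma J_obs: "L2_inner \<Omega> (J f) (J f) = obs f"
  unfolding L2_inner_def obs_def
  by (intro Bochner_Integration.integral_cong) (auto simp: J_def indicator_def power2_eq_square)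

lemma M1_nm: "f \<in> L2 \<Omega> \<Longrightarrow> L2.nm \<Omega> (M1 f) \<le> L2.nm \<Omega> f"
proof -
  assume f: "f \<in> L2 \<Omega>"
  have "L2_inner \<Omega> (M1 f) (M1 f) \<le> 1\<^sup>2 * L2_inner \<Omega> f f"
  proof (rule L2_inner_mono[OF M1_L2[OF f] f])
    fix p
    have "M1 f p = (1 - chi3 p) * f p" by (simp add: M1_def left_diff_distrib)
    then have "\<bar>M1 f p\<bar> = (1 - chi3 p) * \<bar>f p\<bar>" using chi3_range[of p] by (simp add: abs_mult)
    also have "\<dots> \<le> 1 * \<bar>f p\<bar>" using chi3_range[of p] by (intro mult_right_mono) auto
    finally show "\<bar>M1 f p\<bar> \<le> 1 * \<bar>f p\<bar>" .
  qed
  then show ?thesis by (simp add: L2.nm_def)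
qed

lemma M1_bounded: "L2.bounded_op \<Omega> M1"
  unfolding L2.bounded_op_def
proof (intro conjI ballI allI)
  show "\<exists>K\<ge>0. \<forall>f\<in>L2 \<Omega>. L2.nm \<Omega> (M1 f) \<le> K * L2.nm \<Omega> f"
    using M1_nm by (intro exI[of _ 1]) auto
qed (use M1_L2 in \<open>auto simp: M1_def fun_eq_iff algebra_simps\<close>)

lemma M1_pairing_bound: "\<exists>C\<ge>0. \<forall>u\<in>V. \<forall>z\<in>L2 \<Omega>. \<bar>L2_inner \<Omega> z (M1 u)\<bar> \<le> C * (L2.nm \<Omega> z * sqrt (B u u))"
proof (intro exI[of _ "sqrt (2 * pi ^ 4)"] conjI ballI)
  fix u z assume u: "u \<in> V" and z: "z \<in> L2 \<Omega>"
  have "\<bar>L2_inner \<Omega> z (M1 u)\<bar> \<le> L2.nm \<Omega> z * L2.nm \<Omega> (M1 u)" by (rule L2.Cauchy_Schwarz[OF z M1_L2[OF VD(1)[OF u]]])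
  also have "\<dots> \<le> L2.nm \<Omega> z * (sqrt (2 * pi ^ 4) * sqrt (B u u))"
    using order_trans[OF M1_nm[OF VD(1)[OF u]] nm_u[OF u]] L2.nm_nonneg[OF z] by (rule mult_left_mono)
  finally show "\<bar>L2_inner \<Omega> z (M1 u)\<bar> \<le> sqrt (2 * pi ^ 4) * (L2.nm \<Omega> z * sqrt (B u u))" by (simp add: mult_ac)
qed simp

abbreviation "solves u ut \<equiv> weak_wave (L2 \<Omega>) (L2_inner \<Omega>) V B (2 * pi ^ 4) u ut"
abbreviation "E0 u ut \<equiv> L2_inner \<Omega> (ut 0) (ut 0) + B (u 0) (u (0::real))"

lemma solves_D:
  assumes s: "solves u ut" and t: "0 \<le> t"
  shows "u t \<in> V" "ut t \<in> L2 \<Omega>" "L2_inner \<Omega> (ut t) (ut t) + B (u t) (u t) = E0 u ut"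
proof -
  interpret W: weak_wave "L2 \<Omega>" "L2_inner \<Omega>" V B "2 * pi ^ 4" u ut by (rule s)
  show "u t \<in> V" "ut t \<in> L2 \<Omega>" by (rule W.uV[OF t], rule W.utH[OF t])
  show "L2_inner \<Omega> (ut t) (ut t) + B (u t) (u t) = E0 u ut" using W.energy_conservation[OF t] by (simp add: W.en_def)
qed

lemma E0_nonneg: "solves u ut \<Longrightarrow> 0 \<le> E0 u ut"
  using solves_D[of u ut 0] by (auto intro!: add_nonneg_nonneg L2.ip_pos V.ip_pos)

lemma multiplier_integral_bound:
  assumes s: "solves u ut" and T: "0 \<le> T" and M: "L2.bounded_op \<Omega> M" and MV: "\<And>v. v \<in> V \<Longrightarrow> M v \<in> V"
    and D0: "0 \<le> D" and D: "\<And>v z. v \<in> V \<Longrightarrow> z \<in> L2 \<Omega> \<Longrightarrow> \<bar>L2_inner \<Omega> z (M v)\<bar> \<le> D * (L2.nm \<Omega> z * sqrt (B v v))"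
  shows "(\<lambda>t. L2_inner \<Omega> (ut t) (M (ut t)) - B (u t) (M (u t))) integrable_on {0..T}"
    "- (2 * D * E0 u ut) \<le> integral {0..T} (\<lambda>t. L2_inner \<Omega> (ut t) (M (ut t)) - B (u t) (M (u t)))"
proof -
  interpret W: weak_wave "L2 \<Omega>" "L2_inner \<Omega>" V B "2 * pi ^ 4" u ut by (rule s)
  have en: "W.en 0 = E0 u ut" by (simp add: W.en_def)
  have b: "\<bar>L2_inner \<Omega> (ut t) (M (u t))\<bar> \<le> D * E0 u ut" if t: "0 \<le> t" for t
  proof -
    have "\<bar>L2_inner \<Omega> (ut t) (M (u t))\<bar> \<le> D * (L2.nm \<Omega> (ut t) * sqrt (B (u t) (u t)))" by (rule D[OF W.uV[OF t] W.utH[OF t]])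
    also have "\<dots> \<le> D * (sqrt (W.en 0) * sqrt (W.en 0))"
      using W.nm_ut_le[OF t] W.nm_u_le[OF t] V.ip_pos[OF W.uV[OF t]] E0_nonneg[OF s]
      by (intro mult_left_mono[OF _ D0] mult_mono) (simp_all add: V.nm_def en)
    also have "sqrt (W.en 0) * sqrt (W.en 0) = E0 u ut" using E0_nonneg[OF s] by (simp add: en)
    finally show ?thesis .
  qed
  have h: "((\<lambda>t. L2_inner \<Omega> (ut t) (M (ut t)) - B (u t) (M (u t))) has_integral
     (L2_inner \<Omega> (ut T) (M (u T)) - L2_inner \<Omega> (ut 0) (M (u 0)))) {0..T}"
    by (rule W.pairing_identity[OF M _ T]) (rule MV)
  show "(\<lambda>t. L2_inner \<Omega> (ut t) (M (ut t)) - B (u t) (M (u t))) integrable_on {0..T}" by (rule has_integral_integrable[OF h])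
  show "- (2 * D * E0 u ut) \<le> integral {0..T} (\<lambda>t. L2_inner \<Omega> (ut t) (M (ut t)) - B (u t) (M (u t)))"
    using integral_unique[OF h] b[OF T] b[OF order_refl] unfolding abs_le_iff by argo
qed

text \<open>Dominated convergence in time as the step of the difference quotient tends to zero; by conservation of energy the dominating function is
  constant.\<close>

lemma R0_integral_bound:
  "\<exists>D\<ge>0. \<forall>u ut T. solves u ut \<longrightarrow> 0 \<le> T \<longrightarrow>
     (\<lambda>t. R0 k (u t) (ut t)) integrable_on {0..T} \<and> - (2 * D * E0 u ut) \<le> integral {0..T} (\<lambda>t. R0 k (u t) (ut t))"
proof -
  obtain D where D: "0 \<le> D" "\<forall>u\<in>V. \<forall>z\<in>L2 \<Omega>. \<forall>h. \<bar>L2_inner \<Omega> z (Mh k h u)\<bar> \<le> D * (L2.nm \<Omega> z * sqrt (B u u))"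
    using Mh_pairing_bound[of k] by blast
  obtain C where C: "0 \<le> C" "\<forall>u\<in>V. \<forall>z\<in>L2 \<Omega>. \<forall>h. \<bar>R k h u z\<bar> \<le> C * (L2_inner \<Omega> z z + B u u)"
    using R_bound[of k] by blast
  have "(\<lambda>t. R0 k (u t) (ut t)) integrable_on {0..T} \<and> - (2 * D * E0 u ut) \<le> integral {0..T} (\<lambda>t. R0 k (u t) (ut t))"
    if s: "solves u ut" and T: "0 \<le> T" for u ut T
  proof -
    define h where "h n = inverse (real (Suc n))" for n
    have hl: "filterlim h (at 0) sequentially"
      unfolding filterlim_at h_def
      by (intro conjI LIMSEQ_inverse_real_of_nat always_eventually allI UNIV_I nonzero_imp_inverse_nonzero of_nat_neq_0)
    let ?f = "\<lambda>n t. R k (h n) (u t) (ut t)"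
    have Mk: "(?f n) integrable_on {0..T}" "- (2 * D * E0 u ut) \<le> integral {0..T} (?f n)" for n
      using multiplier_integral_bound[OF s T Mh_bounded[of k "h n"] Mh_V D(1)] D(2) unfolding R_def by blast+
    have bd: "norm (?f n t) \<le> C * E0 u ut" if "t \<in> {0..T}" for n t
    proof -
      have t: "0 \<le> t" using that by simp
      have "\<bar>R k (h n) (u t) (ut t)\<bar> \<le> C * (L2_inner \<Omega> (ut t) (ut t) + B (u t) (u t))"
        using C(2) solves_D(1,2)[OF s t] by blast
      then show ?thesis unfolding solves_D(3)[OF s t] by simp
    qed
    have lim: "(\<lambda>n. ?f n t) \<longlonglongrightarrow> R0 k (u t) (ut t)" if "t \<in> {0..T}" for t
      by (rule filterlim_compose[OF R_limit hl]; rule solves_D[OF s]; use that in simp)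
    have const: "(\<lambda>t. C * E0 u ut) integrable_on {0..T}" by (rule integrable_const_ivl)
    note dom = dominated_convergence[of ?f "{0..T}" "\<lambda>t. C * E0 u ut" "\<lambda>t. R0 k (u t) (ut t)", OF Mk(1) const bd lim]
    show ?thesis
      using dom(1) LIMSEQ_le_const[OF dom(2), of "- (2 * D * E0 u ut)"] Mk(2) by blast
  qed
  then show ?thesis using D(1) by blast
qed

lemma weak_observability:
  "\<exists>C1\<ge>0. \<exists>C2\<ge>0. \<forall>u ut T. solves u ut \<longrightarrow> 0 \<le> T \<longrightarrow>
     1 / 2 * T * E0 u ut \<le> C1 * E0 u ut + C2 * integral {0..T} (\<lambda>t. obs (ut t) + obs (u t))"
proof -
  obtain \<kappa> C where k: "0 \<le> \<kappa>" and C: "0 \<le> C" and m: "\<forall>u\<in>V. \<forall>z\<in>L2 \<Omega>. R0 True u z + R0 False u z + \<kappa> * R1 u z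
     \<le> - (1 / 2) * (L2_inner \<Omega> z z + B u u) + C * (obs z + obs u)"
    using multiplier_inequality by blast
  obtain D1 where D1: "0 \<le> D1" "\<forall>u ut T. solves u ut \<longrightarrow> 0 \<le> T \<longrightarrow>
     (\<lambda>t. R0 True (u t) (ut t)) integrable_on {0..T} \<and> - (2 * D1 * E0 u ut) \<le> integral {0..T} (\<lambda>t. R0 True (u t) (ut t))"
    using R0_integral_bound by blast
  obtain D2 where D2: "0 \<le> D2" "\<forall>u ut T. solves u ut \<longrightarrow> 0 \<le> T \<longrightarrow>
     (\<lambda>t. R0 False (u t) (ut t)) integrable_on {0..T} \<and> - (2 * D2 * E0 u ut) \<le> integral {0..T} (\<lambda>t. R0 False (u t) (ut t))"
    using R0_integral_bound by blast
  obtain D3 where D3: "0 \<le> D3" "\<forall>u\<in>V. \<forall>z\<in>L2 \<Omega>. \<bar>L2_inner \<Omega> z (M1 u)\<bar> \<le> D3 * (L2.nm \<Omega> z * sqrt (B u u))"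
    using M1_pairing_bound by blast
  define C1 where "C1 = 2 * D1 + 2 * D2 + \<kappa> * (2 * D3)"
  have C1: "0 \<le> C1" unfolding C1_def using D1(1) D2(1) D3(1) k by simp
  have "1 / 2 * T * E0 u ut \<le> C1 * E0 u ut + C * integral {0..T} (\<lambda>t. obs (ut t) + obs (u t))"
    if s: "solves u ut" and T: "0 \<le> T" for u ut T
  proof -
    interpret W: weak_wave "L2 \<Omega>" "L2_inner \<Omega>" V B "2 * pi ^ 4" u ut by (rule s)
    have a: "(\<lambda>t. R0 True (u t) (ut t)) integrable_on {0..T}" "- (2 * D1 * E0 u ut) \<le> integral {0..T} (\<lambda>t. R0 True (u t) (ut t))"
      using D1(2) s T by blast+
    have b: "(\<lambda>t. R0 False (u t) (ut t)) integrable_on {0..T}" "- (2 * D2 * E0 u ut) \<le> integral {0..T} (\<lambda>t. R0 False (u t) (ut t))"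
      using D2(2) s T by blast+
    have c: "(\<lambda>t. R1 (u t) (ut t)) integrable_on {0..T}" "- (2 * D3 * E0 u ut) \<le> integral {0..T} (\<lambda>t. R1 (u t) (ut t))"
      using multiplier_integral_bound[OF s T M1_bounded M1_V D3(1)] D3(2) unfolding R1_def by blast+
    have cJ: "continuous_on {0..} (\<lambda>t. obs (ut t) + obs (u t))"
      unfolding J_obs[symmetric]
      by (intro continuous_on_add W.continuous_Jut[OF J_bounded J_sym J_idem] W.continuous_Ju[OF J_bounded J_sym J_idem])
    have i: "(\<lambda>t. obs (ut t) + obs (u t)) integrable_on {0..T}" by (rule W.int_cont[OF order_refl cJ])
    have ab: "(\<lambda>t. R0 True (u t) (ut t) + R0 False (u t) (ut t)) integrable_on {0..T}" by (rule integrable_add[OF a(1) b(1)])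
    have kc: "(\<lambda>t. \<kappa> * R1 (u t) (ut t)) integrable_on {0..T}" by (rule integrable_cmul[OF c(1), of \<kappa>, unfolded real_scaleR_def])
    have Ci: "(\<lambda>t. C * (obs (ut t) + obs (u t))) integrable_on {0..T}" by (rule integrable_cmul[OF i, of C, unfolded real_scaleR_def])
    have const: "(\<lambda>t. - (1 / 2) * E0 u ut) integrable_on {0..T}" by (rule integrable_const_ivl)
    have "integral {0..T} (\<lambda>t. R0 True (u t) (ut t) + R0 False (u t) (ut t) + \<kappa> * R1 (u t) (ut t))
        \<le> integral {0..T} (\<lambda>t. - (1 / 2) * E0 u ut + C * (obs (ut t) + obs (u t)))"
    proof (rule integral_le)
      fix t assume "t \<in> {0..T}"
      then have t: "0 \<le> t" by simp
      show "R0 True (u t) (ut t) + R0 False (u t) (ut t) + \<kappa> * R1 (u t) (ut t) \<le> - (1 / 2) * E0 u ut + C * (obs (ut t) + obs (u t))"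
        using m[rule_format, OF solves_D(1,2)[OF s t]] unfolding solves_D(3)[OF s t] .
    qed (rule integrable_add[OF ab kc], rule integrable_add[OF const Ci])
    also have "\<dots> = T * (- (1 / 2) * E0 u ut) + C * integral {0..T} (\<lambda>t. obs (ut t) + obs (u t))"
      using T by (simp add: integral_add[OF const Ci, simplified])
    finally have 1: "integral {0..T} (\<lambda>t. R0 True (u t) (ut t) + R0 False (u t) (ut t) + \<kappa> * R1 (u t) (ut t))
        \<le> T * (- (1 / 2) * E0 u ut) + C * integral {0..T} (\<lambda>t. obs (ut t) + obs (u t))" .
    have 2: "integral {0..T} (\<lambda>t. R0 True (u t) (ut t) + R0 False (u t) (ut t) + \<kappa> * R1 (u t) (ut t))
       = integral {0..T} (\<lambda>t. R0 True (u t) (ut t)) + integral {0..T} (\<lambda>t. R0 False (u t) (ut t)) + \<kappa> * integral {0..T} (\<lambda>t. R1 (u t) (ut t))"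
      unfolding integral_add[OF ab kc] integral_add[OF a(1) b(1)] by simp
    have 3: "\<kappa> * (- (2 * D3 * E0 u ut)) \<le> \<kappa> * integral {0..T} (\<lambda>t. R1 (u t) (ut t))" by (rule mult_left_mono[OF c(2) k])
    have 4: "C1 * E0 u ut = 2 * D1 * E0 u ut + 2 * D2 * E0 u ut - \<kappa> * (- (2 * D3 * E0 u ut))"
      by (simp add: C1_def distrib_right mult.assoc del: distrib_right_numeral)
    have 5: "T * (- (1 / 2) * E0 u ut) = - (1 / 2 * T * E0 u ut)" by simp
    show ?thesis using 1 2 3 4 5 a(2) b(2) by argo
  qed
  then show ?thesis using C1 C by blast
qed

lemma observability:
  "\<exists>C>0. \<exists>T0>0. \<forall>u ut T. solves u ut \<longrightarrow> T0 \<le> T \<longrightarrow>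
     E0 u ut \<le> C * (\<integral>t. obs (ut t) \<partial>lebesgue_on {0..T})"
proof -
  obtain C1 C2 where C: "0 \<le> C1" "0 \<le> C2" and m: "\<forall>u ut T. solves u ut \<longrightarrow> 0 \<le> T \<longrightarrow>
     1 / 2 * T * E0 u ut \<le> C1 * E0 u ut + C2 * integral {0..T} (\<lambda>t. obs (ut t) + obs (u t))"
    using weak_observability by blast
  define P :: real where "P = 2 * pi ^ 4"
  \<comment> \<open>The summand 1 makes \<open>\<tau>\<close> positive when \<open>C2\<close> vanishes.\<close>
  define \<tau> where "\<tau> = 1 + sqrt (32 * C2 * P\<^sup>2)"
  have s0: "0 \<le> sqrt (32 * C2 * P\<^sup>2)" using C by simp
  then have tau: "0 < \<tau>" unfolding \<tau>_def by (rule add_pos_nonneg[OF zero_less_one])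
  have "(sqrt (32 * C2 * P\<^sup>2))\<^sup>2 \<le> \<tau>\<^sup>2" using s0 by (intro power_mono) (simp_all add: \<tau>_def)
  then have tl: "16 * C2 * P\<^sup>2 \<le> 1 / 2 * \<tau>\<^sup>2" using C by simp
  define T0 where "T0 = \<tau> + 2 * (C1 + 1) / (1 / 2)"
  have T0: "0 < T0" using tau C by (simp add: T0_def)
  define C where "C = C2 * (1 + 2 * \<tau>\<^sup>2) + 1"
  have "E0 u ut \<le> C * (\<integral>t. obs (ut t) \<partial>lebesgue_on {0..T})" if s: "solves u ut" and T: "T0 \<le> T" for u ut T
  proof -
    interpret W: weak_wave "L2 \<Omega>" "L2_inner \<Omega>" V B "2 * pi ^ 4" u ut by (rule s)
    have en: "W.en 0 = E0 u ut" by (simp add: W.en_def)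
    have "W.en 0 \<le> C2 * (1 + 2 * \<tau>\<^sup>2) * integral {0..T} (\<lambda>t. L2_inner \<Omega> (J (ut t)) (J (ut t)))"
      by (rule W.absorb_low_order[OF J_bounded J_sym J_idem _ \<open>0 \<le> C1\<close> \<open>0 \<le> C2\<close> tau _ _ T[unfolded T0_def]])
         (use tl m s in \<open>simp_all add: P_def J_obs en\<close>)
    then have 1: "E0 u ut \<le> C2 * (1 + 2 * \<tau>\<^sup>2) * integral {0..T} (\<lambda>t. obs (ut t))" by (simp only: en J_obs)
    have c: "continuous_on {0..T} (\<lambda>t. obs (ut t))"
      using W.continuous_Jut[OF J_bounded J_sym J_idem] unfolding J_obs by (rule continuous_on_subset) auto
    have e: "(\<integral>t. obs (ut t) \<partial>lebesgue_on {0..T}) = integral {0..T} (\<lambda>t. obs (ut t))"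
      by (rule lebesgue_integral_eq_integral[OF continuous_imp_integrable_real[OF c]]) simp
    have "0 \<le> integral {0..T} (\<lambda>t. obs (ut t))"
      by (rule integral_nonneg[OF integrable_continuous_real[OF c]]) (simp add: obs_def)
    then show ?thesis using 1 unfolding e C_def by (simp add: distrib_right)
  qed
  moreover have "0 < C" using \<open>0 \<le> C2\<close> by (simp add: C_def add_nonneg_pos)
  ultimately show ?thesis using T0 by blast
qed

lemma plate_solution_solves:
  assumes s: "plate_solution l \<sigma> u0 u1 u ut" shows "solves u ut"
proof
  show "V \<subseteq> L2 \<Omega>" using VD(1) by blast
  show "0 < 2 * pi ^ 4" by simp
  note s' = s[unfolded plate_solution_def plate_def H2_star_norm_def L2_norm_def]
  fix t :: real
  show "L2_inner \<Omega> v v \<le> 2 * pi ^ 4 * B v v" if "v \<in> V" for v by (rule Poincare[OF that])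
  assume t: "0 \<le> t"
  show "u t \<in> V" "ut t \<in> L2 \<Omega>" using s' t by blast+
  show "((\<lambda>s. V.nm (\<lambda>p. u s p - u t p)) \<longlongrightarrow> 0) (at t within {0..})" unfolding V.nm_def using s' t by blast
  show "((\<lambda>s. L2.nm \<Omega> (\<lambda>p. ut s p - ut t p)) \<longlongrightarrow> 0) (at t within {0..})" unfolding L2.nm_def using s' t by blast
  show "((\<lambda>s. L2.nm \<Omega> (\<lambda>p. (u s p - u t p) / (s - t) - ut t p)) \<longlongrightarrow> 0) (at t within {0..})" unfolding L2.nm_def using s' t by blast
  show "((\<lambda>s. L2_inner \<Omega> (ut s) v) has_real_derivative - B (u t) v) (at t within {0..})" if "v \<in> V" for v using s' t that by blast
qed

lemma plate_energy_E0: "solves u ut \<Longrightarrow> 2 * plate_energy l \<sigma> u ut 0 = E0 u ut"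
  using solves_D(1,2)[of u ut 0] L2.ip_pos[of "ut 0" \<Omega>] V.ip_pos[of "u 0"]
  by (simp add: plate_energy_def L2_norm_def H2_star_norm_def plate_def)

end

theorem theorem2p2:
  fixes l \<sigma> :: real and \<omega> :: "(real \<times> real) set"
  assumes "0 < l" and "l < pi"
    and "0 < \<sigma>" and "\<sigma> < 1 / 2"
    and "boundary_neighbourhood (plate l) \<omega>"
  shows "\<forall>L>0. \<exists>C>0. \<exists>T0>0.
    \<forall>u0\<in>H2_star l. \<forall>u1\<in>L2 (plate l). \<forall>u ut.
      plate_solution l \<sigma> u0 u1 u ut \<longrightarrow> plate_energy l \<sigma> u ut 0 \<le> L \<longrightarrow>
      (\<forall>T\<ge>T0. plate_energy l \<sigma> u ut 0 \<le>
         C * (\<integral>t. (\<integral>p. indicator \<omega> p * \<bar>ut t p\<bar>\<^sup>2 \<partial>lebesgue_on (plate l)) \<partial>lebesgue_on {0..T}))"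
proof -
  have nb: "boundary_neighbourhood (Om l) \<omega>" using assms(5) by (simp add: plate_def)
  obtain \<delta> where d: "0 < \<delta>" "\<forall>p\<in>Om l. p \<notin> plate_setting.Bx l (7 * \<delta>) \<longrightarrow> p \<in> \<omega>"
    using boundary_layer[OF assms(1) nb] by blast
  interpret plate_setting l \<sigma> by unfold_locales (use assms in auto)
  interpret plate_region l \<sigma> \<delta> \<omega>
    by unfold_locales (use d nb in \<open>auto simp: boundary_neighbourhood_def\<close>)
  obtain C T0 where C: "0 < C" "0 < T0" and o: "\<forall>u ut T. solves u ut \<longrightarrow> T0 \<le> T \<longrightarrow>
     E0 u ut \<le> C * (\<integral>t. obs (ut t) \<partial>lebesgue_on {0..T})" using observability by blast
  have "plate_energy l \<sigma> u ut 0 \<le>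
         C / 2 * (\<integral>t. (\<integral>p. indicator \<omega> p * \<bar>ut t p\<bar>\<^sup>2 \<partial>lebesgue_on (plate l)) \<partial>lebesgue_on {0..T})"
    if s: "plate_solution l \<sigma> u0 u1 u ut" and T: "T0 \<le> T" for u0 u1 u ut T
  proof -
    have s': "solves u ut" by (rule plate_solution_solves[OF s])
    have "2 * plate_energy l \<sigma> u ut 0 \<le> C * (\<integral>t. obs (ut t) \<partial>lebesgue_on {0..T})"
      unfolding plate_energy_E0[OF s'] using o s' T by blast
    then show ?thesis by (simp add: obs_def plate_def)
  qed
  then show ?thesis using C by (intro allI impI exI[of _ "C / 2"] conjI exI[of _ T0] ballI) auto
qed


end
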